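(* Let $w$ be a bounded weight structure on a triangulated category $\mathcal C$ with heart $Hw$. 1. There exist natural homomorphisms $K_0(\mathrm{End}\,Hw)\xrightarrow{c}K_0^{tr}(\mathrm{End}\,\mathcal C)\xrightarrow{d}K_0^{ab}(\mathrm{End}\,Hw_*')$, where $K_0(\mathrm{End}\,Hw)=K_0^{add}(\mathrm{End}\,Hw)$; $c$ is a surjection. (Here $c$ is induced by the inclusion $Hw\to\mathcal C$, and $d([g:X\to X])=\sum_i(-1)^i[g_{i*}:H_i(t(X))\to H_i(t(X))]$, where $H_i(t(X))\in\mathrm{Obj}\,Hw_*'$ is the homology of the weight complex of $X$.) 2. $c$ is an isomorphism if $Hw$ is regular.
   Context: $D\perp E$ means $\mathcal C(X,Y)=0$ for all $X\in D$, $Y\in E$. A weight structure $w$ on a triangulated category $\mathcal C$ is a pair of subclasses $\mathcal C^{w\le 0},\mathcal C^{w\ge 0}\subset\mathrm{Obj}\,\mathcal C$ such that: (i) both are additive and Karoubi-closed in $\mathcal C$ (contain all retracts of their objects); (ii) $\mathcal C^{w\ge 0}\subset \mathcal C^{w\ge 0}[1]$ and $\mathcal C^{w\le 0}[1]\subset \mathcal C^{w\le 0}$; (iii) $\mathcal C^{w\ge 0}\perp\mathcal C^{w\le 0}[1]$; (iv) for every $X$ there is a distinguished triangle $B[-1]\to X\to A\to B$ with $A\in\mathcal C^{w\le 0}$, $B\in\mathcal C^{w\ge 0}$ (weight decomposition). The heart $Hw$ is the full subcategory on $\mathcal C^{w=0}=\mathcal C^{w\ge0}\cap\mathcal C^{w\le0}$.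 $w$ is bounded if $\bigcup_l\mathcal C^{w\le0}[-l]=\bigcup_l\mathcal C^{w\ge0}[-l]=\mathrm{Obj}\,\mathcal C$. Weight complex: for each $k$ choose a weight decomposition $X[k]\to X^{w\le k}\xrightarrow{f^k}X^{w\ge k+1}\to X[k+1]$. There are unique morphisms $X^{w\le k}[-1]\to X^{w\le k-1}$, $X^{w\ge k+1}[-1]\to X^{w\ge k}$ compatible with these triangles and $\mathrm{id}_X$, and there are $X^k\in\mathcal C^{w=0}$ and distinguished triangles $X^{w\le k}[-1]\to X^{w\le k-1}\xrightarrow{c^k}X^k\xrightarrow{d^k}X^{w\le k}$ and $X^k[-1]\xrightarrow{x^k}X^{w\ge k+1}[-1]\to X^{w\ge k}\xrightarrow{y^k}X^k$ with $c^k=y^k\circ f^{k-1}$, $x^k=(f^k\circ d^k)[-1]$ (a weight Postnikov tower). $t(X)=(X^i,\,c^{i+1}\circ d^i)$. Endomorphisms of $X$ extend (non-uniquely) to weight Postnikov towers, and the induced maps on the homology $H_i(t(X))=\mathrm{Ker}(X^i\to X^{i+1})/\mathrm{Im}(X^{i-1}\to X^i)$, computed in $Hw_*'$, are well defined. For an additive $A$, $A_*$ is the category of additive functors $A^{op}\to\mathrm{Ab}$, $A$ is embedded into it by Yoneda, and $A_*'$ is the full abelian subcategory of $A_*$ generated by $A$. Grothendieck groups of endomorphisms: generators are classes $[g]$ of endomorphisms of objects; the relations are $[g]=[f]+[h]$ whenever $(f,g,h)$ is an endomorphism of: a split short exact sequence in an additive category $A$ (for $K_0^{add}(\mathrm{End}\,A)$);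 an arbitrary short exact sequence in an abelian $A$ (for $K_0^{ab}(\mathrm{End}\,A)$); a distinguished triangle in a triangulated $A$ (for $K_0^{tr}(\mathrm{End}\,A)$). An additive category $A$ is regular if: 1. $A$ is isomorphic to its small envelope, i.e. if $X,Y\in\mathrm{Obj}\,A$ and $X$ is a retract of $Y$, then $X$ has a complement to $Y$ in $A$; 2. every object of $A_*'$ has a finite resolution by objects of $A$. *)

theory Defs
  imports "HOL-Algebra.Free_Abelian_Groups"
begin

section \<open>Additive categories\<close>

text \<open>
  \<open>Add\<close> and \<open>Zr\<close> are the addition and the zero morphisms of the Hom-groups;
  \<open>g \<cdot>\<^bsub>A\<^esub> f\<close> is the composite ``first \<open>f\<close>, then \<open>g\<close>''.
\<close>

record ('o, 'm) catdata =
  Ob  :: "'o set"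
  Ar  :: "'m set"
  Dom :: "'m \<Rightarrow> 'o"
  Cod :: "'m \<Rightarrow> 'o"
  Idn :: "'o \<Rightarrow> 'm"
  Cmp :: "'m \<Rightarrow> 'm \<Rightarrow> 'm"  (infixl "\<cdot>\<index>" 70)
  Add :: "'m \<Rightarrow> 'm \<Rightarrow> 'm"
  Zr  :: "'o \<Rightarrow> 'o \<Rightarrow> 'm"

definition Hom :: "('o, 'm, 'z) catdata_scheme \<Rightarrow> 'o \<Rightarrow> 'o \<Rightarrow> 'm set" where
  "Hom A X Y = {f \<in> Ar A. Dom A f = X \<and> Cod A f = Y}"

definition hom_group :: "('o, 'm, 'z) catdata_scheme \<Rightarrow> 'o \<Rightarrow> 'o \<Rightarrow> 'm monoid" where
  "hom_group A X Y = \<lparr>carrier = Hom A X Y, monoid.mult = Add A, one = Zr A X Y\<rparr>"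

definition neg :: "('o, 'm, 'z) catdata_scheme \<Rightarrow> 'm \<Rightarrow> 'm" where
  "neg A f = inv\<^bsub>hom_group A (Dom A f) (Cod A f)\<^esub> f"

definition is_category :: "('o, 'm, 'z) catdata_scheme \<Rightarrow> bool" where
  "is_category A \<longleftrightarrow>
     (\<forall>f\<in>Ar A. Dom A f \<in> Ob A \<and> Cod A f \<in> Ob A) \<and>
     (\<forall>X\<in>Ob A. Idn A X \<in> Hom A X X) \<and>
     (\<forall>X Y Z. \<forall>f\<in>Hom A X Y. \<forall>g\<in>Hom A Y Z. g \<cdot>\<^bsub>A\<^esub> f \<in> Hom A X Z) \<and>
     (\<forall>X Y. \<forall>f\<in>Hom A X Y. f \<cdot>\<^bsub>A\<^esub> Idn A X = f \<and> Idn A Y \<cdot>\<^bsub>A\<^esub> f = f) \<and>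
     (\<forall>X Y Z W. \<forall>f\<in>Hom A X Y. \<forall>g\<in>Hom A Y Z. \<forall>h\<in>Hom A Z W.
        h \<cdot>\<^bsub>A\<^esub> (g \<cdot>\<^bsub>A\<^esub> f) = (h \<cdot>\<^bsub>A\<^esub> g) \<cdot>\<^bsub>A\<^esub> f)"

definition preadditive :: "('o, 'm, 'z) catdata_scheme \<Rightarrow> bool" where
  "preadditive A \<longleftrightarrow>
     is_category A \<and>
     (\<forall>X\<in>Ob A. \<forall>Y\<in>Ob A. comm_group (hom_group A X Y)) \<and>
     (\<forall>X Y Z. \<forall>f\<in>Hom A X Y. \<forall>f'\<in>Hom A X Y. \<forall>g\<in>Hom A Y Z. \<forall>g'\<in>Hom A Y Z.
        g \<cdot>\<^bsub>A\<^esub> Add A f f' = Add A (g \<cdot>\<^bsub>A\<^esub> f) (g \<cdot>\<^bsub>A\<^esub> f') \<and>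
        Add A g g' \<cdot>\<^bsub>A\<^esub> f = Add A (g \<cdot>\<^bsub>A\<^esub> f) (g' \<cdot>\<^bsub>A\<^esub> f))"

definition zero_object :: "('o, 'm, 'z) catdata_scheme \<Rightarrow> 'o \<Rightarrow> bool" where
  "zero_object A Z \<longleftrightarrow>
     Z \<in> Ob A \<and> (\<forall>X\<in>Ob A. (\<exists>!f. f \<in> Hom A X Z) \<and> (\<exists>!f. f \<in> Hom A Z X))"

text \<open>\<open>W\<close> is the direct sum of \<open>X\<close> and \<open>Y\<close> with injections \<open>i\<close>, \<open>j\<close> and projections \<open>p\<close>, \<open>q\<close>.\<close>

definition is_biproduct ::
  "('o, 'm, 'z) catdata_scheme \<Rightarrow> 'o \<Rightarrow> 'o \<Rightarrow> 'o \<Rightarrow> 'm \<Rightarrow> 'm \<Rightarrow> 'm \<Rightarrow> 'm \<Rightarrow> bool" where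
  "is_biproduct A X Y W i j p q \<longleftrightarrow>
     X \<in> Ob A \<and> Y \<in> Ob A \<and> W \<in> Ob A \<and>
     i \<in> Hom A X W \<and> j \<in> Hom A Y W \<and> p \<in> Hom A W X \<and> q \<in> Hom A W Y \<and>
     p \<cdot>\<^bsub>A\<^esub> i = Idn A X \<and> q \<cdot>\<^bsub>A\<^esub> j = Idn A Y \<and>
     p \<cdot>\<^bsub>A\<^esub> j = Zr A Y X \<and> q \<cdot>\<^bsub>A\<^esub> i = Zr A X Y \<and>
     Add A (i \<cdot>\<^bsub>A\<^esub> p) (j \<cdot>\<^bsub>A\<^esub> q) = Idn A W"

definition additive_category :: "('o, 'm, 'z) catdata_scheme \<Rightarrow> bool" where
  "additive_category A \<longleftrightarrow>
     preadditive A \<and> (\<exists>Z. zero_object A Z) \<and>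
     (\<forall>X\<in>Ob A. \<forall>Y\<in>Ob A. \<exists>W i j p q. is_biproduct A X Y W i j p q)"

definition is_retraction :: "('o, 'm, 'z) catdata_scheme \<Rightarrow> 'o \<Rightarrow> 'o \<Rightarrow> 'm \<Rightarrow> 'm \<Rightarrow> bool" where
  "is_retraction A X Y i r \<longleftrightarrow>
     X \<in> Ob A \<and> Y \<in> Ob A \<and> i \<in> Hom A X Y \<and> r \<in> Hom A Y X \<and> r \<cdot>\<^bsub>A\<^esub> i = Idn A X"

definition isomorphism :: "('o, 'm, 'z) catdata_scheme \<Rightarrow> 'm \<Rightarrow> bool" where
  "isomorphism A f \<longleftrightarrow>
     f \<in> Ar A \<and>
     (\<exists>g\<in>Hom A (Cod A f) (Dom A f).
        g \<cdot>\<^bsub>A\<^esub> f = Idn A (Dom A f) \<and> f \<cdot>\<^bsub>A\<^esub> g = Idn A (Cod A f))"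

definition full_sub :: "('o, 'm, 'z) catdata_scheme \<Rightarrow> 'o set \<Rightarrow> ('o, 'm) catdata" where
  "full_sub A S =
     \<lparr>Ob = S, Ar = {f \<in> Ar A. Dom A f \<in> S \<and> Cod A f \<in> S}, Dom = Dom A, Cod = Cod A,
      Idn = Idn A, Cmp = Cmp A, Add = Add A, Zr = Zr A\<rparr>"


section \<open>Kernels, cokernels, exactness, homology\<close>

definition is_kernel :: "('o, 'm, 'z) catdata_scheme \<Rightarrow> 'm \<Rightarrow> 'm \<Rightarrow> bool" where
  "is_kernel A f k \<longleftrightarrow>
     f \<in> Ar A \<and> k \<in> Ar A \<and> Cod A k = Dom A f \<and>
     f \<cdot>\<^bsub>A\<^esub> k = Zr A (Dom A k) (Cod A f) \<and>
     (\<forall>t\<in>Ar A. Cod A t = Dom A f \<and> f \<cdot>\<^bsub>A\<^esub> t = Zr A (Dom A t) (Cod A f) \<longrightarrow>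
        (\<exists>!s. s \<in> Hom A (Dom A t) (Dom A k) \<and> k \<cdot>\<^bsub>A\<^esub> s = t))"

definition is_cokernel :: "('o, 'm, 'z) catdata_scheme \<Rightarrow> 'm \<Rightarrow> 'm \<Rightarrow> bool" where
  "is_cokernel A f c \<longleftrightarrow>
     f \<in> Ar A \<and> c \<in> Ar A \<and> Dom A c = Cod A f \<and>
     c \<cdot>\<^bsub>A\<^esub> f = Zr A (Dom A f) (Cod A c) \<and>
     (\<forall>t\<in>Ar A. Dom A t = Cod A f \<and> t \<cdot>\<^bsub>A\<^esub> f = Zr A (Dom A f) (Cod A t) \<longrightarrow>
        (\<exists>!s. s \<in> Hom A (Cod A c) (Cod A t) \<and> s \<cdot>\<^bsub>A\<^esub> c = t))"

definition is_image :: "('o, 'm, 'z) catdata_scheme \<Rightarrow> 'm \<Rightarrow> 'm \<Rightarrow> bool" where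
  "is_image A f m \<longleftrightarrow> (\<exists>c. is_cokernel A f c \<and> is_kernel A c m)"

definition is_epi :: "('o, 'm, 'z) catdata_scheme \<Rightarrow> 'm \<Rightarrow> bool" where
  "is_epi A f \<longleftrightarrow>
     f \<in> Ar A \<and>
     (\<forall>Z. \<forall>s\<in>Hom A (Cod A f) Z. \<forall>t\<in>Hom A (Cod A f) Z. s \<cdot>\<^bsub>A\<^esub> f = t \<cdot>\<^bsub>A\<^esub> f \<longrightarrow> s = t)"

text \<open>Exactness of \<open>\<bullet> \<rightarrow> \<bullet> \<rightarrow> \<bullet>\<close> (first \<open>u\<close>, then \<open>v\<close>) in the middle: the image of \<open>u\<close> is the kernel of \<open>v\<close>.\<close>

definition exact_at :: "('o, 'm, 'z) catdata_scheme \<Rightarrow> 'm \<Rightarrow> 'm \<Rightarrow> bool" where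
  "exact_at A u v \<longleftrightarrow> (\<exists>m. is_image A u m \<and> is_kernel A v m)"

text \<open>
  \<open>h\<close> is the endomorphism induced by an endomorphism \<open>n\<close> of the middle object of
  the complex \<open>u, v\<close> on a homology object \<open>Ker v / Im u\<close>. Here \<open>k\<close> is a kernel
  of \<open>v\<close>, \<open>m\<close> an image of \<open>u\<close>, \<open>e\<close> the inclusion of the image into the kernel,
  \<open>\<pi>\<close> the projection of the kernel onto the quotient, and \<open>\<kappa>\<close> the restriction
  of \<open>n\<close> to the kernel. The homology object is \<open>Dom A h = Cod A h\<close>.
\<close>

definition homology_endo :: "('o, 'm, 'z) catdata_scheme \<Rightarrow> 'm \<Rightarrow> 'm \<Rightarrow> 'm \<Rightarrow> 'm \<Rightarrow> bool" where
  "homology_endo A u v n h \<longleftrightarrow>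
     (\<exists>k m e \<pi> \<kappa>.
        is_kernel A v k \<and> is_image A u m \<and>
        e \<in> Hom A (Dom A m) (Dom A k) \<and> k \<cdot>\<^bsub>A\<^esub> e = m \<and>
        is_cokernel A e \<pi> \<and>
        \<kappa> \<in> Hom A (Dom A k) (Dom A k) \<and> k \<cdot>\<^bsub>A\<^esub> \<kappa> = n \<cdot>\<^bsub>A\<^esub> k \<and>
        h \<in> Hom A (Cod A \<pi>) (Cod A \<pi>) \<and> h \<cdot>\<^bsub>A\<^esub> \<pi> = \<pi> \<cdot>\<^bsub>A\<^esub> \<kappa>)"

text \<open>
  The set of objects of the full abelian subcategory of (an abelian category) \<open>A\<close>
  generated by \<open>S\<close>: the smallest class containing \<open>S\<close> and closed under zero
  objects, finite direct sums, kernels and cokernels, all formed in \<open>A\<close>.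
  Closure under isomorphisms is included (kernels are only determined up to isomorphism).
\<close>

inductive_set abelian_hull :: "('o, 'm, 'z) catdata_scheme \<Rightarrow> 'o set \<Rightarrow> 'o set"
  for A :: "('o, 'm, 'z) catdata_scheme" and S :: "'o set" where
  base: "X \<in> S \<Longrightarrow> X \<in> abelian_hull A S"
| zero: "zero_object A Z \<Longrightarrow> Z \<in> abelian_hull A S"
| sum: "\<lbrakk>X \<in> abelian_hull A S; Y \<in> abelian_hull A S; is_biproduct A X Y W i j p q\<rbrakk>
    \<Longrightarrow> W \<in> abelian_hull A S"
| ker: "\<lbrakk>Dom A f \<in> abelian_hull A S; Cod A f \<in> abelian_hull A S; is_kernel A f k\<rbrakk>
    \<Longrightarrow> Dom A k \<in> abelian_hull A S"
| coker: "\<lbrakk>Dom A f \<in> abelian_hull A S; Cod A f \<in> abelian_hull A S; is_cokernel A f c\<rbrakk>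
    \<Longrightarrow> Cod A c \<in> abelian_hull A S"


section \<open>The category of additive functors to abelian groups and the Yoneda embedding\<close>

text \<open>
  The category of abelian groups is modelled by the abelian groups whose carrier
  is a subset of a fixed type \<open>'u\<close>. Functors are not required to be extensional:
  functors differing only off the carriers are isomorphic objects.
  Natural transformations are triples (source, components, target) with
  extensional components.
\<close>

record ('o, 'm, 'u) presheaf =
  pob :: "'o \<Rightarrow> 'u monoid"
  par :: "'m \<Rightarrow> 'u \<Rightarrow> 'u"

type_synonym ('o, 'm, 'u) nattrans =
  "('o, 'm, 'u) presheaf \<times> ('o \<Rightarrow> 'u \<Rightarrow> 'u) \<times> ('o, 'm, 'u) presheaf"

definition is_presheaf :: "('o, 'm, 'z) catdata_scheme \<Rightarrow> ('o, 'm, 'u) presheaf \<Rightarrow> bool" where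
  "is_presheaf A F \<longleftrightarrow>
     (\<forall>X\<in>Ob A. comm_group (pob F X)) \<and>
     (\<forall>X Y. \<forall>f\<in>Hom A X Y. par F f \<in> hom (pob F Y) (pob F X)) \<and>
     (\<forall>X\<in>Ob A. \<forall>x\<in>carrier (pob F X). par F (Idn A X) x = x) \<and>
     (\<forall>X Y Z. \<forall>f\<in>Hom A X Y. \<forall>g\<in>Hom A Y Z. \<forall>x\<in>carrier (pob F Z).
        par F (g \<cdot>\<^bsub>A\<^esub> f) x = par F f (par F g x)) \<and>
     (\<forall>X Y. \<forall>f\<in>Hom A X Y. \<forall>g\<in>Hom A X Y. \<forall>x\<in>carrier (pob F Y).
        par F (Add A f g) x = par F f x \<otimes>\<^bsub>pob F X\<^esub> par F g x)"

definition is_nattrans :: "('o, 'm, 'z) catdata_scheme \<Rightarrow> ('o, 'm, 'u) nattrans \<Rightarrow> bool" where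
  "is_nattrans A = (\<lambda>(F, \<eta>, G).
     is_presheaf A F \<and> is_presheaf A G \<and>
     \<eta> \<in> extensional (Ob A) \<and>
     (\<forall>X\<in>Ob A. \<eta> X \<in> hom (pob F X) (pob G X) \<and> \<eta> X \<in> extensional (carrier (pob F X))) \<and>
     (\<forall>X Y. \<forall>f\<in>Hom A X Y. \<forall>x\<in>carrier (pob F Y). \<eta> X (par F f x) = par G f (\<eta> Y x)))"

definition presheaves ::
  "('o, 'm, 'z) catdata_scheme \<Rightarrow> (('o, 'm, 'u) presheaf, ('o, 'm, 'u) nattrans) catdata" where
  "presheaves A =
     \<lparr>Ob = {F. is_presheaf A F},
      Ar = {t. is_nattrans A t},
      Dom = (\<lambda>(F, \<eta>, G). F),
      Cod = (\<lambda>(F, \<eta>, G). G),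
      Idn = (\<lambda>F. (F, \<lambda>X\<in>Ob A. \<lambda>x\<in>carrier (pob F X). x, F)),
      Cmp = (\<lambda>(F', \<theta>, G') (F, \<eta>, G). (F, \<lambda>X\<in>Ob A. \<lambda>x\<in>carrier (pob F X). \<theta> X (\<eta> X x), G')),
      Add = (\<lambda>(F, \<eta>, G) (F', \<theta>, G').
        (F, \<lambda>X\<in>Ob A. \<lambda>x\<in>carrier (pob F X). \<eta> X x \<otimes>\<^bsub>pob G X\<^esub> \<theta> X x, G)),
      Zr = (\<lambda>F G. (F, \<lambda>X\<in>Ob A. \<lambda>x\<in>carrier (pob F X). \<one>\<^bsub>pob G X\<^esub>, G))\<rparr>"

text \<open>
  The Yoneda embedding. The Hom-groups live in the type \<open>'m\<close> of morphisms and are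
  transported to \<open>'u\<close> along an injection \<open>j\<close>.
\<close>

definition yoneda :: "('m \<Rightarrow> 'u) \<Rightarrow> ('o, 'm, 'z) catdata_scheme \<Rightarrow> 'o \<Rightarrow> ('o, 'm, 'u) presheaf" where
  "yoneda j A X =
     \<lparr>pob = (\<lambda>Y. \<lparr>carrier = j ` Hom A Y X,
                  monoid.mult = (\<lambda>u v. j (Add A (the_inv j u) (the_inv j v))),
                  one = j (Zr A Y X)\<rparr>),
      par = (\<lambda>f u. j (the_inv j u \<cdot>\<^bsub>A\<^esub> f))\<rparr>"

definition yoneda_arr ::
  "('m \<Rightarrow> 'u) \<Rightarrow> ('o, 'm, 'z) catdata_scheme \<Rightarrow> 'm \<Rightarrow> ('o, 'm, 'u) nattrans" where
  "yoneda_arr j A g =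
     (yoneda j A (Dom A g),
      \<lambda>Y\<in>Ob A. \<lambda>u\<in>j ` Hom A Y (Dom A g). j (g \<cdot>\<^bsub>A\<^esub> the_inv j u),
      yoneda j A (Cod A g))"

definition generated_abelian ::
  "('m \<Rightarrow> 'u) \<Rightarrow> ('o, 'm, 'z) catdata_scheme
    \<Rightarrow> (('o, 'm, 'u) presheaf, ('o, 'm, 'u) nattrans) catdata" where
  "generated_abelian j A =
     full_sub (presheaves A) (abelian_hull (presheaves A) (yoneda j A ` Ob A))"


section \<open>Regular additive categories\<close>

text \<open>
  An augmented finite resolution \<open>0 \<rightarrow> Q (n + 1) \<rightarrow> \<dots> \<rightarrow> Q 1 \<rightarrow> Q 0 = M \<rightarrow> 0\<close> with \<open>Q 1, \<dots>, Q (n + 1)\<close>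
  in \<open>S\<close>, extended by zero objects; \<open>\<delta> i\<close> goes from \<open>Q (i + 1)\<close> to \<open>Q i\<close>.
\<close>

definition has_finite_resolution :: "('o, 'm, 'z) catdata_scheme \<Rightarrow> 'o set \<Rightarrow> 'o \<Rightarrow> bool" where
  "has_finite_resolution B S M \<longleftrightarrow>
     (\<exists>(Q :: nat \<Rightarrow> 'o) (\<delta> :: nat \<Rightarrow> 'm) (n :: nat).
        Q 0 = M \<and>
        (\<forall>i. 1 \<le> i \<and> i \<le> n + 1 \<longrightarrow> Q i \<in> S) \<and>
        (\<forall>i > n + 1. zero_object B (Q i)) \<and>
        (\<forall>i. \<delta> i \<in> Hom B (Q (Suc i)) (Q i)) \<and>
        is_epi B (\<delta> 0) \<and>
        (\<forall>i. exact_at B (\<delta> (Suc i)) (\<delta> i)))"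

text \<open>
  \<open>A\<close> is isomorphic to its small envelope: every retract of an object has a
  complement, i.e. every retraction is the projection of a direct sum decomposition.
\<close>

definition retracts_have_complements :: "('o, 'm, 'z) catdata_scheme \<Rightarrow> bool" where
  "retracts_have_complements A \<longleftrightarrow>
     (\<forall>X Y i r. is_retraction A X Y i r \<longrightarrow> (\<exists>Z i' r'. is_biproduct A X Z Y i i' r r'))"

definition regular_category :: "('m \<Rightarrow> 'u) \<Rightarrow> ('o, 'm, 'z) catdata_scheme \<Rightarrow> bool" where
  "regular_category j A \<longleftrightarrow>
     retracts_have_complements A \<and>
     (\<forall>M\<in>Ob (generated_abelian j A).
        has_finite_resolution (generated_abelian j A) (yoneda j A ` Ob A) M)"


section \<open>Triangulated categories\<close>

text \<open>
  The shift \<open>[1]\<close> is an automorphism, given by \<open>Sh\<close> on objects and \<open>ShA\<close> on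
  morphisms. \<open>Dist\<close> consists of the triples \<open>(u, v, w)\<close> of consecutive morphisms
  of the distinguished triangles \<open>X \<rightarrow> Y \<rightarrow> Z \<rightarrow> X[1]\<close>.
\<close>

record ('o, 'm) tricat = "('o, 'm) catdata" +
  Sh   :: "'o \<Rightarrow> 'o"
  ShA  :: "'m \<Rightarrow> 'm"
  Dist :: "('m \<times> 'm \<times> 'm) set"

definition shift_automorphism :: "('o, 'm) tricat \<Rightarrow> bool" where
  "shift_automorphism C \<longleftrightarrow>
     bij_betw (Sh C) (Ob C) (Ob C) \<and> bij_betw (ShA C) (Ar C) (Ar C) \<and>
     (\<forall>X Y. \<forall>f\<in>Hom C X Y. ShA C f \<in> Hom C (Sh C X) (Sh C Y)) \<and>
     (\<forall>X\<in>Ob C. ShA C (Idn C X) = Idn C (Sh C X)) \<and>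
     (\<forall>X Y Z. \<forall>f\<in>Hom C X Y. \<forall>g\<in>Hom C Y Z. ShA C (g \<cdot>\<^bsub>C\<^esub> f) = ShA C g \<cdot>\<^bsub>C\<^esub> ShA C f) \<and>
     (\<forall>X Y. \<forall>f\<in>Hom C X Y. \<forall>g\<in>Hom C X Y. ShA C (Add C f g) = Add C (ShA C f) (ShA C g))"

definition candidate_triangle :: "('o, 'm) tricat \<Rightarrow> 'm \<Rightarrow> 'm \<Rightarrow> 'm \<Rightarrow> bool" where
  "candidate_triangle C u v w \<longleftrightarrow>
     u \<in> Ar C \<and> v \<in> Hom C (Cod C u) (Dom C w) \<and> w \<in> Ar C \<and> Cod C w = Sh C (Dom C u)"

definition triangle_morphism ::
  "('o, 'm) tricat \<Rightarrow> 'm \<times> 'm \<times> 'm \<Rightarrow> 'm \<times> 'm \<times> 'm \<Rightarrow> 'm \<Rightarrow> 'm \<Rightarrow> 'm \<Rightarrow> bool" where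
  "triangle_morphism C = (\<lambda>(u, v, w) (u', v', w') f g h.
     f \<in> Hom C (Dom C u) (Dom C u') \<and>
     g \<in> Hom C (Dom C v) (Dom C v') \<and>
     h \<in> Hom C (Dom C w) (Dom C w') \<and>
     g \<cdot>\<^bsub>C\<^esub> u = u' \<cdot>\<^bsub>C\<^esub> f \<and> h \<cdot>\<^bsub>C\<^esub> v = v' \<cdot>\<^bsub>C\<^esub> g \<and> ShA C f \<cdot>\<^bsub>C\<^esub> w = w' \<cdot>\<^bsub>C\<^esub> h)"

definition TR1 :: "('o, 'm) tricat \<Rightarrow> bool" where
  "TR1 C \<longleftrightarrow>
     (\<forall>(u, v, w)\<in>Dist C. candidate_triangle C u v w) \<and>
     (\<forall>u v w u' v' w' f g h.
        (u, v, w) \<in> Dist C \<and> candidate_triangle C u' v' w' \<and>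
        triangle_morphism C (u, v, w) (u', v', w') f g h \<and>
        isomorphism C f \<and> isomorphism C g \<and> isomorphism C h \<longrightarrow>
        (u', v', w') \<in> Dist C) \<and>
     (\<forall>X Z. X \<in> Ob C \<and> zero_object C Z \<longrightarrow> (Idn C X, Zr C X Z, Zr C Z (Sh C X)) \<in> Dist C) \<and>
     (\<forall>u\<in>Ar C. \<exists>v w. (u, v, w) \<in> Dist C)"

definition TR2 :: "('o, 'm) tricat \<Rightarrow> bool" where
  "TR2 C \<longleftrightarrow>
     (\<forall>u v w. candidate_triangle C u v w \<longrightarrow>
        ((u, v, w) \<in> Dist C \<longleftrightarrow> (v, w, neg C (ShA C u)) \<in> Dist C))"

definition TR3 :: "('o, 'm) tricat \<Rightarrow> bool" where
  "TR3 C \<longleftrightarrow>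
     (\<forall>u v w u' v' w' f g.
        (u, v, w) \<in> Dist C \<and> (u', v', w') \<in> Dist C \<and>
        f \<in> Hom C (Dom C u) (Dom C u') \<and> g \<in> Hom C (Cod C u) (Cod C u') \<and>
        g \<cdot>\<^bsub>C\<^esub> u = u' \<cdot>\<^bsub>C\<^esub> f \<longrightarrow>
        (\<exists>h. triangle_morphism C (u, v, w) (u', v', w') f g h))"

definition TR4 :: "('o, 'm) tricat \<Rightarrow> bool" where
  "TR4 C \<longleftrightarrow>
     (\<forall>u v j k l i m n.
        (u, j, k) \<in> Dist C \<and> (v, l, i) \<in> Dist C \<and> Cod C u = Dom C v \<and>
        (v \<cdot>\<^bsub>C\<^esub> u, m, n) \<in> Dist C \<longrightarrow>
        (\<exists>f g. (f, g, ShA C j \<cdot>\<^bsub>C\<^esub> i) \<in> Dist C \<and>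
           f \<in> Hom C (Cod C j) (Cod C m) \<and> g \<in> Hom C (Cod C m) (Cod C l) \<and>
           f \<cdot>\<^bsub>C\<^esub> j = m \<cdot>\<^bsub>C\<^esub> v \<and> n \<cdot>\<^bsub>C\<^esub> f = k \<and>
           g \<cdot>\<^bsub>C\<^esub> m = l \<and> i \<cdot>\<^bsub>C\<^esub> g = ShA C u \<cdot>\<^bsub>C\<^esub> n))"

definition triangulated_category :: "('o, 'm) tricat \<Rightarrow> bool" where
  "triangulated_category C \<longleftrightarrow>
     additive_category C \<and> shift_automorphism C \<and> TR1 C \<and> TR2 C \<and> TR3 C \<and> TR4 C"

definition unSh :: "('o, 'm) tricat \<Rightarrow> 'o \<Rightarrow> 'o" where
  "unSh C = inv_into (Ob C) (Sh C)"

definition unShA :: "('o, 'm) tricat \<Rightarrow> 'm \<Rightarrow> 'm" where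
  "unShA C = inv_into (Ar C) (ShA C)"

text \<open>\<open>shift C k X\<close> is \<open>X[k]\<close>, and \<open>shift_arr C k f\<close> is \<open>f[k]\<close>.\<close>

definition shift :: "('o, 'm) tricat \<Rightarrow> int \<Rightarrow> 'o \<Rightarrow> 'o" where
  "shift C k = (if 0 \<le> k then Sh C ^^ nat k else unSh C ^^ nat (- k))"

definition shift_arr :: "('o, 'm) tricat \<Rightarrow> int \<Rightarrow> 'm \<Rightarrow> 'm" where
  "shift_arr C k = (if 0 \<le> k then ShA C ^^ nat k else unShA C ^^ nat (- k))"


section \<open>Weight structures\<close>

definition additive_subclass :: "('o, 'm, 'z) catdata_scheme \<Rightarrow> 'o set \<Rightarrow> bool" where
  "additive_subclass A S \<longleftrightarrow>
     S \<subseteq> Ob A \<and> (\<exists>Z\<in>S. zero_object A Z) \<and>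
     (\<forall>X\<in>S. \<forall>Y\<in>S. \<forall>W i j p q. is_biproduct A X Y W i j p q \<longrightarrow> W \<in> S)"

definition karoubi_closed :: "('o, 'm, 'z) catdata_scheme \<Rightarrow> 'o set \<Rightarrow> bool" where
  "karoubi_closed A S \<longleftrightarrow> (\<forall>X Y i r. Y \<in> S \<and> is_retraction A X Y i r \<longrightarrow> X \<in> S)"

definition orthogonal :: "('o, 'm, 'z) catdata_scheme \<Rightarrow> 'o set \<Rightarrow> 'o set \<Rightarrow> bool" where
  "orthogonal A D E \<longleftrightarrow> (\<forall>X\<in>D. \<forall>Y\<in>E. Hom A X Y = {Zr A X Y})"

text \<open>\<open>Wle\<close> and \<open>Wge\<close> stand for \<open>C\<^sup>w\<^sup>\<le>\<^sup>0\<close> and \<open>C\<^sup>w\<^sup>\<ge>\<^sup>0\<close>.\<close>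

definition weight_structure :: "('o, 'm) tricat \<Rightarrow> 'o set \<Rightarrow> 'o set \<Rightarrow> bool" where
  "weight_structure C Wle Wge \<longleftrightarrow>
     additive_subclass C Wle \<and> additive_subclass C Wge \<and>
     karoubi_closed C Wle \<and> karoubi_closed C Wge \<and>
     Wge \<subseteq> Sh C ` Wge \<and> Sh C ` Wle \<subseteq> Wle \<and>
     orthogonal C Wge (Sh C ` Wle) \<and>
     (\<forall>X\<in>Ob C. \<exists>A\<in>Wle. \<exists>B\<in>Wge. \<exists>u v f.
        u \<in> Hom C (unSh C B) X \<and> v \<in> Hom C X A \<and> f \<in> Hom C A B \<and> (u, v, f) \<in> Dist C)"

definition bounded_weight_structure :: "('o, 'm) tricat \<Rightarrow> 'o set \<Rightarrow> 'o set \<Rightarrow> bool" where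
  "bounded_weight_structure C Wle Wge \<longleftrightarrow>
     weight_structure C Wle Wge \<and>
     (\<Union>l. shift C (- l) ` Wle) = Ob C \<and> (\<Union>l. shift C (- l) ` Wge) = Ob C"

definition heart :: "('o, 'm) tricat \<Rightarrow> 'o set \<Rightarrow> 'o set \<Rightarrow> ('o, 'm) catdata" where
  "heart C Wle Wge = full_sub C (Wge \<inter> Wle)"


section \<open>Weight Postnikov towers and the weight complex\<close>

text \<open>
  In a tower of \<open>X\<close>, for every integer \<open>k\<close>:
  \<open>tL k\<close>, \<open>tR k\<close>, \<open>tG k\<close> are the objects \<open>X\<^sup>w\<^sup>\<le>\<^sup>k\<close>, \<open>X\<^sup>w\<^sup>\<ge>\<^sup>k\<close>, \<open>X\<^sup>k\<close>;

  \<open>X[k] \<rightarrow> X\<^sup>w\<^sup>\<le>\<^sup>k \<rightarrow> X\<^sup>w\<^sup>\<ge>\<^sup>k\<^sup>+\<^sup>1 \<rightarrow> X[k+1]\<close> is formed by \<open>ta k\<close>, \<open>tf k\<close>, \<open>tb k\<close>;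

  \<open>X\<^sup>w\<^sup>\<le>\<^sup>k[-1] \<rightarrow> X\<^sup>w\<^sup>\<le>\<^sup>k\<^sup>-\<^sup>1 \<rightarrow> X\<^sup>k \<rightarrow> X\<^sup>w\<^sup>\<le>\<^sup>k\<close> is formed by \<open>tp k\<close>, \<open>tc k\<close>, \<open>td k\<close>;

  \<open>X\<^sup>w\<^sup>\<ge>\<^sup>k\<^sup>+\<^sup>1[-1] \<rightarrow> X\<^sup>w\<^sup>\<ge>\<^sup>k \<rightarrow> X\<^sup>k \<rightarrow> X\<^sup>w\<^sup>\<ge>\<^sup>k\<^sup>+\<^sup>1\<close> is formed by \<open>tq k\<close>, \<open>ty k\<close> and the
  composite of \<open>td k\<close> and \<open>tf k\<close>.
\<close>

record ('o, 'm) tower =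
  tL :: "int \<Rightarrow> 'o"
  tR :: "int \<Rightarrow> 'o"
  tG :: "int \<Rightarrow> 'o"
  ta :: "int \<Rightarrow> 'm"
  tf :: "int \<Rightarrow> 'm"
  tb :: "int \<Rightarrow> 'm"
  tp :: "int \<Rightarrow> 'm"
  tq :: "int \<Rightarrow> 'm"
  tc :: "int \<Rightarrow> 'm"
  td :: "int \<Rightarrow> 'm"
  ty :: "int \<Rightarrow> 'm"

text \<open>
  Signs: shifting the distinguished triangle \<open>(a, f, b)\<close> by \<open>[-1]\<close> gives, up to isomorphism,
  the distinguished triangle \<open>(a[-1], f[-1], - b[-1])\<close>; this is the source of the minus
  sign in the condition on \<open>tb\<close>. The map \<open>X\<^sup>k[-1] \<rightarrow> X\<^sup>w\<^sup>\<ge>\<^sup>k\<^sup>+\<^sup>1[-1]\<close> of the tower is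
  \<open>x\<^sup>k = (f\<^sup>k \<circ> d\<^sup>k)[-1]\<close>; its triangle is stated in the rotated form, whose last map is
  \<open>x\<^sup>k[1] = f\<^sup>k \<circ> d\<^sup>k\<close>, without a rotation sign.
\<close>

definition weight_tower ::
  "('o, 'm) tricat \<Rightarrow> 'o set \<Rightarrow> 'o set \<Rightarrow> 'o \<Rightarrow> ('o, 'm) tower \<Rightarrow> bool" where
  "weight_tower C Wle Wge X T \<longleftrightarrow>
     (\<forall>k. tL T k \<in> Wle \<and> tR T k \<in> Wge \<and> tG T k \<in> Wge \<inter> Wle \<and>
        ta T k \<in> Hom C (shift C k X) (tL T k) \<and>
        tf T k \<in> Hom C (tL T k) (tR T (k + 1)) \<and>
        tb T k \<in> Hom C (tR T (k + 1)) (shift C (k + 1) X) \<and>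
        (ta T k, tf T k, tb T k) \<in> Dist C \<and>
        tp T k \<in> Hom C (unSh C (tL T k)) (tL T (k - 1)) \<and>
        tq T k \<in> Hom C (unSh C (tR T (k + 1))) (tR T k) \<and>
        tp T k \<cdot>\<^bsub>C\<^esub> unShA C (ta T k) = ta T (k - 1) \<and>
        tq T k \<cdot>\<^bsub>C\<^esub> unShA C (tf T k) = tf T (k - 1) \<cdot>\<^bsub>C\<^esub> tp T k \<and>
        tb T (k - 1) \<cdot>\<^bsub>C\<^esub> tq T k = neg C (unShA C (tb T k)) \<and>
        tc T k \<in> Hom C (tL T (k - 1)) (tG T k) \<and>
        td T k \<in> Hom C (tG T k) (tL T k) \<and>
        ty T k \<in> Hom C (tR T k) (tG T k) \<and>
        (tp T k, tc T k, td T k) \<in> Dist C \<and>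
        (tq T k, ty T k, tf T k \<cdot>\<^bsub>C\<^esub> td T k) \<in> Dist C \<and>
        tc T k = ty T k \<cdot>\<^bsub>C\<^esub> tf T (k - 1))"

text \<open>An endomorphism \<open>(gL, gR, gG)\<close> of the tower \<open>T\<close> of \<open>X\<close> extending \<open>g\<close>.\<close>

definition tower_endo ::
  "('o, 'm) tricat \<Rightarrow> ('o, 'm) tower \<Rightarrow> 'm \<Rightarrow> (int \<Rightarrow> 'm) \<Rightarrow> (int \<Rightarrow> 'm) \<Rightarrow> (int \<Rightarrow> 'm) \<Rightarrow> bool" where
  "tower_endo C T g gL gR gG \<longleftrightarrow>
     (\<forall>k. gL k \<in> Hom C (tL T k) (tL T k) \<and>
        gR k \<in> Hom C (tR T k) (tR T k) \<and>
        gG k \<in> Hom C (tG T k) (tG T k) \<and>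
        gL k \<cdot>\<^bsub>C\<^esub> ta T k = ta T k \<cdot>\<^bsub>C\<^esub> shift_arr C k g \<and>
        gR (k + 1) \<cdot>\<^bsub>C\<^esub> tf T k = tf T k \<cdot>\<^bsub>C\<^esub> gL k \<and>
        shift_arr C (k + 1) g \<cdot>\<^bsub>C\<^esub> tb T k = tb T k \<cdot>\<^bsub>C\<^esub> gR (k + 1) \<and>
        gL (k - 1) \<cdot>\<^bsub>C\<^esub> tp T k = tp T k \<cdot>\<^bsub>C\<^esub> unShA C (gL k) \<and>
        gR k \<cdot>\<^bsub>C\<^esub> tq T k = tq T k \<cdot>\<^bsub>C\<^esub> unShA C (gR (k + 1)) \<and>
        gG k \<cdot>\<^bsub>C\<^esub> tc T k = tc T k \<cdot>\<^bsub>C\<^esub> gL (k - 1) \<and>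
        gL k \<cdot>\<^bsub>C\<^esub> td T k = td T k \<cdot>\<^bsub>C\<^esub> gG k \<and>
        gG k \<cdot>\<^bsub>C\<^esub> ty T k = ty T k \<cdot>\<^bsub>C\<^esub> gR k)"

definition weight_complex_diff :: "('o, 'm) tricat \<Rightarrow> ('o, 'm) tower \<Rightarrow> int \<Rightarrow> 'm" where
  "weight_complex_diff C T i = tc T (i + 1) \<cdot>\<^bsub>C\<^esub> td T i"

text \<open>
  \<open>h i\<close> is the endomorphism \<open>g\<^sub>i\<^sub>*\<close> of \<open>H\<^sub>i(t(X))\<close>, for some choice of a weight Postnikov
  tower of \<open>X\<close>, of an extension of \<open>g\<close> to it and of homology objects.
\<close>

definition weight_homology_endo ::
  "('m \<Rightarrow> 'u) \<Rightarrow> ('o, 'm) tricat \<Rightarrow> 'o set \<Rightarrow> 'o set \<Rightarrow> 'm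
    \<Rightarrow> (int \<Rightarrow> ('o, 'm, 'u) nattrans) \<Rightarrow> bool" where
  "weight_homology_endo j C Wle Wge g h \<longleftrightarrow>
     (\<exists>T gL gR gG.
        weight_tower C Wle Wge (Dom C g) T \<and> tower_endo C T g gL gR gG \<and>
        (\<forall>i. homology_endo (generated_abelian j (heart C Wle Wge))
               (yoneda_arr j (heart C Wle Wge) (weight_complex_diff C T (i - 1)))
               (yoneda_arr j (heart C Wle Wge) (weight_complex_diff C T i))
               (yoneda_arr j (heart C Wle Wge) (gG i))
               (h i)))"


section \<open>Grothendieck groups of endomorphisms\<close>

definition endos :: "('o, 'm, 'z) catdata_scheme \<Rightarrow> 'm set" where
  "endos A = {g \<in> Ar A. Dom A g = Cod A g}"

text \<open>
  The abelian group with generators \<open>G\<close> and relations \<open>[g] = [f] + [h]\<close> for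
  \<open>(f, g, h) \<in> E\<close>. It is written multiplicatively, following the library.
\<close>

definition K0_relations :: "('m \<times> 'm \<times> 'm) set \<Rightarrow> ('m \<Rightarrow>\<^sub>0 int) set" where
  "K0_relations E = {frag_of g - (frag_of f + frag_of h) | f g h. (f, g, h) \<in> E}"

definition K0_presented :: "'m set \<Rightarrow> ('m \<times> 'm \<times> 'm) set \<Rightarrow> ('m \<Rightarrow>\<^sub>0 int) set monoid" where
  "K0_presented G E =
     free_Abelian_group G Mod generate (free_Abelian_group G) (K0_relations E)"

definition K0_presented_class :: "'m set \<Rightarrow> ('m \<times> 'm \<times> 'm) set \<Rightarrow> 'm \<Rightarrow> ('m \<Rightarrow>\<^sub>0 int) set" where
  "K0_presented_class G E g =
     generate (free_Abelian_group G) (K0_relations E) #>\<^bsub>free_Abelian_group G\<^esub> frag_of g"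

text \<open>\<open>(f, g, h)\<close> is an endomorphism of the sequence \<open>X \<rightarrow> Y \<rightarrow> Z\<close> formed by \<open>i\<close> and \<open>p\<close>.\<close>

definition sequence_endo ::
  "('o, 'm, 'z) catdata_scheme \<Rightarrow> 'm \<Rightarrow> 'm \<Rightarrow> 'm \<Rightarrow> 'm \<Rightarrow> 'm \<Rightarrow> bool" where
  "sequence_endo A i p f g h \<longleftrightarrow>
     f \<in> Hom A (Dom A i) (Dom A i) \<and> g \<in> Hom A (Cod A i) (Cod A i) \<and>
     h \<in> Hom A (Cod A p) (Cod A p) \<and> g \<cdot>\<^bsub>A\<^esub> i = i \<cdot>\<^bsub>A\<^esub> f \<and> h \<cdot>\<^bsub>A\<^esub> p = p \<cdot>\<^bsub>A\<^esub> g"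

definition split_exact :: "('o, 'm, 'z) catdata_scheme \<Rightarrow> 'm \<Rightarrow> 'm \<Rightarrow> bool" where
  "split_exact A i p \<longleftrightarrow>
     (\<exists>s r. is_biproduct A (Dom A i) (Cod A p) (Cod A i) i s r p)"

definition short_exact :: "('o, 'm, 'z) catdata_scheme \<Rightarrow> 'm \<Rightarrow> 'm \<Rightarrow> bool" where
  "short_exact A i p \<longleftrightarrow> is_kernel A p i \<and> is_cokernel A i p"

definition add_triples :: "('o, 'm, 'z) catdata_scheme \<Rightarrow> ('m \<times> 'm \<times> 'm) set" where
  "add_triples A = {(f, g, h). \<exists>i p. split_exact A i p \<and> sequence_endo A i p f g h}"

definition ab_triples :: "('o, 'm, 'z) catdata_scheme \<Rightarrow> ('m \<times> 'm \<times> 'm) set" where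
  "ab_triples A = {(f, g, h). \<exists>i p. short_exact A i p \<and> sequence_endo A i p f g h}"

definition tr_triples :: "('o, 'm) tricat \<Rightarrow> ('m \<times> 'm \<times> 'm) set" where
  "tr_triples C =
     {(f, g, h). \<exists>u v w. (u, v, w) \<in> Dist C \<and> triangle_morphism C (u, v, w) (u, v, w) f g h}"

definition K0_add :: "('o, 'm, 'z) catdata_scheme \<Rightarrow> ('m \<Rightarrow>\<^sub>0 int) set monoid" where
  "K0_add A = K0_presented (endos A) (add_triples A)"

definition K0_ab :: "('o, 'm, 'z) catdata_scheme \<Rightarrow> ('m \<Rightarrow>\<^sub>0 int) set monoid" where
  "K0_ab A = K0_presented (endos A) (ab_triples A)"

definition K0_tr :: "('o, 'm) tricat \<Rightarrow> ('m \<Rightarrow>\<^sub>0 int) set monoid" where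
  "K0_tr C = K0_presented (endos C) (tr_triples C)"

definition class_add :: "('o, 'm, 'z) catdata_scheme \<Rightarrow> 'm \<Rightarrow> ('m \<Rightarrow>\<^sub>0 int) set" where
  "class_add A = K0_presented_class (endos A) (add_triples A)"

definition class_ab :: "('o, 'm, 'z) catdata_scheme \<Rightarrow> 'm \<Rightarrow> ('m \<Rightarrow>\<^sub>0 int) set" where
  "class_ab A = K0_presented_class (endos A) (ab_triples A)"

definition class_tr :: "('o, 'm) tricat \<Rightarrow> 'm \<Rightarrow> ('m \<Rightarrow>\<^sub>0 int) set" where
  "class_tr C = K0_presented_class (endos C) (tr_triples C)"

text \<open>
  The alternating sum of the classes of endomorphisms \<open>h i\<close>, in multiplicative notation,
  over the indices for which the underlying object is nonzero
  (endomorphisms of zero objects have trivial class).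
\<close>

definition euler_support ::
  "('o, 'm, 'z) catdata_scheme \<Rightarrow> (int \<Rightarrow> 'm) \<Rightarrow> int set" where
  "euler_support B h = {i. \<not> zero_object B (Dom B (h i))}"

definition euler_class ::
  "('o, 'm, 'z) catdata_scheme \<Rightarrow> (int \<Rightarrow> 'm) \<Rightarrow> ('m \<Rightarrow>\<^sub>0 int) set" where
  "euler_class B h =
     finprod (K0_ab B)
       (\<lambda>i. class_ab B (h i) [^]\<^bsub>K0_ab B\<^esub> (if even i then 1 else - 1 :: int))
       (euler_support B h)"

end

theory Submission
  imports Defs
begin

text \<open>
  Choose a weight decomposition \<open>a : X \<rightarrow> L\<close> of every object \<open>X\<close>, and for \<open>P\<close> in the heart let \<open>H(X)(P)\<close> consist
  of those \<open>y : P \<rightarrow> L\<close> for which \<open>y \<circ> q\<close> factors through \<open>a\<close> for some \<open>q : Q \<rightarrow> P\<close> with cone in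
  \<open>C\<^sup>w\<^sup>\<ge>\<^sup>0[-1]\<close>. This is a homological functor which extends the Yoneda embedding of the heart and vanishes on
  \<open>C\<^sup>w\<^sup>\<le>\<^sup>0[1]\<close> and on \<open>C\<^sup>w\<^sup>\<ge>\<^sup>0[-1]\<close>, and a diagram chase in a weight Postnikov tower identifies \<open>H\<^sub>i(t(X))\<close>
  with \<open>H(X[i])\<close>. So \<open>d\<close> is the Euler characteristic of \<open>H\<close>, which is additive by the long exact sequence.
  The map \<open>c\<close> is onto because an endomorphism of a bounded object is decomposed by splitting off one weight
  after the other. If the heart is regular, endomorphisms lift to finite resolutions by representable functors;
  by the horseshoe argument the alternating sum of the classes of the lifts is additive in short exact sequences,
  and a resolution of a representable functor splits since retracts have complements, so that this sum does not
  depend on the resolution. This gives a homomorphism \<open>e\<close> such that \<open>e \<circ> d \<circ> c\<close> is the identity.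
\<close>

section \<open>Presented Grothendieck groups\<close>

text \<open>Cones are not functorial: an endomorphism of a triangle need not extend to compatible
  endomorphisms of weight Postnikov towers of its three vertices, so additivity of \<open>d\<close>
  cannot be read off from weight complexes. Hence \<open>d\<close> is defined through
  \<open>H\<close>, which involves no tower, and compared with the homology of the weight complex
  afterwards; this also settles independence of all choices. Two more obstacles shape the text. The
  axioms complete one square at a time, whereas a tower endomorphism must respect several triangles
  that share an object; the towers are therefore built by the octahedral axiom, whose extra identity
  \<open>td T k \<cdot> ty T k = ta T k \<cdot> tb T (k - 1)\<close> permits a correction in each
  degree. And all presheaves must take values in groups inside the one type \<open>'u\<close>, which
  colimits and quotients formed from equivalence classes would leave; so the values of
  \<open>H\<close> are cut out of Hom-sets, and quotient groups live on representatives. In the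
  regular case no chain homotopies occur: the alternating sum is shown to be unique by computing it
  for a trivial quotient.\<close>

locale presented =
  fixes G :: "'m set" and E :: "('m \<times> 'm \<times> 'm) set"
  assumes E_subset: "E \<subseteq> G \<times> G \<times> G"
begin

abbreviation "K \<equiv> K0_presented G E"
abbreviation "cls \<equiv> K0_presented_class G E"
abbreviation "F \<equiv> free_Abelian_group G"
abbreviation "N \<equiv> generate F (K0_relations E)"

lemma relations_subset: "K0_relations E \<subseteq> carrier F"
proof
  fix x assume "x \<in> K0_relations E"
  then obtain f g h where x: "x = frag_of g - (frag_of f + frag_of h)" and "(f, g, h) \<in> E"
    by (auto simp: K0_relations_def)
  then have "f \<in> G" "g \<in> G" "h \<in> G" using E_subset by auto
  then show "x \<in> carrier F"
    unfolding x carrier_free_Abelian_group_iff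
    by (intro order_trans[OF keys_diff] Un_least order_trans[OF keys_add]) auto
qed

lemma subgroup_N: "subgroup N F"
  by (rule group.generate_is_subgroup[OF group_free_Abelian_group relations_subset])

lemma normal_N: "N \<lhd> F"
  using comm_group.normal_iff_subgroup[OF abelian_free_Abelian_group] subgroup_N by blast

lemma comm_group_K: "comm_group K"
  unfolding K0_presented_def
  by (rule comm_group.abelian_FactGroup[OF abelian_free_Abelian_group subgroup_N])

sublocale K: comm_group K by (rule comm_group_K)

lemma cls_closed [simp, intro]: "g \<in> G \<Longrightarrow> cls g \<in> carrier K"
  by (auto simp: K0_presented_def K0_presented_class_def carrier_FactGroup)

lemma coset_hom: "(\<lambda>x. N #>\<^bsub>F\<^esub> x) \<in> hom F K"
  unfolding K0_presented_def by (rule normal.r_coset_hom_Mod[OF normal_N])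

lemma cls_relation:
  assumes "(f, g, h) \<in> E"
  shows "cls g = cls f \<otimes>\<^bsub>K\<^esub> cls h"
proof -
  have G: "f \<in> G" "g \<in> G" "h \<in> G" using assms E_subset by auto
  have fh: "frag_of f + frag_of h \<in> carrier F"
    using G by (auto intro!: order_trans[OF keys_add])
  have "frag_of g - (frag_of f + frag_of h) \<in> N"
    by (rule generate.incl) (use assms in \<open>auto simp: K0_relations_def\<close>)
  then have "(frag_of g - (frag_of f + frag_of h)) \<otimes>\<^bsub>F\<^esub> (frag_of f + frag_of h) \<in> N #>\<^bsub>F\<^esub> (frag_of f + frag_of h)"
    unfolding r_coset_def by blast
  then have "frag_of g \<in> N #>\<^bsub>F\<^esub> (frag_of f + frag_of h)" by simp
  then have "N #>\<^bsub>F\<^esub> (frag_of f + frag_of h) = N #>\<^bsub>F\<^esub> frag_of g"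
    by (rule group.repr_independence[OF group_free_Abelian_group _ fh subgroup_N])
  then show ?thesis
    using hom_mult[OF coset_hom, of "frag_of f" "frag_of h"] G
    by (simp add: K0_presented_class_def)
qed

lemma universal:
  assumes "comm_group H" and \<phi>: "\<And>g. g \<in> G \<Longrightarrow> \<phi> g \<in> carrier H"
    and rel: "\<And>f g h. (f, g, h) \<in> E \<Longrightarrow> \<phi> g = \<phi> f \<otimes>\<^bsub>H\<^esub> \<phi> h"
  shows "\<exists>\<psi>\<in>hom K H. \<forall>g\<in>G. \<psi> (cls g) = \<phi> g"
proof -
  interpret H: comm_group H by fact
  obtain h where h: "h \<in> hom F H" and h_of: "\<And>x. x \<in> G \<Longrightarrow> h (frag_of x) = \<phi> x"
    using H.free_Abelian_group_universal[of \<phi> G] \<phi> by blast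
  interpret hm: group_hom F H h
    by (simp add: h group_hom_def group_hom_axioms_def)
  have sub: "subgroup (kernel F H h) F" by (rule hm.subgroup_kernel)
  have "K0_relations E \<subseteq> kernel F H h"
  proof
    fix x assume x: "x \<in> K0_relations E"
    then obtain a b c where xe: "x = frag_of b - (frag_of a + frag_of c)" and abc: "(a, b, c) \<in> E"
      by (auto simp: K0_relations_def)
    have G: "a \<in> G" "b \<in> G" "c \<in> G" using abc E_subset by auto
    have k: "frag_of a \<in> carrier F" "frag_of b \<in> carrier F" "frag_of c \<in> carrier F" using G by auto
    then have ac: "frag_of a + frag_of c \<in> carrier F" using hm.G.m_closed[of "frag_of a" "frag_of c"] by simp
    have xF: "x \<in> carrier F" using x relations_subset by (rule subsetD[rotated])
    have "h (x \<otimes>\<^bsub>F\<^esub> (frag_of a \<otimes>\<^bsub>F\<^esub> frag_of c)) = h x \<otimes>\<^bsub>H\<^esub> (h (frag_of a) \<otimes>\<^bsub>H\<^esub> h (frag_of c))"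
      using k ac xF hm.hom_mult by (metis mult_free_Abelian_group)
    then have "\<phi> b = h x \<otimes>\<^bsub>H\<^esub> (\<phi> a \<otimes>\<^bsub>H\<^esub> \<phi> c)" using h_of G xe by simp
    then have "h x = \<one>\<^bsub>H\<^esub>"
      using rel[OF abc] \<phi>[OF G(1)] \<phi>[OF G(2)] \<phi>[OF G(3)] hm.hom_closed[OF xF]
      by (simp del: H.m_assoc)
    then show "x \<in> kernel F H h" using xF by (simp add: kernel_def)
  qed
  then have N: "N \<subseteq> kernel F H h"
    by (rule group.generate_subgroup_incl[OF group_free_Abelian_group _ sub])
  obtain \<psi> where "\<psi> \<in> hom (F Mod N) H" and \<psi>: "\<And>x. x \<in> carrier F \<Longrightarrow> \<psi> (N #>\<^bsub>F\<^esub> x) = h x"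
  proof (rule FactGroup_universal[OF h normal_N])
    fix x y assume x: "x \<in> carrier F" and y: "y \<in> carrier F" and e: "N #>\<^bsub>F\<^esub> x = N #>\<^bsub>F\<^esub> y"
    have "x \<in> N #>\<^bsub>F\<^esub> y"
      using e group.rcos_self[OF group_free_Abelian_group x subgroup_N] by simp
    then obtain n where n: "n \<in> N" and xn: "x = n \<otimes>\<^bsub>F\<^esub> y" by (auto simp: r_coset_def)
    have "n \<in> carrier F" "h n = \<one>\<^bsub>H\<^esub>" using n N by (auto simp: kernel_def)
    then show "h x = h y" using y hm.hom_mult[of n y] hm.hom_closed[OF y] xn by simp
  qed (use that in blast)
  then show ?thesis
    by (auto intro!: bexI[of _ \<psi>] simp: K0_presented_def K0_presented_class_def h_of)
qed

lemma induct [consumes 1, case_names one cls mult inv]: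
  assumes "x \<in> carrier K"
    and one: "P \<one>\<^bsub>K\<^esub>" and cl: "\<And>g. g \<in> G \<Longrightarrow> P (cls g)"
    and mult: "\<And>x y. x \<in> carrier K \<Longrightarrow> y \<in> carrier K \<Longrightarrow> P x \<Longrightarrow> P y \<Longrightarrow> P (x \<otimes>\<^bsub>K\<^esub> y)"
    and inv: "\<And>x. x \<in> carrier K \<Longrightarrow> P x \<Longrightarrow> P (inv\<^bsub>K\<^esub> x)"
  shows "P x"
proof -
  interpret hm: group_hom F K "\<lambda>x. N #>\<^bsub>F\<^esub> x"
    by (simp add: coset_hom group_hom_def group_hom_axioms_def K.is_group)
  have "Poly_Mapping.keys c \<subseteq> G \<and> P (N #>\<^bsub>F\<^esub> c)" if "Poly_Mapping.keys c \<subseteq> G" for c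
    using that
  proof (induction rule: frag_induction)
    case zero
    then show ?case using hm.hom_one one by simp
  next
    case (one g)
    then show ?case using cl by (simp add: K0_presented_class_def)
  next
    case (diff a b)
    then have ab: "a \<in> carrier F" "b \<in> carrier F" by auto
    have e: "a - b = a \<otimes>\<^bsub>F\<^esub> inv\<^bsub>F\<^esub> b" using diff by simp
    have "P (N #>\<^bsub>F\<^esub> (a - b))"
      unfolding e using ab diff hm.hom_mult hm.hom_inv
      by (metis hm.hom_closed hm.G.inv_closed inv mult K.inv_closed)
    moreover have "Poly_Mapping.keys (a - b) \<subseteq> G"
      using diff by (intro order_trans[OF keys_diff]) auto
    ultimately show ?case by simp
  qed
  then show ?thesis
    using assms(1) by (auto simp: K0_presented_def carrier_FactGroup)
qed

end

section \<open>Alternating products and long exact sequences\<close>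

context comm_group
begin

definition alt :: "(int \<Rightarrow> 'a) \<Rightarrow> int \<Rightarrow> 'a" where
  "alt a i = a i [^] (if even i then 1 else - 1 :: int)"

lemma alt_closed [simp, intro]: "a i \<in> carrier G \<Longrightarrow> alt a i \<in> carrier G"
  by (simp add: alt_def)

lemma alt_mult: "a i \<in> carrier G \<Longrightarrow> b i \<in> carrier G \<Longrightarrow> alt (\<lambda>i. a i \<otimes> b i) i = alt a i \<otimes> alt b i"
  by (simp add: alt_def int_pow_distrib)

lemma alt_one [simp]: "a i = \<one> \<Longrightarrow> alt a i = \<one>"
  by (simp add: alt_def)

lemma alt_shift: "a (i - 1) \<in> carrier G \<Longrightarrow> alt (\<lambda>i. a (i - 1)) i = inv (alt a (i - 1))"
  by (auto simp: alt_def int_pow_neg)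

text \<open>In a long exact sequence with terms of classes \<open>x i\<close>, \<open>y i\<close>, \<open>z i\<close>, the images of the maps have classes \<open>u i\<close>, \<open>v i\<close>, \<open>w i\<close>.\<close>

lemma finprod_alt_long_exact:
  assumes I: "finite I"
    and cl: "\<And>i. u i \<in> carrier G" "\<And>i. v i \<in> carrier G" "\<And>i. w i \<in> carrier G"
    and x: "\<And>i. x i = w (i - 1) \<otimes> u i" and y: "\<And>i. y i = u i \<otimes> v i" and z: "\<And>i. z i = v i \<otimes> w i"
    and out: "\<And>i. i \<notin> I \<Longrightarrow> w i = \<one>" "\<And>i. i - 1 \<notin> I \<Longrightarrow> i \<in> I \<Longrightarrow> w (i - 1) = \<one>"
      "\<And>i. i \<in> I \<Longrightarrow> i + 1 \<notin> I \<Longrightarrow> w i = \<one>"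
  shows "finprod G (alt y) I = finprod G (alt x) I \<otimes> finprod G (alt z) I"
proof -
  \<comment> \<open>Reindexing by \<open>i - 1\<close> inverts every factor. The shifted index set
    differs from \<open>I\<close> only at indices where \<open>w\<close> is trivial, by the
    hypotheses \<open>out\<close>. So the images of the connecting maps, which occur once in
    \<open>x\<close> and once in \<open>z\<close>, cancel.\<close>
  have W: "finprod G (alt (\<lambda>i. w (i - 1))) I = inv (finprod G (alt w) I)"
  proof -
    have "finprod G (alt (\<lambda>i. w (i - 1))) I = finprod G (\<lambda>i. inv (alt w (i - 1))) I"
      by (intro finprod_cong) (auto simp: alt_shift cl)
    also have "\<dots> = finprod G (\<lambda>i. inv (alt w i)) ((\<lambda>i. i - 1) ` I)"
      using finprod_reindex[of "\<lambda>i. inv (alt w i)" "\<lambda>i. i - 1" I] cl by (auto simp: inj_on_def)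
    also have "\<dots> = finprod G (\<lambda>i. inv (alt w i)) I"
    proof (rule finprod_mono_neutral_cong)
      show "finite ((\<lambda>i. i - 1) ` I)" "finite I" using I by auto
      show "inv (alt w i) = \<one>" if "i \<in> (\<lambda>i. i - 1) ` I - I" for i using that out by auto
      show "inv (alt w i) = \<one>" if "i \<in> I - (\<lambda>i. i - 1) ` I" for i
      proof -
        have "i + 1 \<notin> I" using that by (force simp: image_iff)
        then show ?thesis using that out(3) by auto
      qed
    qed (use cl in auto)
    also have "\<dots> = inv (finprod G (alt w) I)"
      using I
    proof (induction I)
      case (insert a J)
      then show ?case using cl by (simp add: inv_mult Pi_def)
    qed simp
    finally show ?thesis .
  qed
  have "finprod G (alt x) I = finprod G (\<lambda>i. alt (\<lambda>i. w (i - 1)) i \<otimes> alt u i) I"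
    using cl by (intro finprod_cong) (auto simp: x[abs_def] alt_mult)
  also have "\<dots> = inv (finprod G (alt w) I) \<otimes> finprod G (alt u) I"
    using cl by (simp add: Pi_def flip: W)
  finally have X: "finprod G (alt x) I = inv (finprod G (alt w) I) \<otimes> finprod G (alt u) I" .
  have Y: "finprod G (alt y) I = finprod G (alt u) I \<otimes> finprod G (alt v) I"
  proof -
    have "finprod G (alt y) I = finprod G (\<lambda>i. alt u i \<otimes> alt v i) I"
      using cl by (intro finprod_cong) (auto simp: y[abs_def] alt_mult)
    then show ?thesis using cl by (simp add: Pi_def)
  qed
  have Z: "finprod G (alt z) I = finprod G (alt v) I \<otimes> finprod G (alt w) I"
  proof -
    have "finprod G (alt z) I = finprod G (\<lambda>i. alt v i \<otimes> alt w i) I"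
      using cl by (intro finprod_cong) (auto simp: z[abs_def] alt_mult)
    then show ?thesis using cl by (simp add: Pi_def)
  qed
  have c: "finprod G (alt u) I \<in> carrier G" "finprod G (alt v) I \<in> carrier G" "finprod G (alt w) I \<in> carrier G"
    using cl by auto
  show ?thesis unfolding X Y Z using c by (simp add: m_ac)
qed

end

section \<open>Preadditive categories\<close>

lemma in_Hom: "f \<in> Hom A X Y \<longleftrightarrow> f \<in> Ar A \<and> Dom A f = X \<and> Cod A f = Y"
  by (auto simp: Hom_def)

lemma HomD:
  assumes "f \<in> Hom A X Y"
  shows "f \<in> Ar A" "Dom A f = X" "Cod A f = Y"
  using assms by (auto simp: Hom_def)

locale preadd =
  fixes A :: "('o, 'm, 'z) catdata_scheme" (structure)
  assumes preadditive: "preadditive A"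
begin

lemma category: "is_category A"
  using preadditive by (simp add: preadditive_def)

lemma Dom_Ob [simp]: "f \<in> Ar A \<Longrightarrow> Dom A f \<in> Ob A"
  and Cod_Ob [simp]: "f \<in> Ar A \<Longrightarrow> Cod A f \<in> Ob A"
  using category by (auto simp: is_category_def)

lemma Idn_Hom [intro]: "X \<in> Ob A \<Longrightarrow> Idn A X \<in> Hom A X X"
  using category by (auto simp: is_category_def)

lemma Idn_simps [simp]:
  assumes "X \<in> Ob A"
  shows "Idn A X \<in> Ar A" "Dom A (Idn A X) = X" "Cod A (Idn A X) = X"
  using Idn_Hom[OF assms] by (auto simp: in_Hom)

lemma Cmp_Hom [intro]: "f \<in> Hom A X Y \<Longrightarrow> g \<in> Hom A Y Z \<Longrightarrow> g \<cdot> f \<in> Hom A X Z"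
  using category by (auto simp: is_category_def)

lemma Cmp_simps [simp]:
  assumes "f \<in> Ar A" "g \<in> Ar A" "Cod A f = Dom A g"
  shows "g \<cdot> f \<in> Ar A" "Dom A (g \<cdot> f) = Dom A f" "Cod A (g \<cdot> f) = Cod A g"
  using Cmp_Hom[of f "Dom A f" "Cod A f" g "Cod A g"] assms by (auto simp: in_Hom)

lemma Cmp_Idn [simp]: "f \<in> Ar A \<Longrightarrow> Dom A f = X \<Longrightarrow> f \<cdot> Idn A X = f"
  and Idn_Cmp [simp]: "f \<in> Ar A \<Longrightarrow> Cod A f = Y \<Longrightarrow> Idn A Y \<cdot> f = f"
proof -
  have "\<forall>X Y. \<forall>f\<in>Hom A X Y. f \<cdot> Idn A X = f \<and> Idn A Y \<cdot> f = f"
    using category unfolding is_category_def by blast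
  then show "f \<in> Ar A \<Longrightarrow> Dom A f = X \<Longrightarrow> f \<cdot> Idn A X = f"
    and "f \<in> Ar A \<Longrightarrow> Cod A f = Y \<Longrightarrow> Idn A Y \<cdot> f = f"
    by (auto simp: in_Hom)
qed

lemma Cmp_assoc:
  "f \<in> Ar A \<Longrightarrow> g \<in> Ar A \<Longrightarrow> h \<in> Ar A \<Longrightarrow> Cod A f = Dom A g \<Longrightarrow> Cod A g = Dom A h
    \<Longrightarrow> (h \<cdot> g) \<cdot> f = h \<cdot> (g \<cdot> f)"
proof -
  assume h: "f \<in> Ar A" "g \<in> Ar A" "h \<in> Ar A" "Cod A f = Dom A g" "Cod A g = Dom A h"
  have "\<forall>X Y Z W. \<forall>f\<in>Hom A X Y. \<forall>g\<in>Hom A Y Z. \<forall>h\<in>Hom A Z W. h \<cdot> (g \<cdot> f) = (h \<cdot> g) \<cdot> f"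
    using category unfolding is_category_def by blast
  then show ?thesis using h by (simp add: in_Hom)
qed

text \<open>Composites are normalized to the right, which hides \<open>g \<cdot> f\<close> inside
  \<open>g \<cdot> (f \<cdot> x)\<close>; this form lets an equation for \<open>g \<cdot> f\<close>
  act there.\<close>

lemma Cmp_rewrite:
  assumes "g \<cdot> f = k" "x \<in> Ar A" "f \<in> Ar A" "g \<in> Ar A" "Cod A x = Dom A f" "Cod A f = Dom A g"
  shows "g \<cdot> (f \<cdot> x) = k \<cdot> x"
  using assms Cmp_assoc[of x f g] by simp

lemma hom_comm_group: "X \<in> Ob A \<Longrightarrow> Y \<in> Ob A \<Longrightarrow> comm_group (hom_group A X Y)"
  using preadditive by (simp add: preadditive_def)

lemma hom_group_simps [simp]:
  "carrier (hom_group A X Y) = Hom A X Y" "monoid.mult (hom_group A X Y) = Add A"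
  "one (hom_group A X Y) = Zr A X Y"
  by (auto simp: hom_group_def)

lemma Add_Hom [intro]:
  assumes "f \<in> Hom A X Y" "g \<in> Hom A X Y"
  shows "Add A f g \<in> Hom A X Y"
proof -
  have "X \<in> Ob A" "Y \<in> Ob A" using assms by (auto simp: in_Hom)
  then interpret comm_group "hom_group A X Y" by (rule hom_comm_group)
  show ?thesis using m_closed assms by simp
qed

lemma Add_simps [simp]:
  assumes "f \<in> Ar A" "g \<in> Ar A" "Dom A g = Dom A f" "Cod A g = Cod A f"
  shows "Add A f g \<in> Ar A" "Dom A (Add A f g) = Dom A f" "Cod A (Add A f g) = Cod A f"
  using Add_Hom[of f "Dom A f" "Cod A f" g] assms by (auto simp: in_Hom)

lemma Zr_Hom [intro]:
  assumes "X \<in> Ob A" "Y \<in> Ob A" shows "Zr A X Y \<in> Hom A X Y"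
proof -
  interpret comm_group "hom_group A X Y" by (rule hom_comm_group[OF assms])
  show ?thesis using one_closed by simp
qed

lemma Zr_simps [simp]:
  assumes "X \<in> Ob A" "Y \<in> Ob A"
  shows "Zr A X Y \<in> Ar A" "Dom A (Zr A X Y) = X" "Cod A (Zr A X Y) = Y"
  using Zr_Hom[OF assms] by (auto simp: in_Hom)

lemma neg_Hom [intro]:
  assumes "f \<in> Hom A X Y" shows "neg A f \<in> Hom A X Y"
proof -
  have "X \<in> Ob A" "Y \<in> Ob A" using assms by (auto simp: in_Hom)
  then interpret comm_group "hom_group A X Y" by (rule hom_comm_group)
  show ?thesis using inv_closed[of f] assms by (simp add: neg_def in_Hom)
qed

lemma neg_simps [simp]:
  assumes "f \<in> Ar A"
  shows "neg A f \<in> Ar A" "Dom A (neg A f) = Dom A f" "Cod A (neg A f) = Cod A f"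
  using neg_Hom[of f "Dom A f" "Cod A f"] assms by (auto simp: in_Hom)

lemma Add_group_laws:
  assumes "f \<in> Ar A" "g \<in> Ar A" "h \<in> Ar A" "Dom A g = Dom A f" "Cod A g = Cod A f"
    "Dom A h = Dom A f" "Cod A h = Cod A f"
  shows Add_assoc: "Add A (Add A f g) h = Add A f (Add A g h)"
    and Add_left_commute: "Add A f (Add A g h) = Add A g (Add A f h)"
    and Add_cancel_left: "Add A f g = Add A f h \<longleftrightarrow> g = h"
proof -
  interpret comm_group "hom_group A (Dom A f) (Cod A f)"
    using assms by (intro hom_comm_group) auto
  show "Add A (Add A f g) h = Add A f (Add A g h)" using m_assoc[of f g h] assms by (simp add: in_Hom)
  show "Add A f (Add A g h) = Add A g (Add A f h)" using m_lcomm[of f g h] assms by (simp add: in_Hom)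
  show "Add A f g = Add A f h \<longleftrightarrow> g = h" using Units_l_cancel[of f g h] assms by (simp add: in_Hom)
qed

lemma Add_commute:
  assumes "f \<in> Ar A" "g \<in> Ar A" "Dom A g = Dom A f" "Cod A g = Cod A f"
  shows "Add A f g = Add A g f"
proof -
  interpret comm_group "hom_group A (Dom A f) (Cod A f)"
    using assms by (intro hom_comm_group) auto
  show ?thesis using m_comm[of f g] assms by (simp add: in_Hom)
qed

lemma Add_Zr [simp]:
  assumes "f \<in> Ar A" "Dom A f = X" "Cod A f = Y"
  shows "Add A f (Zr A X Y) = f" "Add A (Zr A X Y) f = f"
    and "Add A f (neg A f) = Zr A X Y" "Add A (neg A f) f = Zr A X Y" "neg A (neg A f) = f"
proof -
  interpret comm_group "hom_group A X Y"
    using assms by (intro hom_comm_group) auto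
  have f: "f \<in> carrier (hom_group A X Y)" using assms by (simp add: in_Hom)
  show "Add A f (Zr A X Y) = f" "Add A (Zr A X Y) f = f" using r_one[OF f] l_one[OF f] by auto
  have e: "neg A f = inv\<^bsub>hom_group A X Y\<^esub> f" using assms by (simp add: neg_def)
  have e': "neg A (neg A f) = inv\<^bsub>hom_group A X Y\<^esub> (neg A f)"
    using assms neg_simps[of f] by (subst neg_def) simp
  show "Add A f (neg A f) = Zr A X Y" "Add A (neg A f) f = Zr A X Y" "neg A (neg A f) = f"
    unfolding e' unfolding e using r_inv[OF f] l_inv[OF f] inv_inv[OF f] by auto
qed

lemma Cmp_Add:
  assumes "f \<in> Ar A" "f' \<in> Ar A" "g \<in> Ar A" "Dom A f' = Dom A f" "Cod A f' = Cod A f" "Cod A f = Dom A g"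
  shows "g \<cdot> Add A f f' = Add A (g \<cdot> f) (g \<cdot> f')"
proof -
  have "\<forall>X Y Z. \<forall>f\<in>Hom A X Y. \<forall>f'\<in>Hom A X Y. \<forall>g\<in>Hom A Y Z. g \<cdot> Add A f f' = Add A (g \<cdot> f) (g \<cdot> f')"
    using preadditive unfolding preadditive_def by blast
  then show ?thesis using assms by (simp add: in_Hom)
qed

lemma Add_Cmp:
  assumes "f \<in> Ar A" "g \<in> Ar A" "g' \<in> Ar A" "Dom A g' = Dom A g" "Cod A g' = Cod A g" "Cod A f = Dom A g"
  shows "Add A g g' \<cdot> f = Add A (g \<cdot> f) (g' \<cdot> f)"
proof -
  have "\<forall>X Y Z. \<forall>f\<in>Hom A X Y. \<forall>g\<in>Hom A Y Z. \<forall>g'\<in>Hom A Y Z. Add A g g' \<cdot> f = Add A (g \<cdot> f) (g' \<cdot> f)"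
    using preadditive unfolding preadditive_def by blast
  then show ?thesis using assms by (simp add: in_Hom)
qed

lemma Zr_unique:
  assumes "f \<in> Ar A" "g \<in> Ar A" "Dom A g = Dom A f" "Cod A g = Cod A f" "Add A f g = f"
  shows "g = Zr A (Dom A f) (Cod A f)"
  using assms Add_cancel_left[of f g "Zr A (Dom A f) (Cod A f)"] by simp

lemma Cmp_Zr [simp]:
  assumes "f \<in> Ar A" "Dom A f = Y" "X \<in> Ob A"
  shows "f \<cdot> Zr A X Y = Zr A X (Cod A f)"
proof -
  have [simp]: "Y \<in> Ob A" using assms by auto
  have "Add A (f \<cdot> Zr A X Y) (f \<cdot> Zr A X Y) = f \<cdot> Zr A X Y"
    using assms Cmp_Add[of "Zr A X Y" "Zr A X Y" f] by simp
  from Zr_unique[OF _ _ _ _ this] show ?thesis using assms by simp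
qed

lemma Zr_Cmp [simp]:
  assumes "f \<in> Ar A" "Cod A f = X" "Y \<in> Ob A"
  shows "Zr A X Y \<cdot> f = Zr A (Dom A f) Y"
proof -
  have [simp]: "X \<in> Ob A" using assms by auto
  have "Add A (Zr A X Y \<cdot> f) (Zr A X Y \<cdot> f) = Zr A X Y \<cdot> f"
    using assms Add_Cmp[of f "Zr A X Y" "Zr A X Y"] by simp
  from Zr_unique[OF _ _ _ _ this] show ?thesis using assms by simp
qed

lemma neg_unique:
  assumes "f \<in> Ar A" "g \<in> Ar A" "Dom A g = Dom A f" "Cod A g = Cod A f" "Add A f g = Zr A (Dom A f) (Cod A f)"
  shows "g = neg A f"
  using assms Add_cancel_left[of f g "neg A f"] by simp

lemma Cmp_neg:
  assumes "f \<in> Ar A" "g \<in> Ar A" "Cod A f = Dom A g"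
  shows "g \<cdot> neg A f = neg A (g \<cdot> f)"
  by (rule neg_unique) (use assms Cmp_Add[of f "neg A f" g] in auto)

lemma neg_Cmp:
  assumes "f \<in> Ar A" "g \<in> Ar A" "Cod A f = Dom A g"
  shows "neg A g \<cdot> f = neg A (g \<cdot> f)"
  by (rule neg_unique) (use assms Add_Cmp[of f g "neg A g"] in auto)

lemma neg_Zr [simp]: "X \<in> Ob A \<Longrightarrow> Y \<in> Ob A \<Longrightarrow> neg A (Zr A X Y) = Zr A X Y"
  using neg_unique[of "Zr A X Y" "Zr A X Y"] by simp

definition diff :: "'m \<Rightarrow> 'm \<Rightarrow> 'm" where "diff f g = Add A f (neg A g)"

lemma diff_simps [simp]:
  assumes "f \<in> Ar A" "g \<in> Ar A" "Dom A g = Dom A f" "Cod A g = Cod A f"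
  shows "diff f g \<in> Ar A" "Dom A (diff f g) = Dom A f" "Cod A (diff f g) = Cod A f"
  using assms by (auto simp: diff_def)

lemma diff_self [simp]: "f \<in> Ar A \<Longrightarrow> Dom A f = X \<Longrightarrow> Cod A f = Y \<Longrightarrow> diff f f = Zr A X Y"
  by (simp add: diff_def)

lemma Cmp_diff:
  assumes "f \<in> Ar A" "f' \<in> Ar A" "g \<in> Ar A" "Dom A f' = Dom A f" "Cod A f' = Cod A f" "Cod A f = Dom A g"
  shows "g \<cdot> diff f f' = diff (g \<cdot> f) (g \<cdot> f')"
  using assms by (simp add: diff_def Cmp_Add Cmp_neg)

lemma diff_Cmp:
  assumes "f \<in> Ar A" "g \<in> Ar A" "g' \<in> Ar A" "Dom A g' = Dom A g" "Cod A g' = Cod A g" "Cod A f = Dom A g"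
  shows "diff g g' \<cdot> f = diff (g \<cdot> f) (g' \<cdot> f)"
  using assms by (simp add: diff_def Add_Cmp neg_Cmp)

lemma diff_eq_iff:
  assumes "f \<in> Ar A" "g \<in> Ar A" "h \<in> Ar A" "Dom A g = Dom A f" "Cod A g = Cod A f" "Dom A h = Dom A f" "Cod A h = Cod A f"
  shows "diff f g = h \<longleftrightarrow> f = Add A g h"
proof
  assume "diff f g = h"
  then have "Add A g h = Add A g (Add A f (neg A g))" by (simp add: diff_def)
  also have "\<dots> = f" using assms by (simp add: Add_left_commute[of g f])
  finally show "f = Add A g h" by simp
next
  assume f: "f = Add A g h"
  have t: "Dom A h = Dom A g" "Cod A h = Cod A g" using assms by auto
  have "diff f g = Add A g (Add A h (neg A g))"
    unfolding f diff_def using t assms(2,3) by (subst Add_assoc) auto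
  also have "\<dots> = h" using t assms(2,3) by (simp add: Add_left_commute[of g h])
  finally show "diff f g = h" .
qed

lemma diff_zero_iff:
  assumes "f \<in> Ar A" "g \<in> Ar A" "Dom A g = Dom A f" "Cod A g = Cod A f" "X = Dom A f" "Y = Cod A f"
  shows "diff f g = Zr A X Y \<longleftrightarrow> f = g"
  using diff_eq_iff[of f g "Zr A X Y"] assms by simp

lemma zero_object_to:
  assumes "zero_object A Z" "f \<in> Ar A" "Cod A f = Z" shows "f = Zr A (Dom A f) Z"
proof -
  have "Z \<in> Ob A" "\<exists>!g. g \<in> Hom A (Dom A f) Z" using assms by (auto simp: zero_object_def)
  moreover have "f \<in> Hom A (Dom A f) Z" "Zr A (Dom A f) Z \<in> Hom A (Dom A f) Z"
    using assms \<open>Z \<in> Ob A\<close> by (auto simp: in_Hom)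
  ultimately show ?thesis by blast
qed

lemma zero_object_from:
  assumes "zero_object A Z" "f \<in> Ar A" "Dom A f = Z" shows "f = Zr A Z (Cod A f)"
proof -
  have "Z \<in> Ob A" "\<exists>!g. g \<in> Hom A Z (Cod A f)" using assms by (auto simp: zero_object_def)
  moreover have "f \<in> Hom A Z (Cod A f)" "Zr A Z (Cod A f) \<in> Hom A Z (Cod A f)"
    using assms \<open>Z \<in> Ob A\<close> by (auto simp: in_Hom)
  ultimately show ?thesis by blast
qed

lemma zero_object_Ob: "zero_object A Z \<Longrightarrow> Z \<in> Ob A"
  by (simp add: zero_object_def)

lemma zero_objectI:
  assumes Z: "Z \<in> Ob A" and id: "Idn A Z = Zr A Z Z"
  shows "zero_object A Z"
  unfolding zero_object_def
proof (intro conjI ballI Z)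
  fix X assume X: "X \<in> Ob A"
  have "f = Zr A X Z" if "f \<in> Hom A X Z" for f
    using that Idn_Cmp[of f Z] X Z by (simp add: in_Hom id)
  then show "\<exists>!f. f \<in> Hom A X Z" using X Z by blast
  have "f = Zr A Z X" if "f \<in> Hom A Z X" for f
    using that Cmp_Idn[of f Z] X Z by (simp add: in_Hom id)
  then show "\<exists>!f. f \<in> Hom A Z X" using X Z by blast
qed

lemma zero_object_iff: "zero_object A Z \<longleftrightarrow> Z \<in> Ob A \<and> Idn A Z = Zr A Z Z"
  using zero_objectI zero_object_to[of Z "Idn A Z"] zero_object_Ob[of Z] by auto

lemma isomorphismI:
  assumes "f \<in> Hom A X Y" "g \<in> Hom A Y X" "g \<cdot> f = Idn A X" "f \<cdot> g = Idn A Y"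
  shows "isomorphism A f"
  using assms by (auto simp: isomorphism_def in_Hom)

lemma isomorphism_Idn: "X \<in> Ob A \<Longrightarrow> isomorphism A (Idn A X)"
  by (intro isomorphismI[of _ X X "Idn A X"]) auto

lemma biproductD:
  assumes "is_biproduct A X Y W i j p q"
  shows "X \<in> Ob A" "Y \<in> Ob A" "W \<in> Ob A"
    "i \<in> Ar A" "Dom A i = X" "Cod A i = W" "j \<in> Ar A" "Dom A j = Y" "Cod A j = W"
    "p \<in> Ar A" "Dom A p = W" "Cod A p = X" "q \<in> Ar A" "Dom A q = W" "Cod A q = Y"
    "p \<cdot> i = Idn A X" "q \<cdot> j = Idn A Y" "p \<cdot> j = Zr A Y X" "q \<cdot> i = Zr A X Y"
    "Add A (i \<cdot> p) (j \<cdot> q) = Idn A W"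
  using assms by (auto simp: is_biproduct_def in_Hom)

lemma biproduct_decomp_to:
  assumes b: "is_biproduct A X Y W i j p q" and f: "f \<in> Ar A" "Cod A f = W"
  shows "f = Add A (i \<cdot> (p \<cdot> f)) (j \<cdot> (q \<cdot> f))"
proof -
  note [simp] = biproductD[OF b]
  have "f = Add A (i \<cdot> p) (j \<cdot> q) \<cdot> f" using f by simp
  also have "\<dots> = Add A (i \<cdot> (p \<cdot> f)) (j \<cdot> (q \<cdot> f))" using f by (subst Add_Cmp) (auto simp: Cmp_assoc simp del: biproductD(20)[OF b])
  finally show ?thesis .
qed

lemma biproduct_eq_to:
  assumes b: "is_biproduct A X Y W i j p q" and "f \<in> Ar A" "Cod A f = W" "g \<in> Ar A" "Cod A g = W"
    and "p \<cdot> f = p \<cdot> g" "q \<cdot> f = q \<cdot> g"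
  shows "f = g"
  using biproduct_decomp_to[OF b, of f] biproduct_decomp_to[OF b, of g] assms by simp

lemma biproduct_pair:
  assumes b: "is_biproduct A X Y W i j p q" and x: "x \<in> Hom A Q X" and y: "y \<in> Hom A Q Y"
  shows "Add A (i \<cdot> x) (j \<cdot> y) \<in> Hom A Q W"
    "p \<cdot> Add A (i \<cdot> x) (j \<cdot> y) = x" "q \<cdot> Add A (i \<cdot> x) (j \<cdot> y) = y"
proof -
  note [simp] = biproductD[OF b] HomD[OF x] HomD[OF y]
  have Q: "Q \<in> Ob A" using Dom_Ob[of x] by simp
  show "Add A (i \<cdot> x) (j \<cdot> y) \<in> Hom A Q W" by (simp add: in_Hom)
  show "p \<cdot> Add A (i \<cdot> x) (j \<cdot> y) = x" "q \<cdot> Add A (i \<cdot> x) (j \<cdot> y) = y"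
    using Q by (auto simp: Cmp_Add simp flip: Cmp_assoc)
qed

end

lemma full_sub_simps [simp]:
  "Ob (full_sub A S) = S" "Dom (full_sub A S) = Dom A" "Cod (full_sub A S) = Cod A"
  "Idn (full_sub A S) = Idn A" "Cmp (full_sub A S) = Cmp A" "Add (full_sub A S) = Add A" "Zr (full_sub A S) = Zr A"
  "f \<in> Ar (full_sub A S) \<longleftrightarrow> f \<in> Ar A \<and> Dom A f \<in> S \<and> Cod A f \<in> S"
  by (auto simp: full_sub_def)

lemma Hom_full_sub: "Hom (full_sub A S) X Y = (if X \<in> S \<and> Y \<in> S then Hom A X Y else {})"
  by (auto simp: in_Hom)

lemma (in preadd) preadd_full_sub:
  assumes "S \<subseteq> Ob A" shows "preadd (full_sub A S)"
proof
  have "hom_group (full_sub A S) X Y = hom_group A X Y" if "X \<in> S" "Y \<in> S" for X Y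
    using that by (simp add: hom_group_def Hom_full_sub)
  moreover have "comm_group (hom_group A X Y)" if "X \<in> S" "Y \<in> S" for X Y
    using hom_comm_group that assms by (meson subsetD)
  moreover have "is_category (full_sub A S)"
    unfolding is_category_def using assms
    by (auto simp: in_Hom subset_iff Cmp_assoc)
  ultimately show "preadditive (full_sub A S)"
    unfolding preadditive_def
    by (auto simp: in_Hom Cmp_Add Add_Cmp)
qed

section \<open>Triangulated categories\<close>

lemma (in preadd) neg_eq_iff: "f \<in> Ar A \<Longrightarrow> g \<in> Ar A \<Longrightarrow> neg A f = neg A g \<longleftrightarrow> f = g"
  using Add_Zr(5)[OF _ refl refl] by metis

lemma (in preadd) neg_eq_Zr_iff:
  assumes "f \<in> Ar A" "Dom A f = X" "Cod A f = Y" shows "neg A f = Zr A X Y \<longleftrightarrow> f = Zr A X Y"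
proof -
  have "X \<in> Ob A" "Y \<in> Ob A" using assms by auto
  then show ?thesis using neg_eq_iff[of f "Zr A X Y"] assms by simp
qed

locale tricategory =
  fixes C :: "('o, 'm) tricat" (structure)
  assumes triangulated: "triangulated_category C"
begin

sublocale preadd C
  by unfold_locales (use triangulated in \<open>auto simp: triangulated_category_def additive_category_def\<close>)

lemma additive: "additive_category C"
  using triangulated by (simp add: triangulated_category_def)

lemma shift_aut: "shift_automorphism C"
  using triangulated by (simp add: triangulated_category_def)

lemma Sh_bij: "bij_betw (Sh C) (Ob C) (Ob C)" and ShA_bij: "bij_betw (ShA C) (Ar C) (Ar C)"
  using shift_aut by (auto simp: shift_automorphism_def)

lemma Sh_Ob [simp]: "X \<in> Ob C \<Longrightarrow> Sh C X \<in> Ob C"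
  using bij_betwE[OF Sh_bij] by blast

lemma unSh_simps [simp]:
  assumes "X \<in> Ob C" shows "unSh C X \<in> Ob C" "Sh C (unSh C X) = X" "unSh C (Sh C X) = X"
proof -
  have "X \<in> Sh C ` Ob C" using Sh_bij assms by (auto simp: bij_betw_def)
  then show "unSh C X \<in> Ob C" "Sh C (unSh C X) = X"
    by (auto simp: unSh_def inv_into_into f_inv_into_f)
  show "unSh C (Sh C X) = X"
    using Sh_bij assms by (simp add: unSh_def bij_betw_def)
qed

lemma ShA_simps [simp]:
  assumes "f \<in> Ar C" shows "ShA C f \<in> Ar C" "Dom C (ShA C f) = Sh C (Dom C f)" "Cod C (ShA C f) = Sh C (Cod C f)"
proof -
  have "\<forall>X Y. \<forall>f\<in>Hom C X Y. ShA C f \<in> Hom C (Sh C X) (Sh C Y)"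
    using shift_aut unfolding shift_automorphism_def by blast
  then show "ShA C f \<in> Ar C" "Dom C (ShA C f) = Sh C (Dom C f)" "Cod C (ShA C f) = Sh C (Cod C f)"
    using assms by (auto simp: in_Hom)
qed

lemma unShA_simps [simp]:
  assumes "f \<in> Ar C"
  shows "unShA C f \<in> Ar C" "ShA C (unShA C f) = f" "unShA C (ShA C f) = f"
    "Dom C (unShA C f) = unSh C (Dom C f)" "Cod C (unShA C f) = unSh C (Cod C f)"
proof -
  have "f \<in> ShA C ` Ar C" using ShA_bij assms by (auto simp: bij_betw_def)
  then show 1: "unShA C f \<in> Ar C" "ShA C (unShA C f) = f"
    by (auto simp: unShA_def inv_into_into f_inv_into_f)
  show "unShA C (ShA C f) = f"
    using ShA_bij assms by (simp add: unShA_def bij_betw_def)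
  have "Sh C (Dom C (unShA C f)) = Dom C f" "Sh C (Cod C (unShA C f)) = Cod C f"
    using 1 ShA_simps[of "unShA C f"] by auto
  then show "Dom C (unShA C f) = unSh C (Dom C f)" "Cod C (unShA C f) = unSh C (Cod C f)"
    using 1 unSh_simps(3)[of "Dom C (unShA C f)"] unSh_simps(3)[of "Cod C (unShA C f)"] by auto
qed

lemma ShA_inject: "f \<in> Ar C \<Longrightarrow> g \<in> Ar C \<Longrightarrow> ShA C f = ShA C g \<longleftrightarrow> f = g"
  by (metis unShA_simps(3))

lemma ShA_Idn [simp]: "X \<in> Ob C \<Longrightarrow> ShA C (Idn C X) = Idn C (Sh C X)"
  using shift_aut by (simp add: shift_automorphism_def)

lemma ShA_Cmp:
  assumes "f \<in> Ar C" "g \<in> Ar C" "Cod C f = Dom C g" shows "ShA C (g \<cdot> f) = ShA C g \<cdot> ShA C f"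
proof -
  have "\<forall>X Y Z. \<forall>f\<in>Hom C X Y. \<forall>g\<in>Hom C Y Z. ShA C (g \<cdot> f) = ShA C g \<cdot> ShA C f"
    using shift_aut unfolding shift_automorphism_def by blast
  then show ?thesis using assms by (auto simp: in_Hom)
qed

lemma ShA_Add:
  assumes "f \<in> Ar C" "g \<in> Ar C" "Dom C g = Dom C f" "Cod C g = Cod C f"
  shows "ShA C (Add C f g) = Add C (ShA C f) (ShA C g)"
proof -
  have "\<forall>X Y. \<forall>f\<in>Hom C X Y. \<forall>g\<in>Hom C X Y. ShA C (Add C f g) = Add C (ShA C f) (ShA C g)"
    using shift_aut unfolding shift_automorphism_def by blast
  then show ?thesis using assms by (auto simp: in_Hom)
qed

lemma ShA_Zr [simp]:
  assumes "X \<in> Ob C" "Y \<in> Ob C" shows "ShA C (Zr C X Y) = Zr C (Sh C X) (Sh C Y)"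
proof -
  have "Add C (ShA C (Zr C X Y)) (ShA C (Zr C X Y)) = ShA C (Zr C X Y)"
    using assms by (subst ShA_Add[symmetric]) auto
  from Zr_unique[OF _ _ _ _ this] show ?thesis using assms by simp
qed

lemma ShA_neg:
  assumes "f \<in> Ar C" shows "ShA C (neg C f) = neg C (ShA C f)"
  by (rule neg_unique) (use assms ShA_Add[of f "neg C f"] in auto)

lemma unShA_Cmp:
  assumes "f \<in> Ar C" "g \<in> Ar C" "Cod C f = Dom C g" shows "unShA C (g \<cdot> f) = unShA C g \<cdot> unShA C f"
  using ShA_inject[of "unShA C (g \<cdot> f)" "unShA C g \<cdot> unShA C f"] assms by (simp add: ShA_Cmp)

lemma unShA_Zr [simp]:
  "X \<in> Ob C \<Longrightarrow> Y \<in> Ob C \<Longrightarrow> unShA C (Zr C X Y) = Zr C (unSh C X) (unSh C Y)"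
  using ShA_inject[of "unShA C (Zr C X Y)" "Zr C (unSh C X) (unSh C Y)"] by simp

lemma tri_simps:
  assumes "(u, v, w) \<in> Dist C"
  shows "u \<in> Ar C" "v \<in> Ar C" "w \<in> Ar C" "Dom C v = Cod C u" "Dom C w = Cod C v" "Cod C w = Sh C (Dom C u)"
proof -
  have "\<forall>(u, v, w)\<in>Dist C. candidate_triangle C u v w"
    using triangulated unfolding triangulated_category_def TR1_def by blast
  then have "candidate_triangle C u v w" using assms by blast
  then show "u \<in> Ar C" "v \<in> Ar C" "w \<in> Ar C" "Dom C v = Cod C u" "Dom C w = Cod C v" "Cod C w = Sh C (Dom C u)"
    by (auto simp: candidate_triangle_def in_Hom)
qed

lemma candidateI:
  "u \<in> Ar C \<Longrightarrow> v \<in> Ar C \<Longrightarrow> w \<in> Ar C \<Longrightarrow> Dom C v = Cod C u \<Longrightarrow> Dom C w = Cod C v \<Longrightarrow> Cod C w = Sh C (Dom C u)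
    \<Longrightarrow> candidate_triangle C u v w"
  by (auto simp: candidate_triangle_def in_Hom)

lemma TR2_iff: "candidate_triangle C u v w \<Longrightarrow> (u, v, w) \<in> Dist C \<longleftrightarrow> (v, w, neg C (ShA C u)) \<in> Dist C"
  using triangulated unfolding triangulated_category_def TR2_def by blast

lemma tri_rotate:
  assumes "(u, v, w) \<in> Dist C" shows "(v, w, neg C (ShA C u)) \<in> Dist C"
  using TR2_iff[OF candidateI[OF tri_simps[OF assms]]] assms by blast

lemma tri_rotate_back:
  assumes d: "(u, v, w) \<in> Dist C" shows "(neg C (unShA C w), u, v) \<in> Dist C"
proof -
  note [simp] = tri_simps[OF d]
  have "Cod C u \<in> Ob C" "Dom C u \<in> Ob C" by auto
  then have "candidate_triangle C (neg C (unShA C w)) u v"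
    by (intro candidateI) auto
  moreover have "neg C (ShA C (neg C (unShA C w))) = w" by (simp add: ShA_neg)
  ultimately show ?thesis using TR2_iff d by metis
qed

lemma tri_iso:
  assumes "(u, v, w) \<in> Dist C" "candidate_triangle C u' v' w'"
    "triangle_morphism C (u, v, w) (u', v', w') f g h" "isomorphism C f" "isomorphism C g" "isomorphism C h"
  shows "(u', v', w') \<in> Dist C"
  using triangulated assms unfolding triangulated_category_def TR1_def by blast

lemma tri_Idn: "X \<in> Ob C \<Longrightarrow> zero_object C Z \<Longrightarrow> (Idn C X, Zr C X Z, Zr C Z (Sh C X)) \<in> Dist C"
  using triangulated unfolding triangulated_category_def TR1_def by blast

lemma tri_exists: "u \<in> Ar C \<Longrightarrow> \<exists>v w. (u, v, w) \<in> Dist C"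
  using triangulated unfolding triangulated_category_def TR1_def by blast

lemma tri_complete:
  assumes "(u, v, w) \<in> Dist C" "(u', v', w') \<in> Dist C" "f \<in> Hom C (Dom C u) (Dom C u')"
    "g \<in> Hom C (Cod C u) (Cod C u')" "g \<cdot> u = u' \<cdot> f"
  shows "\<exists>h. h \<in> Hom C (Cod C v) (Cod C v') \<and> h \<cdot> v = v' \<cdot> g \<and> ShA C f \<cdot> w = w' \<cdot> h"
proof -
  have "\<exists>h. triangle_morphism C (u, v, w) (u', v', w') f g h"
    using triangulated assms unfolding triangulated_category_def TR3_def by blast
  then show ?thesis
    using tri_simps[OF assms(1)] tri_simps[OF assms(2)] by (auto simp: triangle_morphism_def)
qed

lemma octahedron:
  assumes "(u, j, k) \<in> Dist C" "(v, l, i) \<in> Dist C" "Cod C u = Dom C v" "(v \<cdot> u, m, n) \<in> Dist C"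
  shows "\<exists>f g. (f, g, ShA C j \<cdot> i) \<in> Dist C \<and> f \<in> Hom C (Cod C j) (Cod C m) \<and> g \<in> Hom C (Cod C m) (Cod C l) \<and>
    f \<cdot> j = m \<cdot> v \<and> n \<cdot> f = k \<and> g \<cdot> m = l \<and> i \<cdot> g = ShA C u \<cdot> n"
proof -
  have "TR4 C" using triangulated unfolding triangulated_category_def by blast
  from this[unfolded TR4_def, rule_format, OF conjI[OF assms(1) conjI[OF assms(2) conjI[OF assms(3,4)]]]]
  show ?thesis .
qed

lemma ex_zero: "\<exists>Z. zero_object C Z"
  using additive by (simp add: additive_category_def)

text \<open>The trivial triangle of \<open>Dom C u\<close> maps to the given one by the identity and
  \<open>u\<close>. The completing map starts at a zero object, and its square factors
  \<open>v \<cdot> u\<close> through that object.\<close>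

lemma tri_comp_zero:
  assumes d: "(u, v, w) \<in> Dist C" shows "v \<cdot> u = Zr C (Dom C u) (Cod C v)"
proof -
  note [simp] = tri_simps[OF d]
  obtain Z where Z: "zero_object C Z" using ex_zero by blast
  note [simp] = zero_object_Ob[OF Z]
  obtain h where "h \<in> Hom C Z (Cod C v)" "h \<cdot> Zr C (Dom C u) Z = v \<cdot> u"
    using tri_complete[OF tri_Idn[OF _ Z] d, of "Dom C u" "Idn C (Dom C u)" u] by (auto simp: in_Hom)
  then show ?thesis by (auto simp: in_Hom)
qed

text \<open>The trivial triangle of \<open>Q\<close>, rotated so that it begins with Q -> 0, maps to
  the rotated given triangle by \<open>x\<close> and zero. The completing map is defined on Q[1];
  both sides of its square carry a rotation sign, so the signs cancel and the map can be shifted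
  back. No uniqueness is available.\<close>

lemma tri_weak_kernel:
  assumes d: "(u, v, w) \<in> Dist C" and x: "x \<in> Hom C Q (Cod C u)" and "v \<cdot> x = Zr C Q (Cod C v)"
  shows "\<exists>y\<in>Hom C Q (Dom C u). x = u \<cdot> y"
proof -
  note [simp] = tri_simps[OF d] HomD[OF x]
  obtain Z where Z: "zero_object C Z" using ex_zero by blast
  note [simp] = zero_object_Ob[OF Z]
  have Q [simp]: "Q \<in> Ob C" using Dom_Ob[of x] by simp
  obtain h where h: "h \<in> Hom C (Sh C Q) (Sh C (Dom C u))"
    "ShA C x \<cdot> neg C (ShA C (Idn C Q)) = neg C (ShA C u) \<cdot> h"
    using tri_complete[OF tri_rotate[OF tri_Idn[OF Q Z]] tri_rotate[OF d], of x "Zr C Z (Cod C v)"] assms(3)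
    by (auto simp: in_Hom)
  note [simp] = HomD[OF h(1)]
  have "neg C (ShA C x) = neg C (ShA C u \<cdot> h)" using h(2) by (simp add: Cmp_neg neg_Cmp)
  then have "ShA C x = ShA C u \<cdot> h" by (subst (asm) neg_eq_iff) auto
  also have "\<dots> = ShA C (u \<cdot> unShA C h)" by (simp add: ShA_Cmp)
  finally have "x = u \<cdot> unShA C h" by (simp add: ShA_inject)
  then show ?thesis by (intro bexI[of _ "unShA C h"]) (auto simp: in_Hom)
qed

text \<open>Dual argument: the given triangle maps to the trivial triangle of \<open>Y\<close>
  rotated backwards, whose first object is a desuspended zero object.\<close>

lemma tri_weak_cokernel:
  assumes d: "(u, v, w) \<in> Dist C" and y: "y \<in> Hom C (Cod C u) Y" and "y \<cdot> u = Zr C (Dom C u) Y"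
  shows "\<exists>z\<in>Hom C (Cod C v) Y. y = z \<cdot> v"
proof -
  note [simp] = tri_simps[OF d] HomD[OF y]
  obtain Z where Z: "zero_object C Z" using ex_zero by blast
  note [simp] = zero_object_Ob[OF Z]
  have Y [simp]: "Y \<in> Ob C" using Cod_Ob[of y] by simp
  obtain h where "h \<in> Hom C (Cod C v) Y" "h \<cdot> v = Idn C Y \<cdot> y"
    using tri_complete[OF d tri_rotate_back[OF tri_Idn[OF Y Z]], of "Zr C (Dom C u) (unSh C Z)" y] assms(3)
    by (auto simp: in_Hom)
  then show ?thesis by (auto simp: in_Hom)
qed

text \<open>Exactness of Hom(Q, -) in the middle for every \<open>Q\<close>. Unlike membership in
  \<open>Dist\<close>, this notion ignores signs, so it can be rotated and shifted without the
  bookkeeping of rotation signs, and it is all that a homological functor needs.\<close>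

definition weak_exact :: "'m \<Rightarrow> 'm \<Rightarrow> bool" where
  "weak_exact u v \<longleftrightarrow> u \<in> Ar C \<and> v \<in> Ar C \<and> Cod C u = Dom C v \<and> v \<cdot> u = Zr C (Dom C u) (Cod C v) \<and>
     (\<forall>Q. \<forall>x\<in>Hom C Q (Dom C v). v \<cdot> x = Zr C Q (Cod C v) \<longrightarrow> (\<exists>y\<in>Hom C Q (Dom C u). x = u \<cdot> y))"

lemma weak_exact_tri:
  assumes d: "(u, v, w) \<in> Dist C"
  shows "weak_exact u v" "weak_exact v w" "weak_exact w (ShA C u)"
proof -
  have 1: "weak_exact u v" if "(u, v, w) \<in> Dist C" for u v w
    using tri_weak_kernel[OF that] tri_comp_zero[OF that] tri_simps[OF that]
    by (auto simp: weak_exact_def)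
  show "weak_exact u v" "weak_exact v w" using 1 d tri_rotate[OF d] by auto
  note [simp] = tri_simps[OF d]
  have *: "neg C (ShA C u) \<cdot> x = Zr C Q (Sh C (Cod C u)) \<longleftrightarrow> ShA C u \<cdot> x = Zr C Q (Sh C (Cod C u))"
    if "x \<in> Hom C Q (Sh C (Dom C u))" for x Q
  proof -
    note [simp] = HomD[OF that]
    have [simp]: "Q \<in> Ob C" using Dom_Ob[of x] by simp
    show ?thesis by (simp add: neg_Cmp neg_eq_Zr_iff)
  qed
  have "weak_exact w (neg C (ShA C u))" using 1 tri_rotate[OF tri_rotate[OF d]] by blast
  then show "weak_exact w (ShA C u)"
    unfolding weak_exact_def using * *[of w "Cod C v"]
  proof (elim conjE, intro conjI allI ballI impI)
    fix Q x
    assume k: "\<forall>Q. \<forall>x\<in>Hom C Q (Dom C (neg C (ShA C u))). neg C (ShA C u) \<cdot> x = Zr C Q (Cod C (neg C (ShA C u))) \<longrightarrow>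
        (\<exists>y\<in>Hom C Q (Dom C w). x = w \<cdot> y)"
      and x: "x \<in> Hom C Q (Dom C (ShA C u))" "ShA C u \<cdot> x = Zr C Q (Cod C (ShA C u))"
    then have "neg C (ShA C u) \<cdot> x = Zr C Q (Cod C (neg C (ShA C u)))" using *[of x Q] by simp
    then show "\<exists>y\<in>Hom C Q (Dom C w). x = w \<cdot> y" using k x by simp
  qed (auto simp: in_Hom)
qed

lemma weak_exact_Sh: "weak_exact u v \<Longrightarrow> weak_exact (ShA C u) (ShA C v)"
  and weak_exact_unSh: "weak_exact u v \<Longrightarrow> weak_exact (unShA C u) (unShA C v)"
proof -
  assume e: "weak_exact u v"
  then have [simp]: "u \<in> Ar C" "v \<in> Ar C" "Cod C u = Dom C v" by (auto simp: weak_exact_def)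
  have z: "v \<cdot> u = Zr C (Dom C u) (Cod C v)" using e by (simp add: weak_exact_def)
  have k: "\<exists>y\<in>Hom C Q (Dom C u). x = u \<cdot> y" if "x \<in> Hom C Q (Dom C v)" "v \<cdot> x = Zr C Q (Cod C v)" for x Q
    using e that by (simp add: weak_exact_def)
  show "weak_exact (ShA C u) (ShA C v)"
    unfolding weak_exact_def
  proof (intro conjI allI ballI impI)
    show "ShA C v \<cdot> ShA C u = Zr C (Dom C (ShA C u)) (Cod C (ShA C v))"
      using z by (simp flip: ShA_Cmp)
    fix Q x assume x: "x \<in> Hom C Q (Dom C (ShA C v))" and "ShA C v \<cdot> x = Zr C Q (Cod C (ShA C v))"
    then have "unShA C (ShA C v \<cdot> x) = Zr C (unSh C Q) (Cod C v)" by (auto simp: in_Hom)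
    then have "v \<cdot> unShA C x = Zr C (unSh C Q) (Cod C v)" using x by (simp add: unShA_Cmp in_Hom)
    then obtain y where y: "y \<in> Hom C (unSh C Q) (Dom C u)" "unShA C x = u \<cdot> y"
      using k[of "unShA C x" "unSh C Q"] x by (auto simp: in_Hom)
    have "x = ShA C (unShA C x)" using x by (simp add: in_Hom)
    also have "\<dots> = ShA C u \<cdot> ShA C y" using y by (simp add: ShA_Cmp in_Hom)
    finally show "\<exists>y\<in>Hom C Q (Dom C (ShA C u)). x = ShA C u \<cdot> y"
      using y x by (intro bexI[of _ "ShA C y"]) (auto simp: in_Hom)
  qed auto
  show "weak_exact (unShA C u) (unShA C v)"
    unfolding weak_exact_def
  proof (intro conjI allI ballI impI)
    show "unShA C v \<cdot> unShA C u = Zr C (Dom C (unShA C u)) (Cod C (unShA C v))"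
      using z by (simp flip: unShA_Cmp)
    fix Q x assume x: "x \<in> Hom C Q (Dom C (unShA C v))" and "unShA C v \<cdot> x = Zr C Q (Cod C (unShA C v))"
    then have "ShA C (unShA C v \<cdot> x) = Zr C (Sh C Q) (Cod C v)" by (auto simp: in_Hom)
    then have "v \<cdot> ShA C x = Zr C (Sh C Q) (Cod C v)" using x by (simp add: ShA_Cmp in_Hom)
    then obtain y where y: "y \<in> Hom C (Sh C Q) (Dom C u)" "ShA C x = u \<cdot> y"
      using k[of "ShA C x" "Sh C Q"] x by (auto simp: in_Hom)
    have "x = unShA C (ShA C x)" using x by (simp add: in_Hom)
    also have "\<dots> = unShA C u \<cdot> unShA C y" using y by (simp add: unShA_Cmp in_Hom)
    finally show "\<exists>y\<in>Hom C Q (Dom C (unShA C u)). x = unShA C u \<cdot> y"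
      using y x by (intro bexI[of _ "unShA C y"]) (auto simp: in_Hom)
  qed auto
qed

text \<open>The automorphism -id of the middle object absorbs both signs. Three backward rotations
  of (u, v, w) produce the negatives of u[-1], v[-1] and w[-1]; removing the first two signs gives
  the desuspended triangle in the form used by the towers.\<close>

lemma tri_negate:
  assumes d: "(neg C u, neg C v, w) \<in> Dist C" and [simp]: "u \<in> Ar C" "v \<in> Ar C"
  shows "(u, v, w) \<in> Dist C"
proof -
  have [simp]: "w \<in> Ar C" "Dom C v = Cod C u" "Dom C w = Cod C v" "Cod C w = Sh C (Dom C u)"
    using tri_simps[OF d] by auto
  have "triangle_morphism C (neg C u, neg C v, w) (u, v, w) (Idn C (Dom C u)) (neg C (Idn C (Cod C u))) (Idn C (Cod C v))"
    by (auto simp: triangle_morphism_def in_Hom Cmp_neg neg_Cmp)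
  moreover have "isomorphism C (neg C (Idn C (Cod C u)))"
    by (rule isomorphismI[of _ "Cod C u" "Cod C u" "neg C (Idn C (Cod C u))"]) (auto simp: in_Hom Cmp_neg neg_Cmp)
  ultimately show ?thesis
    by (intro tri_iso[OF d, of u v w "Idn C (Dom C u)" "neg C (Idn C (Cod C u))" "Idn C (Cod C v)"])
      (auto intro!: candidateI isomorphism_Idn)
qed

lemma tri_unShift:
  assumes d: "(u, v, w) \<in> Dist C" shows "(unShA C u, unShA C v, neg C (unShA C w)) \<in> Dist C"
  using tri_negate[of "unShA C u" "unShA C v"] tri_rotate_back[OF tri_rotate_back[OF tri_rotate_back[OF d]]]
    tri_simps[OF d] by simp

text \<open>Complete \<open>i\<close> to a triangle. Its connecting map vanishes because
  \<open>i\<close> is split, and then the comparison map \<open>z\<close> from the cone to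
  \<open>Y\<close> turns out to be invertible with inverse \<open>v \<cdot> s\<close>.\<close>

lemma biproduct_triangle:
  assumes b: "is_biproduct C X Y W i s r p" shows "(i, p, Zr C Y (Sh C X)) \<in> Dist C"
proof -
  note [simp] = biproductD[OF b]
  obtain v w where d: "(i, v, w) \<in> Dist C" using tri_exists[of i] by auto
  define K where "K = Cod C v"
  have [simp]: "v \<in> Ar C" "Dom C v = W" "w \<in> Ar C" "Dom C w = K" "Cod C w = Sh C X" "Cod C v = K"
    using tri_simps[OF d] by (auto simp: K_def)
  have [simp]: "K \<in> Ob C" using Cod_Ob[of v] by simp
  have iw: "ShA C i \<cdot> w = Zr C K (Sh C W)"
    using weak_exact_tri(3)[OF d] by (simp add: weak_exact_def)
  have "w = ShA C (r \<cdot> i) \<cdot> w" by simp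
  also have "\<dots> = ShA C r \<cdot> (ShA C i \<cdot> w)" by (subst ShA_Cmp) (auto simp: Cmp_assoc simp del: biproductD(16)[OF b])
  finally have w: "w = Zr C K (Sh C X)" by (simp add: iw)
  obtain z where z: "z \<in> Hom C K Y" and pz: "p = z \<cdot> v"
    using tri_weak_cokernel[OF d, of p Y] by (auto simp: in_Hom)
  note [simp] = HomD[OF z]
  have vi: "v \<cdot> i = Zr C X K" using tri_comp_zero[OF d] by simp
  have zvs: "z \<cdot> (v \<cdot> s) = Idn C Y" using biproductD(17)[OF b] unfolding pz by (subst Cmp_assoc[symmetric]) auto
  \<comment> \<open>Inserting the decomposition of the identity of \<open>W\<close> shows that (v s)
    z - id vanishes after \<open>v\<close>. Hence it factors through the connecting map, which is
    zero.\<close>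
  have "v = v \<cdot> Add C (i \<cdot> r) (s \<cdot> p)" by simp
  also have "\<dots> = Add C ((v \<cdot> i) \<cdot> r) (((v \<cdot> s) \<cdot> z) \<cdot> v)"
    by (subst Cmp_Add) (auto simp: Cmp_assoc pz[symmetric] simp del: biproductD(20)[OF b])
  also have "\<dots> = ((v \<cdot> s) \<cdot> z) \<cdot> v" by (simp add: vi)
  finally have "diff ((v \<cdot> s) \<cdot> z) (Idn C K) \<cdot> v = Zr C W K"
    by (subst diff_Cmp) auto
  then obtain t where "t \<in> Hom C (Sh C X) K" "diff ((v \<cdot> s) \<cdot> z) (Idn C K) = t \<cdot> w"
    using tri_weak_cokernel[OF tri_rotate[OF d], of "diff ((v \<cdot> s) \<cdot> z) (Idn C K)" K] by (auto simp: in_Hom)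
  then have "diff ((v \<cdot> s) \<cdot> z) (Idn C K) = Zr C K K" unfolding w by (simp add: in_Hom)
  then have vsz: "(v \<cdot> s) \<cdot> z = Idn C K" by (subst (asm) diff_zero_iff) auto
  have "isomorphism C z"
    by (rule isomorphismI[of z K Y "v \<cdot> s"]) (use zvs vsz in \<open>auto simp: in_Hom\<close>)
  moreover have "triangle_morphism C (i, v, w) (i, p, Zr C Y (Sh C X)) (Idn C X) (Idn C W) z"
    unfolding triangle_morphism_def using w pz by (auto simp: in_Hom)
  ultimately show ?thesis
    by (intro tri_iso[OF d, of i p "Zr C Y (Sh C X)" "Idn C X" "Idn C W" z]) (auto intro!: candidateI isomorphism_Idn)
qed

lemma shift_add1: "X \<in> Ob C \<Longrightarrow> shift C k X \<in> Ob C"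
  "X \<in> Ob C \<Longrightarrow> shift C (k + 1) X = Sh C (shift C k X)"
  "X \<in> Ob C \<Longrightarrow> shift C (k - 1) X = unSh C (shift C k X)"
proof -
  have p: "(Sh C ^^ n) X \<in> Ob C" "(unSh C ^^ n) X \<in> Ob C" if "X \<in> Ob C" for n X
    by (induction n) (use that in auto)
  show o: "shift C k X \<in> Ob C" if "X \<in> Ob C" for k X using p that by (auto simp: shift_def)
  show *: "shift C (k + 1) X = Sh C (shift C k X)" if X: "X \<in> Ob C" for k X
  proof (cases "0 \<le> k")
    case True
    then show ?thesis by (simp add: shift_def nat_add_distrib)
  next
    case False
    then have "nat (- k) = Suc (nat (- (k + 1)))" by simp
    then show ?thesis using False X p(2)[of X] by (auto simp: shift_def)
  qed
  show "shift C (k - 1) X = unSh C (shift C k X)" if X: "X \<in> Ob C"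
    using *[OF X, of "k - 1"] o[OF X, of "k - 1"] by simp
qed

lemma shift_arr_Hom:
  assumes f: "f \<in> Hom C X Y"
  shows "shift_arr C k f \<in> Hom C (shift C k X) (shift C k Y)"
    and shift_arr_add1: "shift_arr C (k + 1) f = ShA C (shift_arr C k f)"
    and shift_arr_diff1: "shift_arr C (k - 1) f = unShA C (shift_arr C k f)"
proof -
  have p: "(ShA C ^^ n) f \<in> Ar C" "(unShA C ^^ n) f \<in> Ar C" for n
    by (induction n) (use f in \<open>auto simp: in_Hom\<close>)
  have o: "shift_arr C k f \<in> Ar C" for k using p by (auto simp: shift_arr_def)
  have *: "shift_arr C (k + 1) f = ShA C (shift_arr C k f)" for k
  proof (cases "0 \<le> k")
    case True
    then show ?thesis by (simp add: shift_arr_def nat_add_distrib)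
  next
    case False
    then have "nat (- k) = Suc (nat (- (k + 1)))" by simp
    then show ?thesis using False p(2) by (auto simp: shift_arr_def)
  qed
  then show "shift_arr C (k + 1) f = ShA C (shift_arr C k f)" .
  show **: "shift_arr C (k - 1) f = unShA C (shift_arr C k f)" for k
    using *[of "k - 1"] o[of "k - 1"] by simp
  have X: "X \<in> Ob C" "Y \<in> Ob C" using f by (auto simp: in_Hom)
  show "shift_arr C k f \<in> Hom C (shift C k X) (shift C k Y)"
  proof (induction k rule: int_induct[of _ 0])
    case base
    then show ?case using f by (simp add: shift_arr_def shift_def)
  next
    case (step1 i)
    then show ?case unfolding * shift_add1(2)[OF X(1)] shift_add1(2)[OF X(2)] by (auto simp: in_Hom)
  next
    case (step2 i)
    then show ?case unfolding ** shift_add1(3)[OF X(1)] shift_add1(3)[OF X(2)] by (auto simp: in_Hom)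
  qed
qed

lemma weak_exact_shift:
  assumes "weak_exact u v" shows "weak_exact (shift_arr C k u) (shift_arr C k v)"
proof -
  have u: "u \<in> Hom C (Dom C u) (Cod C u)" and v: "v \<in> Hom C (Dom C v) (Cod C v)"
    using assms by (auto simp: weak_exact_def in_Hom)
  show ?thesis
  proof (induction k rule: int_induct[of _ 0])
    case base
    then show ?case using assms by (simp add: shift_arr_def)
  next
    case (step1 i)
    then show ?case unfolding shift_arr_add1[OF u] shift_arr_add1[OF v] by (intro weak_exact_Sh)
  next
    case (step2 i)
    then show ?case unfolding shift_arr_diff1[OF u] shift_arr_diff1[OF v] by (intro weak_exact_unSh)
  qed
qed

lemma shift_arr_Cmp:
  assumes f: "f \<in> Hom C X Y" and g: "g \<in> Hom C Y Z"
  shows "shift_arr C k (g \<cdot> f) = shift_arr C k g \<cdot> shift_arr C k f"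
proof -
  have gf: "g \<cdot> f \<in> Hom C X Z" using f g by auto
  have t: "shift_arr C k f \<in> Hom C (shift C k X) (shift C k Y)" "shift_arr C k g \<in> Hom C (shift C k Y) (shift C k Z)" for k
    using shift_arr_Hom f g by auto
  show ?thesis
  proof (induction k rule: int_induct[of _ 0])
    case base
    then show ?case by (simp add: shift_arr_def)
  next
    case (step1 i)
    then show ?case using t[of i] unfolding shift_arr_add1[OF gf] shift_arr_add1[OF f] shift_arr_add1[OF g]
      by (simp add: ShA_Cmp in_Hom)
  next
    case (step2 i)
    then show ?case using t[of i] unfolding shift_arr_diff1[OF gf] shift_arr_diff1[OF f] shift_arr_diff1[OF g]
      by (simp add: unShA_Cmp in_Hom)
  qed
qed

end

section \<open>Weight structures and the associated calculus of fractions\<close>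

locale weighted = tricategory C for C :: "('o, 'm) tricat" (structure) +
  fixes Wle Wge :: "'o set"
  assumes weight: "weight_structure C Wle Wge"
begin

lemmas Wle_additive = weight[unfolded weight_structure_def, THEN conjunct1]
  and Wge_additive = weight[unfolded weight_structure_def, THEN conjunct2, THEN conjunct1]
  and Wle_karoubi = weight[unfolded weight_structure_def, THEN conjunct2, THEN conjunct2, THEN conjunct1]
  and Wge_karoubi = weight[unfolded weight_structure_def, THEN conjunct2, THEN conjunct2, THEN conjunct2, THEN conjunct1]
  and Wge_unshift = weight[unfolded weight_structure_def, THEN conjunct2, THEN conjunct2, THEN conjunct2, THEN conjunct2, THEN conjunct1]
  and Wle_shift = weight[unfolded weight_structure_def, THEN conjunct2, THEN conjunct2, THEN conjunct2, THEN conjunct2, THEN conjunct2, THEN conjunct1]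
  and orthogonality = weight[unfolded weight_structure_def, THEN conjunct2, THEN conjunct2, THEN conjunct2, THEN conjunct2, THEN conjunct2, THEN conjunct2, THEN conjunct1]
  and decompositions = weight[unfolded weight_structure_def, THEN conjunct2, THEN conjunct2, THEN conjunct2, THEN conjunct2, THEN conjunct2, THEN conjunct2, THEN conjunct2]

lemma Wle_Ob: "X \<in> Wle \<Longrightarrow> X \<in> Ob C" and Wge_Ob: "X \<in> Wge \<Longrightarrow> X \<in> Ob C"
  using Wle_additive Wge_additive unfolding additive_subclass_def by blast+

lemma Wle_retract: "Y \<in> Wle \<Longrightarrow> is_retraction C X Y i r \<Longrightarrow> X \<in> Wle"
  and Wge_retract: "Y \<in> Wge \<Longrightarrow> is_retraction C X Y i r \<Longrightarrow> X \<in> Wge"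
  using Wle_karoubi Wge_karoubi unfolding karoubi_closed_def by metis+

lemma Wle_Sh: "X \<in> Wle \<Longrightarrow> Sh C X \<in> Wle"
  using Wle_shift by blast

lemma Wge_orth: "X \<in> Wge \<Longrightarrow> Y \<in> Wle \<Longrightarrow> f \<in> Hom C X (Sh C Y) \<Longrightarrow> f = Zr C X (Sh C Y)"
  using orthogonality by (auto simp: orthogonal_def)

text \<open>The class \<open>Wge\<close> shifted by [-1], written without an inverse shift. It is
  exactly the left orthogonal of \<open>Wle\<close> (\<open>negative_iff\<close>), and it is stable
  under [-1] but in general not under [1].\<close>

definition negative :: "'o \<Rightarrow> bool" where
  "negative W \<longleftrightarrow> W \<in> Ob C \<and> Sh C W \<in> Wge"

lemma negative_Ob: "negative W \<Longrightarrow> W \<in> Ob C"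
  by (simp add: negative_def)

lemma negative_Wge: assumes "negative W" shows "W \<in> Wge"
proof -
  have "Sh C W \<in> Sh C ` Wge"
    using assms Wge_unshift by (auto simp: negative_def)
  then obtain V where "V \<in> Wge" "Sh C W = Sh C V" by blast
  then have "W = V" using assms Wge_Ob unSh_simps(3) by (metis negative_def)
  then show ?thesis using \<open>V \<in> Wge\<close> by simp
qed

lemma negative_unSh: "X \<in> Wge \<Longrightarrow> negative (unSh C X)"
  by (auto simp: negative_def Wge_Ob)

lemma negative_orth:
  assumes "negative W" "L \<in> Wle" and f: "f \<in> Hom C W L"
  shows "f = Zr C W L"
proof -
  note [simp] = HomD[OF f] negative_Ob[OF assms(1)] Wle_Ob[OF assms(2)]
  have "ShA C f = ShA C (Zr C W L)"
    using Wge_orth[of "Sh C W" L "ShA C f"] assms by (simp add: negative_def in_Hom)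
  then show ?thesis by (subst (asm) ShA_inject) auto
qed

lemma decomposition:
  assumes "X \<in> Ob C"
  obtains W L r a f where "negative W" "L \<in> Wle" "(r, a, f) \<in> Dist C"
    "r \<in> Hom C W X" "a \<in> Hom C X L" "f \<in> Hom C L (Sh C W)"
proof -
  obtain A B u v f where "A \<in> Wle" "B \<in> Wge"
    "u \<in> Hom C (unSh C B) X" "v \<in> Hom C X A" "f \<in> Hom C A B" "(u, v, f) \<in> Dist C"
    using bspec[OF decompositions assms] by blast
  then show ?thesis using that[of "unSh C B" A u v f] negative_unSh Wge_Ob by simp
qed

text \<open>If all maps from negative objects to \<open>Y\<close> vanish, then the lower map of a
  weight decomposition of \<open>Y\<close> is zero, so \<open>Y\<close> is a retract of the upper
  part \<open>L\<close>; Karoubi closedness finishes. Closure properties of the class become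
  statements about vanishing of maps.\<close>

lemma Wle_iff: "Y \<in> Wle \<longleftrightarrow> Y \<in> Ob C \<and> (\<forall>W. negative W \<longrightarrow> (\<forall>f\<in>Hom C W Y. f = Zr C W Y))"
proof
  assume "Y \<in> Ob C \<and> (\<forall>W. negative W \<longrightarrow> (\<forall>f\<in>Hom C W Y. f = Zr C W Y))"
  then have Y [simp]: "Y \<in> Ob C" and z: "\<And>W f. negative W \<Longrightarrow> f \<in> Hom C W Y \<Longrightarrow> f = Zr C W Y" by auto
  obtain W L r a f where d: "negative W" "L \<in> Wle" "(r, a, f) \<in> Dist C"
    "r \<in> Hom C W Y" "a \<in> Hom C Y L" "f \<in> Hom C L (Sh C W)"
    using decomposition[OF Y] .
  note [simp] = HomD[OF d(4)] HomD[OF d(5)] negative_Ob[OF d(1)]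
  have "r = Zr C W Y" using z d by blast
  then obtain s where "s \<in> Hom C L Y" "Idn C Y = s \<cdot> a"
    using tri_weak_cokernel[OF d(3), of "Idn C Y" Y] tri_simps[OF d(3)] by (auto simp: in_Hom)
  then have "is_retraction C Y L a s" using d Wle_Ob by (auto simp: is_retraction_def)
  then show "Y \<in> Wle" using Wle_retract d(2) by blast
qed (auto simp: Wle_Ob intro: negative_orth)

text \<open>Dual to \<open>Wle_iff\<close>: here the upper map of the decomposition vanishes, and
  \<open>X\<close> is a retract of the lower part.\<close>

lemma negative_iff: "negative X \<longleftrightarrow> X \<in> Ob C \<and> (\<forall>L\<in>Wle. \<forall>f\<in>Hom C X L. f = Zr C X L)"
proof
  assume "X \<in> Ob C \<and> (\<forall>L\<in>Wle. \<forall>f\<in>Hom C X L. f = Zr C X L)"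
  then have X [simp]: "X \<in> Ob C" and z: "\<And>L f. L \<in> Wle \<Longrightarrow> f \<in> Hom C X L \<Longrightarrow> f = Zr C X L" by auto
  obtain W L r a f where d: "negative W" "L \<in> Wle" "(r, a, f) \<in> Dist C"
    "r \<in> Hom C W X" "a \<in> Hom C X L" "f \<in> Hom C L (Sh C W)"
    using decomposition[OF X] .
  note [simp] = HomD[OF d(4)] HomD[OF d(5)] negative_Ob[OF d(1)] Wle_Ob[OF d(2)]
  have "a = Zr C X L" using z d by blast
  then obtain s where s: "s \<in> Hom C X W" "r \<cdot> s = Idn C X"
    using tri_weak_kernel[OF d(3), of "Idn C X" X] tri_simps[OF d(3)] by (metis Cmp_Zr HomD(1,2,3) Idn_Hom X \<open>a = Zr C X L\<close> d(4,5) Cmp_Idn)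
  then have "is_retraction C (Sh C X) (Sh C W) (ShA C s) (ShA C r)"
    by (auto simp: is_retraction_def in_Hom ShA_Cmp[symmetric])
  then show "negative X" using Wge_retract d(1) by (auto simp: negative_def)
qed (auto simp: negative_Ob intro: negative_orth)

text \<open>By \<open>Wle_iff\<close> only maps from a negative object have to be tested. Such a map
  dies in the third vertex, lifts to the first one, and is zero there.\<close>

lemma Wle_extension:
  assumes d: "(u, v, w) \<in> Dist C" and "Dom C u \<in> Wle" "Cod C v \<in> Wle" shows "Cod C u \<in> Wle"
proof -
  note [simp] = tri_simps[OF d]
  show ?thesis unfolding Wle_iff
  proof (intro conjI allI impI ballI)
    fix W f assume W: "negative W" and f: "f \<in> Hom C W (Cod C u)"
    note [simp] = HomD[OF f] negative_Ob[OF W]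
    have "v \<cdot> f = Zr C W (Cod C v)" using negative_orth[OF W assms(3)] by (auto simp: in_Hom)
    then obtain y where "y \<in> Hom C W (Dom C u)" "f = u \<cdot> y" using tri_weak_kernel[OF d f] by blast
    then show "f = Zr C W (Cod C u)" using negative_orth[OF W assms(2), of y] by simp
  qed auto
qed

lemma negative_extension:
  assumes d: "(u, v, w) \<in> Dist C" and "negative (Dom C u)" "negative (Cod C v)" shows "negative (Cod C u)"
proof -
  note [simp] = tri_simps[OF d]
  show ?thesis unfolding negative_iff
  proof (intro conjI ballI)
    fix L f assume L: "L \<in> Wle" and f: "f \<in> Hom C (Cod C u) L"
    note [simp] = HomD[OF f] Wle_Ob[OF L]
    have "f \<cdot> u = Zr C (Dom C u) L" using negative_orth[OF assms(2) L] by (auto simp: in_Hom)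
    then obtain y where "y \<in> Hom C (Cod C v) L" "f = y \<cdot> v" using tri_weak_cokernel[OF d f] by blast
    then show "f = Zr C (Cod C u) L" using negative_orth[OF assms(3) L, of y] by simp
  qed auto
qed

lemma Wge_iff_negative: "X \<in> Ob C \<Longrightarrow> X \<in> Wge \<longleftrightarrow> negative (unSh C X)"
  by (auto simp: negative_def)

lemma Wge_extension:
  assumes d: "(u, v, w) \<in> Dist C" and "Dom C u \<in> Wge" "Cod C v \<in> Wge" shows "Cod C u \<in> Wge"
  using negative_extension[OF tri_unShift[OF d]] tri_simps[OF d] assms by (simp add: Wge_iff_negative)

lemma zero_negative: assumes Z: "zero_object C Z" shows "negative Z"
  unfolding negative_iff using zero_object_Ob[OF Z] zero_object_from[OF Z] by (auto simp: in_Hom)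

lemma zero_Wle: assumes Z: "zero_object C Z" shows "Z \<in> Wle"
  unfolding Wle_iff using zero_object_Ob[OF Z] zero_object_to[OF Z] by (auto simp: in_Hom)

text \<open>The denominators of a calculus of right fractions. Since negative objects need not be
  stable under [1], these are not the denominators of a Verdier quotient. What makes them usable is
  closure under composition, the Ore condition, and bijectivity of restriction along them for maps
  into \<open>Wle\<close>.\<close>

definition den :: "'m \<Rightarrow> bool" where
  "den q \<longleftrightarrow> (\<exists>s t. (q, s, t) \<in> Dist C \<and> negative (Cod C s))"

lemma den_Ar [simp]: "den q \<Longrightarrow> q \<in> Ar C"
  using tri_simps(1) by (auto simp: den_def)

lemma den_Idn: assumes "P \<in> Ob C" shows "den (Idn C P)"
proof -
  obtain Z where Z: "zero_object C Z" using ex_zero by blast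
  then show ?thesis
    using tri_Idn[OF assms Z] zero_negative[OF Z] zero_object_Ob[OF Z] assms by (force simp: den_def)
qed

text \<open>Completing \<open>s\<close> to a triangle and rotating back gives a map to
  \<open>Q\<close> with cone \<open>W\<close>, hence a denominator, and its composite with
  \<open>s\<close> is zero. So a map into a negative object can always be removed by refining the
  source.\<close>

lemma den_kill:
  assumes s: "s \<in> Hom C Q W" and W: "negative W"
  obtains t where "den t" "Cod C t = Q" "s \<cdot> t = Zr C (Dom C t) W"
proof -
  note [simp] = HomD[OF s]
  obtain v w where d: "(s, v, w) \<in> Dist C" using tri_exists[of s] by auto
  let ?t = "neg C (unShA C w)"
  have t: "(?t, s, v) \<in> Dist C" using tri_rotate_back[OF d] .
  show ?thesis
  proof (rule that[of ?t])
    show "den ?t" unfolding den_def using t W by auto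
    show "Cod C ?t = Q" using tri_simps(4)[OF t] by simp
    show "s \<cdot> ?t = Zr C (Dom C ?t) W" using tri_comp_zero[OF t] by simp
  qed
qed

text \<open>By the octahedral axiom the cone of a composite is an extension of the two cones, and
  negative objects are closed under extensions.\<close>

lemma den_Cmp:
  assumes "den q" "den t" "Cod C t = Dom C q" shows "den (q \<cdot> t)"
proof -
  obtain l i where v: "(q, l, i) \<in> Dist C" "negative (Cod C l)" using assms(1) by (auto simp: den_def)
  obtain j k where u: "(t, j, k) \<in> Dist C" "negative (Cod C j)" using assms(2) by (auto simp: den_def)
  obtain m n where m: "(q \<cdot> t, m, n) \<in> Dist C" using tri_exists[of "q \<cdot> t"] assms by auto
  obtain f g where d: "(f, g, ShA C j \<cdot> i) \<in> Dist C" and "f \<in> Hom C (Cod C j) (Cod C m)" "g \<in> Hom C (Cod C m) (Cod C l)"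
    using octahedron[OF u(1) v(1) assms(3) m] by blast
  then have "negative (Cod C m)" using negative_extension[OF d] u v by (simp add: in_Hom)
  then show ?thesis using m by (auto simp: den_def)
qed

text \<open>The Ore condition. The obstruction to lifting \<open>f\<close> through \<open>q\<close>
  is its composite with the map from \<open>Cod C q\<close> to the cone of \<open>q\<close>; that
  map has a negative target and is removed by \<open>den_kill\<close>.\<close>

lemma den_pull:
  assumes q: "den q" and f: "f \<in> Hom C P' (Cod C q)"
  obtains q' f' where "den q'" "Cod C q' = P'" "f' \<in> Hom C (Dom C q') (Dom C q)" "q \<cdot> f' = f \<cdot> q'"
proof -
  obtain s t where d: "(q, s, t) \<in> Dist C" "negative (Cod C s)" using q by (auto simp: den_def)
  note [simp] = HomD[OF f] tri_simps[OF d(1)]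
  obtain q' where q': "den q'" "Cod C q' = P'" "(s \<cdot> f) \<cdot> q' = Zr C (Dom C q') (Cod C s)"
    using den_kill[of "s \<cdot> f" P' "Cod C s"] d by (auto simp: in_Hom)
  then obtain f' where "f' \<in> Hom C (Dom C q') (Dom C q)" "f \<cdot> q' = q \<cdot> f'"
    using tri_weak_kernel[OF d(1), of "f \<cdot> q'" "Dom C q'"] by (auto simp: in_Hom Cmp_assoc)
  then show ?thesis using that q' by metis
qed

lemma den_common:
  assumes q: "den q" "den q'" "Cod C q' = Cod C q"
  obtains t t' where "den (q \<cdot> t)" "t \<in> Hom C (Dom C t) (Dom C q)" "t' \<in> Hom C (Dom C t) (Dom C q')"
    "q \<cdot> t = q' \<cdot> t'"
proof -
  obtain t t' where "den t" "Cod C t = Dom C q" "t' \<in> Hom C (Dom C t) (Dom C q')" "q' \<cdot> t' = q \<cdot> t"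
    using den_pull[OF q(2), of q "Dom C q"] q by (auto simp: in_Hom)
  note t = this
  show ?thesis
  proof (rule that[of t t'])
    show "den (q \<cdot> t)" by (rule den_Cmp[OF q(1) t(1,2)])
    show "t \<in> Hom C (Dom C t) (Dom C q)" using t(1,2) by (simp add: in_Hom)
  qed (use t in auto)
qed

text \<open>The difference of the two maps vanishes on \<open>q\<close>, so it factors through the
  cone of \<open>q\<close>, which is negative and has no nonzero maps to \<open>L\<close>.\<close>

lemma den_cancel:
  assumes q: "den q" and L: "L \<in> Wle" and y: "y \<in> Hom C (Cod C q) L" "y' \<in> Hom C (Cod C q) L"
    and "y \<cdot> q = y' \<cdot> q"
  shows "y = y'"
proof -
  obtain s t where d: "(q, s, t) \<in> Dist C" "negative (Cod C s)" using q by (auto simp: den_def)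
  note [simp] = HomD[OF y(1)] HomD[OF y(2)] tri_simps[OF d(1)] Wle_Ob[OF L]
  have "diff y y' \<cdot> q = Zr C (Dom C q) L" using assms(5) by (simp add: diff_Cmp)
  then obtain z where "z \<in> Hom C (Cod C s) L" "diff y y' = z \<cdot> s"
    using tri_weak_cokernel[OF d(1), of "diff y y'" L] by (auto simp: in_Hom)
  then have "diff y y' = Zr C (Cod C q) L" using negative_orth[OF d(2) L, of z] negative_Ob[OF d(2)] by simp
  then show ?thesis by (subst (asm) diff_zero_iff) auto
qed

text \<open>The obstruction is a map from the desuspended cone, again a negative object, to
  \<open>L\<close>. Together with \<open>den_cancel\<close> this makes restriction Hom(P, L) ->
  Hom(Q, L) bijective for every denominator Q -> P; that is why a colimit over denominators can be
  realized inside the single group Hom(P, L).\<close>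

lemma den_extend:
  assumes q: "den q" and L: "L \<in> Wle" and x: "x \<in> Hom C (Dom C q) L"
  obtains y where "y \<in> Hom C (Cod C q) L" "y \<cdot> q = x"
proof -
  obtain s t where d: "(q, s, t) \<in> Dist C" "negative (Cod C s)" using q by (auto simp: den_def)
  note [simp] = HomD[OF x] tri_simps[OF d(1)] Wle_Ob[OF L] negative_Ob[OF d(2)]
  have W: "negative (unSh C (Cod C s))" using negative_unSh negative_Wge d(2) by blast
  have "x \<cdot> neg C (unShA C t) = Zr C (unSh C (Cod C s)) L"
    by (rule negative_orth[OF W L]) (auto simp: in_Hom)
  then obtain y where "y \<in> Hom C (Cod C q) L" "x = y \<cdot> q"
    using tri_weak_cokernel[OF tri_rotate_back[OF d(1)], of x L] by (auto simp: in_Hom)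
  then show ?thesis using that by metis
qed

text \<open>\<open>wdec a\<close>: the morphism \<open>a : X \<rightarrow> L\<close> is the upper half of a weight decomposition of \<open>X\<close>.\<close>

definition wdec :: "'m \<Rightarrow> bool" where
  "wdec a \<longleftrightarrow> (\<exists>r f. (r, a, f) \<in> Dist C \<and> negative (Dom C r) \<and> Cod C a \<in> Wle)"

lemma wdec_exists: "X \<in> Ob C \<Longrightarrow> \<exists>a. wdec a \<and> Dom C a = X"
  by (rule decomposition[of X]) (auto simp: wdec_def in_Hom)

lemma wdecD [simp]: "wdec a \<Longrightarrow> a \<in> Ar C" "wdec a \<Longrightarrow> Cod C a \<in> Wle"
  using tri_simps(2) by (auto simp: wdec_def)

lemma wdec_zero:
  assumes a: "wdec a" and x: "x \<in> Hom C Q (Dom C a)" and z: "a \<cdot> x = Zr C Q (Cod C a)"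
  obtains W r w where "negative W" "r \<in> Hom C W (Dom C a)" "w \<in> Hom C Q W" "x = r \<cdot> w"
proof -
  obtain r f where d: "(r, a, f) \<in> Dist C" "negative (Dom C r)" using a by (auto simp: wdec_def)
  note [simp] = tri_simps[OF d(1)]
  obtain y where "y \<in> Hom C Q (Dom C r)" "x = r \<cdot> y"
    using tri_weak_kernel[OF d(1), of x Q] x z by auto
  then show ?thesis using that[of "Dom C r" r y] d by (auto simp: in_Hom)
qed

lemma wdec_lift:
  assumes a: "wdec a" and L: "L \<in> Wle" and b: "b \<in> Hom C (Dom C a) L"
  obtains m where "m \<in> Hom C (Cod C a) L" "m \<cdot> a = b"
proof -
  obtain r f where d: "(r, a, f) \<in> Dist C" "negative (Dom C r)" using a by (auto simp: wdec_def)
  note [simp] = tri_simps[OF d(1)]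
  have "b \<cdot> r = Zr C (Dom C r) L" by (rule negative_orth[OF d(2) L]) (use b in \<open>auto simp: in_Hom\<close>)
  then obtain m where "m \<in> Hom C (Cod C a) L" "b = m \<cdot> a"
    using tri_weak_cokernel[OF d(1), of b L] b by auto
  then show ?thesis using that by metis
qed

text \<open>
  The values of the homological functor \<open>H\<close>: the colimit of \<open>Hom(Q, X)\<close> over all \<open>q : Q \<rightarrow> P\<close> with
  \<open>den q\<close>, embedded into \<open>Hom(P, L)\<close> by means of the unique extension of \<open>a \<circ> x : Q \<rightarrow> L\<close> to \<open>P\<close>.
\<close>

definition Hset :: "'m \<Rightarrow> 'o \<Rightarrow> 'm set" where
  "Hset a P = {y \<in> Hom C P (Cod C a). \<exists>q x. den q \<and> Cod C q = P \<and> x \<in> Hom C (Dom C q) (Dom C a) \<and> y \<cdot> q = a \<cdot> x}"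

lemma HsetE:
  assumes "y \<in> Hset a P"
  obtains q x where "y \<in> Hom C P (Cod C a)" "den q" "Cod C q = P" "x \<in> Hom C (Dom C q) (Dom C a)" "y \<cdot> q = a \<cdot> x"
  using assms by (auto simp: Hset_def)

lemma HsetI:
  "y \<in> Hom C P (Cod C a) \<Longrightarrow> den q \<Longrightarrow> Cod C q = P \<Longrightarrow> x \<in> Hom C (Dom C q) (Dom C a) \<Longrightarrow> y \<cdot> q = a \<cdot> x
    \<Longrightarrow> y \<in> Hset a P"
  by (auto simp: Hset_def)

lemma Hset_Hom: "y \<in> Hset a P \<Longrightarrow> y \<in> Hom C P (Cod C a)"
  by (simp add: Hset_def)

lemma Hset_Zr:
  assumes "a \<in> Ar C" "P \<in> Ob C" shows "Zr C P (Cod C a) \<in> Hset a P"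
  by (rule HsetI[of _ _ _ "Idn C P" "Zr C P (Dom C a)"]) (use assms den_Idn in auto)

lemma Hset_neg:
  assumes "a \<in> Ar C" "y \<in> Hset a P" shows "neg C y \<in> Hset a P"
proof -
  obtain q x where "y \<in> Hom C P (Cod C a)" "den q" "Cod C q = P" "x \<in> Hom C (Dom C q) (Dom C a)" "y \<cdot> q = a \<cdot> x"
    using assms(2) by (rule HsetE)
  then show ?thesis
    using assms by (intro HsetI[of _ _ _ q "neg C x"]) (auto simp: in_Hom neg_Cmp Cmp_neg)
qed

lemma Hset_Add:
  assumes a: "a \<in> Ar C" and "y \<in> Hset a P" "y' \<in> Hset a P" shows "Add C y y' \<in> Hset a P"
proof -
  obtain q x where 1: "y \<in> Hom C P (Cod C a)" "den q" "Cod C q = P" "x \<in> Hom C (Dom C q) (Dom C a)" "y \<cdot> q = a \<cdot> x"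
    using assms(2) by (rule HsetE)
  obtain q' x' where 2: "y' \<in> Hom C P (Cod C a)" "den q'" "Cod C q' = P" "x' \<in> Hom C (Dom C q') (Dom C a)" "y' \<cdot> q' = a \<cdot> x'"
    using assms(3) by (rule HsetE)
  obtain t t' where t: "den (q \<cdot> t)" "t \<in> Hom C (Dom C t) (Dom C q)" "t' \<in> Hom C (Dom C t) (Dom C q')" "q \<cdot> t = q' \<cdot> t'"
    using den_common[of q q'] 1 2 by auto
  note [simp] = HomD(1,3)[OF t(2)] HomD[OF t(3)] HomD[OF 1(1)] HomD[OF 2(1)] HomD[OF 1(4)] HomD[OF 2(4)] a 1(2,3) 2(2,3)
  have "y' \<cdot> (q \<cdot> t) = (a \<cdot> x') \<cdot> t'" unfolding t(4) by (simp flip: Cmp_assoc 2(5))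
  moreover have "y \<cdot> (q \<cdot> t) = (a \<cdot> x) \<cdot> t" by (simp flip: Cmp_assoc 1(5))
  ultimately have "Add C y y' \<cdot> (q \<cdot> t) = Add C ((a \<cdot> x) \<cdot> t) ((a \<cdot> x') \<cdot> t')"
    by (subst Add_Cmp) auto
  also have "\<dots> = a \<cdot> Add C (x \<cdot> t) (x' \<cdot> t')" by (subst Cmp_Add) (auto simp: Cmp_assoc)
  finally show ?thesis
    by (intro HsetI[of _ _ _ "q \<cdot> t" "Add C (x \<cdot> t) (x' \<cdot> t')"]) (auto simp: in_Hom t(1))
qed

lemma Hset_precomp:
  assumes a: "a \<in> Ar C" and y: "y \<in> Hset a P" and f: "f \<in> Hom C P' P" shows "y \<cdot> f \<in> Hset a P'"
proof -
  obtain q x where 1: "y \<in> Hom C P (Cod C a)" "den q" "Cod C q = P" "x \<in> Hom C (Dom C q) (Dom C a)" "y \<cdot> q = a \<cdot> x"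
    using y by (rule HsetE)
  obtain q' f' where 2: "den q'" "Cod C q' = P'" "f' \<in> Hom C (Dom C q') (Dom C q)" "q \<cdot> f' = f \<cdot> q'"
    using den_pull[of q f P'] 1 f by auto
  note [simp] = HomD[OF 1(1)] HomD[OF 1(4)] HomD[OF 2(3)] HomD[OF f] 1(2,3) 2(1,2) a
  have "(y \<cdot> f) \<cdot> q' = y \<cdot> (q \<cdot> f')" unfolding 2(4) by (simp add: Cmp_assoc)
  also have "\<dots> = (a \<cdot> x) \<cdot> f'" by (subst Cmp_assoc[symmetric]) (auto simp: 1(5))
  also have "\<dots> = a \<cdot> (x \<cdot> f')" by (simp add: Cmp_assoc)
  finally show ?thesis by (intro HsetI[of _ _ _ q' "x \<cdot> f'"]) (auto simp: in_Hom)
qed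

lemma Hset_postcomp:
  assumes y: "y \<in> Hset a P" and [simp]: "a \<in> Ar C" "a' \<in> Ar C" and m: "m \<in> Hom C (Cod C a) (Cod C a')"
    and g: "g \<in> Hom C (Dom C a) (Dom C a')" and e: "m \<cdot> a = a' \<cdot> g"
  shows "m \<cdot> y \<in> Hset a' P"
proof -
  obtain q x where 1: "y \<in> Hom C P (Cod C a)" "den q" "Cod C q = P" "x \<in> Hom C (Dom C q) (Dom C a)" "y \<cdot> q = a \<cdot> x"
    using y by (rule HsetE)
  note [simp] = HomD[OF 1(1)] HomD[OF 1(4)] HomD[OF m] HomD[OF g] 1(2,3)
  have "(m \<cdot> y) \<cdot> q = (m \<cdot> a) \<cdot> x" by (simp add: Cmp_assoc 1(5))
  then have "(m \<cdot> y) \<cdot> q = a' \<cdot> (g \<cdot> x)" unfolding e by (simp add: Cmp_assoc)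
  then show ?thesis by (intro HsetI[of _ _ _ q "g \<cdot> x"]) (auto simp: in_Hom)
qed

text \<open>Maps out of \<open>Cod C a\<close> are not determined by their composite with
  \<open>a\<close>. On \<open>Hset\<close> the ambiguity disappears: after a denominator its
  elements factor through \<open>a\<close>, and denominators can be cancelled for maps into
  \<open>Wle\<close>. Functoriality of \<open>H\<close> rests on this.\<close>

lemma Hset_postcomp_unique:
  assumes y: "y \<in> Hset a P" and [simp]: "a \<in> Ar C" and L: "L \<in> Wle"
    and m: "m \<in> Hom C (Cod C a) L" "m' \<in> Hom C (Cod C a) L" and e: "m \<cdot> a = m' \<cdot> a"
  shows "m \<cdot> y = m' \<cdot> y"
proof -
  obtain q x where 1: "y \<in> Hom C P (Cod C a)" "den q" "Cod C q = P" "x \<in> Hom C (Dom C q) (Dom C a)" "y \<cdot> q = a \<cdot> x"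
    using y by (rule HsetE)
  note [simp] = HomD[OF 1(1)] HomD[OF 1(4)] HomD[OF m(1)] HomD[OF m(2)] 1(2,3)
  have "(m \<cdot> y) \<cdot> q = (m \<cdot> a) \<cdot> x" by (simp add: Cmp_assoc 1(5))
  also have "\<dots> = (m' \<cdot> y) \<cdot> q" unfolding e by (simp add: Cmp_assoc 1(5))
  finally show ?thesis by (rule den_cancel[OF 1(2) L, rotated 2]) (auto simp: in_Hom)
qed

text \<open>The homological property of \<open>H\<close>. After a denominator, \<open>y\<close> is
  represented by some \<open>x\<close>, and \<open>n \<cdot> y = 0\<close> only says that
  \<open>v \<cdot> x\<close> dies under \<open>c\<close>, that is, factors through a negative
  object. A further denominator kills that factor; then weak exactness lifts \<open>x\<close> to the
  source of \<open>u\<close>, and \<open>den_extend\<close> moves the lift back to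
  \<open>P\<close>.\<close>

lemma Hset_exact:
  assumes uv: "weak_exact u v" and a: "wdec a" "Dom C a = Dom C u" and b: "wdec b" "Dom C b = Dom C v"
    and c: "wdec c" "Dom C c = Cod C v"
    and m: "m \<in> Hom C (Cod C a) (Cod C b)" "m \<cdot> a = b \<cdot> u"
    and n: "n \<in> Hom C (Cod C b) (Cod C c)" "n \<cdot> b = c \<cdot> v"
    and y: "y \<in> Hset b P" and z: "n \<cdot> y = Zr C P (Cod C c)"
  shows "\<exists>x\<in>Hset a P. y = m \<cdot> x"
proof -
  obtain q x where 1: "y \<in> Hom C P (Cod C b)" "den q" "Cod C q = P" "x \<in> Hom C (Dom C q) (Dom C b)" "y \<cdot> q = b \<cdot> x"
    using y by (rule HsetE)
  have [simp]: "u \<in> Ar C" "v \<in> Ar C" "Cod C u = Dom C v" using uv by (auto simp: weak_exact_def)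
  note [simp] = HomD[OF 1(1)] HomD[OF 1(4)] HomD[OF m(1)] HomD[OF n(1)] 1(2,3) a b c
  have "c \<cdot> (v \<cdot> x) = (n \<cdot> b) \<cdot> x" unfolding n(2) by (simp add: Cmp_assoc)
  also have "\<dots> = (n \<cdot> y) \<cdot> q" by (simp add: Cmp_assoc 1(5))
  finally have "c \<cdot> (v \<cdot> x) = Zr C (Dom C q) (Cod C c)" unfolding z by simp
  then obtain W r w where w: "negative W" "r \<in> Hom C W (Cod C v)" "w \<in> Hom C (Dom C q) W" "v \<cdot> x = r \<cdot> w"
    using wdec_zero[OF c(1), of "v \<cdot> x" "Dom C q"] by (auto simp: in_Hom)
  obtain t where t: "den t" "Cod C t = Dom C q" "w \<cdot> t = Zr C (Dom C t) W"
    using den_kill[OF w(3,1)] .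
  note [simp] = HomD[OF w(2)] HomD[OF w(3)] t(1,2)
  have "v \<cdot> (x \<cdot> t) = r \<cdot> (w \<cdot> t)" by (simp add: w(4) flip: Cmp_assoc)
  then have "v \<cdot> (x \<cdot> t) = Zr C (Dom C t) (Cod C v)" by (simp add: t(3))
  moreover have "x \<cdot> t \<in> Hom C (Dom C t) (Dom C v)" by (simp add: in_Hom)
  ultimately obtain x' where x': "x' \<in> Hom C (Dom C t) (Dom C u)" "x \<cdot> t = u \<cdot> x'"
    using uv unfolding weak_exact_def by blast
  note [simp] = HomD[OF x'(1)]
  have qt: "den (q \<cdot> t)" by (rule den_Cmp) auto
  obtain x0 where x0: "x0 \<in> Hom C P (Cod C a)" "x0 \<cdot> (q \<cdot> t) = a \<cdot> x'"
    using den_extend[OF qt, of "Cod C a" "a \<cdot> x'"] by (auto simp: in_Hom)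
  note [simp] = HomD[OF x0(1)]
  have "x0 \<in> Hset a P" by (rule HsetI[OF x0(1) qt _ _ x0(2)]) (auto simp: in_Hom)
  moreover have "y = m \<cdot> x0"
  proof (rule den_cancel[OF qt])
    have "(m \<cdot> x0) \<cdot> (q \<cdot> t) = (m \<cdot> a) \<cdot> x'" by (simp add: Cmp_assoc x0(2))
    also have "\<dots> = b \<cdot> (x \<cdot> t)" unfolding m(2) by (simp add: Cmp_assoc x'(2))
    also have "\<dots> = y \<cdot> (q \<cdot> t)" by (simp add: 1(5) flip: Cmp_assoc)
    finally show "y \<cdot> (q \<cdot> t) = (m \<cdot> x0) \<cdot> (q \<cdot> t)" by simp
    show "Cod C b \<in> Wle" by simp
  qed (auto simp: in_Hom)
  ultimately show ?thesis by blast
qed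

lemma Hset_negative:
  assumes "wdec a" "negative (Dom C a)" "y \<in> Hset a P" shows "y = Zr C P (Cod C a)"
proof -
  obtain q x where 1: "y \<in> Hom C P (Cod C a)" "den q" "Cod C q = P" "x \<in> Hom C (Dom C q) (Dom C a)" "y \<cdot> q = a \<cdot> x"
    using assms(3) by (rule HsetE)
  note [simp] = HomD[OF 1(1)] HomD[OF 1(4)] 1(2,3) assms(1) wdecD(2)[OF assms(1), THEN Wle_Ob]
  have "P \<in> Ob C" using Cod_Ob[OF den_Ar[OF 1(2)]] by simp
  moreover have "a = Zr C (Dom C a) (Cod C a)" by (rule negative_orth[OF assms(2)]) (auto simp: in_Hom)
  then have "a \<cdot> x = Zr C (Dom C a) (Cod C a) \<cdot> x" by simp
  then have "y \<cdot> q = Zr C P (Cod C a) \<cdot> q" using 1(5) \<open>P \<in> Ob C\<close> by simp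
  ultimately show ?thesis by (intro den_cancel[OF 1(2), of "Cod C a" y "Zr C P (Cod C a)"]) (auto simp: in_Hom)
qed

text \<open>A map from the source of a denominator to an object of \<open>Wle\<close> extends to all
  of \<open>P\<close>, so every fraction is represented by an honest map from
  \<open>P\<close>.\<close>

lemma Hset_Wle:
  assumes a: "wdec a" "Dom C a \<in> Wle" and y: "y \<in> Hset a P"
  shows "\<exists>f\<in>Hom C P (Dom C a). y = a \<cdot> f"
proof -
  obtain q x where 1: "y \<in> Hom C P (Cod C a)" "den q" "Cod C q = P" "x \<in> Hom C (Dom C q) (Dom C a)" "y \<cdot> q = a \<cdot> x"
    using y by (rule HsetE)
  obtain f where f: "f \<in> Hom C P (Dom C a)" "f \<cdot> q = x" using den_extend[OF 1(2) a(2) 1(4)] 1(3) by auto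
  note [simp] = HomD[OF 1(1)] HomD[OF 1(4)] HomD[OF f(1)] 1(2,3) a
  have "y \<cdot> q = (a \<cdot> f) \<cdot> q" by (simp add: Cmp_assoc f(2) 1(5))
  then have "y = a \<cdot> f" by (rule den_cancel[OF 1(2), of "Cod C a", rotated 3]) (auto simp: in_Hom)
  then show ?thesis using f by blast
qed

lemma Hset_Sh_Wle:
  assumes a: "wdec a" "Dom C a = Sh C L" "L \<in> Wle" and P: "P \<in> Wge" and y: "y \<in> Hset a P"
  shows "y = Zr C P (Cod C a)"
proof -
  obtain f where "f \<in> Hom C P (Dom C a)" "y = a \<cdot> f" using Hset_Wle[OF a(1) _ y] a Wle_Sh by auto
  then show ?thesis using Wge_orth[OF P a(3), of f] a Wge_Ob[OF P] by (auto simp: in_Hom)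
qed

lemma Hset_comp: "wdec a \<Longrightarrow> f \<in> Hom C P (Dom C a) \<Longrightarrow> a \<cdot> f \<in> Hset a P"
  by (rule HsetI[of _ _ _ "Idn C P" f]) (auto simp: in_Hom intro: den_Idn)

text \<open>A map killed by \<open>a\<close> factors through a negative object, and negative objects
  have no nonzero maps to \<open>Wle\<close>. With \<open>Hset_Wle\<close> this identifies
  \<open>H\<close> on the heart with the Yoneda embedding.\<close>

lemma wdec_mono:
  assumes a: "wdec a" "Dom C a \<in> Wle" and f: "f \<in> Hom C P (Dom C a)" "a \<cdot> f = Zr C P (Cod C a)"
  shows "f = Zr C P (Dom C a)"
proof -
  obtain W r w where w: "negative W" "r \<in> Hom C W (Dom C a)" "w \<in> Hom C P W" "f = r \<cdot> w"
    using wdec_zero[OF a(1) f] .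
  have "r = Zr C W (Dom C a)" by (rule negative_orth[OF w(1) a(2) w(2)])
  then show ?thesis using w Wle_Ob[OF a(2)] by (auto simp: in_Hom)
qed

end

section \<open>Weight Postnikov towers\<close>

text \<open>Endomorphisms of a tower are chosen degree by degree, each depending on its neighbour,
  and the tower extends in both directions. From degree 0 the choices go upwards by
  \<open>up\<close> and downwards by \<open>down\<close>, which below are two different
  corrections.\<close>

lemma int_dependent_choice:
  fixes V :: "int \<Rightarrow> 's \<Rightarrow> bool"
  assumes start: "V 0 s0"
    and up: "\<And>k s'. V (k - 1) s' \<Longrightarrow> \<exists>s. V k s \<and> St k s' s"
    and down: "\<And>k s. V k s \<Longrightarrow> \<exists>s'. V (k - 1) s' \<and> St k s' s"
  shows "\<exists>\<sigma>. \<forall>k. V k (\<sigma> k) \<and> St k (\<sigma> (k - 1)) (\<sigma> k)"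
proof -
  have "\<exists>u. \<forall>n. (V (int n) (u n) \<and> (n = 0 \<longrightarrow> u n = s0)) \<and> St (int n + 1) (u n) (u (Suc n))"
  proof (rule dependent_nat_choice)
    fix x n assume "V (int n) x \<and> (n = 0 \<longrightarrow> x = s0)"
    then show "\<exists>y. (V (int (Suc n)) y \<and> (Suc n = 0 \<longrightarrow> y = s0)) \<and> St (int n + 1) x y"
      using up[of "int n + 1" x] by (simp add: add.commute)
  qed (use start in auto)
  then obtain u where u: "\<And>n. V (int n) (u n)" "u 0 = s0" "\<And>n. St (int n + 1) (u n) (u (Suc n))" by blast
  have "\<exists>d. \<forall>n. (V (- int n) (d n) \<and> (n = 0 \<longrightarrow> d n = s0)) \<and> St (- int n) (d (Suc n)) (d n)"
  proof (rule dependent_nat_choice)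
    fix x n assume V: "V (- int n) x \<and> (n = 0 \<longrightarrow> x = s0)"
    have "- int n - 1 = - int (Suc n)" by simp
    then show "\<exists>y. (V (- int (Suc n)) y \<and> (Suc n = 0 \<longrightarrow> y = s0)) \<and> St (- int n) y x"
      using down[of "- int n" x] V by (metis nat.distinct(1))
  qed (use start in auto)
  then obtain d where d: "\<And>n. V (- int n) (d n)" "d 0 = s0" "\<And>n. St (- int n) (d (Suc n)) (d n)" by blast
  define \<sigma> where "\<sigma> k = (if 0 \<le> k then u (nat k) else d (nat (- k)))" for k
  have "V k (\<sigma> k) \<and> St k (\<sigma> (k - 1)) (\<sigma> k)" for k
  proof (cases "1 \<le> k")
    case True
    then obtain n where "k = int n + 1" by (metis add.commute zle_iff_zadd)
    then show ?thesis using u(1)[of "Suc n"] u(3)[of n] by (simp add: \<sigma>_def add.commute nat_add_distrib)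
  next
    case False
    then obtain n where n: "k = - int n" by (metis int_nat_eq minus_minus neg_0_le_iff_le nle_le not_le zless_imp_add1_zle add_0)
    then have "\<sigma> k = d n" "\<sigma> (k - 1) = d (Suc n)"
      using u(2) d(2) by (auto simp: \<sigma>_def nat_add_distrib intro!: arg_cong[of _ _ d])
    then show ?thesis using d(1)[of n] d(3)[of n] n by simp
  qed
  then show ?thesis by blast
qed

locale weight_postnikov = weighted +
  fixes X and T
  assumes tower: "weight_tower C Wle Wge X T" and X: "X \<in> Ob C"
begin

lemma tower_objects [simp]:
  "tL T k \<in> Wle" "tR T k \<in> Wge" "tG T k \<in> Wge" "tG T k \<in> Wle"
  "tL T k \<in> Ob C" "tR T k \<in> Ob C" "tG T k \<in> Ob C" "shift C k X \<in> Ob C"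
  using tower unfolding weight_tower_def by (auto simp: Wle_Ob Wge_Ob shift_add1 X)

lemma tower_Hom:
  "ta T k \<in> Hom C (shift C k X) (tL T k)" "tf T k \<in> Hom C (tL T k) (tR T (k + 1))"
  "tb T k \<in> Hom C (tR T (k + 1)) (shift C (k + 1) X)"
  "tp T k \<in> Hom C (unSh C (tL T k)) (tL T (k - 1))"
  "tq T k \<in> Hom C (unSh C (tR T (k + 1))) (tR T k)"
  "tc T k \<in> Hom C (tL T (k - 1)) (tG T k)" "td T k \<in> Hom C (tG T k) (tL T k)" "ty T k \<in> Hom C (tR T k) (tG T k)"
  using tower unfolding weight_tower_def by auto

lemmas tower_simps [simp] =
  tower_Hom(1)[THEN HomD(1)] tower_Hom(1)[THEN HomD(2)] tower_Hom(1)[THEN HomD(3)]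
  tower_Hom(2)[THEN HomD(1)] tower_Hom(2)[THEN HomD(2)] tower_Hom(2)[THEN HomD(3)]
  tower_Hom(3)[THEN HomD(1)] tower_Hom(3)[THEN HomD(2)] tower_Hom(3)[THEN HomD(3)]
  tower_Hom(4)[THEN HomD(1)] tower_Hom(4)[THEN HomD(2)] tower_Hom(4)[THEN HomD(3)]
  tower_Hom(5)[THEN HomD(1)] tower_Hom(5)[THEN HomD(2)] tower_Hom(5)[THEN HomD(3)]
  tower_Hom(6)[THEN HomD(1)] tower_Hom(6)[THEN HomD(2)] tower_Hom(6)[THEN HomD(3)]
  tower_Hom(7)[THEN HomD(1)] tower_Hom(7)[THEN HomD(2)] tower_Hom(7)[THEN HomD(3)]
  tower_Hom(8)[THEN HomD(1)] tower_Hom(8)[THEN HomD(2)] tower_Hom(8)[THEN HomD(3)]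

lemma tower_tri:
  "(ta T k, tf T k, tb T k) \<in> Dist C" "(tp T k, tc T k, td T k) \<in> Dist C"
  "(tq T k, ty T k, tf T k \<cdot> td T k) \<in> Dist C"
  using tower unfolding weight_tower_def by blast+

lemma tower_eqs:
  "tp T k \<cdot> unShA C (ta T k) = ta T (k - 1)"
  "tb T (k - 1) \<cdot> tq T k = neg C (unShA C (tb T k))"
  "tc T k = ty T k \<cdot> tf T (k - 1)"
  using tower unfolding weight_tower_def by auto

lemma tower_zero:
  "tf T k \<cdot> ta T k = Zr C (shift C k X) (tR T (k + 1))" "tb T k \<cdot> tf T k = Zr C (tL T k) (shift C (k + 1) X)"
  "tc T k \<cdot> tp T k = Zr C (unSh C (tL T k)) (tG T k)" "td T k \<cdot> tc T k = Zr C (tL T (k - 1)) (tL T k)"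
  using weak_exact_tri(1,2)[OF tower_tri(1)[of k]] weak_exact_tri(1,2)[OF tower_tri(2)[of k]]
  by (auto simp: weak_exact_def)

lemma wdec_ta [simp]: "wdec (ta T k)"
proof -
  have "(neg C (unShA C (tb T k)), ta T k, tf T k) \<in> Dist C" by (rule tri_rotate_back[OF tower_tri(1)])
  moreover have "negative (unSh C (tR T (k + 1)))" by (rule negative_unSh) simp
  ultimately show ?thesis unfolding wdec_def by force
qed

text \<open>
  Comparison of the homology of the weight complex at \<open>X\<^sup>i\<close>, evaluated at an object \<open>P\<close> of the heart,
  with the values of \<open>H\<close> at \<open>X[i]\<close>: the map induced by \<open>td T i\<close> is onto and its kernel consists of the boundaries.
\<close>

lemma cycle_Hset:
  assumes z: "z \<in> Hom C P (tG T i)" and c: "weight_complex_diff C T i \<cdot> z = Zr C P (tG T (i + 1))"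
  shows "td T i \<cdot> z \<in> Hset (ta T i) P"
proof -
  note [simp] = HomD[OF z]
  have P [simp]: "P \<in> Ob C" using Dom_Ob[of z] by simp
  have "ty T (i + 1) \<cdot> (tf T i \<cdot> (td T i \<cdot> z)) = Zr C P (tG T (i + 1))"
    using c tower_eqs(3)[of "i + 1"] by (simp add: weight_complex_diff_def Cmp_assoc)
  \<comment> \<open>The lift ends in the desuspension of \<open>tR T (i + 2)\<close>, a negative
    object. Hence it is killed by a denominator, after which \<open>td T i \<cdot> z\<close> comes
    from X[i].\<close>
  then obtain s where s: "s \<in> Hom C P (unSh C (tR T (2 + i)))" "tf T i \<cdot> (td T i \<cdot> z) = tq T (i + 1) \<cdot> s"
    using tri_weak_kernel[OF tower_tri(3)[of "i + 1"], of "tf T i \<cdot> (td T i \<cdot> z)" P] by (auto simp: in_Hom)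
  obtain t where t: "den t" "Cod C t = P" "s \<cdot> t = Zr C (Dom C t) (unSh C (tR T (2 + i)))"
    using den_kill[OF s(1)] negative_unSh tower_objects by blast
  note [simp] = HomD[OF s(1)] t(1,2)
  have "tf T i \<cdot> (td T i \<cdot> (z \<cdot> t)) = (tf T i \<cdot> (td T i \<cdot> z)) \<cdot> t" by (simp add: Cmp_assoc)
  also have "\<dots> = Zr C (Dom C t) (tR T (i + 1))" using t(3) unfolding s(2) by (simp add: Cmp_assoc)
  finally obtain x where "x \<in> Hom C (Dom C t) (shift C i X)" "td T i \<cdot> (z \<cdot> t) = ta T i \<cdot> x"
    using tri_weak_kernel[OF tower_tri(1)[of i], of "td T i \<cdot> (z \<cdot> t)" "Dom C t"] by (auto simp: in_Hom)
  then show ?thesis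
    by (intro HsetI[of _ _ _ t x]) (auto simp: in_Hom Cmp_assoc)
qed

lemma Hset_cycle:
  assumes y: "y \<in> Hset (ta T i) P" and P: "P \<in> Wge"
  shows "\<exists>z\<in>Hom C P (tG T i). y = td T i \<cdot> z \<and> weight_complex_diff C T i \<cdot> z = Zr C P (tG T (i + 1))"
proof -
  obtain q x where 1: "y \<in> Hom C P (tL T i)" "den q" "Cod C q = P" "x \<in> Hom C (Dom C q) (shift C i X)" "y \<cdot> q = ta T i \<cdot> x"
    using y by (auto elim: HsetE)
  note [simp] = HomD[OF 1(1)] HomD[OF 1(4)] 1(2,3) Wge_Ob[OF P]
  \<comment> \<open>The obstruction to lifting \<open>y\<close> along \<open>td T i\<close> is a map
    from \<open>P\<close> in \<open>Wge\<close> to a shifted object of \<open>Wle\<close>, so it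
    vanishes by orthogonality.\<close>
  have "neg C (ShA C (tp T i)) \<cdot> y = Zr C P (Sh C (tL T (i - 1)))"
    by (rule Wge_orth[OF P]) (auto simp: in_Hom)
  then obtain z where z: "z \<in> Hom C P (tG T i)" "y = td T i \<cdot> z"
    using tri_weak_kernel[OF tri_rotate[OF tri_rotate[OF tower_tri(2)[of i]]], of y P]
      tri_weak_kernel[OF tri_rotate[OF tower_tri(2)[of i]], of y P] by (auto simp: in_Hom)
  note [simp] = HomD[OF z(1)]
  have "tc T (i + 1) \<cdot> y = Zr C P (tG T (i + 1))"
  proof (rule den_cancel[OF 1(2)])
    have "(tc T (i + 1) \<cdot> y) \<cdot> q = ty T (i + 1) \<cdot> ((tf T i \<cdot> ta T i) \<cdot> x)"
      using tower_eqs(3)[of "i + 1"] by (simp add: Cmp_assoc 1(5))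
    then show "(tc T (i + 1) \<cdot> y) \<cdot> q = Zr C P (tG T (i + 1)) \<cdot> q" by (simp add: tower_zero(1))
    show "tG T (i + 1) \<in> Wle" by simp
  qed (auto simp: in_Hom)
  then show ?thesis using z by (intro bexI[of _ z]) (auto simp: weight_complex_diff_def Cmp_assoc)
qed

lemma boundary_iff:
  assumes z: "z \<in> Hom C P (tG T i)" and P: "P \<in> Wge"
  shows "td T i \<cdot> z = Zr C P (tL T i) \<longleftrightarrow> (\<exists>s\<in>Hom C P (tG T (i - 1)). z = weight_complex_diff C T (i - 1) \<cdot> s)"
proof
  note [simp] = HomD[OF z] Wge_Ob[OF P]
  assume "td T i \<cdot> z = Zr C P (tL T i)"
  then obtain s where s: "s \<in> Hom C P (tL T (i - 1))" "z = tc T i \<cdot> s"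
    using tri_weak_kernel[OF tri_rotate[OF tower_tri(2)[of i]], of z P] by (auto simp: in_Hom)
  note [simp] = HomD[OF s(1)]
  \<comment> \<open>The triangle yields only a preimage \<open>s\<close> in
    \<open>tL T (i - 1)\<close>. The same orthogonality, one degree lower, moves it to
    \<open>tG T (i - 1)\<close>, so that \<open>z\<close> is a genuine boundary.\<close>
  have "neg C (ShA C (tp T (i - 1))) \<cdot> s = Zr C P (Sh C (tL T (i - 1 - 1)))"
    by (rule Wge_orth[OF P]) (auto simp: in_Hom)
  then obtain s' where "s' \<in> Hom C P (tG T (i - 1))" "s = td T (i - 1) \<cdot> s'"
    using tri_weak_kernel[OF tri_rotate[OF tri_rotate[OF tower_tri(2)[of "i - 1"]]], of s P]
      tri_weak_kernel[OF tri_rotate[OF tower_tri(2)[of "i - 1"]], of s P] by (auto simp: in_Hom)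
  then show "\<exists>s\<in>Hom C P (tG T (i - 1)). z = weight_complex_diff C T (i - 1) \<cdot> s"
    using s(2) by (intro bexI[of _ s']) (auto simp: weight_complex_diff_def Cmp_assoc in_Hom)
next
  assume "\<exists>s\<in>Hom C P (tG T (i - 1)). z = weight_complex_diff C T (i - 1) \<cdot> s"
  then obtain s where s: "s \<in> Hom C P (tG T (i - 1))" "z = weight_complex_diff C T (i - 1) \<cdot> s" by blast
  note [simp] = HomD[OF s(1)] Wge_Ob[OF P]
  have "td T i \<cdot> z = (td T i \<cdot> tc T i) \<cdot> (td T (i - 1) \<cdot> s)"
    unfolding s(2) weight_complex_diff_def by (simp add: Cmp_assoc)
  then show "td T i \<cdot> z = Zr C P (tL T i)" by (simp add: tower_zero)
qed

end

context weighted
begin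

text \<open>In each degree the octahedral axiom is applied to the factorization of
  \<open>ta T (k - 1)\<close> through the desuspended \<open>ta T k\<close>. It produces both
  triangles through X^k at once, together with the second identity recorded here, which is no part
  of \<open>weight_tower\<close> but is indispensable for extending endomorphisms.\<close>

lemma tower_exists:
  assumes X: "X \<in> Ob C"
  obtains T where "weight_tower C Wle Wge X T" "\<And>k. td T k \<cdot> ty T k = ta T k \<cdot> tb T (k - 1)"
proof -
  note [simp] = shift_add1[OF X]
  have "\<forall>k. \<exists>L R a f b. L \<in> Wle \<and> R \<in> Wge \<and> (a, f, b) \<in> Dist C \<and> a \<in> Hom C (shift C k X) L \<and>
     f \<in> Hom C L R \<and> b \<in> Hom C R (shift C (k + 1) X)"
  proof
    fix k
    obtain W L r a f where d: "negative W" "L \<in> Wle" "(r, a, f) \<in> Dist C"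
      "r \<in> Hom C W (shift C k X)" "a \<in> Hom C (shift C k X) L" "f \<in> Hom C L (Sh C W)"
      using decomposition[OF shift_add1(1)[OF X, of k]] .
    have "Sh C W \<in> Wge" using d(1) by (simp add: negative_def)
    then show "\<exists>L R a f b. L \<in> Wle \<and> R \<in> Wge \<and> (a, f, b) \<in> Dist C \<and> a \<in> Hom C (shift C k X) L \<and>
     f \<in> Hom C L R \<and> b \<in> Hom C R (shift C (k + 1) X)"
      using d tri_rotate[OF d(3)]
      by (intro exI[of _ L] exI[of _ "Sh C W"] exI[of _ a] exI[of _ f] exI[of _ "neg C (ShA C r)"]) (auto simp: in_Hom)
  qed
  then obtain L R a f b where LR: "\<And>k. L k \<in> Wle" "\<And>k. R k \<in> Wge"
    and afb: "\<And>k. (a k, f k, b k) \<in> Dist C"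
    and a: "\<And>k. a k \<in> Hom C (shift C k X) (L k)" and f: "\<And>k. f k \<in> Hom C (L k) (R k)"
    and b: "\<And>k. b k \<in> Hom C (R k) (shift C (k + 1) X)"
    by metis
  note [simp] = LR LR(1)[THEN Wle_Ob] LR(2)[THEN Wge_Ob] HomD[OF a] HomD[OF f] HomD[OF b]
  define \<Phi> where "\<Phi> = (\<lambda>k (p, q, c, d, y, G). p \<in> Hom C (unSh C (L k)) (L (k - 1)) \<and> q \<in> Hom C (unSh C (R k)) (R (k - 1)) \<and>
      G \<in> Wge \<and> G \<in> Wle \<and> c \<in> Hom C (L (k - 1)) G \<and> d \<in> Hom C G (L k) \<and> y \<in> Hom C (R (k - 1)) G \<and>
      p \<cdot> unShA C (a k) = a (k - 1) \<and> q \<cdot> unShA C (f k) = f (k - 1) \<cdot> p \<and> b (k - 1) \<cdot> q = neg C (unShA C (b k)) \<and>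
      (p, c, d) \<in> Dist C \<and> (q, y, f k \<cdot> d) \<in> Dist C \<and> c = y \<cdot> f (k - 1) \<and> d \<cdot> y = a k \<cdot> b (k - 1))"
  have "\<forall>k. \<exists>s. \<Phi> k s"
  proof
    fix k
    have ush: "(unShA C (a k), unShA C (f k), neg C (unShA C (b k))) \<in> Dist C" by (rule tri_unShift[OF afb])
    have n: "negative (unSh C (unSh C (R k)))" using negative_unSh negative_Wge LR(2) by blast
    \<comment> \<open>The obstruction to factoring \<open>a (k - 1)\<close> through a[-1] is a map
      from a twice desuspended object of \<open>Wge\<close> to \<open>L (k - 1)\<close>.\<close>
    have "a (k - 1) \<cdot> neg C (unShA C (neg C (unShA C (b k)))) = Zr C (unSh C (unSh C (R k))) (L (k - 1))"
      by (rule negative_orth[OF n]) (auto simp: in_Hom)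
    then obtain p where p: "p \<in> Hom C (unSh C (L k)) (L (k - 1))" "a (k - 1) = p \<cdot> unShA C (a k)"
      using tri_weak_cokernel[OF tri_rotate_back[OF ush], of "a (k - 1)" "L (k - 1)"] by (auto simp: in_Hom)
    note [simp] = HomD[OF p(1)]
    obtain c d where pcd: "(p, c, d) \<in> Dist C" using tri_exists[of p] by auto
    define G where "G = Cod C c"
    have [simp]: "c \<in> Ar C" "d \<in> Ar C" "Dom C c = L (k - 1)" "Cod C c = G" "Dom C d = G" "Cod C d = L k"
      using tri_simps[OF pcd] by (auto simp: G_def)
    have [simp]: "G \<in> Ob C" using Cod_Ob[of c] by simp
    have "(p \<cdot> unShA C (a k), f (k - 1), b (k - 1)) \<in> Dist C" using afb p(2) by metis
    then obtain q y where qy: "(q, y, ShA C (unShA C (f k)) \<cdot> d) \<in> Dist C" "q \<in> Hom C (unSh C (R k)) (R (k - 1))"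
       "y \<in> Hom C (R (k - 1)) G" "q \<cdot> unShA C (f k) = f (k - 1) \<cdot> p" "b (k - 1) \<cdot> q = neg C (unShA C (b k))"
       "y \<cdot> f (k - 1) = c" "d \<cdot> y = ShA C (unShA C (a k)) \<cdot> b (k - 1)"
      using octahedron[OF ush pcd, of "f (k - 1)" "b (k - 1)"] by auto
    note [simp] = HomD[OF qy(2)] HomD[OF qy(3)]
    \<comment> \<open>The two triangles exhibit \<open>G\<close> as an extension of
      \<open>L k\<close> by \<open>L (k - 1)\<close> and as an extension of \<open>R k\<close> by
      \<open>R (k - 1)\<close>, which places it in the heart.\<close>
    have Gle: "G \<in> Wle"
      using Wle_extension[OF tri_rotate[OF pcd]] by simp
    have Gge: "G \<in> Wge"
      using Wge_extension[OF tri_rotate[OF qy(1)]] by simp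
    have "\<Phi> k (p, q, c, d, y, G)"
      using p qy pcd Gle Gge by (simp add: \<Phi>_def in_Hom)
    then show "\<exists>s. \<Phi> k s" by blast
  qed
  then obtain s where s: "\<And>k. \<Phi> k (s k)" using choice by metis
  define p q c d y G where "p k = fst (s k)" and "q k = fst (snd (s k))" and "c k = fst (snd (snd (s k)))"
    and "d k = fst (snd (snd (snd (s k))))" and "y k = fst (snd (snd (snd (snd (s k)))))"
    and "G k = snd (snd (snd (snd (snd (s k)))))" for k
  then have "\<Phi> k (p k, q k, c k, d k, y k, G k)" for k using s by simp
  then have t: "\<And>k. p k \<in> Hom C (unSh C (L k)) (L (k - 1))" "\<And>k. q k \<in> Hom C (unSh C (R k)) (R (k - 1))"
      "\<And>k. G k \<in> Wge" "\<And>k. G k \<in> Wle" "\<And>k. c k \<in> Hom C (L (k - 1)) (G k)" "\<And>k. d k \<in> Hom C (G k) (L k)"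
      "\<And>k. y k \<in> Hom C (R (k - 1)) (G k)" "\<And>k. p k \<cdot> unShA C (a k) = a (k - 1)" "\<And>k. q k \<cdot> unShA C (f k) = f (k - 1) \<cdot> p k"
      "\<And>k. b (k - 1) \<cdot> q k = neg C (unShA C (b k))" "\<And>k. (p k, c k, d k) \<in> Dist C" "\<And>k. (q k, y k, f k \<cdot> d k) \<in> Dist C"
      "\<And>k. c k = y k \<cdot> f (k - 1)" "\<And>k. d k \<cdot> y k = a k \<cdot> b (k - 1)"
    unfolding \<Phi>_def prod.case by blast+
  \<comment> \<open>During the construction \<open>R k\<close> is the third vertex of the k-th
    decomposition, whereas the tower calls this object \<open>tR T (k + 1)\<close>; hence the shift
    of the index.\<close>
  define T where "T = \<lparr>tL = L, tR = \<lambda>k. R (k - 1), tG = G, ta = a, tf = f, tb = b, tp = p, tq = q, tc = c, td = d, ty = y\<rparr>"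
  have "weight_tower C Wle Wge X T"
    unfolding weight_tower_def T_def tower.select_convs add_diff_cancel_right' Int_iff
    by (intro allI conjI) (rule t a f b afb LR)+
  moreover have "td T k \<cdot> ty T k = ta T k \<cdot> tb T (k - 1)" for k using t(14) by (simp add: T_def)
  ultimately show ?thesis using that by blast
qed

end

section \<open>Extending an endomorphism to a weight Postnikov tower\<close>

context weight_postnikov
begin

text \<open>Both triangles through X^k give, by completion, an endomorphism of X^k, but a map
  compatible with the first need not be compatible with the second. The defect is killed on two
  sides, once by the octahedral identity \<open>oct\<close>, and therefore factors in such a way
  that changing the endomorphism of one adjacent weight decomposition absorbs it.\<close>

lemma tower_endo_exists:
  assumes oct: "\<And>k. td T k \<cdot> ty T k = ta T k \<cdot> tb T (k - 1)" and g: "g \<in> Hom C X X"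
  shows "\<exists>gL gR gG. tower_endo C T g gL gR gG"
proof -
  define \<gamma> where "\<gamma> k = shift_arr C k g" for k
  have \<gamma>: "\<gamma> k \<in> Hom C (shift C k X) (shift C k X)" for k using shift_arr_Hom[OF g] by (simp add: \<gamma>_def)
  have un\<gamma>: "unShA C (\<gamma> k) = \<gamma> (k - 1)" for k using shift_arr_diff1[OF g] by (simp add: \<gamma>_def)
  have sh: "shift C (k - 1 + 1) X = shift C k X" for k by simp
  have unsh [simp]: "unSh C (shift C k X) = shift C (k - 1) X" for k using shift_add1(3)[OF X] by simp
  note [simp] = HomD[OF \<gamma>]
  \<comment> \<open>A state in degree \<open>k\<close> is the pair (\<open>gL k\<close>,
    \<open>gR (k + 1)\<close>) acting on the k-th weight decomposition. \<open>St k\<close> asks for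
    a map on X^k that is compatible with the states in degrees \<open>k - 1\<close> and
    \<open>k\<close>.\<close>
  define V where "V k s \<longleftrightarrow> fst s \<in> Hom C (tL T k) (tL T k) \<and> snd s \<in> Hom C (tR T (k + 1)) (tR T (k + 1)) \<and>
    fst s \<cdot> ta T k = ta T k \<cdot> \<gamma> k \<and> snd s \<cdot> tf T k = tf T k \<cdot> fst s \<and> \<gamma> (k + 1) \<cdot> tb T k = tb T k \<cdot> snd s" for k s
  define St where "St k s' s \<longleftrightarrow> (\<exists>h\<in>Hom C (tG T k) (tG T k). h \<cdot> tc T k = tc T k \<cdot> fst s' \<and>
    fst s \<cdot> td T k = td T k \<cdot> h \<and> h \<cdot> ty T k = ty T k \<cdot> snd s')" for k and s' s :: "'b \<times> 'b"
  have ex: "\<exists>s. V k s" for k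
  proof -
    obtain l where l: "l \<in> Hom C (tL T k) (tL T k)" "l \<cdot> ta T k = ta T k \<cdot> \<gamma> k"
      using wdec_lift[of "ta T k" "tL T k" "ta T k \<cdot> \<gamma> k"] by (auto simp: in_Hom)
    have s: "ShA C (\<gamma> k) = \<gamma> (k + 1)" using shift_arr_add1[OF g] by (simp add: \<gamma>_def)
    obtain r where "r \<in> Hom C (tR T (k + 1)) (tR T (k + 1))" "r \<cdot> tf T k = tf T k \<cdot> l" "\<gamma> (k + 1) \<cdot> tb T k = tb T k \<cdot> r"
      using tri_complete[OF tower_tri(1)[of k] tower_tri(1)[of k], of "\<gamma> k" l] l \<gamma> s by auto
    then show ?thesis using l by (intro exI[of _ "(l, r)"]) (simp add: V_def)
  qed
  \<comment> \<open>Compatibility with \<open>tp\<close> and \<open>tq\<close> is automatic. Each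
    difference factors through a map from the desuspension of \<open>tR T (k + 1)\<close>, which is
    negative, to \<open>tL T (k - 1)\<close>, and such maps vanish.\<close>
  have pq: "fst s' \<cdot> tp T k = tp T k \<cdot> unShA C (fst s) \<and> snd s' \<cdot> tq T k = tq T k \<cdot> unShA C (snd s)"
    if s': "V (k - 1) s'" and s: "V k s" for k s' s
  proof
    have t: "fst s' \<in> Hom C (tL T (k - 1)) (tL T (k - 1))" "snd s' \<in> Hom C (tR T k) (tR T k)"
      "fst s \<in> Hom C (tL T k) (tL T k)" "snd s \<in> Hom C (tR T (k + 1)) (tR T (k + 1))"
      using s' s by (auto simp: V_def)
    note [simp] = HomD[OF t(1)] HomD[OF t(2)] HomD[OF t(3)] HomD[OF t(4)]
    have e: "fst s' \<cdot> ta T (k - 1) = ta T (k - 1) \<cdot> \<gamma> (k - 1)" "fst s \<cdot> ta T k = ta T k \<cdot> \<gamma> k"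
       "tb T (k - 1) \<cdot> snd s' = \<gamma> k \<cdot> tb T (k - 1)" "tb T k \<cdot> snd s = \<gamma> (k + 1) \<cdot> tb T k"
      using s s' by (auto simp: V_def)
    have neg: "negative (unSh C (tR T (k + 1)))" by (rule negative_unSh) simp
    define \<delta> where "\<delta> = diff (fst s' \<cdot> tp T k) (tp T k \<cdot> unShA C (fst s))"
    have [simp]: "\<delta> \<in> Ar C" "Dom C \<delta> = unSh C (tL T k)" "Cod C \<delta> = tL T (k - 1)" by (auto simp: \<delta>_def)
    have "(tp T k \<cdot> unShA C (fst s)) \<cdot> unShA C (ta T k) = tp T k \<cdot> unShA C (fst s \<cdot> ta T k)"
      by (simp add: Cmp_assoc unShA_Cmp)
    also have "\<dots> = tp T k \<cdot> (unShA C (ta T k) \<cdot> \<gamma> (k - 1))" unfolding e by (simp add: unShA_Cmp un\<gamma>)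
    also have "\<dots> = ta T (k - 1) \<cdot> \<gamma> (k - 1)" using Cmp_rewrite[OF tower_eqs(1)[of k]] by simp
    also have "\<dots> = (fst s' \<cdot> tp T k) \<cdot> unShA C (ta T k)" using e(1) tower_eqs(1)[of k] by (simp add: Cmp_assoc)
    finally have "\<delta> \<cdot> unShA C (ta T k) = Zr C (shift C (k - 1) X) (tL T (k - 1))"
      by (simp add: \<delta>_def diff_Cmp)
    then obtain z where z: "z \<in> Hom C (unSh C (tR T (k + 1))) (tL T (k - 1))" "\<delta> = z \<cdot> unShA C (tf T k)"
      using tri_weak_cokernel[OF tri_unShift[OF tower_tri(1)[of k]], of \<delta> "tL T (k - 1)"] by (auto simp: in_Hom)
    have "z = Zr C (unSh C (tR T (k + 1))) (tL T (k - 1))" using negative_orth[OF neg _ z(1)] by simp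
    then have "\<delta> = Zr C (unSh C (tL T k)) (tL T (k - 1))" using z(2) by simp
    then show "fst s' \<cdot> tp T k = tp T k \<cdot> unShA C (fst s)"
      unfolding \<delta>_def by (subst (asm) diff_zero_iff) auto
    define \<epsilon> where "\<epsilon> = diff (snd s' \<cdot> tq T k) (tq T k \<cdot> unShA C (snd s))"
    have [simp]: "\<epsilon> \<in> Ar C" "Dom C \<epsilon> = unSh C (tR T (k + 1))" "Cod C \<epsilon> = tR T k" by (auto simp: \<epsilon>_def)
    have "tb T (k - 1) \<cdot> (tq T k \<cdot> unShA C (snd s)) = neg C (unShA C (tb T k \<cdot> snd s))"
      using Cmp_rewrite[OF tower_eqs(2)[of k]] by (simp add: unShA_Cmp neg_Cmp)
    also have "\<dots> = \<gamma> k \<cdot> (tb T (k - 1) \<cdot> tq T k)"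
      unfolding e by (simp add: unShA_Cmp un\<gamma> tower_eqs(2) Cmp_neg)
    also have "\<dots> = tb T (k - 1) \<cdot> (snd s' \<cdot> tq T k)"
      using Cmp_rewrite[OF e(3)] by (simp add: Cmp_assoc)
    finally have "tb T (k - 1) \<cdot> \<epsilon> = Zr C (unSh C (tR T (k + 1))) (shift C k X)"
      by (simp add: \<epsilon>_def Cmp_diff)
    then obtain z where z: "z \<in> Hom C (unSh C (tR T (k + 1))) (tL T (k - 1))" "\<epsilon> = tf T (k - 1) \<cdot> z"
      using tri_weak_kernel[OF tri_rotate[OF tower_tri(1)[of "k - 1"]], of \<epsilon> "unSh C (tR T (k + 1))"] by (auto simp: in_Hom)
    have "z = Zr C (unSh C (tR T (k + 1))) (tL T (k - 1))" using negative_orth[OF neg _ z(1)] by simp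
    then have "\<epsilon> = Zr C (unSh C (tR T (k + 1))) (tR T k)" using z(2) by simp
    then show "snd s' \<cdot> tq T k = tq T k \<cdot> unShA C (snd s)"
      unfolding \<epsilon>_def by (subst (asm) diff_zero_iff) auto
  qed
  have down: "\<exists>s'. V (k - 1) s' \<and> St k s' s" if s: "V k s" for k s
  proof -
    obtain s0 where s0: "V (k - 1) s0" using ex by blast
    obtain l r where [simp]: "s = (l, r)" by (cases s)
    obtain l0 r0 where [simp]: "s0 = (l0, r0)" by (cases s0)
    have t: "l0 \<in> Hom C (tL T (k - 1)) (tL T (k - 1))" "r0 \<in> Hom C (tR T k) (tR T k)"
      "l \<in> Hom C (tL T k) (tL T k)" "r \<in> Hom C (tR T (k + 1)) (tR T (k + 1))"
      using s0 s by (auto simp: V_def)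
    have e: "l0 \<cdot> ta T (k - 1) = ta T (k - 1) \<cdot> \<gamma> (k - 1)" "l \<cdot> ta T k = ta T k \<cdot> \<gamma> k"
       "tb T (k - 1) \<cdot> r0 = \<gamma> k \<cdot> tb T (k - 1)" "r0 \<cdot> tf T (k - 1) = tf T (k - 1) \<cdot> l0"
      using s s0 by (auto simp: V_def)
    note [simp] = HomD[OF t(1)] HomD[OF t(2)] HomD[OF t(3)] HomD[OF t(4)]
    obtain h where h: "h \<in> Hom C (tG T k) (tG T k)" "h \<cdot> tc T k = tc T k \<cdot> l0" "l \<cdot> td T k = td T k \<cdot> h"
      using tri_complete[OF tower_tri(2)[of k] tower_tri(2)[of k], of "unShA C l" l0] pq[OF s0 s] t by (auto simp: in_Hom)
    note [simp] = HomD[OF h(1)]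
    \<comment> \<open>The completion \<open>h\<close> respects \<open>tc\<close> and
      \<open>td\<close>; this is its defect with respect to \<open>ty\<close>. It vanishes after
      precomposition with \<open>tf T (k - 1)\<close>, and by \<open>oct\<close> also after
      postcomposition with \<open>td T k\<close>, so it lifts through \<open>tc T k\<close>.\<close>
    define \<delta> where "\<delta> = diff (h \<cdot> ty T k) (ty T k \<cdot> r0)"
    have [simp]: "\<delta> \<in> Ar C" "Dom C \<delta> = tR T k" "Cod C \<delta> = tG T k" by (auto simp: \<delta>_def)
    have "(ty T k \<cdot> r0) \<cdot> tf T (k - 1) = tc T k \<cdot> l0" by (simp add: Cmp_assoc e(4) tower_eqs(3))
    then have \<delta>f: "\<delta> \<cdot> tf T (k - 1) = Zr C (tL T (k - 1)) (tG T k)"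
      using h(2) by (simp add: \<delta>_def diff_Cmp Cmp_assoc flip: tower_eqs(3))
    have "td T k \<cdot> (h \<cdot> ty T k) = l \<cdot> (td T k \<cdot> ty T k)" using h(3) by (simp flip: Cmp_assoc)
    also have "\<dots> = ta T k \<cdot> (\<gamma> k \<cdot> tb T (k - 1))" unfolding oct by (simp add: e(2) Cmp_assoc flip: Cmp_assoc[of _ _ l])
    also have "\<dots> = (td T k \<cdot> ty T k) \<cdot> r0" unfolding oct by (simp add: Cmp_assoc e(3))
    finally have "td T k \<cdot> \<delta> = Zr C (tR T k) (tL T k)" by (simp add: \<delta>_def Cmp_diff Cmp_assoc)
    then obtain \<rho> where \<rho>: "\<rho> \<in> Hom C (tR T k) (tL T (k - 1))" "\<delta> = tc T k \<cdot> \<rho>"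
      using tri_weak_kernel[OF tri_rotate[OF tower_tri(2)[of k]], of \<delta> "tR T k"] by (auto simp: in_Hom)
    note [simp] = HomD[OF \<rho>(1)]
    \<comment> \<open>Adding the homotopy-like terms built from \<rho> changes neither the relations
      with \<open>ta\<close> and \<open>tb\<close>, since consecutive maps of the decomposition
      compose to zero, nor the one with \<open>tc\<close>, since \<delta> dies on
      \<open>tf T (k - 1)\<close>. It changes \<open>ty T k \<cdot> r0\<close> by exactly
      \<delta>.\<close>
    define l' where "l' = Add C l0 (\<rho> \<cdot> tf T (k - 1))"
    define r' where "r' = Add C r0 (tf T (k - 1) \<cdot> \<rho>)"
    have [simp]: "l' \<in> Ar C" "Dom C l' = tL T (k - 1)" "Cod C l' = tL T (k - 1)"
      "r' \<in> Ar C" "Dom C r' = tR T k" "Cod C r' = tR T k" by (auto simp: l'_def r'_def)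
    have "l' \<cdot> ta T (k - 1) = ta T (k - 1) \<cdot> \<gamma> (k - 1)"
      using tower_zero(1)[of "k - 1"] by (simp add: l'_def Add_Cmp Cmp_assoc e(1))
    moreover have "r' \<cdot> tf T (k - 1) = tf T (k - 1) \<cdot> l'"
      by (simp add: l'_def r'_def Add_Cmp Cmp_Add Cmp_assoc e(4))
    moreover have "\<gamma> k \<cdot> tb T (k - 1) = tb T (k - 1) \<cdot> r'"
      using Cmp_rewrite[OF tower_zero(2)[of "k - 1"]] by (simp add: r'_def Cmp_Add e(3))
    ultimately have V': "V (k - 1) (l', r')" by (simp add: V_def in_Hom)
    have "ty T k \<cdot> (tf T (k - 1) \<cdot> \<rho>) = \<delta>" unfolding \<rho>(2) tower_eqs(3) by (simp add: Cmp_assoc)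
    then have "ty T k \<cdot> r' = Add C (ty T k \<cdot> r0) \<delta>" by (simp add: r'_def Cmp_Add)
    then have "h \<cdot> ty T k = ty T k \<cdot> r'"
      using diff_eq_iff[of "h \<cdot> ty T k" "ty T k \<cdot> r0" \<delta>] by (simp add: \<delta>_def)
    moreover have "tc T k \<cdot> (\<rho> \<cdot> tf T (k - 1)) = \<delta> \<cdot> tf T (k - 1)" unfolding \<rho>(2) by (simp add: Cmp_assoc)
    then have "h \<cdot> tc T k = tc T k \<cdot> l'" unfolding \<delta>f by (simp add: l'_def Cmp_Add h(2))
    ultimately have "St k (l', r') s" using h by (auto simp: St_def)
    then show ?thesis using V' by blast
  qed
  have up: "\<exists>s. V k s \<and> St k s' s" if s': "V (k - 1) s'" for k s'
  proof -
    obtain s0 where s0: "V k s0" using ex by blast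
    obtain l' r' where [simp]: "s' = (l', r')" by (cases s')
    obtain l0 r0 where [simp]: "s0 = (l0, r0)" by (cases s0)
    have t: "l' \<in> Hom C (tL T (k - 1)) (tL T (k - 1))" "r' \<in> Hom C (tR T k) (tR T k)"
      "l0 \<in> Hom C (tL T k) (tL T k)" "r0 \<in> Hom C (tR T (k + 1)) (tR T (k + 1))"
      using s0 s' by (auto simp: V_def)
    have e: "l0 \<cdot> ta T k = ta T k \<cdot> \<gamma> k" "tb T (k - 1) \<cdot> r' = \<gamma> k \<cdot> tb T (k - 1)"
       "r' \<cdot> tf T (k - 1) = tf T (k - 1) \<cdot> l'" "r0 \<cdot> tf T k = tf T k \<cdot> l0" "tb T k \<cdot> r0 = \<gamma> (k + 1) \<cdot> tb T k"
      using s' s0 by (auto simp: V_def)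
    note [simp] = HomD[OF t(1)] HomD[OF t(2)] HomD[OF t(3)] HomD[OF t(4)]
    obtain h where h: "h \<in> Hom C (tG T k) (tG T k)" "h \<cdot> ty T k = ty T k \<cdot> r'"
      "r0 \<cdot> (tf T k \<cdot> td T k) = (tf T k \<cdot> td T k) \<cdot> h"
      using tri_complete[OF tower_tri(3)[of k] tower_tri(3)[of k], of "unShA C r0" r'] pq[OF s' s0] t by (auto simp: in_Hom)
    note [simp] = HomD[OF h(1)]
    have hc: "h \<cdot> tc T k = tc T k \<cdot> l'"
      using h(2) e(3) Cmp_rewrite[OF h(2)] by (simp add: tower_eqs(3) Cmp_assoc)
    \<comment> \<open>Going up, the completion is taken in the other triangle, so \<open>ty\<close>
      and the composite of \<open>td\<close> and \<open>tf\<close> are respected, and the defect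
      concerns \<open>td\<close> alone. By \<open>oct\<close> it vanishes on \<open>ty T k\<close>;
      hence it factors through \<open>tf T k \<cdot> td T k\<close>.\<close>
    define \<delta> where "\<delta> = diff (l0 \<cdot> td T k) (td T k \<cdot> h)"
    have [simp]: "\<delta> \<in> Ar C" "Dom C \<delta> = tG T k" "Cod C \<delta> = tL T k" by (auto simp: \<delta>_def)
    have "tf T k \<cdot> (l0 \<cdot> td T k) = (tf T k \<cdot> td T k) \<cdot> h" using h(3) e(4) by (simp flip: Cmp_assoc)
    then have f\<delta>: "tf T k \<cdot> \<delta> = Zr C (tG T k) (tR T (k + 1))" by (simp add: \<delta>_def Cmp_diff Cmp_assoc)
    have "(l0 \<cdot> td T k) \<cdot> ty T k = l0 \<cdot> (td T k \<cdot> ty T k)" by (simp add: Cmp_assoc)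
    also have "\<dots> = ta T k \<cdot> (\<gamma> k \<cdot> tb T (k - 1))" unfolding oct by (simp add: e(1) Cmp_assoc flip: Cmp_assoc[of _ _ l0])
    also have "\<dots> = (td T k \<cdot> ty T k) \<cdot> r'" unfolding oct by (simp add: Cmp_assoc e(2))
    also have "\<dots> = (td T k \<cdot> h) \<cdot> ty T k" by (simp add: Cmp_assoc h(2))
    finally have "\<delta> \<cdot> ty T k = Zr C (tR T k) (tL T k)" by (simp add: \<delta>_def diff_Cmp)
    then obtain \<rho> where \<rho>: "\<rho> \<in> Hom C (tR T (k + 1)) (tL T k)" "\<delta> = \<rho> \<cdot> (tf T k \<cdot> td T k)"
      using tri_weak_cokernel[OF tri_rotate[OF tower_tri(3)[of k]], of \<delta> "tL T k"] by (auto simp: in_Hom)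
    note [simp] = HomD[OF \<rho>(1)]
    \<comment> \<open>Now the state in degree \<open>k\<close> is corrected, by subtraction, while
      \<open>s'\<close> stays fixed.\<close>
    define l where "l = diff l0 (\<rho> \<cdot> tf T k)"
    define r where "r = diff r0 (tf T k \<cdot> \<rho>)"
    have [simp]: "l \<in> Ar C" "Dom C l = tL T k" "Cod C l = tL T k"
      "r \<in> Ar C" "Dom C r = tR T (k + 1)" "Cod C r = tR T (k + 1)" by (auto simp: l_def r_def)
    have "l \<cdot> ta T k = ta T k \<cdot> \<gamma> k"
      using tower_zero(1)[of k] by (simp add: l_def diff_def Add_Cmp neg_Cmp Cmp_assoc e(1))
    moreover have "r \<cdot> tf T k = tf T k \<cdot> l"
      by (simp add: l_def r_def diff_Cmp Cmp_diff Cmp_assoc e(4))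
    moreover have "\<gamma> (k + 1) \<cdot> tb T k = tb T k \<cdot> r"
      using Cmp_rewrite[OF tower_zero(2)[of k]] by (simp add: r_def diff_def Cmp_neg Cmp_Add e(5))
    ultimately have V': "V k (l, r)" by (simp add: V_def in_Hom)
    have "l \<cdot> td T k = diff (l0 \<cdot> td T k) \<delta>" unfolding \<rho>(2) by (simp add: l_def diff_Cmp Cmp_assoc)
    also have "\<dots> = td T k \<cdot> h"
    proof -
      have "l0 \<cdot> td T k = Add C (td T k \<cdot> h) \<delta>"
        by (rule diff_eq_iff[THEN iffD1, OF _ _ _ _ _ _ _ \<delta>_def[symmetric]]) auto
      also have "\<dots> = Add C \<delta> (td T k \<cdot> h)" by (rule Add_commute) auto
      finally show ?thesis by (intro diff_eq_iff[THEN iffD2]) auto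
    qed
    finally have "St k s' (l, r)" unfolding St_def using h(1,2) hc by (intro bexI[of _ h]) simp_all
    then show ?thesis using V' by blast
  qed
  obtain s0 where "V 0 s0" using ex by blast
  then obtain \<sigma> where \<sigma>: "\<And>k. V k (\<sigma> k)" "\<And>k. St k (\<sigma> (k - 1)) (\<sigma> k)"
    using int_dependent_choice[of V s0 St] up down by blast
  from \<sigma>(2) obtain gG where gG: "\<And>k. gG k \<in> Hom C (tG T k) (tG T k)" "\<And>k. gG k \<cdot> tc T k = tc T k \<cdot> fst (\<sigma> (k - 1))"
    "\<And>k. fst (\<sigma> k) \<cdot> td T k = td T k \<cdot> gG k" "\<And>k. gG k \<cdot> ty T k = ty T k \<cdot> snd (\<sigma> (k - 1))"
    unfolding St_def Bex_def by metis
  have "tower_endo C T g (\<lambda>k. fst (\<sigma> k)) (\<lambda>k. snd (\<sigma> (k - 1))) gG"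
    unfolding tower_endo_def using gG pq[OF \<sigma>(1) \<sigma>(1)] \<sigma>(1)[unfolded V_def] \<sigma>(1)[of "_ - 1", unfolded V_def]
    by (simp add: \<gamma>_def)
  then show ?thesis by blast
qed

end

section \<open>Presheaves of abelian groups\<close>

text \<open>Natural transformations, without the extensionality that is required of the components of an arrow.\<close>

definition pmap :: "('o, 'm, 'z) catdata_scheme \<Rightarrow> ('o, 'm, 'u) presheaf \<Rightarrow> ('o \<Rightarrow> 'u \<Rightarrow> 'u) \<Rightarrow> ('o, 'm, 'u) presheaf \<Rightarrow> bool"
  where "pmap A F \<eta> G \<longleftrightarrow> is_presheaf A F \<and> is_presheaf A G \<and> (\<forall>X\<in>Ob A. \<eta> X \<in> hom (pob F X) (pob G X)) \<and>
    (\<forall>X Y. \<forall>f\<in>Hom A X Y. \<forall>x\<in>carrier (pob F Y). \<eta> X (par F f x) = par G f (\<eta> Y x))"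

text \<open>Normal form of an arrow: restricting the components makes them extensional, so that
  equality of arrows becomes equality of components on carriers (\<open>parr_eq_iff\<close>) and
  proofs can work with plain functions.\<close>

definition parr :: "('o, 'm, 'z) catdata_scheme \<Rightarrow> ('o, 'm, 'u) presheaf \<Rightarrow> ('o \<Rightarrow> 'u \<Rightarrow> 'u) \<Rightarrow> ('o, 'm, 'u) presheaf
    \<Rightarrow> ('o, 'm, 'u) nattrans"
  where "parr A F \<eta> G = (F, \<lambda>X\<in>Ob A. \<lambda>x\<in>carrier (pob F X). \<eta> X x, G)"

lemma presheaf_simps [simp]:
  assumes "is_presheaf A F"
  shows "X \<in> Ob A \<Longrightarrow> comm_group (pob F X)"
    and "f \<in> Hom A X Y \<Longrightarrow> par F f \<in> hom (pob F Y) (pob F X)"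
    and "X \<in> Ob A \<Longrightarrow> x \<in> carrier (pob F X) \<Longrightarrow> par F (Idn A X) x = x"
    and "f \<in> Hom A X Y \<Longrightarrow> g \<in> Hom A Y Z \<Longrightarrow> x \<in> carrier (pob F Z) \<Longrightarrow> par F (g \<cdot>\<^bsub>A\<^esub> f) x = par F f (par F g x)"
    and "f \<in> Hom A X Y \<Longrightarrow> g \<in> Hom A X Y \<Longrightarrow> x \<in> carrier (pob F Y)
      \<Longrightarrow> par F (Add A f g) x = par F f x \<otimes>\<^bsub>pob F X\<^esub> par F g x"
proof -
  note * = assms[unfolded is_presheaf_def]
  show "X \<in> Ob A \<Longrightarrow> comm_group (pob F X)" using *[THEN conjunct1] by blast
  show "f \<in> Hom A X Y \<Longrightarrow> par F f \<in> hom (pob F Y) (pob F X)" using *[THEN conjunct2, THEN conjunct1] by blast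
  show "X \<in> Ob A \<Longrightarrow> x \<in> carrier (pob F X) \<Longrightarrow> par F (Idn A X) x = x"
    using *[THEN conjunct2, THEN conjunct2, THEN conjunct1] by blast
  show "f \<in> Hom A X Y \<Longrightarrow> g \<in> Hom A Y Z \<Longrightarrow> x \<in> carrier (pob F Z) \<Longrightarrow> par F (g \<cdot>\<^bsub>A\<^esub> f) x = par F f (par F g x)"
    using *[THEN conjunct2, THEN conjunct2, THEN conjunct2, THEN conjunct1] by blast
  show "f \<in> Hom A X Y \<Longrightarrow> g \<in> Hom A X Y \<Longrightarrow> x \<in> carrier (pob F Y)
      \<Longrightarrow> par F (Add A f g) x = par F f x \<otimes>\<^bsub>pob F X\<^esub> par F g x"
    using *[THEN conjunct2, THEN conjunct2, THEN conjunct2, THEN conjunct2] by blast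
qed

lemma par_closed: "is_presheaf A F \<Longrightarrow> f \<in> Hom A X Y \<Longrightarrow> x \<in> carrier (pob F Y) \<Longrightarrow> par F f x \<in> carrier (pob F X)"
  by (rule hom_in_carrier[OF presheaf_simps(2)])

lemma pmapD:
  assumes "pmap A F \<eta> G"
  shows "is_presheaf A F" "is_presheaf A G"
    "X \<in> Ob A \<Longrightarrow> \<eta> X \<in> hom (pob F X) (pob G X)"
    "X \<in> Ob A \<Longrightarrow> x \<in> carrier (pob F X) \<Longrightarrow> \<eta> X x \<in> carrier (pob G X)"
    "f \<in> Hom A X Y \<Longrightarrow> x \<in> carrier (pob F Y) \<Longrightarrow> \<eta> X (par F f x) = par G f (\<eta> Y x)"
proof -
  show "is_presheaf A F" "is_presheaf A G" "X \<in> Ob A \<Longrightarrow> \<eta> X \<in> hom (pob F X) (pob G X)"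
    "f \<in> Hom A X Y \<Longrightarrow> x \<in> carrier (pob F Y) \<Longrightarrow> \<eta> X (par F f x) = par G f (\<eta> Y x)"
    using assms unfolding pmap_def by blast+
  then show "X \<in> Ob A \<Longrightarrow> x \<in> carrier (pob F X) \<Longrightarrow> \<eta> X x \<in> carrier (pob G X)"
    by (blast intro: hom_in_carrier)
qed

lemma pmap_group_hom:
  assumes "pmap A F \<eta> G" "X \<in> Ob A" shows "group_hom (pob F X) (pob G X) (\<eta> X)"
proof -
  interpret F: comm_group "pob F X" using presheaf_simps(1)[OF pmapD(1)[OF assms(1)] assms(2)] .
  interpret G: comm_group "pob G X" using presheaf_simps(1)[OF pmapD(2)[OF assms(1)] assms(2)] .
  show ?thesis using pmapD(3)[OF assms] by unfold_locales
qed

lemma pmap_one: "pmap A F \<eta> G \<Longrightarrow> X \<in> Ob A \<Longrightarrow> \<eta> X \<one>\<^bsub>pob F X\<^esub> = \<one>\<^bsub>pob G X\<^esub>"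
  by (rule group_hom.hom_one[OF pmap_group_hom])

lemma presheaf_one: "is_presheaf A F \<Longrightarrow> X \<in> Ob A \<Longrightarrow> \<one>\<^bsub>pob F X\<^esub> \<in> carrier (pob F X)"
  by (rule monoid.one_closed[OF group.is_monoid[OF comm_group.axioms(2)[OF presheaf_simps(1)]]])

lemma is_nattrans_parr:
  assumes "is_category A" "pmap A F \<eta> G" shows "is_nattrans A (parr A F \<eta> G)"
proof -
  have Ob: "X \<in> Ob A" "Y \<in> Ob A" if "f \<in> Hom A X Y" for f X Y
    using assms(1) that unfolding is_category_def in_Hom by auto
  have "(\<lambda>x\<in>carrier (pob F X). \<eta> X x) \<in> hom (pob F X) (pob G X)" if X: "X \<in> Ob A" for X
  proof -
    interpret group_hom "pob F X" "pob G X" "\<eta> X" by (rule pmap_group_hom[OF assms(2) X])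
    show ?thesis by (auto simp: hom_def)
  qed
  moreover have "\<eta> X (par F f x) = par G f (\<eta> Y x)" "par F f x \<in> carrier (pob F X)"
    if "f \<in> Hom A X Y" "x \<in> carrier (pob F Y)" for X Y f x
    using pmapD[OF assms(2)] par_closed that by auto
  ultimately show ?thesis
    using assms(2) Ob unfolding is_nattrans_def parr_def by (auto simp: pmapD)
qed

lemma nattrans_cases:
  assumes "is_category A" "is_nattrans A t"
  obtains F \<eta> G where "t = parr A F \<eta> G" "pmap A F \<eta> G"
proof -
  obtain F \<eta> G where t: "t = (F, \<eta>, G)" by (cases t)
  note n = assms(2)[unfolded t is_nattrans_def prod.case]
  have "pmap A F \<eta> G" using n unfolding pmap_def by blast
  moreover have "t = parr A F \<eta> G"
  proof -
    have "\<eta> = (\<lambda>X\<in>Ob A. \<lambda>x\<in>carrier (pob F X). \<eta> X x)"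
    proof
      fix X
      have 1: "\<eta> \<in> extensional (Ob A)" and 2: "X \<in> Ob A \<Longrightarrow> \<eta> X \<in> extensional (carrier (pob F X))"
        using n by blast+
      show "\<eta> X = (\<lambda>X\<in>Ob A. \<lambda>x\<in>carrier (pob F X). \<eta> X x) X"
      proof (cases "X \<in> Ob A")
        case True
        then show ?thesis using extensional_restrict[OF 2] by simp
      next
        case False
        then show ?thesis using extensional_arb[OF 1 False] by simp
      qed
    qed
    then show ?thesis unfolding t parr_def by simp
  qed
  ultimately show ?thesis using that by blast
qed

lemma presheaves_simps [simp]:
  "Ob (presheaves A) = {F. is_presheaf A F}" "Ar (presheaves A) = {t. is_nattrans A t}"
  "Dom (presheaves A) (parr A F \<eta> G) = F" "Cod (presheaves A) (parr A F \<eta> G) = G"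
  "Idn (presheaves A) F = parr A F (\<lambda>X x. x) F" "Zr (presheaves A) F G = parr A F (\<lambda>X x. \<one>\<^bsub>pob G X\<^esub>) G"
  by (auto simp: presheaves_def parr_def)

lemma parr_eq_iff:
  "parr A F \<eta> G = parr A F' \<theta> G' \<longleftrightarrow> F = F' \<and> G = G' \<and> (\<forall>X\<in>Ob A. \<forall>x\<in>carrier (pob F X). \<eta> X x = \<theta> X x)"
proof
  assume e: "parr A F \<eta> G = parr A F' \<theta> G'"
  then have FG: "F = F'" "G = G'" by (auto simp: parr_def)
  have "(\<lambda>X\<in>Ob A. \<lambda>x\<in>carrier (pob F X). \<eta> X x) = (\<lambda>X\<in>Ob A. \<lambda>x\<in>carrier (pob F' X). \<theta> X x)"
    using arg_cong[OF e, of "\<lambda>t. fst (snd t)"] by (simp only: parr_def fst_conv snd_conv)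
  note fe = this
  have "\<eta> X x = \<theta> X x" if "X \<in> Ob A" "x \<in> carrier (pob F X)" for X x
    using fun_cong[OF fun_cong[OF fe, of X], of x] that FG(1) by simp
  then show "F = F' \<and> G = G' \<and> (\<forall>X\<in>Ob A. \<forall>x\<in>carrier (pob F X). \<eta> X x = \<theta> X x)" using FG by blast
qed (auto simp: parr_def intro!: restrict_ext)

lemma parr_Cmp:
  "pmap A F \<eta> G \<Longrightarrow> parr A G \<theta> K \<cdot>\<^bsub>presheaves A\<^esub> parr A F \<eta> G = parr A F (\<lambda>X x. \<theta> X (\<eta> X x)) K"
  by (auto simp: presheaves_def parr_def pmapD(4) intro!: restrict_ext)

locale presheaf_category = preadd A for A :: "('o, 'm, 'z) catdata_scheme" (structure)
begin

lemma Hom_Ob: "f \<in> Hom A X Y \<Longrightarrow> X \<in> Ob A" "f \<in> Hom A X Y \<Longrightarrow> Y \<in> Ob A"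
  by (auto simp: in_Hom)

lemma pmap_comp:
  assumes "pmap A F \<eta> G" "pmap A G \<theta> K" shows "pmap A F (\<lambda>X x. \<theta> X (\<eta> X x)) K"
proof -
  have "(\<lambda>x. \<theta> X (\<eta> X x)) \<in> hom (pob F X) (pob K X)" if X: "X \<in> Ob A" for X
    using hom_compose[OF pmapD(3)[OF assms(1) X] pmapD(3)[OF assms(2) X]] by (simp add: comp_def)
  then show ?thesis using pmapD[OF assms(1)] pmapD[OF assms(2)] Hom_Ob unfolding pmap_def by simp
qed

lemma pmap_id: "is_presheaf A F \<Longrightarrow> pmap A F (\<lambda>X x. x) F"
  by (simp add: pmap_def hom_def)

lemma pmap_zero:
  assumes "is_presheaf A F" "is_presheaf A G" shows "pmap A F (\<lambda>X x. \<one>\<^bsub>pob G X\<^esub>) G"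
proof -
  have "par G f \<one>\<^bsub>pob G Y\<^esub> = \<one>\<^bsub>pob G X\<^esub>" if f: "f \<in> Hom A X Y" for f X Y
    using hom_one[OF presheaf_simps(2)[OF assms(2) f]] presheaf_simps(1)[OF assms(2)] Hom_Ob[OF f] comm_group.axioms(2)
    by blast
  moreover have "(\<lambda>x. \<one>\<^bsub>pob G X\<^esub>) \<in> hom (pob F X) (pob G X)" if "X \<in> Ob A" for X
    using comm_group.axioms(2)[OF presheaf_simps(1)[OF assms(2) that]] by (simp add: hom_def group.is_monoid monoid.one_closed)
  ultimately show ?thesis using assms by (simp add: pmap_def)
qed

lemma Hom_sub:
  assumes "S \<subseteq> {F. is_presheaf A F}"
  shows "t \<in> Hom (full_sub (presheaves A) S) F G \<longleftrightarrow> F \<in> S \<and> G \<in> S \<and> (\<exists>\<eta>. pmap A F \<eta> G \<and> t = parr A F \<eta> G)"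
proof
  assume "t \<in> Hom (full_sub (presheaves A) S) F G"
  then have t: "is_nattrans A t" "Dom (presheaves A) t = F" "Cod (presheaves A) t = G" "F \<in> S" "G \<in> S"
    by (auto simp: in_Hom)
  obtain F' \<eta> G' where "t = parr A F' \<eta> G'" "pmap A F' \<eta> G'"
    by (rule nattrans_cases[OF category t(1)])
  then show "F \<in> S \<and> G \<in> S \<and> (\<exists>\<eta>. pmap A F \<eta> G \<and> t = parr A F \<eta> G)"
    using t(2-5) by auto
qed (auto simp: in_Hom is_nattrans_parr[OF category])

lemma Ar_sub:
  assumes "S \<subseteq> {F. is_presheaf A F}"
  shows "t \<in> Ar (full_sub (presheaves A) S) \<longleftrightarrow> (\<exists>F\<in>S. \<exists>G\<in>S. \<exists>\<eta>. pmap A F \<eta> G \<and> t = parr A F \<eta> G)"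
proof
  assume "t \<in> Ar (full_sub (presheaves A) S)"
  then have "t \<in> Hom (full_sub (presheaves A) S) (Dom (full_sub (presheaves A) S) t) (Cod (full_sub (presheaves A) S) t)"
    unfolding in_Hom by blast
  then show "\<exists>F\<in>S. \<exists>G\<in>S. \<exists>\<eta>. pmap A F \<eta> G \<and> t = parr A F \<eta> G"
    unfolding Hom_sub[OF assms] by blast
next
  assume "\<exists>F\<in>S. \<exists>G\<in>S. \<exists>\<eta>. pmap A F \<eta> G \<and> t = parr A F \<eta> G"
  then obtain F G where "t \<in> Hom (full_sub (presheaves A) S) F G" using Hom_sub[OF assms] by blast
  then show "t \<in> Ar (full_sub (presheaves A) S)" by (rule HomD(1))
qed

text \<open>Kernels are computed pointwise. The set \<open>S\<close> is arbitrary because the lemma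
  serves twice: for all presheaves, where it yields closure properties of the hull, and for the hull
  itself.\<close>

lemma kernelI:
  assumes S: "S \<subseteq> {F. is_presheaf A F}" and FG: "F \<in> S" "G \<in> S" "K \<in> S"
    and v: "pmap A F v G" and k: "pmap A K k F"
    and inj: "\<And>X. X \<in> Ob A \<Longrightarrow> inj_on (k X) (carrier (pob K X))"
    and im: "\<And>X. X \<in> Ob A \<Longrightarrow> k X ` carrier (pob K X) = {x \<in> carrier (pob F X). v X x = \<one>\<^bsub>pob G X\<^esub>}"
  shows "is_kernel (full_sub (presheaves A) S) (parr A F v G) (parr A K k F)"
  unfolding is_kernel_def
proof (intro conjI ballI impI)
  let ?B = "full_sub (presheaves A) S"
  show "parr A F v G \<in> Ar ?B" "parr A K k F \<in> Ar ?B" using FG v k by (auto simp: is_nattrans_parr[OF category])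
  show "Cod ?B (parr A K k F) = Dom ?B (parr A F v G)" by simp
  show "parr A F v G \<cdot>\<^bsub>?B\<^esub> parr A K k F = Zr ?B (Dom ?B (parr A K k F)) (Cod ?B (parr A F v G))"
    using im by (auto simp: parr_Cmp[OF k] parr_eq_iff)
  fix t assume t: "t \<in> Ar ?B" and "Cod ?B t = Dom ?B (parr A F v G) \<and> parr A F v G \<cdot>\<^bsub>?B\<^esub> t = Zr ?B (Dom ?B t) (Cod ?B (parr A F v G))"
  then obtain H \<tau> where H: "H \<in> S" and \<tau>: "pmap A H \<tau> F" and te: "t = parr A H \<tau> F"
    and z: "\<And>X x. X \<in> Ob A \<Longrightarrow> x \<in> carrier (pob H X) \<Longrightarrow> v X (\<tau> X x) = \<one>\<^bsub>pob G X\<^esub>"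
    using t unfolding Ar_sub[OF S] by (auto simp: parr_Cmp parr_eq_iff)
  define s where "s X x = inv_into (carrier (pob K X)) (k X) (\<tau> X x)" for X x
  have s: "s X x \<in> carrier (pob K X)" "k X (s X x) = \<tau> X x" if "X \<in> Ob A" "x \<in> carrier (pob H X)" for X x
  proof -
    have "\<tau> X x \<in> k X ` carrier (pob K X)" using im[OF that(1)] z[OF that] pmapD(4)[OF \<tau> that] by auto
    then show "s X x \<in> carrier (pob K X)" "k X (s X x) = \<tau> X x"
      by (auto simp: s_def inv_into_into f_inv_into_f)
  qed
  have cancel: "a = b" if "X \<in> Ob A" "a \<in> carrier (pob K X)" "b \<in> carrier (pob K X)" "k X a = k X b" for X a b
    using inj[OF that(1)] that by (auto dest: inj_onD)
  have ps: "pmap A H s K" unfolding pmap_def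
  proof (intro conjI ballI allI)
    show "is_presheaf A H" "is_presheaf A K" using \<tau> k by (auto simp: pmapD)
    fix X assume X: "X \<in> Ob A"
    interpret K: group_hom "pob K X" "pob F X" "k X" by (rule pmap_group_hom[OF k X])
    interpret H: group_hom "pob H X" "pob F X" "\<tau> X" by (rule pmap_group_hom[OF \<tau> X])
    show "s X \<in> hom (pob H X) (pob K X)"
    proof (rule homI)
      fix x y assume "x \<in> carrier (pob H X)" "y \<in> carrier (pob H X)"
      then show "s X (x \<otimes>\<^bsub>pob H X\<^esub> y) = s X x \<otimes>\<^bsub>pob K X\<^esub> s X y"
        by (intro cancel[OF X, of "s X (x \<otimes>\<^bsub>pob H X\<^esub> y)"]) (auto simp: s X)
    qed (use s X in auto)
  next
    fix X Y f x assume f: "f \<in> Hom A X Y" and x: "x \<in> carrier (pob H Y)"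
    note o = Hom_Ob[OF f]
    have px: "par H f x \<in> carrier (pob H X)" using par_closed[OF pmapD(1)[OF \<tau>] f x] .
    have ps: "par K f (s Y x) \<in> carrier (pob K X)" using par_closed[OF pmapD(1)[OF k] f] s o x by auto
    have "k X (s X (par H f x)) = k X (par K f (s Y x))"
      using s[OF o(1) px] pmapD(5)[OF k f, of "s Y x"] pmapD(5)[OF \<tau> f x] s[OF o(2) x] by simp
    then show "s X (par H f x) = par K f (s Y x)" using cancel[OF o(1)] s[OF o(1) px] ps by blast
  qed
  show "\<exists>!s. s \<in> Hom ?B (Dom ?B t) (Dom ?B (parr A K k F)) \<and> parr A K k F \<cdot>\<^bsub>?B\<^esub> s = t"
  proof (rule ex1I[of _ "parr A H s K"])
    show "parr A H s K \<in> Hom ?B (Dom ?B t) (Dom ?B (parr A K k F)) \<and> parr A K k F \<cdot>\<^bsub>?B\<^esub> parr A H s K = t"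
      using ps H FG s by (auto simp: te Hom_sub[OF S] parr_Cmp parr_eq_iff)
    fix r assume "r \<in> Hom ?B (Dom ?B t) (Dom ?B (parr A K k F)) \<and> parr A K k F \<cdot>\<^bsub>?B\<^esub> r = t"
    then obtain \<rho> where r: "r = parr A H \<rho> K" "pmap A H \<rho> K" "parr A K k F \<cdot>\<^bsub>presheaves A\<^esub> r = t"
      by (auto simp: te Hom_sub[OF S])
    then have "k X (\<rho> X x) = \<tau> X x" if "X \<in> Ob A" "x \<in> carrier (pob H X)" for X x
      using that by (auto simp: te parr_Cmp parr_eq_iff)
    then show "r = parr A H s K"
      using s(2) cancel[OF _ pmapD(4)[OF r(2)] s(1)] by (simp add: r(1) parr_eq_iff)
  qed
qed

lemma cokernelI:
  assumes S: "S \<subseteq> {F. is_presheaf A F}" and FG: "F \<in> S" "G \<in> S" "Q \<in> S"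
    and u: "pmap A F u G" and c: "pmap A G c Q"
    and surj: "\<And>X. X \<in> Ob A \<Longrightarrow> c X ` carrier (pob G X) = carrier (pob Q X)"
    and ker: "\<And>X. X \<in> Ob A \<Longrightarrow> {x \<in> carrier (pob G X). c X x = \<one>\<^bsub>pob Q X\<^esub>} = u X ` carrier (pob F X)"
  shows "is_cokernel (full_sub (presheaves A) S) (parr A F u G) (parr A G c Q)"
  unfolding is_cokernel_def
proof (intro conjI ballI impI)
  let ?B = "full_sub (presheaves A) S"
  show "parr A F u G \<in> Ar ?B" "parr A G c Q \<in> Ar ?B" using FG u c by (auto simp: is_nattrans_parr[OF category])
  show "Dom ?B (parr A G c Q) = Cod ?B (parr A F u G)" by simp
  show "parr A G c Q \<cdot>\<^bsub>?B\<^esub> parr A F u G = Zr ?B (Dom ?B (parr A F u G)) (Cod ?B (parr A G c Q))"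
    using ker by (auto simp: parr_Cmp[OF u] parr_eq_iff)
  fix t assume t: "t \<in> Ar ?B" and "Dom ?B t = Cod ?B (parr A F u G) \<and> t \<cdot>\<^bsub>?B\<^esub> parr A F u G = Zr ?B (Dom ?B (parr A F u G)) (Cod ?B t)"
  then obtain H \<tau> where H: "H \<in> S" and \<tau>: "pmap A G \<tau> H" and te: "t = parr A G \<tau> H"
    and z: "\<And>X x. X \<in> Ob A \<Longrightarrow> x \<in> carrier (pob F X) \<Longrightarrow> \<tau> X (u X x) = \<one>\<^bsub>pob H X\<^esub>"
    using t unfolding Ar_sub[OF S] by (auto simp: parr_Cmp[OF u] parr_eq_iff)
  have wd: "\<tau> X x = \<tau> X y" if X: "X \<in> Ob A" and xy: "x \<in> carrier (pob G X)" "y \<in> carrier (pob G X)" "c X x = c X y" for X x y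
  proof -
    interpret c: group_hom "pob G X" "pob Q X" "c X" by (rule pmap_group_hom[OF c X])
    interpret t: group_hom "pob G X" "pob H X" "\<tau> X" by (rule pmap_group_hom[OF \<tau> X])
    have "c X (x \<otimes>\<^bsub>pob G X\<^esub> inv\<^bsub>pob G X\<^esub> y) = \<one>\<^bsub>pob Q X\<^esub>" using xy by simp
    then have "x \<otimes>\<^bsub>pob G X\<^esub> inv\<^bsub>pob G X\<^esub> y \<in> u X ` carrier (pob F X)" using ker[OF X] xy by auto
    then have "\<tau> X (x \<otimes>\<^bsub>pob G X\<^esub> inv\<^bsub>pob G X\<^esub> y) = \<one>\<^bsub>pob H X\<^esub>" using z[OF X] by auto
    then have "\<tau> X x \<otimes>\<^bsub>pob H X\<^esub> inv\<^bsub>pob H X\<^esub> \<tau> X y = \<one>\<^bsub>pob H X\<^esub>" using xy by simp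
    then show ?thesis using xy t.H.inv_solve_right[of "\<one>\<^bsub>pob H X\<^esub>" "\<tau> X x" "\<tau> X y"] by auto
  qed
  define s where "s X y = \<tau> X (inv_into (carrier (pob G X)) (c X) y)" for X y
  have s: "s X (c X x) = \<tau> X x" if "X \<in> Ob A" "x \<in> carrier (pob G X)" for X x
    unfolding s_def using that by (intro wd) (auto simp: inv_into_into f_inv_into_f)
  have ps: "pmap A Q s H" unfolding pmap_def
  proof (intro conjI ballI allI)
    show "is_presheaf A Q" "is_presheaf A H" using \<tau> c by (auto simp: pmapD)
    fix X assume X: "X \<in> Ob A"
    interpret c: group_hom "pob G X" "pob Q X" "c X" by (rule pmap_group_hom[OF c X])
    interpret t: group_hom "pob G X" "pob H X" "\<tau> X" by (rule pmap_group_hom[OF \<tau> X])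
    show "s X \<in> hom (pob Q X) (pob H X)"
    proof (rule homI)
      fix x assume "x \<in> carrier (pob Q X)"
      then obtain x' where x': "x' \<in> carrier (pob G X)" "x = c X x'" using surj[OF X] by auto
      then show "s X x \<in> carrier (pob H X)" using s[OF X] by simp
      fix y assume "y \<in> carrier (pob Q X)"
      then obtain y' where y': "y' \<in> carrier (pob G X)" "y = c X y'" using surj[OF X] by auto
      have "x \<otimes>\<^bsub>pob Q X\<^esub> y = c X (x' \<otimes>\<^bsub>pob G X\<^esub> y')" using x' y' by simp
      then show "s X (x \<otimes>\<^bsub>pob Q X\<^esub> y) = s X x \<otimes>\<^bsub>pob H X\<^esub> s X y"
        using s[OF X] x' y' by (metis c.G.m_closed t.hom_mult)
    qed
  next
    fix X Y f y assume f: "f \<in> Hom A X Y" and y: "y \<in> carrier (pob Q Y)"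
    note o = Hom_Ob[OF f]
    obtain x where x: "x \<in> carrier (pob G Y)" "y = c Y x" using surj[OF o(2)] y by auto
    have "s X (par Q f y) = s X (c X (par G f x))" using pmapD(5)[OF c f x(1)] x(2) by simp
    also have "\<dots> = par H f (s Y y)"
      using s[OF o(1)] s[OF o(2) x(1)] par_closed[OF pmapD(1)[OF c] f x(1)] pmapD(5)[OF \<tau> f x(1)] x(2) by simp
    finally show "s X (par Q f y) = par H f (s Y y)" .
  qed
  show "\<exists>!s. s \<in> Hom ?B (Cod ?B (parr A G c Q)) (Cod ?B t) \<and> s \<cdot>\<^bsub>?B\<^esub> parr A G c Q = t"
  proof (rule ex1I[of _ "parr A Q s H"])
    show "parr A Q s H \<in> Hom ?B (Cod ?B (parr A G c Q)) (Cod ?B t) \<and> parr A Q s H \<cdot>\<^bsub>?B\<^esub> parr A G c Q = t"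
      using ps H FG s by (auto simp: te Hom_sub[OF S] parr_Cmp[OF c] parr_eq_iff)
    fix r assume "r \<in> Hom ?B (Cod ?B (parr A G c Q)) (Cod ?B t) \<and> r \<cdot>\<^bsub>?B\<^esub> parr A G c Q = t"
    then obtain \<rho> where r: "r = parr A Q \<rho> H" "pmap A Q \<rho> H" "r \<cdot>\<^bsub>presheaves A\<^esub> parr A G c Q = t"
      by (auto simp: te Hom_sub[OF S])
    then have \<rho>: "\<rho> X (c X x) = \<tau> X x" if "X \<in> Ob A" "x \<in> carrier (pob G X)" for X x
      using that by (auto simp: te parr_Cmp[OF c] parr_eq_iff)
    have "\<rho> X y = s X y" if X: "X \<in> Ob A" and y: "y \<in> carrier (pob Q X)" for X y
    proof -
      obtain x where "x \<in> carrier (pob G X)" "y = c X x" using y surj[OF X] by auto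
      then show ?thesis using X s \<rho> by simp
    qed
    then show "r = parr A Q s H" by (auto simp: r(1) parr_eq_iff)
  qed
qed

section \<open>Subpresheaves, kernels, images and quotients\<close>

definition subpresheaf :: "('o, 'm, 'u) presheaf \<Rightarrow> ('o \<Rightarrow> 'u set) \<Rightarrow> bool" where
  "subpresheaf F S \<longleftrightarrow> is_presheaf A F \<and> (\<forall>X\<in>Ob A. subgroup (S X) (pob F X)) \<and>
     (\<forall>X Y. \<forall>f\<in>Hom A X Y. \<forall>x\<in>S Y. par F f x \<in> S X)"

definition psub :: "('o, 'm, 'u) presheaf \<Rightarrow> ('o \<Rightarrow> 'u set) \<Rightarrow> ('o, 'm, 'u) presheaf" where
  "psub F S = F\<lparr>pob := (\<lambda>X. (pob F X)\<lparr>carrier := S X\<rparr>)\<rparr>"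

lemma psub_simps [simp]:
  "carrier (pob (psub F S) X) = S X" "one (pob (psub F S) X) = one (pob F X)"
  "monoid.mult (pob (psub F S) X) = monoid.mult (pob F X)" "par (psub F S) = par F"
  by (auto simp: psub_def)

lemma subpresheaf_subset: "subpresheaf F S \<Longrightarrow> X \<in> Ob A \<Longrightarrow> x \<in> S X \<Longrightarrow> x \<in> carrier (pob F X)"
  by (auto simp: subpresheaf_def intro: subgroup.mem_carrier)

lemma psub_presheaf:
  assumes S: "subpresheaf F S" shows "is_presheaf A (psub F S)"
proof -
  have F: "is_presheaf A F" and sg: "\<And>X. X \<in> Ob A \<Longrightarrow> subgroup (S X) (pob F X)"
    and cl: "\<And>X Y f x. f \<in> Hom A X Y \<Longrightarrow> x \<in> S Y \<Longrightarrow> par F f x \<in> S X"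
    using S unfolding subpresheaf_def by auto
  note sub = subpresheaf_subset[OF S]
  have g: "comm_group (pob (psub F S) X)" if X: "X \<in> Ob A" for X
  proof -
    interpret comm_group "pob F X" by (rule presheaf_simps(1)[OF F X])
    have e: "pob (psub F S) X = (pob F X)\<lparr>carrier := S X\<rparr>" by (simp add: psub_def)
    show ?thesis
      unfolding e using subgroup.subgroup_is_group[OF sg[OF X] is_group] subgroup.mem_carrier[OF sg[OF X]]
      by (intro group.group_comm_groupI) (auto intro: m_comm)
  qed
  have "par F f \<in> hom (pob (psub F S) Y) (pob (psub F S) X)" if f: "f \<in> Hom A X Y" for f X Y
    using hom_mult[OF presheaf_simps(2)[OF F f]] cl[OF f] sub[OF Hom_Ob(2)[OF f]] by (auto simp: hom_def)
  then show ?thesis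
    unfolding is_presheaf_def using g sub Hom_Ob F by simp
qed

lemma psub_incl: "subpresheaf F S \<Longrightarrow> pmap A (psub F S) (\<lambda>X x. x) F"
  using psub_presheaf[of F S] subpresheaf_subset[of F S] by (auto simp: pmap_def hom_def subpresheaf_def)

lemma pmap_psub_to:
  assumes "pmap A F \<eta> G" "subpresheaf G S" "\<And>X x. X \<in> Ob A \<Longrightarrow> x \<in> carrier (pob F X) \<Longrightarrow> \<eta> X x \<in> S X"
  shows "pmap A F \<eta> (psub G S)"
  using assms psub_presheaf[OF assms(2)] by (auto simp: pmap_def hom_def)

lemma pmap_psub_from:
  assumes "pmap A F \<eta> G" "subpresheaf F S" shows "pmap A (psub F S) \<eta> G"
  using pmap_comp[OF psub_incl[OF assms(2)] assms(1)] .

definition pker :: "('o, 'm, 'u) presheaf \<Rightarrow> ('o \<Rightarrow> 'u \<Rightarrow> 'u) \<Rightarrow> ('o, 'm, 'u) presheaf \<Rightarrow> 'o \<Rightarrow> 'u set" where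
  "pker F \<eta> G X = {x \<in> carrier (pob F X). \<eta> X x = \<one>\<^bsub>pob G X\<^esub>}"

definition pim :: "('o, 'm, 'u) presheaf \<Rightarrow> ('o \<Rightarrow> 'u \<Rightarrow> 'u) \<Rightarrow> 'o \<Rightarrow> 'u set" where
  "pim F \<eta> X = \<eta> X ` carrier (pob F X)"

lemma subpresheaf_pker:
  assumes "pmap A F \<eta> G" shows "subpresheaf F (pker F \<eta> G)"
proof -
  have "subgroup (pker F \<eta> G X) (pob F X)" if X: "X \<in> Ob A" for X
    using group_hom.subgroup_kernel[OF pmap_group_hom[OF assms X]] by (simp add: pker_def kernel_def)
  moreover have "par F f x \<in> pker F \<eta> G X" if f: "f \<in> Hom A X Y" and x: "x \<in> pker F \<eta> G Y" for X Y f x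
  proof -
    have "par G f \<one>\<^bsub>pob G Y\<^esub> = \<one>\<^bsub>pob G X\<^esub>"
      using pmapD(5)[OF pmap_zero[OF pmapD(1,2)[OF assms]] f] x by (auto simp: pker_def)
    then show ?thesis
      using x pmapD(5)[OF assms f] par_closed[OF pmapD(1)[OF assms] f] by (auto simp: pker_def)
  qed
  ultimately show ?thesis using pmapD(1)[OF assms] by (simp add: subpresheaf_def)
qed

lemma subpresheaf_pim:
  assumes "pmap A F \<eta> G" shows "subpresheaf G (pim F \<eta>)"
proof -
  have "subgroup (pim F \<eta> X) (pob G X)" if X: "X \<in> Ob A" for X
    using group_hom.img_is_subgroup[OF pmap_group_hom[OF assms X]] by (simp add: pim_def)
  moreover have "par G f x \<in> pim F \<eta> X" if f: "f \<in> Hom A X Y" and x: "x \<in> pim F \<eta> Y" for X Y f x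
  proof -
    obtain y where y: "y \<in> carrier (pob F Y)" "x = \<eta> Y y" using x by (auto simp: pim_def)
    then have "par G f x = \<eta> X (par F f y)" using pmapD(5)[OF assms f] by simp
    then show ?thesis using par_closed[OF pmapD(1)[OF assms] f y(1)] by (auto simp: pim_def)
  qed
  ultimately show ?thesis using pmapD(2)[OF assms] by (simp add: subpresheaf_def)
qed

text \<open>The quotient by a subpresheaf, realized on representatives of the cosets so that it lives in the same type.\<close>

definition rep :: "('o, 'm, 'u) presheaf \<Rightarrow> ('o \<Rightarrow> 'u set) \<Rightarrow> 'o \<Rightarrow> 'u \<Rightarrow> 'u" where
  "rep F S X x = (SOME y. y \<in> carrier (pob F X) \<and> S X #>\<^bsub>pob F X\<^esub> y = S X #>\<^bsub>pob F X\<^esub> x)"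

definition pquo :: "('o, 'm, 'u) presheaf \<Rightarrow> ('o \<Rightarrow> 'u set) \<Rightarrow> ('o, 'm, 'u) presheaf" where
  "pquo F S = \<lparr>pob = (\<lambda>X. \<lparr>carrier = rep F S X ` carrier (pob F X),
      monoid.mult = (\<lambda>a b. rep F S X (a \<otimes>\<^bsub>pob F X\<^esub> b)), one = rep F S X \<one>\<^bsub>pob F X\<^esub>\<rparr>),
    par = (\<lambda>f x. rep F S (Dom A f) (par F f x))\<rparr>"

lemma quotient:
  assumes S: "subpresheaf F S"
  shows pmap_rep: "pmap A F (rep F S) (pquo F S)"
    and rep_surj: "rep F S X ` carrier (pob F X) = carrier (pob (pquo F S) X)"
    and rep_ker: "X \<in> Ob A \<Longrightarrow> {x \<in> carrier (pob F X). rep F S X x = \<one>\<^bsub>pob (pquo F S) X\<^esub>} = S X"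
proof -
  have F: "is_presheaf A F" and sg: "\<And>X. X \<in> Ob A \<Longrightarrow> subgroup (S X) (pob F X)"
    and cl: "\<And>X Y f x. f \<in> Hom A X Y \<Longrightarrow> x \<in> S Y \<Longrightarrow> par F f x \<in> S X"
    using S unfolding subpresheaf_def by auto
  have rep: "rep F S X x \<in> carrier (pob F X)" "S X #>\<^bsub>pob F X\<^esub> rep F S X x = S X #>\<^bsub>pob F X\<^esub> x"
    if "x \<in> carrier (pob F X)" for X x
    using that someI[of "\<lambda>y. y \<in> carrier (pob F X) \<and> S X #>\<^bsub>pob F X\<^esub> y = S X #>\<^bsub>pob F X\<^esub> x" x] by (auto simp: rep_def)
  have rep_eq: "rep F S X x = rep F S X y \<longleftrightarrow> S X #>\<^bsub>pob F X\<^esub> x = S X #>\<^bsub>pob F X\<^esub> y"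
    if "x \<in> carrier (pob F X)" "y \<in> carrier (pob F X)" for X x y
  proof
    assume "rep F S X x = rep F S X y"
    then show "S X #>\<^bsub>pob F X\<^esub> x = S X #>\<^bsub>pob F X\<^esub> y" using rep(2)[OF that(1)] rep(2)[OF that(2)] by simp
  next
    assume "S X #>\<^bsub>pob F X\<^esub> x = S X #>\<^bsub>pob F X\<^esub> y"
    then show "rep F S X x = rep F S X y" by (simp add: rep_def)
  qed
  have mult: "rep F S X (rep F S X x \<otimes>\<^bsub>pob F X\<^esub> rep F S X y) = rep F S X (x \<otimes>\<^bsub>pob F X\<^esub> y)"
    if X: "X \<in> Ob A" and xy: "x \<in> carrier (pob F X)" "y \<in> carrier (pob F X)" for X x y
  proof -
    interpret comm_group "pob F X" by (rule presheaf_simps(1)[OF F X])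
    have N: "S X \<lhd> pob F X" using sg[OF X] normal_iff_subgroup by blast
    have "S X #>\<^bsub>pob F X\<^esub> (rep F S X x \<otimes>\<^bsub>pob F X\<^esub> rep F S X y)
        = (S X #>\<^bsub>pob F X\<^esub> rep F S X x) <#>\<^bsub>pob F X\<^esub> (S X #>\<^bsub>pob F X\<^esub> rep F S X y)"
      using normal.rcos_sum[OF N rep(1)[OF xy(1)] rep(1)[OF xy(2)]] by simp
    also have "\<dots> = S X #>\<^bsub>pob F X\<^esub> (x \<otimes>\<^bsub>pob F X\<^esub> y)"
      unfolding rep(2)[OF xy(1)] rep(2)[OF xy(2)] by (rule normal.rcos_sum[OF N xy])
    finally show ?thesis
      using rep(1)[OF xy(1)] rep(1)[OF xy(2)] xy by (simp add: rep_eq)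
  qed
  have group: "comm_group (pob (pquo F S) X)" if X: "X \<in> Ob A" for X
  proof -
    interpret comm_group "pob F X" by (rule presheaf_simps(1)[OF F X])
    \<comment> \<open>The target is no group and its unit is irrelevant: the image of a commutative
      group under a multiplicative map is a commutative group whose unit is the image of the unit,
      and that structure is \<open>pob (pquo F S) X\<close>.\<close>
    have "rep F S X \<in> hom (pob F X) \<lparr>carrier = UNIV, monoid.mult = (\<lambda>a b. rep F S X (a \<otimes>\<^bsub>pob F X\<^esub> b)), one = undefined\<rparr>"
      using mult[OF X] by (auto simp: hom_def)
    from hom_imp_img_comm_group[OF this] show ?thesis by (simp add: pquo_def)
  qed
  have rep_hom: "rep F S X \<in> hom (pob F X) (pob (pquo F S) X)" if X: "X \<in> Ob A" for X
    using mult[OF X] by (auto simp: hom_def pquo_def)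
  have nat: "rep F S X (par F f (rep F S Y x)) = rep F S X (par F f x)"
    if f: "f \<in> Hom A X Y" and x: "x \<in> carrier (pob F Y)" for f X Y x
  proof -
    interpret Y: comm_group "pob F Y" by (rule presheaf_simps(1)[OF F Hom_Ob(2)[OF f]])
    interpret X: comm_group "pob F X" by (rule presheaf_simps(1)[OF F Hom_Ob(1)[OF f]])
    note r = rep[OF x]
    have "rep F S Y x \<in> S Y #>\<^bsub>pob F Y\<^esub> x"
      using Y.rcos_self[OF r(1) sg[OF Hom_Ob(2)[OF f]]] r(2) by simp
    then obtain s where s: "s \<in> S Y" "rep F S Y x = s \<otimes>\<^bsub>pob F Y\<^esub> x" by (auto simp: r_coset_def)
    have sc: "s \<in> carrier (pob F Y)" using subpresheaf_subset[OF S Hom_Ob(2)[OF f] s(1)] .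
    have "par F f (rep F S Y x) = par F f s \<otimes>\<^bsub>pob F X\<^esub> par F f x"
      unfolding s(2) using hom_mult[OF presheaf_simps(2)[OF F f] sc x] .
    then have "par F f (rep F S Y x) \<in> S X #>\<^bsub>pob F X\<^esub> par F f x"
      using cl[OF f s(1)] by (auto simp: r_coset_def)
    then have "S X #>\<^bsub>pob F X\<^esub> par F f x = S X #>\<^bsub>pob F X\<^esub> par F f (rep F S Y x)"
      by (rule X.repr_independence[OF _ par_closed[OF F f x] sg[OF Hom_Ob(1)[OF f]]])
    then show ?thesis using rep_eq[OF par_closed[OF F f r(1)] par_closed[OF F f x]] by simp
  qed
  have pq: "is_presheaf A (pquo F S)" unfolding is_presheaf_def
  proof (intro conjI ballI allI)
    fix X Y f assume f: "f \<in> Hom A X Y"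
    note o = Hom_Ob[OF f]
    have D: "Dom A f = X" using f by (simp add: in_Hom)
    show "par (pquo F S) f \<in> hom (pob (pquo F S) Y) (pob (pquo F S) X)"
    proof (rule homI)
      fix x y assume "x \<in> carrier (pob (pquo F S) Y)" "y \<in> carrier (pob (pquo F S) Y)"
      then have x: "x \<in> carrier (pob F Y)" and y: "y \<in> carrier (pob F Y)" using rep(1) by (auto simp: pquo_def)
      interpret Y: comm_group "pob F Y" by (rule presheaf_simps(1)[OF F o(2)])
      have "rep F S X (par F f (x \<otimes>\<^bsub>pob F Y\<^esub> y)) = rep F S X (rep F S X (par F f x) \<otimes>\<^bsub>pob F X\<^esub> rep F S X (par F f y))"
        using mult[OF o(1) par_closed[OF F f x] par_closed[OF F f y]] hom_mult[OF presheaf_simps(2)[OF F f] x y] by simp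
      then show "par (pquo F S) f (x \<otimes>\<^bsub>pob (pquo F S) Y\<^esub> y) = par (pquo F S) f x \<otimes>\<^bsub>pob (pquo F S) X\<^esub> par (pquo F S) f y"
        using nat[OF f, of "x \<otimes>\<^bsub>pob F Y\<^esub> y"] x y by (simp add: pquo_def D)
    qed (use rep(1) par_closed[OF F f] in \<open>auto simp: pquo_def D\<close>)
  next
    fix X x assume X: "X \<in> Ob A" and "x \<in> carrier (pob (pquo F S) X)"
    then obtain x' where "x' \<in> carrier (pob F X)" "x = rep F S X x'" by (auto simp: pquo_def)
    then show "par (pquo F S) (Idn A X) x = x"
      using rep(1)[of x' X] rep_eq[of "rep F S X x'" X x'] rep(2)[of x' X] X F by (simp add: pquo_def)
  next
    fix X Y Z f g x assume f: "f \<in> Hom A X Y" and g: "g \<in> Hom A Y Z" and "x \<in> carrier (pob (pquo F S) Z)"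
    then have x: "x \<in> carrier (pob F Z)" using rep(1) by (auto simp: pquo_def)
    have D: "Dom A f = X" "Dom A g = Y" "Dom A (g \<cdot> f) = X" using f g by (auto simp: in_Hom)
    show "par (pquo F S) (g \<cdot> f) x = par (pquo F S) f (par (pquo F S) g x)"
      using nat[OF f par_closed[OF F g x]] presheaf_simps(4)[OF F f g x] by (simp add: pquo_def D)
  next
    fix X Y f g x assume f: "f \<in> Hom A X Y" and g: "g \<in> Hom A X Y" and "x \<in> carrier (pob (pquo F S) Y)"
    then have x: "x \<in> carrier (pob F Y)" using rep(1) by (auto simp: pquo_def)
    have D: "Dom A f = X" "Dom A g = X" "Dom A (Add A f g) = X" using f g by (auto simp: in_Hom)
    show "par (pquo F S) (Add A f g) x = par (pquo F S) f x \<otimes>\<^bsub>pob (pquo F S) X\<^esub> par (pquo F S) g x"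
      using mult[OF Hom_Ob(1)[OF f] par_closed[OF F f x] par_closed[OF F g x]] presheaf_simps(5)[OF F f g x]
      by (simp add: pquo_def D)
  qed (use group in auto)
  show "pmap A F (rep F S) (pquo F S)" unfolding pmap_def
    using F pq rep_hom nat by (auto simp: pquo_def in_Hom)
  show "rep F S X ` carrier (pob F X) = carrier (pob (pquo F S) X)" by (simp add: pquo_def)
  show "{x \<in> carrier (pob F X). rep F S X x = \<one>\<^bsub>pob (pquo F S) X\<^esub>} = S X" if X: "X \<in> Ob A"
  proof -
    interpret comm_group "pob F X" by (rule presheaf_simps(1)[OF F X])
    have "S X #>\<^bsub>pob F X\<^esub> x = S X #>\<^bsub>pob F X\<^esub> \<one>\<^bsub>pob F X\<^esub> \<longleftrightarrow> x \<in> S X" if "x \<in> carrier (pob F X)" for x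
      using coset_join1[OF _ that sg[OF X]] coset_join2[OF that sg[OF X]] subgroup.subset[OF sg[OF X]]
      by (auto simp: coset_mult_one)
    then show ?thesis
      using subpresheaf_subset[OF S X] by (auto simp: pquo_def rep_eq)
  qed
qed

end

section \<open>The abelian category generated by the representable presheaves\<close>

declare presheaf_simps [simp del]

text \<open>One construction covers the representable presheaves, where \<open>S P\<close> is the
  whole Hom-group, and the functor \<open>H\<close>, where \<open>S P\<close> is
  \<open>Hset\<close>. It is formed in the ambient category because for \<open>H\<close> the object
  \<open>L\<close> lies in \<open>Wle\<close> but not necessarily in the heart.\<close>

definition hsub :: "('m \<Rightarrow> 'u) \<Rightarrow> ('o, 'm, 'z) catdata_scheme \<Rightarrow> 'o \<Rightarrow> ('o \<Rightarrow> 'm set) \<Rightarrow> ('o, 'm, 'u) presheaf" where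
  "hsub j A L S =
     \<lparr>pob = (\<lambda>P. \<lparr>carrier = j ` S P,
                  monoid.mult = (\<lambda>u v. j (Add A (the_inv j u) (the_inv j v))),
                  one = j (Zr A P L)\<rparr>),
      par = (\<lambda>f u. j (the_inv j u \<cdot>\<^bsub>A\<^esub> f))\<rparr>"

lemma yoneda_hsub: "yoneda j A X = hsub j A X (\<lambda>Y. Hom A Y X)"
  by (simp add: yoneda_def hsub_def)

lemma hsub_simps [simp]:
  "carrier (pob (hsub j A L S) P) = j ` S P"
  "one (pob (hsub j A L S) P) = j (Zr A P L)"
  "inj j \<Longrightarrow> monoid.mult (pob (hsub j A L S) P) (j x) (j y) = j (Add A x y)"
  "inj j \<Longrightarrow> par (hsub j A L S) f (j x) = j (x \<cdot>\<^bsub>A\<^esub> f)"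
  by (auto simp: hsub_def the_inv_f_f)

lemma (in preadd) hsub_presheaf:
  assumes j: "inj j" and O: "O' \<subseteq> Ob A" and L: "L \<in> Ob A"
    and S: "\<And>P y. P \<in> O' \<Longrightarrow> y \<in> S P \<Longrightarrow> y \<in> Hom A P L"
    and S0: "\<And>P. P \<in> O' \<Longrightarrow> Zr A P L \<in> S P"
    and Sadd: "\<And>P x y. P \<in> O' \<Longrightarrow> x \<in> S P \<Longrightarrow> y \<in> S P \<Longrightarrow> Add A x y \<in> S P"
    and Sneg: "\<And>P x. P \<in> O' \<Longrightarrow> x \<in> S P \<Longrightarrow> neg A x \<in> S P"
    and Scmp: "\<And>P P' f x. P \<in> O' \<Longrightarrow> P' \<in> O' \<Longrightarrow> f \<in> Hom A P' P \<Longrightarrow> x \<in> S P \<Longrightarrow> x \<cdot> f \<in> S P'"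
  shows "is_presheaf (full_sub A O') (hsub j A L S)"
proof -
  have g: "comm_group (pob (hsub j A L S) P)" if P: "P \<in> O'" for P
  proof (rule comm_groupI)
    have t: "x \<in> Ar A" "Dom A x = P" "Cod A x = L" if "x \<in> S P" for x
      using S[OF P that] by (auto simp: in_Hom)
    fix x y z
    assume "x \<in> carrier (pob (hsub j A L S) P)" then obtain x' where x: "x = j x'" "x' \<in> S P" by auto
    have "neg A x' \<in> S P" "Add A (neg A x') x' = Zr A P L" using Sneg P x t[OF x(2)] by auto
    then show "\<exists>y\<in>carrier (pob (hsub j A L S) P). y \<otimes>\<^bsub>pob (hsub j A L S) P\<^esub> x = \<one>\<^bsub>pob (hsub j A L S) P\<^esub>"
      unfolding x(1) using j by (intro bexI[of _ "j (neg A x')"]) auto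
    show "\<one>\<^bsub>pob (hsub j A L S) P\<^esub> \<otimes>\<^bsub>pob (hsub j A L S) P\<^esub> x = x" using x t[OF x(2)] j by simp
    assume "y \<in> carrier (pob (hsub j A L S) P)" then obtain y' where y: "y = j y'" "y' \<in> S P" by auto
    show "x \<otimes>\<^bsub>pob (hsub j A L S) P\<^esub> y \<in> carrier (pob (hsub j A L S) P)" using x y Sadd[OF P] j by simp
    show "x \<otimes>\<^bsub>pob (hsub j A L S) P\<^esub> y = y \<otimes>\<^bsub>pob (hsub j A L S) P\<^esub> x"
      unfolding x(1) y(1) hsub_simps(3)[OF j] by (intro arg_cong[of _ _ j] Add_commute) (simp_all add: t[OF x(2)] t[OF y(2)])
    assume "z \<in> carrier (pob (hsub j A L S) P)" then obtain z' where z: "z = j z'" "z' \<in> S P" by auto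
    show "x \<otimes>\<^bsub>pob (hsub j A L S) P\<^esub> y \<otimes>\<^bsub>pob (hsub j A L S) P\<^esub> z = x \<otimes>\<^bsub>pob (hsub j A L S) P\<^esub> (y \<otimes>\<^bsub>pob (hsub j A L S) P\<^esub> z)"
      using x(1) y(1) z(1) t[OF x(2)] t[OF y(2)] t[OF z(2)] Add_assoc[of x' y' z'] j by simp
  qed (use S0[OF P] in auto)
  show ?thesis unfolding is_presheaf_def full_sub_simps
  proof (intro conjI ballI allI)
    fix X Y f assume f: "f \<in> Hom (full_sub A O') X Y"
    then have XY: "X \<in> O'" "Y \<in> O'" "f \<in> Hom A X Y" by (auto simp: in_Hom)
    note [simp] = HomD[OF XY(3)]
    show "par (hsub j A L S) f \<in> hom (pob (hsub j A L S) Y) (pob (hsub j A L S) X)"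
    proof (rule homI)
      fix x assume "x \<in> carrier (pob (hsub j A L S) Y)" then obtain x' where x: "x = j x'" "x' \<in> S Y" by auto
      show "par (hsub j A L S) f x \<in> carrier (pob (hsub j A L S) X)" using x Scmp[OF XY(2,1,3)] j by simp
      fix y assume "y \<in> carrier (pob (hsub j A L S) Y)" then obtain y' where y: "y = j y'" "y' \<in> S Y" by auto
      show "par (hsub j A L S) f (x \<otimes>\<^bsub>pob (hsub j A L S) Y\<^esub> y) = par (hsub j A L S) f x \<otimes>\<^bsub>pob (hsub j A L S) X\<^esub> par (hsub j A L S) f y"
        using x(1) y(1) HomD[OF S[OF XY(2) x(2)]] HomD[OF S[OF XY(2) y(2)]] j by (simp add: Add_Cmp)
    qed
  next
    fix X x assume X: "X \<in> O'" and "x \<in> carrier (pob (hsub j A L S) X)"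
    then obtain x' where x: "x = j x'" "x' \<in> S X" by auto
    show "par (hsub j A L S) (Idn A X) x = x" using x(1) HomD[OF S[OF X x(2)]] j by simp
  next
    fix X Y Z f g x assume f: "f \<in> Hom (full_sub A O') X Y" and g: "g \<in> Hom (full_sub A O') Y Z"
      and "x \<in> carrier (pob (hsub j A L S) Z)"
    then obtain x' where x: "x = j x'" "x' \<in> S Z" by auto
    have t: "Z \<in> O'" "f \<in> Hom A X Y" "g \<in> Hom A Y Z" using f g by (auto simp: in_Hom)
    show "par (hsub j A L S) (g \<cdot> f) x = par (hsub j A L S) f (par (hsub j A L S) g x)"
      using x(1) HomD[OF t(2)] HomD[OF t(3)] HomD[OF S[OF t(1) x(2)]] j by (simp add: Cmp_assoc)
  next
    fix X Y f g x assume f: "f \<in> Hom (full_sub A O') X Y" and g: "g \<in> Hom (full_sub A O') X Y"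
      and "x \<in> carrier (pob (hsub j A L S) Y)"
    then obtain x' where x: "x = j x'" "x' \<in> S Y" by auto
    have t: "Y \<in> O'" "f \<in> Hom A X Y" "g \<in> Hom A X Y" using f g by (auto simp: in_Hom)
    show "par (hsub j A L S) (Add A f g) x = par (hsub j A L S) f x \<otimes>\<^bsub>pob (hsub j A L S) X\<^esub> par (hsub j A L S) g x"
      using x(1) HomD[OF t(2)] HomD[OF t(3)] HomD[OF S[OF t(1) x(2)]] j by (simp add: Cmp_Add)
  qed (use g in auto)
qed

lemma add_triples_endos: "add_triples A \<subseteq> endos A \<times> endos A \<times> endos A"
  by (auto simp: add_triples_def sequence_endo_def endos_def in_Hom)

lemma ab_triples_endos: "ab_triples A \<subseteq> endos A \<times> endos A \<times> endos A"
  by (auto simp: ab_triples_def sequence_endo_def endos_def in_Hom)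

lemma tr_triples_endos: "tr_triples C \<subseteq> endos C \<times> endos C \<times> endos C"
  by (auto simp: tr_triples_def triangle_morphism_def endos_def in_Hom)

locale yoneda_category = presheaf_category A for A :: "('o, 'm, 'z) catdata_scheme" (structure) +
  fixes j :: "'m \<Rightarrow> 'u"
  assumes j: "inj j"
begin

abbreviation "B \<equiv> generated_abelian j A"
abbreviation "hull \<equiv> abelian_hull (presheaves A) (yoneda j A ` Ob A)"
abbreviation "y \<equiv> yoneda j A"

lemma y_simps [simp]:
  "carrier (pob (y X) P) = j ` Hom A P X" "one (pob (y X) P) = j (Zr A P X)"
  "monoid.mult (pob (y X) P) (j f) (j g) = j (Add A f g)" "par (y X) f (j g) = j (g \<cdot> f)"
  "the_inv j (j f) = f" "j f = j g \<longleftrightarrow> f = g"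
  using j by (auto simp: yoneda_hsub the_inv_f_f dest: injD)

lemma y_presheaf: assumes X: "X \<in> Ob A" shows "is_presheaf A (y X)"
proof -
  have "is_presheaf (full_sub A (Ob A)) (y X)"
    unfolding yoneda_hsub by (rule hsub_presheaf[OF j order_refl X]) (use X in auto)
  moreover have e: "Hom (full_sub A (Ob A)) X Y = Hom A X Y" for X Y by (auto simp: in_Hom)
  ultimately show ?thesis unfolding is_presheaf_def full_sub_simps e by blast
qed

lemma yoneda_arr_parr: "yoneda_arr j A g = parr A (y (Dom A g)) (\<lambda>Y u. j (g \<cdot> the_inv j u)) (y (Cod A g))"
  by (simp add: yoneda_arr_def parr_def)

lemma y_pmap:
  assumes g: "g \<in> Hom A X Y" shows "pmap A (y X) (\<lambda>P u. j (g \<cdot> the_inv j u)) (y Y)"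
  unfolding pmap_def
proof (intro conjI ballI allI)
  note [simp] = HomD[OF g]
  show "is_presheaf A (y X)" "is_presheaf A (y Y)" using Hom_Ob[OF g] y_presheaf by auto
  fix P assume P: "P \<in> Ob A"
  show "(\<lambda>u. j (g \<cdot> the_inv j u)) \<in> hom (pob (y X) P) (pob (y Y) P)"
    by (auto intro!: homI simp: in_Hom Cmp_Add)
next
  note [simp] = HomD[OF g]
  fix P P' f x assume f: "f \<in> Hom A P P'" and "x \<in> carrier (pob (y X) P')"
  then obtain x' where "x = j x'" "x' \<in> Hom A P' X" by auto
  then show "j (g \<cdot> the_inv j (par (y X) f x)) = par (y Y) f (j (g \<cdot> the_inv j x))"
    using f by (simp add: Cmp_assoc in_Hom)
qed

lemma hull_presheaf: assumes "F \<in> hull" shows "is_presheaf A F"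
  using assms
proof cases
  case base
  then show ?thesis using y_presheaf by auto
next
  case zero
  then show ?thesis by (simp add: zero_object_def)
next
  case (sum X Y i j p q)
  then show ?thesis by (simp add: is_biproduct_def)
next
  case (ker f k)
  obtain K \<kappa> G where "k = parr A K \<kappa> G" "pmap A K \<kappa> G"
    by (rule nattrans_cases[OF category, of k]) (use ker in \<open>auto simp: is_kernel_def\<close>)
  then show ?thesis using ker by (simp add: pmapD)
next
  case (coker f c)
  obtain G \<kappa> Q where "c = parr A G \<kappa> Q" "pmap A G \<kappa> Q"
    by (rule nattrans_cases[OF category, of c]) (use coker in \<open>auto simp: is_cokernel_def\<close>)
  then show ?thesis using coker by (simp add: pmapD)
qed

lemma hull_subset: "hull \<subseteq> {F. is_presheaf A F}"
  using hull_presheaf by blast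

lemma full_sub_presheaves: "full_sub (presheaves A) {F. is_presheaf A F} = presheaves A"
proof -
  have "{f. is_nattrans A f \<and> is_presheaf A (Dom (presheaves A) f) \<and> is_presheaf A (Cod (presheaves A) f)} = {f. is_nattrans A f}"
    by (auto simp: is_nattrans_def presheaves_def)
  then show ?thesis by (simp add: full_sub_def presheaves_def)
qed

lemma hull_kernel:
  assumes "F \<in> hull" "G \<in> hull" and v: "pmap A F v G" and k: "pmap A K k F"
    and inj: "\<And>X. X \<in> Ob A \<Longrightarrow> inj_on (k X) (carrier (pob K X))"
    and im: "\<And>X. X \<in> Ob A \<Longrightarrow> k X ` carrier (pob K X) = {x \<in> carrier (pob F X). v X x = \<one>\<^bsub>pob G X\<^esub>}"
  shows "K \<in> hull"
proof -
  have "is_kernel (presheaves A) (parr A F v G) (parr A K k F)"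
    by (rule kernelI[OF order_refl, unfolded full_sub_presheaves, OF _ _ _ v k inj im])
      (simp_all add: pmapD(1)[OF v] pmapD(2)[OF v] pmapD(1)[OF k])
  then show ?thesis using abelian_hull.ker[of "presheaves A" "parr A F v G" _ "parr A K k F"] assms(1,2) by simp
qed

lemma hull_cokernel:
  assumes "F \<in> hull" "G \<in> hull" and u: "pmap A F u G" and c: "pmap A G c Q"
    and surj: "\<And>X. X \<in> Ob A \<Longrightarrow> c X ` carrier (pob G X) = carrier (pob Q X)"
    and ker: "\<And>X. X \<in> Ob A \<Longrightarrow> {x \<in> carrier (pob G X). c X x = \<one>\<^bsub>pob Q X\<^esub>} = u X ` carrier (pob F X)"
  shows "Q \<in> hull"
proof -
  have "is_cokernel (presheaves A) (parr A F u G) (parr A G c Q)"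
    by (rule cokernelI[OF order_refl, unfolded full_sub_presheaves, OF _ _ _ u c surj ker])
      (simp_all add: pmapD(1)[OF u] pmapD(2)[OF u] pmapD(2)[OF c])
  then show ?thesis using abelian_hull.coker[of "presheaves A" "parr A F u G" _ "parr A G c Q"] assms(1,2) by simp
qed

lemma hull_pker:
  assumes "F \<in> hull" "G \<in> hull" "pmap A F v G" shows "psub F (pker F v G) \<in> hull"
  by (rule hull_kernel[OF assms psub_incl[OF subpresheaf_pker[OF assms(3)]]]) (auto simp: pker_def)

lemma hull_pquo:
  assumes "F \<in> hull" "G \<in> hull" "pmap A F u G" shows "pquo G (pim F u) \<in> hull"
  by (rule hull_cokernel[OF assms pmap_rep[OF subpresheaf_pim[OF assms(3)]]])
    (use quotient(2,3)[OF subpresheaf_pim[OF assms(3)]] in \<open>auto simp: pim_def\<close>)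

text \<open>An image is the kernel of the projection to the cokernel, so it is reached by one
  cokernel and one kernel.\<close>

lemma hull_pim:
  assumes "F \<in> hull" "G \<in> hull" "pmap A F u G" shows "psub G (pim F u) \<in> hull"
  by (rule hull_kernel[OF assms(2) hull_pquo[OF assms] pmap_rep[OF subpresheaf_pim[OF assms(3)]]
    psub_incl[OF subpresheaf_pim[OF assms(3)]]])
    (use quotient(3)[OF subpresheaf_pim[OF assms(3)]] in auto)

lemma B_simps:
  "Ob B = hull" "Dom B = Dom (presheaves A)" "Cod B = Cod (presheaves A)" "Cmp B = Cmp (presheaves A)"
  "Zr B = Zr (presheaves A)" "Idn B = Idn (presheaves A)"
  by (auto simp: generated_abelian_def)

lemma Hom_B: "t \<in> Hom B F G \<longleftrightarrow> F \<in> hull \<and> G \<in> hull \<and> (\<exists>\<eta>. pmap A F \<eta> G \<and> t = parr A F \<eta> G)"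
  unfolding generated_abelian_def by (rule Hom_sub[OF hull_subset])

lemma Ar_B: "t \<in> Ar B \<longleftrightarrow> (\<exists>F\<in>hull. \<exists>G\<in>hull. \<exists>\<eta>. pmap A F \<eta> G \<and> t = parr A F \<eta> G)"
  unfolding generated_abelian_def by (rule Ar_sub[OF hull_subset])

lemma endos_B: "t \<in> endos B \<longleftrightarrow> (\<exists>F\<in>hull. \<exists>\<eta>. pmap A F \<eta> F \<and> t = parr A F \<eta> F)"
proof
  assume "t \<in> endos B"
  then have "t \<in> Ar B" "Dom B t = Cod B t" by (auto simp: endos_def)
  then obtain F G \<eta> where "F \<in> hull" "pmap A F \<eta> G" "t = parr A F \<eta> G" "F = G" by (auto simp: Ar_B B_simps)
  then show "\<exists>F\<in>hull. \<exists>\<eta>. pmap A F \<eta> F \<and> t = parr A F \<eta> F" by blast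
next
  assume "\<exists>F\<in>hull. \<exists>\<eta>. pmap A F \<eta> F \<and> t = parr A F \<eta> F"
  then obtain F \<eta> where "F \<in> hull" "pmap A F \<eta> F" "t = parr A F \<eta> F" by blast
  moreover from this have "t \<in> Ar B" unfolding Ar_B by blast
  ultimately show "t \<in> endos B" by (simp add: endos_def B_simps)
qed

lemmas kernelI_B = kernelI[OF hull_subset, folded generated_abelian_def]
lemmas cokernelI_B = cokernelI[OF hull_subset, folded generated_abelian_def]

text \<open>The universal property is available only against presheaves in the hull, but the hull
  contains the pointwise kernels needed as tests. On the pointwise kernel of \<kappa>, inclusion and
  zero map agree after \<kappa>, whence injectivity; the pointwise kernel of \<open>v\<close>
  factors through \<kappa>, which gives the image.\<close>

lemma kernelD_B:
  assumes k: "is_kernel B (parr A F v G) k" and FG: "F \<in> hull" "G \<in> hull" and v: "pmap A F v G"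
  obtains K \<kappa> where "k = parr A K \<kappa> F" "K \<in> hull" "pmap A K \<kappa> F"
    "\<And>X. X \<in> Ob A \<Longrightarrow> inj_on (\<kappa> X) (carrier (pob K X))"
    "\<And>X. X \<in> Ob A \<Longrightarrow> \<kappa> X ` carrier (pob K X) = {x \<in> carrier (pob F X). v X x = \<one>\<^bsub>pob G X\<^esub>}"
proof -
  have "k \<in> Ar B" "Cod (presheaves A) k = F" using k by (auto simp: is_kernel_def B_simps)
  then obtain K \<kappa> where kk: "k = parr A K \<kappa> F" "K \<in> hull" "pmap A K \<kappa> F" by (auto simp: Ar_B)
  have z: "v X (\<kappa> X x) = \<one>\<^bsub>pob G X\<^esub>" if "X \<in> Ob A" "x \<in> carrier (pob K X)" for X x
    using k that by (auto simp: is_kernel_def B_simps kk parr_Cmp[OF kk(3)] parr_eq_iff)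
  have univ: "\<exists>!s. s \<in> Hom B H K \<and> parr A K \<kappa> F \<cdot>\<^bsub>presheaves A\<^esub> s = parr A H \<tau> F"
    if H: "H \<in> hull" "pmap A H \<tau> F" "\<And>X x. X \<in> Ob A \<Longrightarrow> x \<in> carrier (pob H X) \<Longrightarrow> v X (\<tau> X x) = \<one>\<^bsub>pob G X\<^esub>" for H \<tau>
  proof -
    have "parr A H \<tau> F \<in> Ar B" using H FG by (auto simp: Ar_B)
    moreover have "parr A F v G \<cdot>\<^bsub>presheaves A\<^esub> parr A H \<tau> F = Zr (presheaves A) H G"
      using H by (simp add: parr_Cmp parr_eq_iff)
    moreover have "\<And>t. t \<in> Ar B \<Longrightarrow> Cod (presheaves A) t = F \<Longrightarrow>
        parr A F v G \<cdot>\<^bsub>presheaves A\<^esub> t = Zr (presheaves A) (Dom (presheaves A) t) G \<Longrightarrow>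
        \<exists>!s. s \<in> Hom B (Dom (presheaves A) t) K \<and> parr A K \<kappa> F \<cdot>\<^bsub>presheaves A\<^esub> s = t"
      using k unfolding is_kernel_def kk(1) B_simps presheaves_simps(3,4) by blast
    ultimately show ?thesis by (metis presheaves_simps(3,4))
  qed
  have "inj_on (\<kappa> X) (carrier (pob K X))" if X: "X \<in> Ob A" for X
  proof -
    interpret h: group_hom "pob K X" "pob F X" "\<kappa> X" by (rule pmap_group_hom[OF kk(3) X])
    let ?N = "psub K (pker K \<kappa> F)"
    have N: "?N \<in> hull" by (rule hull_pker[OF kk(2) FG(1) kk(3)])
    have i: "pmap A ?N (\<lambda>X x. x) K" by (rule psub_incl[OF subpresheaf_pker[OF kk(3)]])
    have c: "pmap A ?N (\<lambda>X x. \<kappa> X x) F" using pmap_comp[OF i kk(3)] .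
    have o: "pmap A ?N (\<lambda>X x. \<one>\<^bsub>pob K X\<^esub>) K" by (rule pmap_zero[OF pmapD(1,2)[OF i]])
    have "\<exists>!s. s \<in> Hom B ?N K \<and> parr A K \<kappa> F \<cdot>\<^bsub>presheaves A\<^esub> s = parr A ?N (\<lambda>X x. \<kappa> X x) F"
      by (rule univ[OF N c]) (use pmap_one[OF v] in \<open>simp add: pker_def\<close>)
    moreover have "parr A K \<kappa> F \<cdot>\<^bsub>presheaves A\<^esub> parr A ?N (\<lambda>X x. x) K = parr A ?N (\<lambda>X x. \<kappa> X x) F"
      by (simp add: parr_Cmp[OF i])
    moreover have "parr A K \<kappa> F \<cdot>\<^bsub>presheaves A\<^esub> parr A ?N (\<lambda>X x. \<one>\<^bsub>pob K X\<^esub>) K = parr A ?N (\<lambda>X x. \<kappa> X x) F"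
      using pmap_one[OF kk(3)] by (simp add: parr_Cmp[OF o] parr_eq_iff pker_def)
    moreover have "parr A ?N (\<lambda>X x. x) K \<in> Hom B ?N K" "parr A ?N (\<lambda>X x. \<one>\<^bsub>pob K X\<^esub>) K \<in> Hom B ?N K"
      using N kk(2) i o by (auto simp: Hom_B)
    ultimately have "parr A ?N (\<lambda>X x. x) K = parr A ?N (\<lambda>X x. \<one>\<^bsub>pob K X\<^esub>) K" by blast
    then have "x = \<one>\<^bsub>pob K X\<^esub>" if "x \<in> carrier (pob K X)" "\<kappa> X x = \<one>\<^bsub>pob F X\<^esub>" for x
      using that X by (auto simp: parr_eq_iff pker_def)
    then show ?thesis unfolding h.inj_on_one_iff by blast
  qed
  moreover have "\<kappa> X ` carrier (pob K X) = {x \<in> carrier (pob F X). v X x = \<one>\<^bsub>pob G X\<^esub>}" if X: "X \<in> Ob A" for X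
  proof
    show "\<kappa> X ` carrier (pob K X) \<subseteq> {x \<in> carrier (pob F X). v X x = \<one>\<^bsub>pob G X\<^esub>}"
      using z[OF X] pmapD(4)[OF kk(3) X] by auto
    let ?N = "psub F (pker F v G)"
    have N: "?N \<in> hull" by (rule hull_pker[OF FG v])
    have i: "pmap A ?N (\<lambda>X x. x) F" by (rule psub_incl[OF subpresheaf_pker[OF v]])
    have "\<exists>!s. s \<in> Hom B ?N K \<and> parr A K \<kappa> F \<cdot>\<^bsub>presheaves A\<^esub> s = parr A ?N (\<lambda>X x. x) F"
      by (rule univ[OF N i]) (simp add: pker_def)
    then obtain t where "t \<in> Hom B ?N K" "parr A K \<kappa> F \<cdot>\<^bsub>presheaves A\<^esub> t = parr A ?N (\<lambda>X x. x) F" by blast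
    then obtain \<sigma> where s: "pmap A ?N \<sigma> K" "parr A K \<kappa> F \<cdot>\<^bsub>presheaves A\<^esub> parr A ?N \<sigma> K = parr A ?N (\<lambda>X x. x) F"
      by (auto simp: Hom_B)
    have "\<kappa> X (\<sigma> X x) = x" if "x \<in> pker F v G X" for x
      using that X s(2) by (simp add: parr_Cmp[OF s(1)] parr_eq_iff)
    then show "{x \<in> carrier (pob F X). v X x = \<one>\<^bsub>pob G X\<^esub>} \<subseteq> \<kappa> X ` carrier (pob K X)"
      using pmapD(4)[OF s(1) X] by (force simp: pker_def image_iff)
  qed
  ultimately show ?thesis using that kk by blast
qed

text \<open>Dual, with the pointwise quotients by the images of \<kappa> and of \<open>u\<close> as
  test objects; these lie in the hull as well.\<close>

lemma cokernelD_B: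
  assumes c: "is_cokernel B (parr A F u G) c" and FG: "F \<in> hull" "G \<in> hull" and u: "pmap A F u G"
  obtains Q \<kappa> where "c = parr A G \<kappa> Q" "Q \<in> hull" "pmap A G \<kappa> Q"
    "\<And>X. X \<in> Ob A \<Longrightarrow> \<kappa> X ` carrier (pob G X) = carrier (pob Q X)"
    "\<And>X. X \<in> Ob A \<Longrightarrow> {x \<in> carrier (pob G X). \<kappa> X x = \<one>\<^bsub>pob Q X\<^esub>} = u X ` carrier (pob F X)"
proof -
  have "c \<in> Ar B" "Dom (presheaves A) c = G" using c by (auto simp: is_cokernel_def B_simps)
  then obtain Q \<kappa> where cc: "c = parr A G \<kappa> Q" "Q \<in> hull" "pmap A G \<kappa> Q" by (auto simp: Ar_B)
  have z: "\<kappa> X (u X x) = \<one>\<^bsub>pob Q X\<^esub>" if "X \<in> Ob A" "x \<in> carrier (pob F X)" for X x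
    using c that by (auto simp: is_cokernel_def B_simps cc parr_Cmp[OF u] parr_eq_iff)
  have univ: "\<exists>!s. s \<in> Hom B Q H \<and> s \<cdot>\<^bsub>presheaves A\<^esub> parr A G \<kappa> Q = parr A G \<tau> H"
    if H: "H \<in> hull" "pmap A G \<tau> H" "\<And>X x. X \<in> Ob A \<Longrightarrow> x \<in> carrier (pob F X) \<Longrightarrow> \<tau> X (u X x) = \<one>\<^bsub>pob H X\<^esub>" for H \<tau>
  proof -
    have "parr A G \<tau> H \<in> Ar B" using H FG by (auto simp: Ar_B)
    moreover have "parr A G \<tau> H \<cdot>\<^bsub>presheaves A\<^esub> parr A F u G = Zr (presheaves A) F H"
      using H by (simp add: parr_Cmp[OF u] parr_eq_iff)
    moreover have "\<And>t. t \<in> Ar B \<Longrightarrow> Dom (presheaves A) t = G \<Longrightarrow>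
        t \<cdot>\<^bsub>presheaves A\<^esub> parr A F u G = Zr (presheaves A) F (Cod (presheaves A) t) \<Longrightarrow>
        \<exists>!s. s \<in> Hom B Q (Cod (presheaves A) t) \<and> s \<cdot>\<^bsub>presheaves A\<^esub> parr A G \<kappa> Q = t"
      using c unfolding is_cokernel_def cc(1) B_simps presheaves_simps(3,4) by blast
    ultimately show ?thesis by (metis presheaves_simps(3,4))
  qed
  have "\<kappa> X ` carrier (pob G X) = carrier (pob Q X)" if X: "X \<in> Ob A" for X
  proof -
    let ?N = "pquo Q (pim G \<kappa>)"
    have N: "?N \<in> hull" by (rule hull_pquo[OF FG(2) cc(2,3)])
    note sp = subpresheaf_pim[OF cc(3)]
    have i: "pmap A Q (rep Q (pim G \<kappa>)) ?N" by (rule pmap_rep[OF sp])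
    have o: "pmap A Q (\<lambda>X x. \<one>\<^bsub>pob ?N X\<^esub>) ?N" by (rule pmap_zero[OF pmapD(1,2)[OF i]])
    have k1: "rep Q (pim G \<kappa>) X (\<kappa> X x) = \<one>\<^bsub>pob ?N X\<^esub>" if "X \<in> Ob A" "x \<in> carrier (pob G X)" for X x
      using quotient(3)[OF sp that(1)] that by (auto simp: pim_def)
    have c0: "pmap A G (\<lambda>X x. \<one>\<^bsub>pob ?N X\<^esub>) ?N" by (rule pmap_zero[OF pmapD(1)[OF cc(3)] pmapD(2)[OF i]])
    have "\<exists>!s. s \<in> Hom B Q ?N \<and> s \<cdot>\<^bsub>presheaves A\<^esub> parr A G \<kappa> Q = parr A G (\<lambda>X x. \<one>\<^bsub>pob ?N X\<^esub>) ?N"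
      by (intro univ[OF N c0]) auto
    moreover have "parr A Q (rep Q (pim G \<kappa>)) ?N \<cdot>\<^bsub>presheaves A\<^esub> parr A G \<kappa> Q = parr A G (\<lambda>X x. \<one>\<^bsub>pob ?N X\<^esub>) ?N"
      using k1 by (simp add: parr_Cmp[OF cc(3)] parr_eq_iff)
    moreover have "parr A Q (\<lambda>X x. \<one>\<^bsub>pob ?N X\<^esub>) ?N \<cdot>\<^bsub>presheaves A\<^esub> parr A G \<kappa> Q = parr A G (\<lambda>X x. \<one>\<^bsub>pob ?N X\<^esub>) ?N"
      by (simp add: parr_Cmp[OF cc(3)])
    moreover have "parr A Q (rep Q (pim G \<kappa>)) ?N \<in> Hom B Q ?N" "parr A Q (\<lambda>X x. \<one>\<^bsub>pob ?N X\<^esub>) ?N \<in> Hom B Q ?N"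
      using N cc(2) i o by (auto simp: Hom_B)
    ultimately have "parr A Q (rep Q (pim G \<kappa>)) ?N = parr A Q (\<lambda>X x. \<one>\<^bsub>pob ?N X\<^esub>) ?N" by blast
    then have "x \<in> pim G \<kappa> X" if "x \<in> carrier (pob Q X)" for x
      using quotient(3)[OF sp X] that X by (auto simp: parr_eq_iff)
    then show ?thesis using pmapD(4)[OF cc(3) X] by (auto simp: pim_def)
  qed
  moreover have "{x \<in> carrier (pob G X). \<kappa> X x = \<one>\<^bsub>pob Q X\<^esub>} = u X ` carrier (pob F X)" if X: "X \<in> Ob A" for X
  proof
    show "u X ` carrier (pob F X) \<subseteq> {x \<in> carrier (pob G X). \<kappa> X x = \<one>\<^bsub>pob Q X\<^esub>}"
      using z[OF X] pmapD(4)[OF u X] by auto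
    let ?N = "pquo G (pim F u)"
    note sp = subpresheaf_pim[OF u]
    have N: "?N \<in> hull" by (rule hull_pquo[OF FG u])
    have i: "pmap A G (rep G (pim F u)) ?N" by (rule pmap_rep[OF sp])
    have "rep G (pim F u) X (u X x) = \<one>\<^bsub>pob ?N X\<^esub>" if "X \<in> Ob A" "x \<in> carrier (pob F X)" for X x
      using quotient(3)[OF sp that(1)] that by (auto simp: pim_def)
    then have "\<exists>!s. s \<in> Hom B Q ?N \<and> s \<cdot>\<^bsub>presheaves A\<^esub> parr A G \<kappa> Q = parr A G (rep G (pim F u)) ?N"
      by (rule univ[OF N i])
    then obtain t where "t \<in> Hom B Q ?N" "t \<cdot>\<^bsub>presheaves A\<^esub> parr A G \<kappa> Q = parr A G (rep G (pim F u)) ?N" by blast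
    then obtain \<sigma> where s: "pmap A Q \<sigma> ?N" "parr A Q \<sigma> ?N \<cdot>\<^bsub>presheaves A\<^esub> parr A G \<kappa> Q = parr A G (rep G (pim F u)) ?N"
      by (auto simp: Hom_B)
    have r: "\<sigma> X (\<kappa> X x) = rep G (pim F u) X x" if "x \<in> carrier (pob G X)" for x
      using that X s(2) by (simp add: parr_Cmp[OF cc(3)] parr_eq_iff)
    have "rep G (pim F u) X x = \<one>\<^bsub>pob ?N X\<^esub>" if "x \<in> carrier (pob G X)" "\<kappa> X x = \<one>\<^bsub>pob Q X\<^esub>" for x
      using r[OF that(1)] that(2) pmap_one[OF s(1) X] by simp
    then show "{x \<in> carrier (pob G X). \<kappa> X x = \<one>\<^bsub>pob Q X\<^esub>} \<subseteq> u X ` carrier (pob F X)"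
      using quotient(3)[OF sp X] by (auto simp: pim_def)
  qed
  ultimately show ?thesis using that cc by blast
qed

lemma imageD_B:
  assumes m: "is_image B (parr A F u G) m" and FG: "F \<in> hull" "G \<in> hull" and u: "pmap A F u G"
  obtains I \<iota> where "m = parr A I \<iota> G" "I \<in> hull" "pmap A I \<iota> G"
    "\<And>X. X \<in> Ob A \<Longrightarrow> inj_on (\<iota> X) (carrier (pob I X))"
    "\<And>X. X \<in> Ob A \<Longrightarrow> \<iota> X ` carrier (pob I X) = u X ` carrier (pob F X)"
proof -
  obtain c where c: "is_cokernel B (parr A F u G) c" "is_kernel B c m" using m by (auto simp: is_image_def)
  obtain Q \<kappa> where q: "c = parr A G \<kappa> Q" "Q \<in> hull" "pmap A G \<kappa> Q"
    "\<And>X. X \<in> Ob A \<Longrightarrow> \<kappa> X ` carrier (pob G X) = carrier (pob Q X)"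
    "\<And>X. X \<in> Ob A \<Longrightarrow> {x \<in> carrier (pob G X). \<kappa> X x = \<one>\<^bsub>pob Q X\<^esub>} = u X ` carrier (pob F X)"
    by (rule cokernelD_B[OF c(1) FG u]) (rule that, simp_all)
  obtain K \<iota> where k: "m = parr A K \<iota> G" "K \<in> hull" "pmap A K \<iota> G"
    "\<And>X. X \<in> Ob A \<Longrightarrow> inj_on (\<iota> X) (carrier (pob K X))"
    "\<And>X. X \<in> Ob A \<Longrightarrow> \<iota> X ` carrier (pob K X) = {x \<in> carrier (pob G X). \<kappa> X x = \<one>\<^bsub>pob Q X\<^esub>}"
    by (rule kernelD_B[OF c(2)[unfolded q(1)] FG(2) q(2,3)]) (rule that, simp_all)
  show ?thesis by (rule that[OF k(1-4)]) (use k(5) q(5) in auto)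
qed

lemma imageI_B:
  assumes FG: "F \<in> hull" "G \<in> hull" and u: "pmap A F u G"
  shows "is_image B (parr A F u G) (parr A (psub G (pim F u)) (\<lambda>X x. x) G)"
proof -
  note sp = subpresheaf_pim[OF u]
  have "is_cokernel B (parr A F u G) (parr A G (rep G (pim F u)) (pquo G (pim F u)))"
    by (rule cokernelI_B[OF FG hull_pquo[OF FG u] u pmap_rep[OF sp]])
      (use quotient(2,3)[OF sp] in \<open>auto simp: pim_def\<close>)
  moreover have "is_kernel B (parr A G (rep G (pim F u)) (pquo G (pim F u))) (parr A (psub G (pim F u)) (\<lambda>X x. x) G)"
    by (rule kernelI_B[OF FG(2) hull_pquo[OF FG u] hull_pim[OF FG u] pmap_rep[OF sp] psub_incl[OF sp]])
      (use quotient(3)[OF sp] in auto)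
  ultimately show ?thesis unfolding is_image_def by blast
qed

text \<open>The projection of \<open>G\<close> modulo the pointwise image of \<open>u\<close> and
  the zero map agree after \<open>u\<close>. The quotient belongs to the hull, so the two coincide
  and the image is everything.\<close>

lemma epiD_B:
  assumes e: "is_epi B (parr A F u G)" and FG: "F \<in> hull" "G \<in> hull" and u: "pmap A F u G" and X: "X \<in> Ob A"
  shows "u X ` carrier (pob F X) = carrier (pob G X)"
proof -
  let ?N = "pquo G (pim F u)"
  note sp = subpresheaf_pim[OF u]
  have N: "?N \<in> hull" by (rule hull_pquo[OF FG u])
  have i: "pmap A G (rep G (pim F u)) ?N" by (rule pmap_rep[OF sp])
  have o: "pmap A G (\<lambda>X x. \<one>\<^bsub>pob ?N X\<^esub>) ?N" by (rule pmap_zero[OF pmapD(1,2)[OF i]])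
  have "rep G (pim F u) X (u X x) = \<one>\<^bsub>pob ?N X\<^esub>" if "X \<in> Ob A" "x \<in> carrier (pob F X)" for X x
    using quotient(3)[OF sp that(1)] that by (auto simp: pim_def)
  then have "parr A G (rep G (pim F u)) ?N \<cdot>\<^bsub>presheaves A\<^esub> parr A F u G = parr A G (\<lambda>X x. \<one>\<^bsub>pob ?N X\<^esub>) ?N \<cdot>\<^bsub>presheaves A\<^esub> parr A F u G"
    by (simp add: parr_Cmp[OF u] parr_eq_iff)
  moreover have "parr A G (rep G (pim F u)) ?N \<in> Hom B G ?N" "parr A G (\<lambda>X x. \<one>\<^bsub>pob ?N X\<^esub>) ?N \<in> Hom B G ?N"
    using N FG(2) i o by (auto simp: Hom_B)
  ultimately have "parr A G (rep G (pim F u)) ?N = parr A G (\<lambda>X x. \<one>\<^bsub>pob ?N X\<^esub>) ?N"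
    using e unfolding is_epi_def B_simps presheaves_simps by blast
  then have "x \<in> pim F u X" if "x \<in> carrier (pob G X)" for x
    using quotient(3)[OF sp X] that X by (auto simp: parr_eq_iff)
  then show ?thesis using pmapD(4)[OF u X] by (auto simp: pim_def)
qed

definition trivial :: "('o, 'm, 'u) presheaf \<Rightarrow> bool" where
  "trivial F \<longleftrightarrow> (\<forall>X\<in>Ob A. carrier (pob F X) = {\<one>\<^bsub>pob F X\<^esub>})"

lemma zero_object_B: "zero_object B F \<longleftrightarrow> F \<in> hull \<and> trivial F"
proof
  assume z: "zero_object B F"
  then have F: "F \<in> hull" by (simp add: zero_object_def B_simps)
  have pF: "is_presheaf A F" by (rule hull_presheaf[OF F])
  have "\<exists>!f. f \<in> Hom B F F" using z by (auto simp: zero_object_def)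
  moreover have "parr A F (\<lambda>X x. x) F \<in> Hom B F F" "parr A F (\<lambda>X x. \<one>\<^bsub>pob F X\<^esub>) F \<in> Hom B F F"
    using F pmap_id[OF pF] pmap_zero[OF pF pF] by (auto simp: Hom_B)
  ultimately have "parr A F (\<lambda>X x. x) F = parr A F (\<lambda>X x. \<one>\<^bsub>pob F X\<^esub>) F" by blast
  then show "F \<in> hull \<and> trivial F" using F presheaf_one[OF pF] by (auto simp: parr_eq_iff trivial_def)
next
  assume F: "F \<in> hull \<and> trivial F"
  show "zero_object B F" unfolding zero_object_def B_simps
  proof (intro conjI ballI)
    fix G assume G: "G \<in> hull"
    have p: "is_presheaf A F" "is_presheaf A G" using F G hull_presheaf by auto
    show "\<exists>!f. f \<in> Hom B G F"
    proof (rule ex1I)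
      show "parr A G (\<lambda>X x. \<one>\<^bsub>pob F X\<^esub>) F \<in> Hom B G F" using F G pmap_zero[OF p(2,1)] by (auto simp: Hom_B)
      fix f assume "f \<in> Hom B G F"
      then obtain \<eta> where "pmap A G \<eta> F" "f = parr A G \<eta> F" by (auto simp: Hom_B)
      then show "f = parr A G (\<lambda>X x. \<one>\<^bsub>pob F X\<^esub>) F"
        using F pmapD(4)[of A G \<eta> F] by (auto simp: trivial_def parr_eq_iff)
    qed
    show "\<exists>!f. f \<in> Hom B F G"
    proof (rule ex1I)
      show "parr A F (\<lambda>X x. \<one>\<^bsub>pob G X\<^esub>) G \<in> Hom B F G" using F G pmap_zero[OF p] by (auto simp: Hom_B)
      fix f assume "f \<in> Hom B F G"
      then obtain \<eta> where "pmap A F \<eta> G" "f = parr A F \<eta> G" by (auto simp: Hom_B)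
      then show "f = parr A F (\<lambda>X x. \<one>\<^bsub>pob G X\<^esub>) G"
        using F pmap_one[of A F \<eta> G] by (auto simp: trivial_def parr_eq_iff)
    qed
  qed (use F in auto)
qed

section \<open>Classes of endomorphisms of presheaves\<close>

sublocale KB: presented "endos B" "ab_triples B"
  by unfold_locales (rule ab_triples_endos)

definition cl :: "('o, 'm, 'u) presheaf \<Rightarrow> ('o \<Rightarrow> 'u \<Rightarrow> 'u) \<Rightarrow> (('o, 'm, 'u) nattrans \<Rightarrow>\<^sub>0 int) set" where
  "cl F f = class_ab B (parr A F f F)"

lemma K0_ab_eq: "K0_ab B = KB.K" "class_ab B = KB.cls"
  by (simp_all add: K0_ab_def class_ab_def)

lemma cl_closed: "F \<in> hull \<Longrightarrow> pmap A F f F \<Longrightarrow> cl F f \<in> carrier (K0_ab B)"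
  unfolding cl_def K0_ab_eq by (rule KB.cls_closed) (unfold endos_B, rule bexI[of _ F], rule exI[of _ f], rule conjI, assumption, rule HOL.refl)

lemma cl_ses:
  assumes h: "F \<in> hull" "G \<in> hull" "K \<in> hull" and i: "pmap A F i G" and p: "pmap A G p K"
    and inj: "\<And>X. X \<in> Ob A \<Longrightarrow> inj_on (i X) (carrier (pob F X))"
    and surj: "\<And>X. X \<in> Ob A \<Longrightarrow> p X ` carrier (pob G X) = carrier (pob K X)"
    and ex: "\<And>X. X \<in> Ob A \<Longrightarrow> i X ` carrier (pob F X) = {x \<in> carrier (pob G X). p X x = \<one>\<^bsub>pob K X\<^esub>}"
    and f: "pmap A F f F" and g: "pmap A G g G" and k: "pmap A K k K"
    and gi: "\<And>X x. X \<in> Ob A \<Longrightarrow> x \<in> carrier (pob F X) \<Longrightarrow> g X (i X x) = i X (f X x)"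
    and kp: "\<And>X x. X \<in> Ob A \<Longrightarrow> x \<in> carrier (pob G X) \<Longrightarrow> k X (p X x) = p X (g X x)"
  shows "cl G g = cl F f \<otimes>\<^bsub>K0_ab B\<^esub> cl K k"
proof -
  have "short_exact B (parr A F i G) (parr A G p K)"
    unfolding short_exact_def using kernelI_B[OF h(2,3,1) p i inj ex] cokernelI_B[OF h i p surj] ex by simp
  moreover have "sequence_endo B (parr A F i G) (parr A G p K) (parr A F f F) (parr A G g G) (parr A K k K)"
    unfolding sequence_endo_def B_simps using h f g k gi kp
    by (auto simp: Hom_B parr_Cmp[OF i] parr_Cmp[OF p] parr_Cmp[OF f] parr_Cmp[OF g] parr_eq_iff)
  ultimately have "(parr A F f F, parr A G g G, parr A K k K) \<in> ab_triples B" unfolding ab_triples_def by blast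
  then show ?thesis unfolding cl_def K0_ab_eq by (rule KB.cls_relation)
qed

text \<open>The sequence F -> F -> F of identities is short exact for a trivial presheaf, so the
  class equals its own square.\<close>

lemma cl_trivial:
  assumes F: "F \<in> hull" "trivial F" and f: "pmap A F f F" shows "cl F f = \<one>\<^bsub>K0_ab B\<^esub>"
proof -
  have i: "pmap A F (\<lambda>X x. x) F" by (rule pmap_id[OF hull_presheaf[OF F(1)]])
  have "cl F f = cl F f \<otimes>\<^bsub>K0_ab B\<^esub> cl F f"
    by (rule cl_ses[OF F(1) F(1) F(1) i i _ _ _ f f f]) (use F(2) in \<open>auto simp: trivial_def\<close>)
  then show ?thesis using cl_closed[OF F(1) f] KB.K.r_cancel_one'[of "cl F f" "cl F f"] by (simp add: K0_ab_eq)
qed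

lemma restrict_ker_im:
  assumes p: "pmap A F \<phi> G" and f: "pmap A F f F" and g: "pmap A G g G"
    and c: "\<And>X x. X \<in> Ob A \<Longrightarrow> x \<in> carrier (pob F X) \<Longrightarrow> g X (\<phi> X x) = \<phi> X (f X x)"
  shows "pmap A (psub F (pker F \<phi> G)) f (psub F (pker F \<phi> G))" "pmap A (psub G (pim F \<phi>)) g (psub G (pim F \<phi>))"
proof -
  have "f X x \<in> pker F \<phi> G X" if "X \<in> Ob A" "x \<in> pker F \<phi> G X" for X x
    using that c[of X x, symmetric] pmapD(4)[OF f] pmap_one[OF g] by (auto simp: pker_def)
  then show "pmap A (psub F (pker F \<phi> G)) f (psub F (pker F \<phi> G))"
    by (intro pmap_psub_to pmap_psub_from f subpresheaf_pker[OF p]) auto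
  have "g X x \<in> pim F \<phi> X" if "X \<in> Ob A" "x \<in> pim F \<phi> X" for X x
    using that c pmapD(4)[OF f] by (auto simp: pim_def)
  then show "pmap A (psub G (pim F \<phi>)) g (psub G (pim F \<phi>))"
    by (intro pmap_psub_to pmap_psub_from g subpresheaf_pim[OF p]) auto
qed

lemma trivial_iff:
  assumes p: "pmap A K \<pi> M" and surj: "\<And>X. X \<in> Ob A \<Longrightarrow> \<pi> X ` carrier (pob K X) = carrier (pob M X)"
  shows "trivial M \<longleftrightarrow> (\<forall>X\<in>Ob A. pker K \<pi> M X = carrier (pob K X))"
proof
  assume "trivial M"
  then show "\<forall>X\<in>Ob A. pker K \<pi> M X = carrier (pob K X)"
    using pmapD(4)[OF p] unfolding trivial_def pker_def by blast
next
  assume a: "\<forall>X\<in>Ob A. pker K \<pi> M X = carrier (pob K X)"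
  show "trivial M" unfolding trivial_def
  proof
    fix X assume X: "X \<in> Ob A"
    have "carrier (pob M X) = \<pi> X ` pker K \<pi> M X" using surj[OF X] bspec[OF a X] by simp
    also have "\<dots> \<subseteq> {\<one>\<^bsub>pob M X\<^esub>}" by (auto simp: pker_def)
    finally show "carrier (pob M X) = {\<one>\<^bsub>pob M X\<^esub>}"
      using presheaf_one[OF pmapD(2)[OF p] X] by blast
  qed
qed

text \<open>\<open>M\<close> and \<open>H\<close> are quotients of \<open>K\<close> by the same
  subpresheaf. No isomorphism between them is constructed: both are cokernels of one inclusion,
  which puts \<open>H\<close> into the hull, and both classes equal the class on \<open>K\<close>
  divided by the class on that subpresheaf.\<close>

lemma cl_compare:
  assumes h: "K \<in> hull" "M \<in> hull" and p: "pmap A K \<pi> M" and r: "pmap A K \<rho> H"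
    and psurj: "\<And>X. X \<in> Ob A \<Longrightarrow> \<pi> X ` carrier (pob K X) = carrier (pob M X)"
    and rsurj: "\<And>X. X \<in> Ob A \<Longrightarrow> \<rho> X ` carrier (pob K X) = carrier (pob H X)"
    and ker: "\<And>X. X \<in> Ob A \<Longrightarrow> pker K \<pi> M X = pker K \<rho> H X"
  shows "H \<in> hull" "trivial M \<longleftrightarrow> trivial H"
    and "pmap A K k K \<Longrightarrow> pmap A M m M \<Longrightarrow> pmap A H l H
      \<Longrightarrow> (\<And>X x. X \<in> Ob A \<Longrightarrow> x \<in> carrier (pob K X) \<Longrightarrow> m X (\<pi> X x) = \<pi> X (k X x))
      \<Longrightarrow> (\<And>X x. X \<in> Ob A \<Longrightarrow> x \<in> carrier (pob K X) \<Longrightarrow> l X (\<rho> X x) = \<rho> X (k X x)) \<Longrightarrow> cl M m = cl H l"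
proof -
  let ?N = "psub K (pker K \<pi> M)"
  have N: "?N \<in> hull" by (rule hull_pker[OF h p])
  have i: "pmap A ?N (\<lambda>X x. x) K" by (rule psub_incl[OF subpresheaf_pker[OF p]])
  show H: "H \<in> hull" by (rule hull_cokernel[OF N h(1) i r rsurj]) (use ker in \<open>auto simp: pker_def\<close>)
  show "trivial M \<longleftrightarrow> trivial H" using trivial_iff[OF p psurj] trivial_iff[OF r rsurj] ker by simp
  assume k: "pmap A K k K" and m: "pmap A M m M" and l: "pmap A H l H"
    and mc: "\<And>X x. X \<in> Ob A \<Longrightarrow> x \<in> carrier (pob K X) \<Longrightarrow> m X (\<pi> X x) = \<pi> X (k X x)"
    and lc: "\<And>X x. X \<in> Ob A \<Longrightarrow> x \<in> carrier (pob K X) \<Longrightarrow> l X (\<rho> X x) = \<rho> X (k X x)"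
  have kN: "pmap A ?N k ?N" by (rule restrict_ker_im(1)[OF p k m]) (rule mc)
  have "cl K k = cl ?N k \<otimes>\<^bsub>K0_ab B\<^esub> cl M m"
    by (rule cl_ses[OF N h i p _ psurj _ kN k m]) (simp_all add: pker_def mc)
  moreover have "cl K k = cl ?N k \<otimes>\<^bsub>K0_ab B\<^esub> cl H l"
    by (rule cl_ses[OF N h(1) H i r _ rsurj _ kN k l]) (simp_all add: ker[unfolded pker_def] pker_def lc)
  ultimately show "cl M m = cl H l"
    using cl_closed[OF N kN] cl_closed[OF h(2) m] cl_closed[OF H l] KB.K.Units_l_cancel by (simp add: K0_ab_eq)
qed

end

context yoneda_category
begin

text \<open>Exactness at \<open>F\<close> makes the image of \<psi> the kernel of the corestriction
  of \<phi> to its own image; the class splits along this short exact sequence. Applied around a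
  triangle, it cuts the long exact sequence into images.\<close>

lemma cl_exact:
  assumes h: "E \<in> hull" "F \<in> hull" "G \<in> hull" and e: "pmap A E \<psi> F" and p: "pmap A F \<phi> G"
    and ex: "\<And>X. X \<in> Ob A \<Longrightarrow> pker F \<phi> G X = pim E \<psi> X"
    and l: "pmap A E l E" and f: "pmap A F f F" and g: "pmap A G g G"
    and d: "\<And>X x. X \<in> Ob A \<Longrightarrow> x \<in> carrier (pob E X) \<Longrightarrow> f X (\<psi> X x) = \<psi> X (l X x)"
    and c: "\<And>X x. X \<in> Ob A \<Longrightarrow> x \<in> carrier (pob F X) \<Longrightarrow> g X (\<phi> X x) = \<phi> X (f X x)"
  shows "cl F f = cl (psub F (pim E \<psi>)) f \<otimes>\<^bsub>K0_ab B\<^esub> cl (psub G (pim F \<phi>)) g"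
proof (rule cl_ses[OF hull_pim[OF h(1,2) e] h(2) hull_pim[OF h(2,3) p]])
  show "pmap A (psub F (pim E \<psi>)) (\<lambda>X x. x) F" by (rule psub_incl[OF subpresheaf_pim[OF e]])
  show "pmap A F \<phi> (psub G (pim F \<phi>))" by (intro pmap_psub_to p subpresheaf_pim) (auto simp: pim_def)
  show "pmap A (psub F (pim E \<psi>)) f (psub F (pim E \<psi>))" by (rule restrict_ker_im(2)[OF e l f]) (rule d)
  show "pmap A (psub G (pim F \<phi>)) g (psub G (pim F \<phi>))" by (rule restrict_ker_im(2)[OF p f g]) (rule c)
  fix X assume "X \<in> Ob A"
  then show "(\<lambda>x. x) ` carrier (pob (psub F (pim E \<psi>)) X) = {x \<in> carrier (pob F X). \<phi> X x = \<one>\<^bsub>pob (psub G (pim F \<phi>)) X\<^esub>}"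
    using ex by (simp add: pker_def)
qed (simp_all add: f c, simp_all add: pim_def)

lemma cl_trivial_image:
  assumes "E \<in> hull" "F \<in> hull" and e: "pmap A E \<psi> F" and l: "pmap A E l E" and f: "pmap A F f F"
    and d: "\<And>X x. X \<in> Ob A \<Longrightarrow> x \<in> carrier (pob E X) \<Longrightarrow> f X (\<psi> X x) = \<psi> X (l X x)"
    and t: "trivial E \<or> trivial F"
  shows "cl (psub F (pim E \<psi>)) f = \<one>\<^bsub>K0_ab B\<^esub>"
proof (rule cl_trivial[OF hull_pim[OF assms(1,2) e]])
  show "pmap A (psub F (pim E \<psi>)) f (psub F (pim E \<psi>))" by (rule restrict_ker_im(2)[OF e l f]) (rule d)
  have "pim E \<psi> X = {\<one>\<^bsub>pob F X\<^esub>}" if X: "X \<in> Ob A" for X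
  proof -
    have "pim E \<psi> X \<subseteq> carrier (pob F X)" "\<one>\<^bsub>pob F X\<^esub> \<in> pim E \<psi> X"
      using pmapD(4)[OF e X] pmap_one[OF e X] presheaf_one[OF pmapD(1)[OF e] X] unfolding pim_def by (blast, force)
    moreover have "pim E \<psi> X = {\<one>\<^bsub>pob F X\<^esub>}" if "trivial E"
      using that X pmap_one[OF e X] by (simp add: trivial_def pim_def)
    ultimately show ?thesis using t X unfolding trivial_def by blast
  qed
  then show "trivial (psub F (pim E \<psi>))" by (simp add: trivial_def)
qed

text \<open>Homology is defined with arbitrary kernels, images and cokernels. This extracts the
  pointwise content of any such choice: cycles \<open>K\<close>, their projection \<pi> to the
  homology \<open>M\<close>, and the boundaries as the kernel of \<pi>.\<close>

lemma homology_endoE: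
  assumes he: "homology_endo B (parr A F u G) (parr A G v K') (parr A G n G) h"
    and H: "F \<in> hull" "G \<in> hull" "K' \<in> hull" and u: "pmap A F u G" and v: "pmap A G v K'" and n: "pmap A G n G"
  obtains K k M \<pi> \<kappa> \<eta> where "K \<in> hull" "M \<in> hull" "pmap A K k G" "pmap A K \<pi> M" "pmap A K \<kappa> K" "pmap A M \<eta> M"
    "h = parr A M \<eta> M"
    "\<And>X. X \<in> Ob A \<Longrightarrow> inj_on (k X) (carrier (pob K X))"
    "\<And>X. X \<in> Ob A \<Longrightarrow> k X ` carrier (pob K X) = {x \<in> carrier (pob G X). v X x = \<one>\<^bsub>pob K' X\<^esub>}"
    "\<And>X. X \<in> Ob A \<Longrightarrow> \<pi> X ` carrier (pob K X) = carrier (pob M X)"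
    "\<And>X. X \<in> Ob A \<Longrightarrow> pker K \<pi> M X = {x \<in> carrier (pob K X). k X x \<in> u X ` carrier (pob F X)}"
    "\<And>X x. X \<in> Ob A \<Longrightarrow> x \<in> carrier (pob K X) \<Longrightarrow> k X (\<kappa> X x) = n X (k X x)"
    "\<And>X x. X \<in> Ob A \<Longrightarrow> x \<in> carrier (pob K X) \<Longrightarrow> \<eta> X (\<pi> X x) = \<pi> X (\<kappa> X x)"
proof -
  obtain k' m' e' \<pi>' \<kappa>' where a: "is_kernel B (parr A G v K') k'" "is_image B (parr A F u G) m'"
    "e' \<in> Hom B (Dom B m') (Dom B k')" "k' \<cdot>\<^bsub>B\<^esub> e' = m'" "is_cokernel B e' \<pi>'"
    "\<kappa>' \<in> Hom B (Dom B k') (Dom B k')" "k' \<cdot>\<^bsub>B\<^esub> \<kappa>' = parr A G n G \<cdot>\<^bsub>B\<^esub> k'"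
    "h \<in> Hom B (Cod B \<pi>') (Cod B \<pi>')" "h \<cdot>\<^bsub>B\<^esub> \<pi>' = \<pi>' \<cdot>\<^bsub>B\<^esub> \<kappa>'"
    using he unfolding homology_endo_def by blast
  obtain K k where k: "k' = parr A K k G" "K \<in> hull" "pmap A K k G"
    "\<And>X. X \<in> Ob A \<Longrightarrow> inj_on (k X) (carrier (pob K X))"
    "\<And>X. X \<in> Ob A \<Longrightarrow> k X ` carrier (pob K X) = {x \<in> carrier (pob G X). v X x = \<one>\<^bsub>pob K' X\<^esub>}"
    by (rule kernelD_B[OF a(1) H(2,3) v]) (rule that, simp_all)
  obtain I \<iota> where i: "m' = parr A I \<iota> G" "I \<in> hull" "pmap A I \<iota> G"
    "\<And>X. X \<in> Ob A \<Longrightarrow> inj_on (\<iota> X) (carrier (pob I X))"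
    "\<And>X. X \<in> Ob A \<Longrightarrow> \<iota> X ` carrier (pob I X) = u X ` carrier (pob F X)"
    by (rule imageD_B[OF a(2) H(1,2) u]) (rule that, assumption+)
  obtain e where e: "e' = parr A I e K" "pmap A I e K" using a(3) by (auto simp: B_simps k(1) i(1) Hom_B)
  obtain M \<pi> where p: "\<pi>' = parr A K \<pi> M" "M \<in> hull" "pmap A K \<pi> M"
    "\<And>X. X \<in> Ob A \<Longrightarrow> \<pi> X ` carrier (pob K X) = carrier (pob M X)"
    "\<And>X. X \<in> Ob A \<Longrightarrow> {x \<in> carrier (pob K X). \<pi> X x = \<one>\<^bsub>pob M X\<^esub>} = e X ` carrier (pob I X)"
    by (rule cokernelD_B[OF a(5)[unfolded e(1)] i(2) k(2) e(2)]) (rule that, simp_all)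
  obtain \<kappa> where \<kappa>: "\<kappa>' = parr A K \<kappa> K" "pmap A K \<kappa> K" using a(6) by (auto simp: B_simps k(1) Hom_B)
  obtain \<eta> where \<eta>: "h = parr A M \<eta> M" "pmap A M \<eta> M" using a(8) by (auto simp: B_simps p(1) Hom_B)
  have ke: "k X (e X x) = \<iota> X x" if "X \<in> Ob A" "x \<in> carrier (pob I X)" for X x
    using a(4) that by (simp add: B_simps k(1) e(1) i(1) parr_Cmp[OF e(2)] parr_eq_iff)
  show ?thesis
  proof (rule that[OF k(2) p(2) k(3) p(3) \<kappa>(2) \<eta>(2) \<eta>(1) k(4,5) p(4)])
    show "k X (\<kappa> X x) = n X (k X x)" if "X \<in> Ob A" "x \<in> carrier (pob K X)" for X x
      using a(7) that by (simp add: B_simps k(1) \<kappa>(1) parr_Cmp[OF \<kappa>(2)] parr_Cmp[OF k(3)] parr_eq_iff)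
    show "\<eta> X (\<pi> X x) = \<pi> X (\<kappa> X x)" if "X \<in> Ob A" "x \<in> carrier (pob K X)" for X x
      using a(9) that by (simp add: B_simps p(1) \<eta>(1) \<kappa>(1) parr_Cmp[OF \<kappa>(2)] parr_Cmp[OF p(3)] parr_eq_iff)
    show "pker K \<pi> M X = {x \<in> carrier (pob K X). k X x \<in> u X ` carrier (pob F X)}" if X: "X \<in> Ob A" for X
    proof -
      have "x \<in> e X ` carrier (pob I X) \<longleftrightarrow> k X x \<in> \<iota> X ` carrier (pob I X)" if x: "x \<in> carrier (pob K X)" for x
      proof
        assume "k X x \<in> \<iota> X ` carrier (pob I X)"
        then obtain y where y: "y \<in> carrier (pob I X)" "k X x = k X (e X y)" using ke[OF X] by auto
        then have "x = e X y" using inj_onD[OF k(4)[OF X] y(2) x] pmapD(4)[OF e(2) X y(1)] by simp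
        then show "x \<in> e X ` carrier (pob I X)" using y by simp
      qed (use ke[OF X] in force)
      then show ?thesis unfolding pker_def p(5)[OF X, symmetric] i(5)[OF X, symmetric] by blast
    qed
  qed
qed

lemma homology_endo_exists:
  assumes H: "F \<in> hull" "G \<in> hull" "K' \<in> hull" and u: "pmap A F u G" and v: "pmap A G v K'" and n: "pmap A G n G"
    and vu: "\<And>X x. X \<in> Ob A \<Longrightarrow> x \<in> carrier (pob F X) \<Longrightarrow> v X (u X x) = \<one>\<^bsub>pob K' X\<^esub>"
    and n1: "pmap A F n1 F" "\<And>X x. X \<in> Ob A \<Longrightarrow> x \<in> carrier (pob F X) \<Longrightarrow> n X (u X x) = u X (n1 X x)"
    and n2: "pmap A K' n2 K'" "\<And>X x. X \<in> Ob A \<Longrightarrow> x \<in> carrier (pob G X) \<Longrightarrow> n2 X (v X x) = v X (n X x)"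
  shows "\<exists>h. homology_endo B (parr A F u G) (parr A G v K') (parr A G n G) h"
proof -
  let ?K = "psub G (pker G v K')" and ?I = "psub G (pim F u)"
  have hK: "?K \<in> hull" and hI: "?I \<in> hull" using hull_pker hull_pim H u v by auto
  note sk = subpresheaf_pker[OF v] and si = subpresheaf_pim[OF u]
  have k: "pmap A ?K (\<lambda>X x. x) G" by (rule psub_incl[OF sk])
  have m: "pmap A ?I (\<lambda>X x. x) G" by (rule psub_incl[OF si])
  have e: "pmap A ?I (\<lambda>X x. x) ?K"
    by (rule pmap_psub_to[OF m sk]) (use vu pmapD(4)[OF u] in \<open>auto simp: pim_def pker_def\<close>)
  have \<kappa>: "pmap A ?K n ?K" by (rule restrict_ker_im(1)[OF v n n2(1)]) (rule n2(2))
  have n': "pmap A ?I n ?I" by (rule restrict_ker_im(2)[OF u n1(1) n]) (rule n1(2))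
  let ?Q = "pquo ?K (pim ?I (\<lambda>X x. x))" and ?\<pi> = "rep ?K (pim ?I (\<lambda>X x. x))"
  note sp = subpresheaf_pim[OF e]
  have hQ: "?Q \<in> hull" by (rule hull_pquo[OF hI hK e])
  have \<pi>: "pmap A ?K ?\<pi> ?Q" by (rule pmap_rep[OF sp])
  have kern: "is_kernel B (parr A G v K') (parr A ?K (\<lambda>X x. x) G)"
    by (rule kernelI_B[OF H(2,3) hK v k]) (auto simp: pker_def)
  have coker: "is_cokernel B (parr A ?I (\<lambda>X x. x) ?K) (parr A ?K ?\<pi> ?Q)"
    by (rule cokernelI_B[OF hI hK hQ e \<pi> quotient(2)[OF sp]]) (use quotient(3)[OF sp] in \<open>simp add: pim_def\<close>)
  have \<pi>n: "pmap A ?K (\<lambda>X x. ?\<pi> X (n X x)) ?Q" by (rule pmap_comp[OF \<kappa> \<pi>])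
  have "?\<pi> X (n X x) = \<one>\<^bsub>pob ?Q X\<^esub>" if "X \<in> Ob A" "x \<in> pim F u X" for X x
    using quotient(3)[OF sp that(1)] pmapD(4)[OF n' that(1)] that(2) unfolding pim_def[of ?I] by auto
  then have z: "parr A ?K (\<lambda>X x. ?\<pi> X (n X x)) ?Q \<cdot>\<^bsub>B\<^esub> parr A ?I (\<lambda>X x. x) ?K = Zr B ?I ?Q"
    by (simp add: B_simps parr_Cmp[OF e] parr_eq_iff)
  have ar: "parr A ?K (\<lambda>X x. ?\<pi> X (n X x)) ?Q \<in> Ar B" using \<pi>n hK hQ unfolding Ar_B by blast
  have "\<And>t. t \<in> Ar B \<Longrightarrow> Dom B t = ?K \<Longrightarrow> t \<cdot>\<^bsub>B\<^esub> parr A ?I (\<lambda>X x. x) ?K = Zr B ?I (Cod B t) \<Longrightarrow>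
     \<exists>!s. s \<in> Hom B ?Q (Cod B t) \<and> s \<cdot>\<^bsub>B\<^esub> parr A ?K ?\<pi> ?Q = t"
    using coker unfolding is_cokernel_def by (simp add: B_simps)
  from this[OF ar] obtain h where h: "h \<in> Hom B ?Q ?Q" "h \<cdot>\<^bsub>B\<^esub> parr A ?K ?\<pi> ?Q = parr A ?K (\<lambda>X x. ?\<pi> X (n X x)) ?Q"
    using z by (auto simp: B_simps)
  have "homology_endo B (parr A F u G) (parr A G v K') (parr A G n G) h"
    unfolding homology_endo_def
  proof (intro exI conjI)
    show "is_kernel B (parr A G v K') (parr A ?K (\<lambda>X x. x) G)" by (rule kern)
    show "is_image B (parr A F u G) (parr A ?I (\<lambda>X x. x) G)" by (rule imageI_B[OF H(1,2) u])
    show "parr A ?I (\<lambda>X x. x) ?K \<in> Hom B (Dom B (parr A ?I (\<lambda>X x. x) G)) (Dom B (parr A ?K (\<lambda>X x. x) G))"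
      using hI hK e by (auto simp: B_simps Hom_B)
    show "parr A ?K (\<lambda>X x. x) G \<cdot>\<^bsub>B\<^esub> parr A ?I (\<lambda>X x. x) ?K = parr A ?I (\<lambda>X x. x) G"
      by (simp add: B_simps parr_Cmp[OF e])
    show "is_cokernel B (parr A ?I (\<lambda>X x. x) ?K) (parr A ?K ?\<pi> ?Q)" by (rule coker)
    show "parr A ?K n ?K \<in> Hom B (Dom B (parr A ?K (\<lambda>X x. x) G)) (Dom B (parr A ?K (\<lambda>X x. x) G))"
      using hK \<kappa> by (auto simp: B_simps Hom_B)
    show "parr A ?K (\<lambda>X x. x) G \<cdot>\<^bsub>B\<^esub> parr A ?K n ?K = parr A G n G \<cdot>\<^bsub>B\<^esub> parr A ?K (\<lambda>X x. x) G"
      by (simp add: B_simps parr_Cmp[OF k] parr_Cmp[OF \<kappa>])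
    show "h \<in> Hom B (Cod B (parr A ?K ?\<pi> ?Q)) (Cod B (parr A ?K ?\<pi> ?Q))" using h(1) by (simp add: B_simps)
    show "h \<cdot>\<^bsub>B\<^esub> parr A ?K ?\<pi> ?Q = parr A ?K ?\<pi> ?Q \<cdot>\<^bsub>B\<^esub> parr A ?K n ?K"
      unfolding h(2) by (simp add: B_simps parr_Cmp[OF \<kappa>])
  qed
  then show ?thesis by blast
qed

end

section \<open>The homological functor on a category with a weight structure\<close>

context tricategory
begin

lemma shift_shift: "X \<in> Ob C \<Longrightarrow> shift C k (shift C l X) = shift C (k + l) X"
proof (induction k rule: int_induct[of _ 0])
  case base
  then show ?case by (simp add: shift_def)
next
  case (step1 i)
  then show ?case using shift_add1(1,2)[of "shift C l X" i] shift_add1(1)[of X l] shift_add1(2)[of X "i + l"]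
    by (simp add: ac_simps)
next
  case (step2 i)
  then show ?case using shift_add1(1,3)[of "shift C l X" i] shift_add1(1)[of X l] shift_add1(3)[of X "i + l"]
    by (simp add: algebra_simps)
qed

lemma shift_Sh: "X \<in> Ob C \<Longrightarrow> shift C k (Sh C X) = shift C (k + 1) X"
  using shift_shift[of X k 1] by (simp add: shift_def)

lemma shift_arr_ShA:
  assumes f: "f \<in> Hom C X Y" shows "shift_arr C k (ShA C f) = shift_arr C (k + 1) f"
proof -
  have Sf: "ShA C f \<in> Hom C (Sh C X) (Sh C Y)" using f by (auto simp: in_Hom)
  have a: "shift_arr C k f \<in> Ar C" for k using shift_arr_Hom(1)[OF f] by (auto simp: in_Hom)
  show ?thesis
  proof (induction k rule: int_induct[of _ 0])
    case base
    then show ?case by (simp add: shift_arr_def)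
  next
    case (step1 i)
    then show ?case using shift_arr_add1[OF Sf, of i] shift_arr_add1[OF f, of "i + 1"] by simp
  next
    case (step2 i)
    then show ?case using shift_arr_diff1[OF Sf, of i] shift_arr_diff1[OF f, of "i + 1"] by simp
  qed
qed

end

locale weighted_yoneda = weighted C Wle Wge for C :: "('o, 'm) tricat" (structure) and Wle Wge +
  fixes j :: "'m \<Rightarrow> 'u"
  assumes inj_j: "inj j"
begin

abbreviation "A \<equiv> heart C Wle Wge"

lemma Ob_A: "Ob A = Wge \<inter> Wle" and Cmp_A: "Cmp A = Cmp C" and Zr_A: "Zr A = Zr C" and Add_A: "Add A = Add C"
  and Dom_A: "Dom A = Dom C" and Cod_A: "Cod A = Cod C" and Idn_A: "Idn A = Idn C"
  by (simp_all add: heart_def)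

lemma Hom_A: "Hom A P Q = (if P \<in> Wge \<inter> Wle \<and> Q \<in> Wge \<inter> Wle then Hom C P Q else {})"
  unfolding heart_def by (rule Hom_full_sub)

sublocale Y: yoneda_category A j
proof -
  interpret H: preadd A unfolding heart_def by (rule preadd_full_sub) (auto simp: Wle_Ob)
  show "yoneda_category A j" by unfold_locales (rule inj_j)
qed

definition dec :: "'o \<Rightarrow> 'm" where "dec X = (SOME a. wdec a \<and> Dom C a = X)"

lemma dec: "X \<in> Ob C \<Longrightarrow> wdec (dec X)" "X \<in> Ob C \<Longrightarrow> Dom C (dec X) = X"
  using someI_ex[OF wdec_exists[of X]] by (auto simp: dec_def)

text \<open>A choice, functorial neither in composites nor in sums. Only its action on
  \<open>Hset\<close> is used, and there every map with the same composite with \<open>dec\<close>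
  acts in the same way (\<open>lift_unique\<close>).\<close>

definition lift :: "'m \<Rightarrow> 'm" where
  "lift g = (SOME m. m \<in> Hom C (Cod C (dec (Dom C g))) (Cod C (dec (Cod C g))) \<and> m \<cdot> dec (Dom C g) = dec (Cod C g) \<cdot> g)"

lemma lift:
  assumes g: "g \<in> Hom C X X'"
  shows "lift g \<in> Hom C (Cod C (dec X)) (Cod C (dec X'))" "lift g \<cdot> dec X = dec X' \<cdot> g"
proof -
  have [simp]: "X \<in> Ob C" "X' \<in> Ob C" using g by (auto simp: in_Hom)
  note [simp] = HomD[OF g]
  have "\<exists>m. m \<in> Hom C (Cod C (dec X)) (Cod C (dec X')) \<and> m \<cdot> dec X = dec X' \<cdot> g"
    by (rule wdec_lift[of "dec X" "Cod C (dec X')" "dec X' \<cdot> g"]) (auto simp: dec in_Hom)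
  from someI_ex[OF this]
  show "lift g \<in> Hom C (Cod C (dec X)) (Cod C (dec X'))" "lift g \<cdot> dec X = dec X' \<cdot> g"
    by (auto simp: lift_def)
qed

definition Hob :: "'o \<Rightarrow> ('o, 'm, 'u) presheaf" where
  "Hob X = hsub j C (Cod C (dec X)) (Hset (dec X))"

definition Har :: "'m \<Rightarrow> 'o \<Rightarrow> 'u \<Rightarrow> 'u" where
  "Har g P x = j (lift g \<cdot> the_inv j x)"

lemma Hob_simps [simp]:
  "carrier (pob (Hob X) P) = j ` Hset (dec X) P" "one (pob (Hob X) P) = j (Zr C P (Cod C (dec X)))"
  "monoid.mult (pob (Hob X) P) (j x) (j y) = j (Add C x y)" "par (Hob X) f (j x) = j (x \<cdot> f)"
  "Har g P (j x) = j (lift g \<cdot> x)"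
  using inj_j by (auto simp: Hob_def Har_def the_inv_f_f)

lemma Hob_presheaf:
  assumes X: "X \<in> Ob C" shows "is_presheaf A (Hob X)"
  unfolding heart_def Hob_def
proof (rule hsub_presheaf[OF inj_j])
  have a: "dec X \<in> Ar C" "Cod C (dec X) \<in> Ob C" using dec(1)[OF X] Wle_Ob by auto
  show "Wge \<inter> Wle \<subseteq> Ob C" by (auto simp: Wle_Ob)
  show "Cod C (dec X) \<in> Ob C" by (rule a(2))
  fix P assume "P \<in> Wge \<inter> Wle"
  then have P: "P \<in> Ob C" by (auto simp: Wle_Ob)
  show "Zr C P (Cod C (dec X)) \<in> Hset (dec X) P" by (rule Hset_Zr[OF a(1) P])
  fix y assume y: "y \<in> Hset (dec X) P"
  show "y \<in> Hom C P (Cod C (dec X))" by (rule Hset_Hom[OF y])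
  show "neg C y \<in> Hset (dec X) P" by (rule Hset_neg[OF a(1) y])
  fix z assume "z \<in> Hset (dec X) P"
  then show "Add C y z \<in> Hset (dec X) P" by (rule Hset_Add[OF a(1) y])
next
  fix P P' f y assume "f \<in> Hom C P' P" "y \<in> Hset (dec X) P"
  then show "y \<cdot> f \<in> Hset (dec X) P'" using dec(1)[OF X] by (intro Hset_precomp) auto
qed

lemma Har_pmap:
  assumes g: "g \<in> Hom C X X'" shows "pmap A (Hob X) (Har g) (Hob X')"
proof -
  have [simp]: "X \<in> Ob C" "X' \<in> Ob C" using g by (auto simp: in_Hom)
  note m = lift[OF g]
  have post: "lift g \<cdot> y \<in> Hset (dec X') P" if "y \<in> Hset (dec X) P" for y P
    by (rule Hset_postcomp[OF that]) (use m g in \<open>auto simp: dec\<close>)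
  show ?thesis unfolding pmap_def
  proof (intro conjI ballI allI)
    show "is_presheaf A (Hob X)" "is_presheaf A (Hob X')" by (auto intro: Hob_presheaf)
    fix P assume "P \<in> Ob A"
    show "Har g P \<in> hom (pob (Hob X) P) (pob (Hob X') P)"
    proof (rule homI)
      fix x assume "x \<in> carrier (pob (Hob X) P)" then obtain x' where x: "x = j x'" "x' \<in> Hset (dec X) P" by auto
      then show "Har g P x \<in> carrier (pob (Hob X') P)" using post by simp
      fix z assume "z \<in> carrier (pob (Hob X) P)" then obtain z' where z: "z = j z'" "z' \<in> Hset (dec X) P" by auto
      show "Har g P (x \<otimes>\<^bsub>pob (Hob X) P\<^esub> z) = Har g P x \<otimes>\<^bsub>pob (Hob X') P\<^esub> Har g P z"
        using HomD[OF m(1)] HomD[OF Hset_Hom[OF x(2)]] HomD[OF Hset_Hom[OF z(2)]] x(1) z(1) by (simp add: Cmp_Add)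
    qed
  next
    fix P P' f x assume f: "f \<in> Hom A P P'" and "x \<in> carrier (pob (Hob X) P')"
    then obtain x' where x: "x = j x'" "x' \<in> Hset (dec X) P'" by auto
    have f: "f \<in> Hom C P P'" using f by (auto simp: Hom_A split: if_splits)
    show "Har g P (par (Hob X) f x) = par (Hob X') f (Har g P' x)"
      using HomD[OF f] HomD[OF m(1)] HomD[OF Hset_Hom[OF x(2)]] x(1) by (simp add: Cmp_assoc)
  qed
qed

lemma lift_unique:
  assumes g: "g \<in> Hom C X X'" and y: "y \<in> Hset (dec X) P"
    and m: "m \<in> Hom C (Cod C (dec X)) (Cod C (dec X'))" "m \<cdot> dec X = dec X' \<cdot> g"
  shows "lift g \<cdot> y = m \<cdot> y"
proof -
  have [simp]: "X \<in> Ob C" "X' \<in> Ob C" using g by (auto simp: in_Hom)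
  show ?thesis by (rule Hset_postcomp_unique[OF y _ _ lift(1)[OF g] m(1)]) (simp_all add: dec lift(2)[OF g] m(2))
qed

text \<open>The product of the chosen lifts is itself a lift of the composite, and lifts have only
  one action on \<open>Hset\<close>.\<close>

lemma Har_Cmp:
  assumes f: "f \<in> Hom C X Y" and g: "g \<in> Hom C Y Z" and x: "x \<in> carrier (pob (Hob X) P)"
  shows "Har g P (Har f P x) = Har (g \<cdot> f) P x"
proof -
  obtain y where y: "x = j y" "y \<in> Hset (dec X) P" using x by auto
  have o: "X \<in> Ob C" "Y \<in> Ob C" "Z \<in> Ob C" using f g by (auto simp: in_Hom)
  note [simp] = HomD[OF lift(1)[OF f]] HomD[OF lift(1)[OF g]] HomD[OF f] HomD[OF g] HomD[OF Hset_Hom[OF y(2)]] dec(1)[OF o(1)] dec(1)[OF o(2)] dec(1)[OF o(3)]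
    dec(2)[OF o(1)] dec(2)[OF o(2)] dec(2)[OF o(3)]
  have gf: "g \<cdot> f \<in> Hom C X Z" using f g by auto
  have "(lift g \<cdot> lift f) \<cdot> dec X = (lift g \<cdot> dec Y) \<cdot> f"
    by (simp add: Cmp_assoc lift(2)[OF f])
  also have "\<dots> = dec Z \<cdot> (g \<cdot> f)" unfolding lift(2)[OF g] by (simp add: Cmp_assoc)
  finally have "lift (g \<cdot> f) \<cdot> y = (lift g \<cdot> lift f) \<cdot> y"
    by (intro lift_unique[OF gf y(2)]) (auto simp: in_Hom)
  then show ?thesis using y(1) by (simp add: Cmp_assoc)
qed

lemma Har_exact:
  assumes uv: "weak_exact u v" and u: "u \<in> Hom C X Y" and v: "v \<in> Hom C Y Z" and P: "P \<in> Ob A"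
  shows "Y.pker (Hob Y) (Har v) (Hob Z) P = Y.pim (Hob X) (Har u) P"
proof -
  have o: "X \<in> Ob C" "Y \<in> Ob C" "Z \<in> Ob C" using u v by (auto simp: in_Hom)
  have [simp]: "P \<in> Ob C" using P by (auto simp: Ob_A Wle_Ob)
  note [simp] = HomD[OF lift(1)[OF u]] HomD[OF lift(1)[OF v]] HomD[OF u] HomD[OF v] dec(1)[OF o(1)] dec(1)[OF o(2)] dec(1)[OF o(3)]
    dec(2)[OF o(1)] dec(2)[OF o(2)] dec(2)[OF o(3)]
  show ?thesis
  proof
    show "Y.pker (Hob Y) (Har v) (Hob Z) P \<subseteq> Y.pim (Hob X) (Har u) P"
    proof
      fix x assume "x \<in> Y.pker (Hob Y) (Har v) (Hob Z) P"
      then obtain y where y: "x = j y" "y \<in> Hset (dec Y) P" "lift v \<cdot> y = Zr C P (Cod C (dec Z))"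
        using inj_j by (auto simp: Y.pker_def dest: injD)
      obtain z where "z \<in> Hset (dec X) P" "y = lift u \<cdot> z"
        using Hset_exact[OF uv _ _ _ _ _ _ lift(1)[OF u] lift(2)[OF u] lift(1)[OF v] lift(2)[OF v] y(2,3)] by auto
      then show "x \<in> Y.pim (Hob X) (Har u) P" using y(1) by (auto simp: Y.pim_def image_image)
    qed
    show "Y.pim (Hob X) (Har u) P \<subseteq> Y.pker (Hob Y) (Har v) (Hob Z) P"
    proof
      fix x assume "x \<in> Y.pim (Hob X) (Har u) P"
      then obtain y where y: "x = j (lift u \<cdot> y)" "y \<in> Hset (dec X) P" by (auto simp: Y.pim_def)
      have vu: "v \<cdot> u = Zr C X Z" using uv by (simp add: weak_exact_def)
      have "Zr C (Cod C (dec X)) (Cod C (dec Z)) \<cdot> dec X = dec Z \<cdot> (v \<cdot> u)" unfolding vu using o by (simp add: Wle_Ob)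
      then have "lift (v \<cdot> u) \<cdot> y = Zr C (Cod C (dec X)) (Cod C (dec Z)) \<cdot> y"
        using lift_unique[OF Cmp_Hom[OF u v] y(2), of "Zr C (Cod C (dec X)) (Cod C (dec Z))"] by (auto simp: Wle_Ob in_Hom)
      also have "\<dots> = Zr C P (Cod C (dec Z))" using HomD[OF Hset_Hom[OF y(2)]] by (simp add: Wle_Ob)
      finally have "Har v P (Har u P (j y)) = j (Zr C P (Cod C (dec Z)))"
        using Har_Cmp[OF u v, of "j y" P] y(2) by simp
      then show "x \<in> Y.pker (Hob Y) (Har v) (Hob Z) P"
        using y pmapD(4)[OF Har_pmap[OF u] P, of "j y"] by (simp add: Y.pker_def)
    qed
  qed
qed

end

section \<open>Comparison with the homology of the weight complex\<close>

context weighted_yoneda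
begin

lemma yoneda_arr_A:
  "yoneda_arr j A f = parr A (yoneda j A (Dom C f)) (\<lambda>P u. j (f \<cdot> the_inv j u)) (yoneda j A (Cod C f))"
  using Y.yoneda_arr_parr[of f] by (simp only: Cmp_A Dom_A Cod_A)

lemma y_pmap_A:
  assumes "f \<in> Hom C P Q" "P \<in> Wge \<inter> Wle" "Q \<in> Wge \<inter> Wle"
  shows "pmap A (yoneda j A P) (\<lambda>P u. j (f \<cdot> the_inv j u)) (yoneda j A Q)"
  using Y.y_pmap[of f P Q] assms by (simp only: Cmp_A Hom_A if_True conj_ac refl HOL.simp_thms)

lemma y_hull: "P \<in> Wge \<inter> Wle \<Longrightarrow> yoneda j A P \<in> Y.hull"
  by (rule abelian_hull.base) (simp add: Ob_A)

declare Zr_A [simp] Add_A [simp] Cmp_A [simp]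

end

locale weight_postnikov_yoneda = weighted_yoneda C Wle Wge j + weight_postnikov C Wle Wge X T
  for C :: "('o, 'm) tricat" (structure) and Wle Wge and j :: "'m \<Rightarrow> 'u" and X T
begin

lemma tG_heart [simp]: "tG T i \<in> Wge \<inter> Wle"
  by simp

lemma diff_Hom: "weight_complex_diff C T i \<in> Hom C (tG T i) (tG T (i + 1))"
  by (simp add: weight_complex_diff_def in_Hom)

lemma diff_Hom': "weight_complex_diff C T (i - 1) \<in> Hom C (tG T (i - 1)) (tG T i)"
  using diff_Hom[of "i - 1"] by simp

abbreviation \<delta> :: "int \<Rightarrow> 'o \<Rightarrow> 'u \<Rightarrow> 'u" where
  "\<delta> i P \<equiv> (\<lambda>u. j (weight_complex_diff C T i \<cdot> the_inv j u))"

text \<open>\<open>K\<close> and \<open>M\<close> are left general because homology may be formed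
  with any choice of kernel and cokernel. The tower carries its own decomposition
  \<open>ta T i\<close> of X[i]; it is compared with the chosen one by \<open>m\<close> and
  \<open>m'\<close>, which are mutually inverse on \<open>Hset\<close>. Then \<open>M\<close> and
  \<open>H(X[i])\<close> are quotients of the cycles with the same kernel, and
  \<open>cl_compare\<close> applies.\<close>

lemma tower_comparison:
  assumes K: "K \<in> Y.hull" "M \<in> Y.hull" and k: "pmap A K k (yoneda j A (tG T i))" and p: "pmap A K \<pi> M"
    and kinj: "\<And>P. P \<in> Ob A \<Longrightarrow> inj_on (k P) (carrier (pob K P))"
    and kim: "\<And>P. P \<in> Ob A \<Longrightarrow> k P ` carrier (pob K P) =
      {x \<in> carrier (pob (yoneda j A (tG T i)) P). \<delta> i P x = \<one>\<^bsub>pob (yoneda j A (tG T (i + 1))) P\<^esub>}"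
    and psurj: "\<And>P. P \<in> Ob A \<Longrightarrow> \<pi> P ` carrier (pob K P) = carrier (pob M P)"
    and pker: "\<And>P. P \<in> Ob A \<Longrightarrow> Y.pker K \<pi> M P =
      {x \<in> carrier (pob K P). k P x \<in> \<delta> (i - 1) P ` carrier (pob (yoneda j A (tG T (i - 1))) P)}"
  shows "Hob (shift C i X) \<in> Y.hull" "Y.trivial M \<longleftrightarrow> Y.trivial (Hob (shift C i X))"
    and "tower_endo C T g gL gR gG \<Longrightarrow> g \<in> Hom C X X \<Longrightarrow> pmap A K \<kappa> K \<Longrightarrow> pmap A M \<eta> M
      \<Longrightarrow> (\<And>P x. P \<in> Ob A \<Longrightarrow> x \<in> carrier (pob K P) \<Longrightarrow> k P (\<kappa> P x) = j (gG i \<cdot> the_inv j (k P x)))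
      \<Longrightarrow> (\<And>P x. P \<in> Ob A \<Longrightarrow> x \<in> carrier (pob K P) \<Longrightarrow> \<eta> P (\<pi> P x) = \<pi> P (\<kappa> P x))
      \<Longrightarrow> Y.cl M \<eta> = Y.cl (Hob (shift C i X)) (Har (shift_arr C i g))"
proof -
  define a where "a = dec (shift C i X)"
  have a: "wdec a" "Dom C a = shift C i X" using dec[of "shift C i X"] by (auto simp: a_def)
  note [simp] = a wdecD[OF a(1)] Wle_Ob[OF wdecD(2)[OF a(1)]]
  obtain m where m: "m \<in> Hom C (tL T i) (Cod C a)" "m \<cdot> ta T i = a"
    using wdec_lift[of "ta T i" "Cod C a" a] by (auto simp: in_Hom)
  obtain m' where m': "m' \<in> Hom C (Cod C a) (tL T i)" "m' \<cdot> a = ta T i"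
    using wdec_lift[of a "tL T i" "ta T i"] by (auto simp: in_Hom)
  note [simp] = HomD[OF m(1)] HomD[OF m'(1)]
  have mto: "m \<cdot> y \<in> Hset a P" if "y \<in> Hset (ta T i) P" for y P
    by (rule Hset_postcomp[OF that, of _ _ "Idn C (shift C i X)"]) (auto simp: m in_Hom)
  have mfrom: "m' \<cdot> y \<in> Hset (ta T i) P" if "y \<in> Hset a P" for y P
    by (rule Hset_postcomp[OF that, of _ _ "Idn C (shift C i X)"]) (auto simp: m' in_Hom)
  have m'm: "m' \<cdot> (m \<cdot> y) = y" if y: "y \<in> Hset (ta T i) P" for y P
  proof -
    note [simp] = HomD[OF Hset_Hom[OF y]]
    have "(m' \<cdot> m) \<cdot> y = Idn C (tL T i) \<cdot> y"
      by (rule Hset_postcomp_unique[OF y, of "tL T i"]) (auto simp: in_Hom Cmp_assoc m(2) m'(2))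
    then show ?thesis by (simp add: Cmp_assoc)
  qed
  have mm': "m \<cdot> (m' \<cdot> y) = y" if y: "y \<in> Hset a P" for y P
  proof -
    note [simp] = HomD[OF Hset_Hom[OF y]]
    have "(m \<cdot> m') \<cdot> y = Idn C (Cod C a) \<cdot> y"
      by (rule Hset_postcomp_unique[OF y, of "Cod C a"]) (auto simp: in_Hom Cmp_assoc m(2) m'(2))
    then show ?thesis by (simp add: Cmp_assoc)
  qed
  \<comment> \<open>The map from cycles to \<open>H(X[i])\<close>: read an element of
    \<open>K\<close> as a cycle, apply \<open>td T i\<close>, and pass to the chosen
    decomposition.\<close>
  define \<rho> where "\<rho> P x = j (m \<cdot> (td T i \<cdot> the_inv j (k P x)))" for P x
  have cyc: "\<exists>z. k P x = j z \<and> z \<in> Hom C P (tG T i) \<and> weight_complex_diff C T i \<cdot> z = Zr C P (tG T (i + 1))"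
    if P: "P \<in> Ob A" and x: "x \<in> carrier (pob K P)" for P x
  proof -
    have "k P x \<in> {x \<in> carrier (pob (yoneda j A (tG T i)) P). \<delta> i P x = \<one>\<^bsub>pob (yoneda j A (tG T (i + 1))) P\<^esub>}"
      using x kim[OF P] by blast
    then show ?thesis using P by (auto simp: Hom_A Ob_A split: if_splits)
  qed
  have PO: "P \<in> Ob C" "P \<in> Wge" if "P \<in> Ob A" for P using that by (auto simp: Ob_A Wle_Ob)
  have \<rho>: "pmap A K \<rho> (Hob (shift C i X))"
    unfolding pmap_def
  proof (intro conjI ballI allI)
    show "is_presheaf A K" by (rule pmapD(1)[OF k])
    show "is_presheaf A (Hob (shift C i X))" by (rule Hob_presheaf) simp
    fix P assume P: "P \<in> Ob A"
    show "\<rho> P \<in> hom (pob K P) (pob (Hob (shift C i X)) P)"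
    proof (rule homI)
      fix x assume x: "x \<in> carrier (pob K P)"
      obtain z where z: "k P x = j z" "z \<in> Hom C P (tG T i)" "weight_complex_diff C T i \<cdot> z = Zr C P (tG T (i + 1))"
        using cyc[OF P x] by blast
      show "\<rho> P x \<in> carrier (pob (Hob (shift C i X)) P)"
        using mto[OF cycle_Hset[OF z(2,3)]] by (simp add: \<rho>_def z(1) a_def)
      fix x' assume x': "x' \<in> carrier (pob K P)"
      obtain z' where z': "k P x' = j z'" "z' \<in> Hom C P (tG T i)" "weight_complex_diff C T i \<cdot> z' = Zr C P (tG T (i + 1))"
        using cyc[OF P x'] by blast
      note [simp] = HomD[OF z(2)] HomD[OF z'(2)]
      have "k P (x \<otimes>\<^bsub>pob K P\<^esub> x') = j (Add C z z')"
        using hom_mult[OF pmapD(3)[OF k P] x x'] by (simp add: z(1) z'(1))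
      then show "\<rho> P (x \<otimes>\<^bsub>pob K P\<^esub> x') = \<rho> P x \<otimes>\<^bsub>pob (Hob (shift C i X)) P\<^esub> \<rho> P x'"
        by (simp add: \<rho>_def z(1) z'(1) Cmp_Add)
    qed
  next
    fix P Q f x assume f: "f \<in> Hom A P Q" and x: "x \<in> carrier (pob K Q)"
    have Q: "Q \<in> Ob A" "f \<in> Hom C P Q" using f by (auto simp: Hom_A Ob_A split: if_splits)
    obtain z where z: "k Q x = j z" "z \<in> Hom C Q (tG T i)" using cyc[OF Q(1) x] by blast
    show "\<rho> P (par K f x) = par (Hob (shift C i X)) f (\<rho> Q x)"
      using pmapD(5)[OF k f x] HomD[OF Q(2)] HomD[OF z(2)] by (simp add: \<rho>_def z(1) Cmp_assoc)
  qed
  have \<rho>surj: "\<rho> P ` carrier (pob K P) = carrier (pob (Hob (shift C i X)) P)" if P: "P \<in> Ob A" for P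
  proof
    show "\<rho> P ` carrier (pob K P) \<subseteq> carrier (pob (Hob (shift C i X)) P)" using pmapD(4)[OF \<rho> P] by blast
    show "carrier (pob (Hob (shift C i X)) P) \<subseteq> \<rho> P ` carrier (pob K P)"
    proof
      fix x assume "x \<in> carrier (pob (Hob (shift C i X)) P)"
      then obtain y where y: "x = j y" "y \<in> Hset a P" by (auto simp: a_def)
      obtain z where z: "z \<in> Hom C P (tG T i)" "m' \<cdot> y = td T i \<cdot> z" "weight_complex_diff C T i \<cdot> z = Zr C P (tG T (i + 1))"
        using Hset_cycle[OF mfrom[OF y(2)] PO(2)[OF P]] by blast
      have "j z \<in> k P ` carrier (pob K P)"
        unfolding kim[OF P] using z P by (simp add: Hom_A Ob_A)
      then obtain x' where "x' \<in> carrier (pob K P)" "k P x' = j z" by force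
      moreover from this have "\<rho> P x' = x" using mm'[OF y(2)] y(1) z(2) by (simp add: \<rho>_def)
      ultimately show "x \<in> \<rho> P ` carrier (pob K P)" by blast
    qed
  qed
  have ker: "Y.pker K \<pi> M P = Y.pker K \<rho> (Hob (shift C i X)) P" if P: "P \<in> Ob A" for P
  proof -
    have "k P x \<in> \<delta> (i - 1) P ` carrier (pob (yoneda j A (tG T (i - 1))) P) \<longleftrightarrow> \<rho> P x = \<one>\<^bsub>pob (Hob (shift C i X)) P\<^esub>"
      if x: "x \<in> carrier (pob K P)" for x
    proof -
      obtain z where z: "k P x = j z" "z \<in> Hom C P (tG T i)" "weight_complex_diff C T i \<cdot> z = Zr C P (tG T (i + 1))"
        using cyc[OF P x] by blast
      note [simp] = HomD[OF z(2)] PO(1)[OF P]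
      have "\<rho> P x = \<one>\<^bsub>pob (Hob (shift C i X)) P\<^esub> \<longleftrightarrow> m \<cdot> (td T i \<cdot> z) = Zr C P (Cod C a)"
        by (simp add: \<rho>_def z(1) a_def)
      also have "\<dots> \<longleftrightarrow> td T i \<cdot> z = Zr C P (tL T i)"
      proof
        assume e: "m \<cdot> (td T i \<cdot> z) = Zr C P (Cod C a)"
        have "td T i \<cdot> z = m' \<cdot> (m \<cdot> (td T i \<cdot> z))" using m'm[OF cycle_Hset[OF z(2,3)]] by simp
        also have "\<dots> = Zr C P (tL T i)" unfolding e by simp
        finally show "td T i \<cdot> z = Zr C P (tL T i)" .
      qed simp
      also have "\<dots> \<longleftrightarrow> (\<exists>s\<in>Hom C P (tG T (i - 1)). z = weight_complex_diff C T (i - 1) \<cdot> s)"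
        by (rule boundary_iff[OF z(2) PO(2)[OF P]])
      also have "\<dots> \<longleftrightarrow> k P x \<in> \<delta> (i - 1) P ` carrier (pob (yoneda j A (tG T (i - 1))) P)"
        using P by (auto simp: z(1) Hom_A Ob_A image_image)
      finally show ?thesis by blast
    qed
    then show ?thesis unfolding pker[OF P] by (auto simp: Y.pker_def)
  qed
  note cmp = Y.cl_compare[OF K p \<rho> psurj \<rho>surj ker]
  show "Hob (shift C i X) \<in> Y.hull" using cmp(1) by simp
  show "Y.trivial M \<longleftrightarrow> Y.trivial (Hob (shift C i X))" using cmp(2) by simp
  assume te: "tower_endo C T g gL gR gG" and g: "g \<in> Hom C X X" and \<kappa>: "pmap A K \<kappa> K" and \<eta>: "pmap A M \<eta> M"
    and k\<kappa>: "\<And>P x. P \<in> Ob A \<Longrightarrow> x \<in> carrier (pob K P) \<Longrightarrow> k P (\<kappa> P x) = j (gG i \<cdot> the_inv j (k P x))"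
    and \<eta>\<pi>: "\<And>P x. P \<in> Ob A \<Longrightarrow> x \<in> carrier (pob K P) \<Longrightarrow> \<eta> P (\<pi> P x) = \<pi> P (\<kappa> P x)"
  have gi: "shift_arr C i g \<in> Hom C (shift C i X) (shift C i X)" by (rule shift_arr_Hom[OF g])
  have t: "gL i \<in> Hom C (tL T i) (tL T i)" "gG i \<in> Hom C (tG T i) (tG T i)" "gL i \<cdot> ta T i = ta T i \<cdot> shift_arr C i g"
    "gL i \<cdot> td T i = td T i \<cdot> gG i"
    using te unfolding tower_endo_def by auto
  have l: "lift (shift_arr C i g) \<in> Hom C (Cod C a) (Cod C a)" "lift (shift_arr C i g) \<cdot> a = a \<cdot> shift_arr C i g"
    using lift[OF gi] by (auto simp: a_def)
  note [simp] = HomD[OF t(1)] HomD[OF t(2)] HomD[OF l(1)] HomD[OF gi]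
  have "Har (shift_arr C i g) P (\<rho> P x) = \<rho> P (\<kappa> P x)" if P: "P \<in> Ob A" and x: "x \<in> carrier (pob K P)" for P x
  proof -
    obtain z where z: "k P x = j z" "z \<in> Hom C P (tG T i)" "weight_complex_diff C T i \<cdot> z = Zr C P (tG T (i + 1))"
      using cyc[OF P x] by blast
    note [simp] = HomD[OF z(2)]
    \<comment> \<open>The chosen lift and \<open>gL i\<close> need not correspond under
      \<open>m\<close>; they agree only after precomposition with \<open>ta T i\<close>. On the
      elements of \<open>Hset\<close> given by cycles this suffices.\<close>
    have "(lift (shift_arr C i g) \<cdot> m) \<cdot> ta T i = (m \<cdot> gL i) \<cdot> ta T i"
      by (simp add: Cmp_assoc m(2) l(2) t(3)) (simp add: m(2) flip: Cmp_assoc)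
    then have "(lift (shift_arr C i g) \<cdot> m) \<cdot> (td T i \<cdot> z) = (m \<cdot> gL i) \<cdot> (td T i \<cdot> z)"
      by (intro Hset_postcomp_unique[OF cycle_Hset[OF z(2,3)], of "Cod C a"]) (auto simp: in_Hom)
    also have "\<dots> = m \<cdot> (td T i \<cdot> (gG i \<cdot> z))"
      using Cmp_rewrite[OF t(4)] by (simp add: Cmp_assoc)
    finally show ?thesis using k\<kappa>[OF P x] by (simp add: \<rho>_def z(1) Cmp_assoc)
  qed
  then show "Y.cl M \<eta> = Y.cl (Hob (shift C i X)) (Har (shift_arr C i g))"
    using cmp(3)[OF _ _ _ \<kappa> \<eta> Har_pmap[OF gi] \<eta>\<pi>] by simp
qed

end

context weighted_yoneda
begin

text \<open>The tower is taken from \<open>tower_exists\<close>, because extending \<open>g\<close>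
  to it relies on the octahedral identity supplied there.\<close>

lemma weight_homology_exists:
  assumes g: "g \<in> Hom C X X"
  shows "\<exists>h. weight_homology_endo j C Wle Wge g h"
proof -
  have X: "X \<in> Ob C" and D: "Dom C g = X" using g by (auto simp: in_Hom)
  obtain T where T: "weight_tower C Wle Wge X T" "\<And>k. td T k \<cdot> ty T k = ta T k \<cdot> tb T (k - 1)"
    using tower_exists[OF X] by blast
  interpret T: weight_postnikov_yoneda C Wle Wge j X T
    by unfold_locales (fact T(1), fact X)
  obtain gL gR gG where te: "tower_endo C T g gL gR gG"
    using T.tower_endo_exists[OF T(2) g] by blast
  have G: "gG i \<in> Hom C (tG T i) (tG T i)" and gc: "gG i \<cdot> tc T i = tc T i \<cdot> gL (i - 1)"
    and gd: "gL i \<cdot> td T i = td T i \<cdot> gG i" and gL: "gL i \<in> Hom C (tL T i) (tL T i)" for i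
    using te unfolding tower_endo_def by auto
  have dd: "weight_complex_diff C T i \<cdot> weight_complex_diff C T (i - 1) = Zr C (tG T (i - 1)) (tG T (i + 1))" for i
    using Cmp_rewrite[OF T.tower_zero(4)[of i], of "td T (i - 1)"] by (simp add: weight_complex_diff_def Cmp_assoc)
  have gdiff: "gG (i + 1) \<cdot> weight_complex_diff C T i = weight_complex_diff C T i \<cdot> gG i" for i
    using HomD[OF G[of i]] HomD[OF G[of "i + 1"]] HomD[OF gL[of i]] gc[of "i + 1"] gd[of i]
      Cmp_rewrite[OF gc[of "i + 1"], of "td T i"] by (simp add: weight_complex_diff_def Cmp_assoc)
  have "\<exists>h. homology_endo Y.B (yoneda_arr j A (weight_complex_diff C T (i - 1)))
      (yoneda_arr j A (weight_complex_diff C T i)) (yoneda_arr j A (gG i)) h" for i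
  proof -
    note [simp] = HomD[OF T.diff_Hom[of i]] HomD[OF T.diff_Hom'[of i]] HomD[OF G]
    note pm = y_pmap_A[OF T.diff_Hom'[of i] T.tG_heart T.tG_heart] y_pmap_A[OF T.diff_Hom[of i] T.tG_heart T.tG_heart]
      y_pmap_A[OF G T.tG_heart T.tG_heart]
    have Zc: "P \<in> Ob C" if "P \<in> Ob A" for P using that by (auto simp: Ob_A Wle_Ob)
    have el: "\<exists>f. x = j f \<and> f \<in> Hom C P Q" if "x \<in> carrier (pob (yoneda j A Q) P)" for x P Q
      using that by (auto simp: Hom_A split: if_splits)
    show ?thesis unfolding yoneda_arr_A HomD[OF T.diff_Hom[of i]] HomD[OF T.diff_Hom'[of i]] HomD[OF G]
    proof (rule Y.homology_endo_exists[OF y_hull[OF T.tG_heart] y_hull[OF T.tG_heart] y_hull[OF T.tG_heart] pm(1,2) pm(3)[of i] _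
          pm(3)[of "i - 1"] _ pm(3)[of "i + 1"]])
      fix P x assume P: "P \<in> Ob A" and "x \<in> carrier (pob (yoneda j A (tG T (i - 1))) P)"
      then obtain f where f: "x = j f" "f \<in> Hom C P (tG T (i - 1))" using el by blast
      note [simp] = HomD[OF f(2)]
      show "j (weight_complex_diff C T i \<cdot> the_inv j (j (weight_complex_diff C T (i - 1) \<cdot> the_inv j x)))
          = \<one>\<^bsub>pob (yoneda j A (tG T (i + 1))) P\<^esub>"
        using Cmp_rewrite[OF dd[of i], of f] by (simp add: f(1))
      show "j (gG i \<cdot> the_inv j (j (weight_complex_diff C T (i - 1) \<cdot> the_inv j x)))
          = j (weight_complex_diff C T (i - 1) \<cdot> the_inv j (j (gG (i - 1) \<cdot> the_inv j x)))"
        using Cmp_rewrite[OF gdiff[of "i - 1"], of f] by (simp add: f(1) Cmp_assoc)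
    next
      fix P x assume P: "P \<in> Ob A" and "x \<in> carrier (pob (yoneda j A (tG T i)) P)"
      then obtain f where f: "x = j f" "f \<in> Hom C P (tG T i)" using el by blast
      note [simp] = HomD[OF f(2)]
      show "j (gG (i + 1) \<cdot> the_inv j (j (weight_complex_diff C T i \<cdot> the_inv j x)))
          = j (weight_complex_diff C T i \<cdot> the_inv j (j (gG i \<cdot> the_inv j x)))"
        using Cmp_rewrite[OF gdiff[of i], of f] by (simp add: f(1) Cmp_assoc)
    qed
  qed
  then obtain h where "\<And>i. homology_endo Y.B (yoneda_arr j A (weight_complex_diff C T (i - 1)))
      (yoneda_arr j A (weight_complex_diff C T i)) (yoneda_arr j A (gG i)) (h i)"
    by metis
  then have "weight_homology_endo j C Wle Wge g h"
    unfolding weight_homology_endo_def D using T(1) te by blast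
  then show ?thesis by blast
qed

lemma weight_homology_class:
  assumes g: "g \<in> Hom C X X" and h: "weight_homology_endo j C Wle Wge g h"
  obtains M \<eta> where "h i = parr A M \<eta> M" "M \<in> Y.hull" "pmap A M \<eta> M" "Hob (shift C i X) \<in> Y.hull"
    "Y.trivial M \<longleftrightarrow> Y.trivial (Hob (shift C i X))" "Y.cl M \<eta> = Y.cl (Hob (shift C i X)) (Har (shift_arr C i g))"
proof -
  have X: "X \<in> Ob C" and D: "Dom C g = X" using g by (auto simp: in_Hom)
  obtain T gL gR gG where T: "weight_tower C Wle Wge X T" and te: "tower_endo C T g gL gR gG"
    and he: "homology_endo Y.B (yoneda_arr j A (weight_complex_diff C T (i - 1)))
      (yoneda_arr j A (weight_complex_diff C T i)) (yoneda_arr j A (gG i)) (h i)"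
    using h unfolding weight_homology_endo_def D by blast
  interpret T: weight_postnikov_yoneda C Wle Wge j X T
    by unfold_locales (fact T, fact X)
  have G: "gG i \<in> Hom C (tG T i) (tG T i)" for i using te unfolding tower_endo_def by auto
  note pm = y_pmap_A[OF T.diff_Hom'[of i] T.tG_heart T.tG_heart] y_pmap_A[OF T.diff_Hom[of i] T.tG_heart T.tG_heart]
      y_pmap_A[OF G T.tG_heart T.tG_heart]
  note he' = he[unfolded yoneda_arr_A HomD[OF T.diff_Hom[of i]] HomD[OF T.diff_Hom'[of i]] HomD[OF G]]
  show ?thesis
  proof (rule Y.homology_endoE[OF he' y_hull[OF T.tG_heart] y_hull[OF T.tG_heart] y_hull[OF T.tG_heart] pm(1,2) pm(3)[of i]])
    fix K k M \<pi> \<kappa> \<eta>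
    assume a: "K \<in> Y.hull" "M \<in> Y.hull" "pmap A K k (yoneda j A (tG T i))" "pmap A K \<pi> M" "pmap A K \<kappa> K" "pmap A M \<eta> M"
      "h i = parr A M \<eta> M"
      "\<And>X. X \<in> Ob A \<Longrightarrow> inj_on (k X) (carrier (pob K X))"
      and kim: "\<And>X. X \<in> Ob A \<Longrightarrow> k X ` carrier (pob K X) =
          {x \<in> carrier (pob (yoneda j A (tG T i)) X).
           j (weight_complex_diff C T i \<cdot> the_inv j x) = \<one>\<^bsub>pob (yoneda j A (tG T (i + 1))) X\<^esub>}"
      and ps: "\<And>X. X \<in> Ob A \<Longrightarrow> \<pi> X ` carrier (pob K X) = carrier (pob M X)"
      and pk: "\<And>X. X \<in> Ob A \<Longrightarrow> Y.pker K \<pi> M X = {x \<in> carrier (pob K X). k X x \<in>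
          (\<lambda>u. j (weight_complex_diff C T (i - 1) \<cdot> the_inv j u)) ` carrier (pob (yoneda j A (tG T (i - 1))) X)}"
      and kk: "\<And>X x. X \<in> Ob A \<Longrightarrow> x \<in> carrier (pob K X) \<Longrightarrow> k X (\<kappa> X x) = j (gG i \<cdot> the_inv j (k X x))"
      and ee: "\<And>X x. X \<in> Ob A \<Longrightarrow> x \<in> carrier (pob K X) \<Longrightarrow> \<eta> X (\<pi> X x) = \<pi> X (\<kappa> X x)"
    note tc = T.tower_comparison[OF a(1-4,8) kim ps pk]
    show ?thesis
    proof (rule that[OF a(7,2,6)])
      show "Hob (shift C i X) \<in> Y.hull" using tc(1) by simp
      show "Y.trivial M \<longleftrightarrow> Y.trivial (Hob (shift C i X))" using tc(2) by simp
      show "Y.cl M \<eta> = Y.cl (Hob (shift C i X)) (Har (shift_arr C i g))"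
        using tc(3)[OF _ _ _ _ te g a(5,6) kk ee] by simp
    qed
  qed
qed

text \<open>The definition of \<open>H(X)\<close> shows no finite construction from representable
  presheaves. Membership in the hull comes from the weight complex: its homology in degree 0 lies in
  the hull, and the comparison, used here for the identity of \<open>X\<close>, carries this over to
  \<open>H(X)\<close>.\<close>

lemma Hob_hull: assumes X: "X \<in> Ob C" shows "Hob X \<in> Y.hull"
proof -
  have i: "Idn C X \<in> Hom C X X" using X by auto
  obtain h where h: "weight_homology_endo j C Wle Wge (Idn C X) h" using weight_homology_exists[OF i] by blast
  have "Hob (shift C 0 X) \<in> Y.hull" by (rule weight_homology_class[OF i h, of 0])
  then show ?thesis by (simp add: shift_def)
qed

end

section \<open>The homomorphisms between the Grothendieck groups\<close>

lemma (in comm_group) finprod_superset: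
  assumes "finite I" "S \<subseteq> I" "\<And>i. i \<in> I \<Longrightarrow> f i \<in> carrier G" "\<And>i. i \<in> I - S \<Longrightarrow> f i = \<one>"
  shows "finprod G f I = finprod G f S"
  by (rule finprod_mono_neutral_cong_left[symmetric]) (use assms in auto)

locale bounded_weighted_yoneda = weighted_yoneda C Wle Wge j
  for C :: "('o, 'm) tricat" (structure) and Wle Wge and j :: "'m \<Rightarrow> 'u" +
  assumes bounded: "bounded_weight_structure C Wle Wge"
begin

lemma shift_unshift: "X \<in> Ob C \<Longrightarrow> shift C l (shift C (- l) X) = X"
  by (simp add: shift_shift) (simp add: shift_def)

lemma bounded_shift:
  assumes X: "X \<in> Ob C"
  obtains l l' where "shift C l X \<in> Wle" "shift C l' X \<in> Wge"
proof -
  have "X \<in> (\<Union>l. shift C (- l) ` Wle)" "X \<in> (\<Union>l. shift C (- l) ` Wge)"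
    using bounded X unfolding bounded_weight_structure_def by auto
  then obtain l Y l' Y' where Y: "Y \<in> Wle" "X = shift C (- l) Y" and Y': "Y' \<in> Wge" "X = shift C (- l') Y'"
    by blast
  show ?thesis
    by (rule that[of l l']) (use Y shift_unshift[OF Wle_Ob[OF Y(1)]] Y' shift_unshift[OF Wge_Ob[OF Y'(1)]] in metis)+
qed

lemma Wle_shift_nat: "Y \<in> Wle \<Longrightarrow> shift C (int n) Y \<in> Wle"
proof (induction n)
  case (Suc n)
  then show ?case using shift_add1(2)[OF Wle_Ob[OF Suc.prems], of "int n"] Wle_Sh by (simp add: add.commute)
qed (simp add: shift_def)

lemma Wge_shift_nat: "Y \<in> Wge \<Longrightarrow> shift C (- int n) Y \<in> Wge"
proof (induction n)
  case (Suc n)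
  then have "negative (unSh C (shift C (- int n) Y))" using negative_unSh by simp
  moreover have e: "- int (Suc n) = - int n - 1" by simp
  ultimately show ?case unfolding e shift_add1(3)[OF Wge_Ob[OF Suc.prems]] using negative_Wge by blast
qed (simp add: shift_def)

lemma Wle_shift_ge: "X \<in> Ob C \<Longrightarrow> shift C l X \<in> Wle \<Longrightarrow> l \<le> i \<Longrightarrow> shift C i X \<in> Wle"
  using Wle_shift_nat[of "shift C l X" "nat (i - l)"] by (simp add: shift_shift)

lemma Wge_shift_le: "X \<in> Ob C \<Longrightarrow> shift C l X \<in> Wge \<Longrightarrow> i \<le> l \<Longrightarrow> shift C i X \<in> Wge"
  using Wge_shift_nat[of "shift C l X" "nat (l - i)"] by (simp add: shift_shift)

lemma trivial_HobI:
  assumes X: "X \<in> Ob C" and "\<And>P y. P \<in> Ob A \<Longrightarrow> y \<in> Hset (dec X) P \<Longrightarrow> y = Zr C P (Cod C (dec X))"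
  shows "Y.trivial (Hob X)"
  unfolding Y.trivial_def
proof
  fix P assume P: "P \<in> Ob A"
  have "Zr C P (Cod C (dec X)) \<in> Hset (dec X) P" by (rule Hset_Zr) (use P dec(1)[OF X] in \<open>auto simp: Ob_A Wle_Ob\<close>)
  then have "Hset (dec X) P = {Zr C P (Cod C (dec X))}" using assms(2)[OF P] by blast
  then show "carrier (pob (Hob X) P) = {\<one>\<^bsub>pob (Hob X) P\<^esub>}" by simp
qed

lemma trivial_negative: assumes "negative X" shows "Y.trivial (Hob X)"
proof (rule trivial_HobI)
  show X: "X \<in> Ob C" by (rule negative_Ob[OF assms])
  fix P y assume "y \<in> Hset (dec X) P"
  then show "y = Zr C P (Cod C (dec X))"
    by (rule Hset_negative[rotated 2]) (use assms dec[OF X] in auto)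
qed

lemma trivial_Sh_Wle: assumes "L \<in> Wle" shows "Y.trivial (Hob (Sh C L))"
proof (rule trivial_HobI)
  show X: "Sh C L \<in> Ob C" using Wle_Ob[OF assms] by simp
  fix P y assume "P \<in> Ob A" "y \<in> Hset (dec (Sh C L)) P"
  then show "y = Zr C P (Cod C (dec (Sh C L)))"
    by (intro Hset_Sh_Wle[OF _ _ assms]) (use dec[OF X] in \<open>auto simp: Ob_A\<close>)
qed

section \<open>The Euler characteristic of the homological functor\<close>

definition supp :: "'o \<Rightarrow> int set" where
  "supp X = {i. \<not> Y.trivial (Hob (shift C i X))}"

text \<open>Boundedness is used here. Sufficiently positive shifts of \<open>X\<close> lie in
  \<open>Wle\<close> shifted by [1] and sufficiently negative ones are negative objects;
  \<open>H\<close> vanishes on both.\<close>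

lemma finite_supp: assumes X: "X \<in> Ob C" shows "finite (supp X)"
proof -
  obtain l l' where l: "shift C l X \<in> Wle" and l': "shift C l' X \<in> Wge" using bounded_shift[OF X] .
  have "supp X \<subseteq> {l'..l}"
  proof
    fix i assume i: "i \<in> supp X"
    have "i \<le> l"
    proof (rule ccontr)
      assume "\<not> i \<le> l"
      then have "shift C (i - 1) X \<in> Wle" using Wle_shift_ge[OF X l, of "i - 1"] by simp
      then have "Y.trivial (Hob (shift C i X))" using trivial_Sh_Wle shift_add1(2)[OF X, of "i - 1"] by force
      then show False using i by (simp add: supp_def)
    qed
    moreover have "l' \<le> i"
    proof (rule ccontr)
      assume "\<not> l' \<le> i"
      then have "shift C (i + 1) X \<in> Wge" using Wge_shift_le[OF X l', of "i + 1"] by simp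
      then have "negative (shift C i X)" using shift_add1(1,2)[OF X, of i] by (simp add: negative_def)
      then show False using i trivial_negative by (simp add: supp_def)
    qed
    ultimately show "i \<in> {l'..l}" by simp
  qed
  then show ?thesis using finite_subset by blast
qed

definition hcls :: "'m \<Rightarrow> int \<Rightarrow> (('o, 'm, 'u) nattrans \<Rightarrow>\<^sub>0 int) set" where
  "hcls g i = Y.cl (Hob (shift C i (Dom C g))) (Har (shift_arr C i g))"

definition hclass :: "'m \<Rightarrow> (('o, 'm, 'u) nattrans \<Rightarrow>\<^sub>0 int) set" where
  "hclass g = finprod Y.KB.K (Y.KB.K.alt (hcls g)) (supp (Dom C g))"

lemma Hob_shift_hull: "X \<in> Ob C \<Longrightarrow> Hob (shift C i X) \<in> Y.hull"
  by (rule Hob_hull) (rule shift_add1)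

lemma hcls_closed:
  assumes g: "g \<in> Hom C X X" shows "hcls g i \<in> carrier Y.KB.K"
proof -
  have X: "X \<in> Ob C" and D: "Dom C g = X" using g by (auto simp: in_Hom)
  show ?thesis unfolding hcls_def D Y.K0_ab_eq[symmetric]
    by (rule Y.cl_closed[OF Hob_shift_hull[OF X] Har_pmap[OF shift_arr_Hom(1)[OF g]]])
qed

lemma hcls_one:
  assumes g: "g \<in> Hom C X X" and i: "i \<notin> supp X" shows "hcls g i = \<one>\<^bsub>Y.KB.K\<^esub>"
proof -
  have X: "X \<in> Ob C" and D: "Dom C g = X" using g by (auto simp: in_Hom)
  show ?thesis unfolding hcls_def D Y.K0_ab_eq[symmetric]
    by (rule Y.cl_trivial[OF Hob_shift_hull[OF X] _ Har_pmap[OF shift_arr_Hom(1)[OF g]]]) (use i in \<open>simp add: supp_def\<close>)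
qed

lemma hclass_superset:
  assumes g: "g \<in> Hom C X X" and I: "finite I" "supp X \<subseteq> I"
  shows "hclass g = finprod Y.KB.K (Y.KB.K.alt (hcls g)) I"
proof -
  have D: "Dom C g = X" using g by (auto simp: in_Hom)
  show ?thesis unfolding hclass_def D
    by (rule Y.KB.K.finprod_superset[symmetric, OF I]) (use hcls_closed[OF g] hcls_one[OF g] in auto)
qed

lemma hclass_closed:
  assumes g: "g \<in> Hom C X X" shows "hclass g \<in> carrier Y.KB.K"
  unfolding hclass_def by (rule Y.KB.K.finprod_closed) (use hcls_closed[OF g] in auto)

text \<open>The shifts of the triangle give a long exact sequence of presheaves on which
  \<open>f\<close>, \<open>g\<close> and \<open>h\<close> act. Cutting it at the images turns each
  term into a product of two classes, and each image class occurs in two neighbouring terms.\<close>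

lemma hclass_triangle:
  assumes d: "(u, v, w) \<in> Dist C" and tm: "triangle_morphism C (u, v, w) (u, v, w) f g h"
  shows "hclass g = hclass f \<otimes>\<^bsub>Y.KB.K\<^esub> hclass h"
proof -
  define X Y Z where "X = Dom C u" and "Y = Dom C v" and "Z = Dom C w"
  note t = tri_simps[OF d]
  have u: "u \<in> Hom C X Y" and v: "v \<in> Hom C Y Z" and w: "w \<in> Hom C Z (Sh C X)"
    using t by (auto simp: X_def Y_def Z_def in_Hom)
  have f: "f \<in> Hom C X X" and g: "g \<in> Hom C Y Y" and h: "h \<in> Hom C Z Z"
    and gu: "g \<cdot> u = u \<cdot> f" and hv: "h \<cdot> v = v \<cdot> g" and fw: "ShA C f \<cdot> w = w \<cdot> h"
    using tm by (auto simp: triangle_morphism_def X_def Y_def Z_def)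
  have o: "X \<in> Ob C" "Y \<in> Ob C" "Z \<in> Ob C" using u v by (auto simp: in_Hom)
  define ui vi wi where "ui i = shift_arr C i u" and "vi i = shift_arr C i v" and "wi i = shift_arr C i w" for i
  define fi gi hi where "fi i = shift_arr C i f" and "gi i = shift_arr C i g" and "hi i = shift_arr C i h" for i
  define Xi Yi Zi where "Xi i = shift C i X" and "Yi i = shift C i Y" and "Zi i = shift C i Z" for i
  have ui: "ui i \<in> Hom C (Xi i) (Yi i)" and vi: "vi i \<in> Hom C (Yi i) (Zi i)" and wi: "wi i \<in> Hom C (Zi i) (Xi (i + 1))" for i
    using shift_arr_Hom[OF u, of i] shift_arr_Hom[OF v, of i] shift_arr_Hom[OF w, of i] o
    by (simp_all add: ui_def vi_def wi_def Xi_def Yi_def Zi_def shift_Sh)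
  have fi: "fi i \<in> Hom C (Xi i) (Xi i)" and gi: "gi i \<in> Hom C (Yi i) (Yi i)" and hi: "hi i \<in> Hom C (Zi i) (Zi i)" for i
    using shift_arr_Hom[OF f, of i] shift_arr_Hom[OF g, of i] shift_arr_Hom[OF h, of i]
    by (simp_all add: fi_def gi_def hi_def Xi_def Yi_def Zi_def)
  have Sf: "ShA C f \<in> Hom C (Sh C X) (Sh C X)" using f by (auto simp: in_Hom)
  have c: "gi i \<cdot> ui i = ui i \<cdot> fi i" "hi i \<cdot> vi i = vi i \<cdot> gi i" "fi (i + 1) \<cdot> wi i = wi i \<cdot> hi i" for i
    unfolding ui_def vi_def wi_def fi_def gi_def hi_def
    using shift_arr_Cmp[OF u g, of i] shift_arr_Cmp[OF f u, of i] gu shift_arr_Cmp[OF v h, of i] shift_arr_Cmp[OF g v, of i] hv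
      shift_arr_Cmp[OF w Sf, of i] shift_arr_Cmp[OF h w, of i] fw shift_arr_ShA[OF f, of i] by auto
  \<comment> \<open>Exactness is shifted instead of the triangle itself, so no signs arise. The last
    sequence is shifted by \<open>i - 1\<close> and links degree \<open>i - 1\<close> of
    \<open>Z\<close> with degree \<open>i\<close> of \<open>X\<close>.\<close>
  have ex: "weak_exact (ui i) (vi i)" "weak_exact (vi i) (wi i)" "weak_exact (wi (i - 1)) (ui i)" for i
    using weak_exact_shift[OF weak_exact_tri(1)[OF d], of i] weak_exact_shift[OF weak_exact_tri(2)[OF d], of i]
      weak_exact_shift[OF weak_exact_tri(3)[OF d], of "i - 1"] shift_arr_ShA[OF u, of "i - 1"]
    by (simp_all add: ui_def vi_def wi_def)
  have hull: "Hob (Xi i) \<in> Y.hull" "Hob (Yi i) \<in> Y.hull" "Hob (Zi i) \<in> Y.hull" for i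
    using Hob_shift_hull o by (auto simp: Xi_def Yi_def Zi_def)
  note pu = Har_pmap[OF ui] and pv = Har_pmap[OF vi] and pw = Har_pmap[OF wi]
    and pf = Har_pmap[OF fi] and pg = Har_pmap[OF gi] and ph = Har_pmap[OF hi]
  have comm: "Har (gi i) P (Har (ui i) P x) = Har (ui i) P (Har (fi i) P x)" if "x \<in> carrier (pob (Hob (Xi i)) P)" for i P x
    using Har_Cmp[OF ui gi that] Har_Cmp[OF fi ui that] c(1)[of i] by simp
  have comm2: "Har (hi i) P (Har (vi i) P x) = Har (vi i) P (Har (gi i) P x)" if "x \<in> carrier (pob (Hob (Yi i)) P)" for i P x
    using Har_Cmp[OF vi hi that] Har_Cmp[OF gi vi that] c(2)[of i] by simp
  have comm3: "Har (fi (i + 1)) P (Har (wi i) P x) = Har (wi i) P (Har (hi i) P x)" if "x \<in> carrier (pob (Hob (Zi i)) P)" for i P x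
    using Har_Cmp[OF wi fi that] Har_Cmp[OF hi wi that] c(3)[of i] by simp
  define U where "U i = Y.cl (Y.psub (Hob (Yi i)) (Y.pim (Hob (Xi i)) (Har (ui i)))) (Har (gi i))" for i
  define V where "V i = Y.cl (Y.psub (Hob (Zi i)) (Y.pim (Hob (Yi i)) (Har (vi i)))) (Har (hi i))" for i
  define W where "W i = Y.cl (Y.psub (Hob (Xi (i + 1))) (Y.pim (Hob (Zi i)) (Har (wi i)))) (Har (fi (i + 1)))" for i
  have hc: "hcls f i = Y.cl (Hob (Xi i)) (Har (fi i))" "hcls g i = Y.cl (Hob (Yi i)) (Har (gi i))" "hcls h i = Y.cl (Hob (Zi i)) (Har (hi i))" for i
    using HomD(2)[OF f] HomD(2)[OF g] HomD(2)[OF h]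
    by (simp_all add: hcls_def fi_def gi_def hi_def Xi_def Yi_def Zi_def)
  have K: "Y.KB.K = K0_ab Y.B" by (simp add: Y.K0_ab_eq)
  have y: "hcls g i = U i \<otimes>\<^bsub>Y.KB.K\<^esub> V i" for i
    unfolding hc U_def V_def K
    by (rule Y.cl_exact[OF hull(1) hull(2) hull(3) pu pv Har_exact[OF ex(1) ui vi] pf pg ph]) (simp_all add: comm comm2)
  have z: "hcls h i = V i \<otimes>\<^bsub>Y.KB.K\<^esub> W i" for i
    unfolding hc V_def W_def K
    by (rule Y.cl_exact[OF hull(2) hull(3) hull(1) pv pw Har_exact[OF ex(2) vi wi] pg ph pf]) (simp_all add: comm2 comm3)
  have x: "hcls f i = W (i - 1) \<otimes>\<^bsub>Y.KB.K\<^esub> U i" for i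
  proof -
    have wi': "wi (i - 1) \<in> Hom C (Zi (i - 1)) (Xi i)" using wi[of "i - 1"] by simp
    have c3: "Har (fi i) P (Har (wi (i - 1)) P x) = Har (wi (i - 1)) P (Har (hi (i - 1)) P x)"
      if "x \<in> carrier (pob (Hob (Zi (i - 1))) P)" for P x using comm3[OF that] by simp
    have "Y.cl (Hob (Xi i)) (Har (fi i)) = Y.cl (Y.psub (Hob (Xi i)) (Y.pim (Hob (Zi (i - 1))) (Har (wi (i - 1))))) (Har (fi i))
        \<otimes>\<^bsub>K0_ab Y.B\<^esub> U i"
      unfolding U_def
      by (rule Y.cl_exact[OF hull(3) hull(1) hull(2) Har_pmap[OF wi'] pu Har_exact[OF ex(3) wi' ui] ph pf pg]) (simp_all add: comm c3)
    then show ?thesis by (simp add: hc W_def K)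
  qed
  have UVW: "U i \<in> carrier Y.KB.K" "V i \<in> carrier Y.KB.K" "W i \<in> carrier Y.KB.K" for i
  proof -
    show "U i \<in> carrier Y.KB.K" unfolding U_def K
      by (rule Y.cl_closed[OF Y.hull_pim[OF hull(1,2) pu] Y.restrict_ker_im(2)[OF pu pf pg]]) (rule comm)
    show "V i \<in> carrier Y.KB.K" unfolding V_def K
      by (rule Y.cl_closed[OF Y.hull_pim[OF hull(2,3) pv] Y.restrict_ker_im(2)[OF pv pg ph]]) (rule comm2)
    show "W i \<in> carrier Y.KB.K" unfolding W_def K
      by (rule Y.cl_closed[OF Y.hull_pim[OF hull(3,1) pw] Y.restrict_ker_im(2)[OF pw ph pf]]) (rule comm3)
  qed
  \<comment> \<open>The image of a connecting map vanishes as soon as its source or its target does.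
    This supplies the boundary conditions for the alternating product over the finite set
    \<open>I\<close> below.\<close>
  have W1: "W i = \<one>\<^bsub>Y.KB.K\<^esub>" if "i \<notin> supp Z \<or> i + 1 \<notin> supp X" for i
    unfolding W_def K
    by (rule Y.cl_trivial_image[OF hull(3,1) pw ph pf]) (use that in \<open>simp_all add: comm3 supp_def Xi_def Zi_def disj_commute\<close>)
  define I where "I = supp X \<union> supp Y \<union> supp Z"
  have I: "finite I" "supp X \<subseteq> I" "supp Y \<subseteq> I" "supp Z \<subseteq> I" using finite_supp o by (auto simp: I_def)
  have "finprod Y.KB.K (Y.KB.K.alt (hcls g)) I = finprod Y.KB.K (Y.KB.K.alt (hcls f)) I \<otimes>\<^bsub>Y.KB.K\<^esub> finprod Y.KB.K (Y.KB.K.alt (hcls h)) I"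
    by (rule Y.KB.K.finprod_alt_long_exact[where u = U and v = V and w = W, OF I(1) UVW x y z]) (use W1 I in auto)
  then show ?thesis
    using hclass_superset[OF f I(1,2)] hclass_superset[OF g I(1,3)] hclass_superset[OF h I(1,4)] by simp
qed

lemma d_exists:
  "\<exists>d\<in>hom (K0_tr C) (K0_ab Y.B). \<forall>g\<in>endos C. d (class_tr C g) = hclass g"
proof -
  interpret T: presented "endos C" "tr_triples C" by unfold_locales (rule tr_triples_endos)
  have "\<exists>\<psi>\<in>hom T.K Y.KB.K. \<forall>g\<in>endos C. \<psi> (T.cls g) = hclass g"
  proof (rule T.universal[OF Y.KB.comm_group_K])
    fix g assume "g \<in> endos C"
    then have "g \<in> Hom C (Dom C g) (Dom C g)" by (simp add: endos_def in_Hom)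
    then show "hclass g \<in> carrier Y.KB.K" by (rule hclass_closed)
  next
    fix f g h assume "(f, g, h) \<in> tr_triples C"
    then show "hclass g = hclass f \<otimes>\<^bsub>Y.KB.K\<^esub> hclass h"
      using hclass_triangle by (auto simp: tr_triples_def)
  qed
  then show ?thesis by (simp add: K0_tr_def class_tr_def Y.K0_ab_eq)
qed

text \<open>In each degree the class of \<open>h i\<close> is the class on \<open>H(X[i])\<close>,
  in which no tower, extension or homology object appears. Thus independence of these choices is
  obtained together with the formula for \<open>d\<close>.\<close>

lemma euler_class_hclass:
  assumes g: "g \<in> endos C" and h: "weight_homology_endo j C Wle Wge g h"
  shows "finite (euler_support Y.B h)" "euler_class Y.B h = hclass g"
proof -
  define X where "X = Dom C g"
  have g': "g \<in> Hom C X X" using g by (simp add: endos_def in_Hom X_def)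
  then have X: "X \<in> Ob C" by (auto simp: in_Hom)
  have *: "\<not> zero_object Y.B (Dom Y.B (h i)) \<longleftrightarrow> i \<in> supp X" "class_ab Y.B (h i) = hcls g i" for i
  proof -
    obtain M \<eta> where M: "h i = parr A M \<eta> M" "M \<in> Y.hull" "pmap A M \<eta> M" "Hob (shift C i X) \<in> Y.hull"
    "Y.trivial M \<longleftrightarrow> Y.trivial (Hob (shift C i X))" "Y.cl M \<eta> = Y.cl (Hob (shift C i X)) (Har (shift_arr C i g))"
      by (rule weight_homology_class[OF g' h])
    show "\<not> zero_object Y.B (Dom Y.B (h i)) \<longleftrightarrow> i \<in> supp X"
      using M(1,2,5) by (simp add: Y.zero_object_B Y.B_simps supp_def)
    show "class_ab Y.B (h i) = hcls g i"
      using M(6) by (simp add: M(1) Y.cl_def hcls_def X_def)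
  qed
  have S: "euler_support Y.B h = supp X" using *(1) by (auto simp: euler_support_def)
  then show "finite (euler_support Y.B h)" using finite_supp[OF X] by simp
  show "euler_class Y.B h = hclass g"
    unfolding euler_class_def S *(2) hclass_def X_def[symmetric] Y.K0_ab_eq(1)
    by (simp add: Y.KB.K.alt_def[abs_def])
qed

end

section \<open>The map \<open>c\<close> and its surjectivity\<close>

context weighted
begin

sublocale T: presented "endos C" "tr_triples C"
  by unfold_locales (rule tr_triples_endos)

lemma K0_tr_eq: "K0_tr C = T.K" "class_tr C = T.cls"
  by (simp_all add: K0_tr_def class_tr_def)

lemma class_zero:
  assumes Z: "zero_object C Z" and f: "f \<in> Hom C Z Z" shows "T.cls f = \<one>\<^bsub>T.K\<^esub>"
proof -
  note [simp] = HomD[OF f] zero_object_Ob[OF Z]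
  have fz: "f = Zr C Z Z" using zero_object_to[OF Z, of f] by simp
  have i: "Idn C Z = Zr C Z Z" using Z zero_object_iff by simp
  have "(f, f, f) \<in> tr_triples C"
  proof -
    have "triangle_morphism C (Idn C Z, Zr C Z Z, Zr C Z (Sh C Z)) (Idn C Z, Zr C Z Z, Zr C Z (Sh C Z)) f f f"
      unfolding triangle_morphism_def by (simp add: in_Hom fz)
    then show ?thesis using tri_Idn[OF zero_object_Ob[OF Z] Z] unfolding tr_triples_def by blast
  qed
  then have "T.cls f = T.cls f \<otimes>\<^bsub>T.K\<^esub> T.cls f" by (rule T.cls_relation)
  moreover have "T.cls f \<in> carrier T.K" by (rule T.cls_closed) (simp add: endos_def)
  ultimately show ?thesis using T.K.r_cancel_one' by blast
qed

text \<open>The rotated trivial triangle X -> 0 -> X[1] relates the two classes to the class of an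
  endomorphism of zero.\<close>

lemma class_ShA:
  assumes f: "f \<in> Hom C X X" shows "T.cls (ShA C f) = inv\<^bsub>T.K\<^esub> T.cls f"
proof -
  obtain Z where Z: "zero_object C Z" using ex_zero by blast
  have X [simp]: "X \<in> Ob C" using f by (auto simp: in_Hom)
  note [simp] = HomD[OF f] zero_object_Ob[OF Z]
  have d: "(Zr C X Z, Zr C Z (Sh C X), neg C (ShA C (Idn C X))) \<in> Dist C"
    by (rule tri_rotate[OF tri_Idn[OF X Z]])
  have "(f, Zr C Z Z, ShA C f) \<in> tr_triples C"
  proof -
    have "triangle_morphism C (Zr C X Z, Zr C Z (Sh C X), neg C (ShA C (Idn C X)))
       (Zr C X Z, Zr C Z (Sh C X), neg C (ShA C (Idn C X))) f (Zr C Z Z) (ShA C f)"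
      unfolding triangle_morphism_def by (simp add: in_Hom Cmp_neg neg_Cmp)
    then show ?thesis using d unfolding tr_triples_def by blast
  qed
  then have "T.cls (Zr C Z Z) = T.cls f \<otimes>\<^bsub>T.K\<^esub> T.cls (ShA C f)" by (rule T.cls_relation)
  moreover have "T.cls (Zr C Z Z) = \<one>\<^bsub>T.K\<^esub>" by (rule class_zero[OF Z]) (auto simp: in_Hom)
  moreover have "T.cls f \<in> carrier T.K" "T.cls (ShA C f) \<in> carrier T.K"
    by (rule T.cls_closed, simp add: endos_def)+
  ultimately have "T.cls (ShA C f) \<otimes>\<^bsub>T.K\<^esub> T.cls f = \<one>\<^bsub>T.K\<^esub>" using T.K.m_comm by simp
  then show ?thesis
    using T.K.inv_equality \<open>T.cls f \<in> carrier T.K\<close> \<open>T.cls (ShA C f) \<in> carrier T.K\<close> by simp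
qed

lemma heart_triples:
  assumes "(f, g, h) \<in> add_triples (heart C Wle Wge)" shows "(f, g, h) \<in> tr_triples C"
proof -
  obtain i p where s: "split_exact (heart C Wle Wge) i p" and q: "sequence_endo (heart C Wle Wge) i p f g h"
    using assms by (auto simp: add_triples_def)
  obtain s' r where "is_biproduct (heart C Wle Wge) (Dom C i) (Cod C p) (Cod C i) i s' r p"
    using s by (auto simp: split_exact_def heart_def)
  then have b: "is_biproduct C (Dom C i) (Cod C p) (Cod C i) i s' r p"
    unfolding is_biproduct_def heart_def by (auto simp: in_Hom Wle_Ob)
  have "triangle_morphism C (i, p, Zr C (Cod C p) (Sh C (Dom C i))) (i, p, Zr C (Cod C p) (Sh C (Dom C i))) f g h"
  proof -
    have fgh: "f \<in> Hom C (Dom C i) (Dom C i)" "g \<in> Hom C (Cod C i) (Cod C i)" "h \<in> Hom C (Cod C p) (Cod C p)"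
      "g \<cdot> i = i \<cdot> f" "h \<cdot> p = p \<cdot> g"
      using q by (auto simp: sequence_endo_def heart_def in_Hom)
    note [simp] = biproductD(1-3)[OF b] HomD[OF fgh(1)] HomD[OF fgh(3)]
    have "ShA C f \<cdot> Zr C (Cod C p) (Sh C (Dom C i)) = Zr C (Cod C p) (Sh C (Dom C i)) \<cdot> h" by simp
    then show ?thesis
      unfolding triangle_morphism_def using fgh biproductD(2,14)[OF b] by simp
  qed
  then show ?thesis using biproduct_triangle[OF b] unfolding tr_triples_def by blast
qed

lemma c_exists:
  "\<exists>c\<in>hom (K0_add (heart C Wle Wge)) T.K. \<forall>g\<in>endos (heart C Wle Wge). c (class_add (heart C Wle Wge) g) = T.cls g"
proof -
  interpret H: presented "endos (heart C Wle Wge)" "add_triples (heart C Wle Wge)"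
    by unfold_locales (rule add_triples_endos)
  have e: "endos (heart C Wle Wge) \<subseteq> endos C" by (auto simp: endos_def heart_def)
  have "\<exists>\<psi>\<in>hom H.K T.K. \<forall>g\<in>endos (heart C Wle Wge). \<psi> (H.cls g) = T.cls g"
    by (rule H.universal[OF T.comm_group_K]) (use e heart_triples T.cls_relation in auto)
  then show ?thesis by (simp add: K0_add_def class_add_def)
qed

lemma Wge_unSh_pow: "X \<in> Wge \<Longrightarrow> (unSh C ^^ n) X \<in> Wge"
  by (induction n) (auto intro: negative_Wge negative_unSh)

lemma Wge_pow_extension:
  "(u, v, w) \<in> Dist C \<Longrightarrow> (unSh C ^^ n) (Dom C u) \<in> Wge \<Longrightarrow> (unSh C ^^ n) (Cod C v) \<in> Wge \<Longrightarrow>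
    (unSh C ^^ n) (Cod C u) \<in> Wge"
proof (induction n arbitrary: u v w)
  case 0
  then show ?case using Wge_extension by simp
next
  case (Suc n)
  show ?case
    using Suc.IH[OF tri_unShift[OF Suc.prems(1)]] Suc.prems(2,3) tri_simps[OF Suc.prems(1)]
    by (simp add: funpow_Suc_right del: funpow.simps(2))
qed

text \<open>
  Splitting off the lowest weight: an object \<open>X\<close> of \<open>C\<^sup>w\<^sup>\<le>\<^sup>0\<close> sits in a triangle \<open>L \<rightarrow> R \<rightarrow> X\<close> with \<open>R\<close> in
  the heart, where \<open>L\<close> is shorter than \<open>X\<close>.
\<close>

lemma class_generated:
  assumes S: "subgroup S T.K" and heart: "\<And>g. g \<in> endos (heart C Wle Wge) \<Longrightarrow> T.cls g \<in> S"
  shows "g \<in> Hom C X X \<Longrightarrow> X \<in> Wle \<Longrightarrow> (unSh C ^^ n) X \<in> Wge \<Longrightarrow> T.cls g \<in> S"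
proof (induction n arbitrary: X g)
  case 0
  then have "g \<in> endos (heart C Wle Wge)" by (auto simp: endos_def heart_def in_Hom)
  then show ?case by (rule heart)
next
  case (Suc n)
  note g = Suc.prems(1) and Xle = Suc.prems(2)
  have X [simp]: "X \<in> Ob C" by (rule Wle_Ob[OF Xle])
  \<comment> \<open>Decomposing X[-1] rather than \<open>X\<close> makes W[1] map to
    \<open>X\<close>, with \<open>L\<close> as the remaining vertex.\<close>
  obtain W L r a f where d: "negative W" "L \<in> Wle" "(r, a, f) \<in> Dist C"
    "r \<in> Hom C W (unSh C X)" "a \<in> Hom C (unSh C X) L" "f \<in> Hom C L (Sh C W)"
    using decomposition[OF unSh_simps(1)[OF X]] .
  define R where "R = Sh C W"
  have R: "R \<in> Wge" using d(1) by (simp add: negative_def R_def)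
  define \<rho> \<sigma> where "\<rho> = neg C (ShA C r)" and "\<sigma> = neg C (ShA C a)"
  have t1: "(a, f, \<rho>) \<in> Dist C" using tri_rotate[OF d(3)] by (simp add: \<rho>_def)
  have t2: "(f, \<rho>, \<sigma>) \<in> Dist C" using tri_rotate[OF t1] by (simp add: \<sigma>_def)
  note [simp] = HomD[OF d(4)] HomD[OF d(5)] HomD[OF d(6)] HomD[OF g] Wle_Ob[OF d(2)] Wge_Ob[OF R]
  have [simp]: "\<rho> \<in> Ar C" "Dom C \<rho> = R" "Cod C \<rho> = X" "\<sigma> \<in> Ar C" "Dom C \<sigma> = X" "Cod C \<sigma> = Sh C L" "Sh C W = R"
    by (auto simp: \<rho>_def \<sigma>_def R_def)
  \<comment> \<open>\<open>R\<close> is an extension of \<open>X\<close> by \<open>L\<close>, both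
    in \<open>Wle\<close>; being a shifted lower part, it is in \<open>Wge\<close> as well.\<close>
  have Rle: "R \<in> Wle" using Wle_extension[OF t2] d(2) Xle by simp
  \<comment> \<open>\<open>L\<close> is an extension of \<open>R\<close> by X[-1], so one
    desuspension less than for \<open>X\<close> brings it into \<open>Wge\<close>. This is the
    induction parameter.\<close>
  have Ln: "(unSh C ^^ n) L \<in> Wge"
    using Wge_pow_extension[OF t1, of n] Suc.prems(3) Wge_unSh_pow[OF R, of n]
    by (simp add: funpow_Suc_right del: funpow.simps(2))
  \<comment> \<open>The obstruction to lifting \<open>g\<close> to \<open>R\<close> lies in Hom(R,
    L[1]), which vanishes by orthogonality.\<close>
  have "\<sigma> \<cdot> (g \<cdot> \<rho>) = Zr C R (Sh C L)" by (rule Wge_orth[OF R d(2)]) (simp add: in_Hom)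
  then obtain gR where gR: "gR \<in> Hom C R R" "g \<cdot> \<rho> = \<rho> \<cdot> gR"
    using tri_weak_kernel[OF tri_rotate[OF t2], of "g \<cdot> \<rho>" R] by (auto simp: in_Hom)
  note [simp] = HomD[OF gR(1)]
  obtain h where h: "h \<in> Hom C (Sh C L) (Sh C L)" "h \<cdot> \<sigma> = \<sigma> \<cdot> g" "ShA C gR \<cdot> neg C (ShA C f) = neg C (ShA C f) \<cdot> h"
    using tri_complete[OF tri_rotate[OF t2] tri_rotate[OF t2], of gR g] gR by (auto simp: in_Hom)
  note [simp] = HomD[OF h(1)]
  define gL where "gL = unShA C h"
  have gL: "gL \<in> Hom C L L" "ShA C gL = h" by (auto simp: gL_def in_Hom)
  note [simp] = HomD[OF gL(1)]
  have "neg C (ShA C (gR \<cdot> f)) = neg C (ShA C (f \<cdot> gL))" using h(3) by (simp add: ShA_Cmp Cmp_neg neg_Cmp gL(2))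
  then have "gR \<cdot> f = f \<cdot> gL" by (simp add: neg_eq_iff ShA_inject)
  then have "triangle_morphism C (f, \<rho>, \<sigma>) (f, \<rho>, \<sigma>) gL gR g"
    unfolding triangle_morphism_def using gR h gL by (simp add: in_Hom)
  then have "(gL, gR, g) \<in> tr_triples C" using t2 by (auto simp: tr_triples_def)
  then have rel: "T.cls gR = T.cls gL \<otimes>\<^bsub>T.K\<^esub> T.cls g" by (rule T.cls_relation)
  have L: "T.cls gL \<in> S" by (rule Suc.IH[OF gL(1) d(2) Ln])
  have "gR \<in> endos (heart C Wle Wge)" using Rle R by (auto simp: endos_def heart_def)
  then have R: "T.cls gR \<in> S" by (rule heart)
  have gc: "T.cls g \<in> carrier T.K" by (rule T.cls_closed) (simp add: endos_def)
  note Sc = subgroup.mem_carrier[OF S]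
  have "T.cls g = inv\<^bsub>T.K\<^esub> T.cls gL \<otimes>\<^bsub>T.K\<^esub> T.cls gR"
    unfolding rel using Sc[OF L] gc T.K.m_assoc[symmetric] by simp
  then show ?case using subgroup.m_closed[OF S subgroup.m_inv_closed[OF S L] R] by simp
qed

end

context bounded_weighted_yoneda
begin

lemma shift_neg_nat: "X \<in> Ob C \<Longrightarrow> shift C (- int n) X = (unSh C ^^ n) X"
  by (simp add: shift_def)

lemma class_shift_nat:
  assumes g: "g \<in> Hom C X X" and S: "subgroup S T.K"
  shows "T.cls (shift_arr C (int m) g) \<in> S \<Longrightarrow> T.cls g \<in> S"
proof (induction m)
  case 0
  then show ?case by (simp add: shift_arr_def)
next
  case (Suc m)
  note h = shift_arr_Hom(1)[OF g, of "int m"]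
  have "shift_arr C (int (Suc m)) g = ShA C (shift_arr C (int m) g)"
    using shift_arr_add1[OF g, of "int m"] by (simp add: add.commute)
  then have "inv\<^bsub>T.K\<^esub> T.cls (shift_arr C (int m) g) \<in> S" using Suc.prems class_ShA[OF h] by simp
  moreover have "T.cls (shift_arr C (int m) g) \<in> carrier T.K"
    by (rule T.cls_closed) (use h in \<open>simp add: endos_def in_Hom\<close>)
  ultimately have "T.cls (shift_arr C (int m) g) \<in> S" using subgroup.m_inv_closed[OF S] T.K.inv_inv by metis
  then show ?case by (rule Suc.IH)
qed

text \<open>Shifting changes a class only by inversion, so each object may first be moved into
  \<open>Wle\<close>. Boundedness then supplies the number of desuspensions that
  \<open>class_generated\<close> takes as its induction parameter.\<close>

lemma T_generated:
  assumes S: "subgroup S T.K" and heart: "\<And>g. g \<in> endos A \<Longrightarrow> T.cls g \<in> S"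
  shows "carrier T.K \<subseteq> S"
proof
  have gen: "T.cls g \<in> S" if "g \<in> endos C" for g
  proof -
    define X where "X = Dom C g"
    have g: "g \<in> Hom C X X" using that by (simp add: endos_def in_Hom X_def)
    then have X: "X \<in> Ob C" by (auto simp: in_Hom)
    obtain l l' where l: "shift C l X \<in> Wle" "shift C l' X \<in> Wge" using bounded_shift[OF X] .
    define m n where "m = nat l" and "n = nat (int m - l')"
    have 1: "shift C (int m) X \<in> Wle" by (rule Wle_shift_ge[OF X l(1)]) (simp add: m_def)
    have "(unSh C ^^ n) (shift C (int m) X) = shift C (- int n + int m) X"
      using shift_neg_nat[of "shift C (int m) X" n] shift_add1(1)[OF X] shift_shift[OF X] by simp
    also have "\<dots> \<in> Wge" by (rule Wge_shift_le[OF X l(2)]) (simp add: n_def)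
    finally have "T.cls (shift_arr C (int m) g) \<in> S"
      by (intro class_generated[OF S heart shift_arr_Hom(1)[OF g] 1])
    then show ?thesis by (rule class_shift_nat[OF g S])
  qed
  fix x assume "x \<in> carrier T.K"
  then show "x \<in> S"
  proof (induction x rule: T.induct)
    case one
    show ?case by (rule subgroup.one_closed[OF S])
  next
    case (cls g)
    then show ?case by (rule gen)
  next
    case (mult x y)
    then show ?case using subgroup.m_closed[OF S] by blast
  next
    case (inv x)
    then show ?case using subgroup.m_inv_closed[OF S] by blast
  qed
qed

lemma c_epi:
  obtains c where "c \<in> epi (K0_add A) (K0_tr C)" "\<And>g. g \<in> endos A \<Longrightarrow> c (class_add A g) = class_tr C g"
proof -
  interpret H: presented "endos A" "add_triples A"
    by unfold_locales (rule add_triples_endos)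
  obtain c where c: "c \<in> hom (K0_add A) T.K" and cc: "\<And>g. g \<in> endos A \<Longrightarrow> c (class_add A g) = T.cls g"
    using c_exists by blast
  have e: "K0_add A = H.K" "class_add A = H.cls" by (simp_all add: K0_add_def class_add_def)
  interpret hm: group_hom H.K T.K c
    using c by unfold_locales (simp add: e)
  have "carrier T.K \<subseteq> c ` carrier H.K"
  proof (rule T_generated)
    show "subgroup (c ` carrier H.K) T.K" by (rule hm.img_is_subgroup)
    fix g assume g: "g \<in> endos A"
    then have "T.cls g = c (H.cls g)" using cc by (simp add: e)
    then show "T.cls g \<in> c ` carrier H.K" using H.cls_closed[OF g] by blast
  qed
  moreover have "c ` carrier H.K \<subseteq> carrier T.K" using hm.hom_closed by blast
  ultimately have "c \<in> epi (K0_add A) (K0_tr C)"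
    using c by (auto simp: epi_def K0_tr_eq e)
  then show ?thesis using that[of c] cc by (simp add: K0_tr_eq)
qed

end

section \<open>Resolutions by representable presheaves\<close>

context yoneda_category
begin

lemma pmap_factor:
  assumes i: "pmap A H \<iota> G" and inj: "\<And>X. X \<in> Ob A \<Longrightarrow> inj_on (\<iota> X) (carrier (pob H X))" and p: "pmap A F \<phi> G"
    and im: "\<And>X x. X \<in> Ob A \<Longrightarrow> x \<in> carrier (pob F X) \<Longrightarrow> \<phi> X x \<in> \<iota> X ` carrier (pob H X)"
  obtains \<psi> where "pmap A F \<psi> H" "\<And>X x. X \<in> Ob A \<Longrightarrow> x \<in> carrier (pob F X) \<Longrightarrow> \<iota> X (\<psi> X x) = \<phi> X x"
proof
  define \<psi> where "\<psi> X x = inv_into (carrier (pob H X)) (\<iota> X) (\<phi> X x)" for X x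
  show e: "\<iota> X (\<psi> X x) = \<phi> X x" if "X \<in> Ob A" "x \<in> carrier (pob F X)" for X x
    unfolding \<psi>_def by (rule f_inv_into_f[OF im[OF that]])
  have c: "\<psi> X x \<in> carrier (pob H X)" if "X \<in> Ob A" "x \<in> carrier (pob F X)" for X x
    unfolding \<psi>_def by (rule inv_into_into[OF im[OF that]])
  have u: "\<psi> X x = z" if "X \<in> Ob A" "x \<in> carrier (pob F X)" "z \<in> carrier (pob H X)" "\<phi> X x = \<iota> X z" for X x z
    using inj_onD[OF inj[OF that(1)]] e c that by simp
  show "pmap A F \<psi> H" unfolding pmap_def
  proof (intro conjI ballI allI)
    show "is_presheaf A F" "is_presheaf A H" by (rule pmapD[OF p] pmapD[OF i])+
    fix X assume X: "X \<in> Ob A"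
    interpret p: group_hom "pob F X" "pob G X" "\<phi> X" by (rule pmap_group_hom[OF p X])
    interpret i: group_hom "pob H X" "pob G X" "\<iota> X" by (rule pmap_group_hom[OF i X])
    show "\<psi> X \<in> hom (pob F X) (pob H X)"
    proof (rule homI)
      fix x x' assume x: "x \<in> carrier (pob F X)" "x' \<in> carrier (pob F X)"
      show "\<psi> X (x \<otimes>\<^bsub>pob F X\<^esub> x') = \<psi> X x \<otimes>\<^bsub>pob H X\<^esub> \<psi> X x'"
        by (rule u[OF X]) (simp_all add: x c[OF X] e[OF X])
    qed (rule c[OF X])
  next
    fix X Y f x assume f: "f \<in> Hom A X Y" and x: "x \<in> carrier (pob F Y)"
    note X = Hom_Ob(1)[OF f] and Y = Hom_Ob(2)[OF f]
    show "\<psi> X (par F f x) = par H f (\<psi> Y x)"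
      by (rule u[OF X par_closed[OF pmapD(1)[OF p] f x] par_closed[OF pmapD(1)[OF i] f c[OF Y x]]])
        (simp add: pmapD(5)[OF p f x] pmapD(5)[OF i f c[OF Y x]] e[OF Y x])
  qed
qed

abbreviation post :: "'m \<Rightarrow> 'o \<Rightarrow> 'u \<Rightarrow> 'u" where
  "post g \<equiv> (\<lambda>Q u. j (g \<cdot> the_inv j u))"

text \<open>The Yoneda correspondence: an element \<open>e\<close> of \<open>M\<close> at
  \<open>P\<close> stands for the map from the representable presheaf of \<open>P\<close> to
  \<open>M\<close> that sends the identity to \<open>e\<close>. Maps out of representables can thus
  be replaced by single elements.\<close>

abbreviation ev :: "('o, 'm, 'u) presheaf \<Rightarrow> 'u \<Rightarrow> 'o \<Rightarrow> 'u \<Rightarrow> 'u" where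
  "ev M e \<equiv> (\<lambda>Q u. par M (the_inv j u) e)"

definition syz :: "('o, 'm, 'u) presheaf \<Rightarrow> 'o \<Rightarrow> 'u \<Rightarrow> ('o, 'm, 'u) presheaf" where
  "syz M P e = psub (y P) (pker (y P) (ev M e) M)"

lemma par_Zr:
  assumes M: "is_presheaf A M" and "Q \<in> Ob A" "P \<in> Ob A" and e: "e \<in> carrier (pob M P)"
  shows "par M (Zr A Q P) e = \<one>\<^bsub>pob M Q\<^esub>"
proof -
  interpret comm_group "pob M Q" by (rule presheaf_simps(1)[OF M assms(2)])
  have z: "Zr A Q P \<in> Hom A Q P" using assms by blast
  have "par M (Zr A Q P) e \<otimes>\<^bsub>pob M Q\<^esub> par M (Zr A Q P) e = par M (Zr A Q P) e"
    using presheaf_simps(5)[OF M z z e] assms by simp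
  then show ?thesis using par_closed[OF M z e] r_cancel_one' by metis
qed

lemma ev_pmap:
  assumes M: "is_presheaf A M" and P: "P \<in> Ob A" and e: "e \<in> carrier (pob M P)"
  shows "pmap A (y P) (ev M e) M"
  unfolding pmap_def
proof (intro conjI ballI allI)
  show "is_presheaf A (y P)" "is_presheaf A M" by (rule y_presheaf[OF P] M)+
  fix Q assume Q: "Q \<in> Ob A"
  show "ev M e Q \<in> hom (pob (y P) Q) (pob M Q)"
  proof (rule homI)
    fix u assume "u \<in> carrier (pob (y P) Q)"
    then obtain f where f: "u = j f" "f \<in> Hom A Q P" by auto
    show "ev M e Q u \<in> carrier (pob M Q)" using par_closed[OF M f(2) e] by (simp add: f)
    fix v assume "v \<in> carrier (pob (y P) Q)"
    then obtain g where g: "v = j g" "g \<in> Hom A Q P" by auto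
    show "ev M e Q (u \<otimes>\<^bsub>pob (y P) Q\<^esub> v) = ev M e Q u \<otimes>\<^bsub>pob M Q\<^esub> ev M e Q v"
      using presheaf_simps(5)[OF M f(2) g(2) e] by (simp add: f(1) g(1))
  qed
next
  fix X Y f u assume f: "f \<in> Hom A X Y" and "u \<in> carrier (pob (y P) Y)"
  then obtain g where g: "u = j g" "g \<in> Hom A Y P" by auto
  show "ev M e X (par (y P) f u) = par M f (ev M e Y u)"
    using presheaf_simps(4)[OF M f g(2) e] by (simp add: g(1))
qed

lemma in_syz:
  "u \<in> carrier (pob (syz M P e) Q) \<longleftrightarrow> (\<exists>f\<in>Hom A Q P. u = j f \<and> par M f e = \<one>\<^bsub>pob M Q\<^esub>)"
  by (auto simp: syz_def pker_def)

lemma syz_simps [simp]: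
  "one (pob (syz M P e) Q) = j (Zr A Q P)" "monoid.mult (pob (syz M P e) Q) (j f) (j g) = j (Add A f g)"
  "par (syz M P e) f (j g) = j (g \<cdot> f)"
  by (simp_all add: syz_def)

lemma syz_presheaf:
  assumes "is_presheaf A M" "P \<in> Ob A" "e \<in> carrier (pob M P)"
  shows "is_presheaf A (syz M P e)"
  unfolding syz_def by (rule psub_presheaf[OF subpresheaf_pker[OF ev_pmap[OF assms]]])

text \<open>The last clause says that the map given by \<open>e\<close> is onto. By Yoneda a single
  equation at \<open>e\<close> makes \<open>p\<close> a lift of \<open>m\<close>; projectivity of
  representables amounts to solving that equation by a generator property.\<close>

definition stage :: "('o, 'm, 'u) presheaf \<Rightarrow> ('o \<Rightarrow> 'u \<Rightarrow> 'u) \<Rightarrow> 'o \<Rightarrow> 'm \<Rightarrow> 'u \<Rightarrow> bool" where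
  "stage M m P p e \<longleftrightarrow> P \<in> Ob A \<and> p \<in> Hom A P P \<and> e \<in> carrier (pob M P) \<and> par M p e = m P e \<and>
     (\<forall>Q\<in>Ob A. \<forall>x\<in>carrier (pob M Q). \<exists>f\<in>Hom A Q P. par M f e = x)"

lemma stageD:
  assumes "stage M m P p e"
  shows "P \<in> Ob A" "p \<in> Hom A P P" "e \<in> carrier (pob M P)" "par M p e = m P e"
  using assms by (auto simp: stage_def)

lemma stage_gen:
  assumes "stage M m P p e" "Q \<in> Ob A" "x \<in> carrier (pob M Q)"
  obtains f where "f \<in> Hom A Q P" "par M f e = x"
  using assms unfolding stage_def by blast

lemma stage_par:
  assumes st: "stage M m P p e" and m: "pmap A M m M" and f: "f \<in> Hom A Q P"
  shows "par M (p \<cdot> f) e = m Q (par M f e)"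
  using presheaf_simps(4)[OF pmapD(1)[OF m] f stageD(2,3)[OF st]] pmapD(5)[OF m f stageD(3)[OF st]] stageD(4)[OF st] by simp

lemma syz_endo:
  assumes st: "stage M m P p e" and m: "pmap A M m M"
  shows "pmap A (syz M P e) (post p) (syz M P e)"
  unfolding syz_def
proof (rule restrict_ker_im(1)[OF ev_pmap[OF pmapD(1)[OF m] stageD(1,3)[OF st]] y_pmap[OF stageD(2)[OF st]] m])
  fix X u assume "u \<in> carrier (pob (y P) X)"
  then obtain f where f: "u = j f" "f \<in> Hom A X P" by auto
  show "m X (ev M e X u) = ev M e X (post p X u)" using stage_par[OF st m f(2)] by (simp add: f(1))
qed

end

locale additive_yoneda = yoneda_category A j
  for A :: "('o, 'm, 'z) catdata_scheme" (structure) and j :: "'m \<Rightarrow> 'u" +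
  assumes additive: "additive_category A"
begin

sublocale KA: presented "endos A" "add_triples A"
  by unfold_locales (rule add_triples_endos)

lemma KA_cls_closed [simp]: "p \<in> Hom A P P \<Longrightarrow> KA.cls p \<in> carrier KA.K"
  by (rule KA.cls_closed) (simp add: endos_def in_Hom)

lemma zero_exists: obtains Z where "zero_object A Z"
  using additive unfolding additive_category_def by blast

lemma biproduct_exists:
  assumes "X \<in> Ob A" "Y \<in> Ob A" obtains W i s r q where "is_biproduct A X Y W i s r q"
  using additive assms unfolding additive_category_def by blast

lemma class_biproduct:
  assumes b: "is_biproduct A X Y W i s r q" and f: "f \<in> Hom A X X" and g: "g \<in> Hom A W W" and h: "h \<in> Hom A Y Y"
    and gi: "g \<cdot> i = i \<cdot> f" and hq: "h \<cdot> q = q \<cdot> g"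
  shows "KA.cls g = KA.cls f \<otimes>\<^bsub>KA.K\<^esub> KA.cls h"
proof (rule KA.cls_relation)
  note d = biproductD[OF b]
  have "split_exact A i q" unfolding split_exact_def d by (rule exI, rule exI, rule b)
  moreover have "sequence_endo A i q f g h" unfolding sequence_endo_def d using f g h gi hq by simp
  ultimately show "(f, g, h) \<in> add_triples A" unfolding add_triples_def by blast
qed

lemma class_zero_object:
  assumes Z: "zero_object A Z" and f: "f \<in> Hom A Z Z" shows "KA.cls f = \<one>\<^bsub>KA.K\<^esub>"
proof -
  note [simp] = zero_object_Ob[OF Z] HomD[OF f]
  have fz: "f = Zr A Z Z" and i: "Idn A Z = Zr A Z Z" using zero_object_to[OF Z, of f] Z zero_object_iff by auto
  have "is_biproduct A Z Z Z (Idn A Z) (Idn A Z) (Idn A Z) (Idn A Z)"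
    unfolding is_biproduct_def i by (simp add: in_Hom)
  then have "KA.cls f = KA.cls f \<otimes>\<^bsub>KA.K\<^esub> KA.cls f" by (rule class_biproduct[OF _ f f f]) simp_all
  then show ?thesis using KA_cls_closed[OF f] KA.K.r_cancel_one' by metis
qed

text \<open>
  \<open>res n M m \<alpha>\<close>: the endomorphism \<open>m\<close> of \<open>M\<close> lifts to a resolution of \<open>M\<close> of length at most \<open>n\<close> by representable
  presheaves, and \<open>\<alpha>\<close> is the alternating sum of the classes of the lifted endomorphisms. In each step the
  element \<open>e\<close> of \<open>M P\<close> stands for the epimorphism from the representable presheaf of \<open>P\<close> onto \<open>M\<close>.
\<close>

primrec res :: "nat \<Rightarrow> ('o, 'm, 'u) presheaf \<Rightarrow> ('o \<Rightarrow> 'u \<Rightarrow> 'u) \<Rightarrow> ('m \<Rightarrow>\<^sub>0 int) set \<Rightarrow> bool" where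
  "res 0 M m \<alpha> \<longleftrightarrow> trivial M \<and> \<alpha> = \<one>\<^bsub>KA.K\<^esub>"
| "res (Suc n) M m \<alpha> \<longleftrightarrow> (\<exists>P p e \<beta>. stage M m P p e \<and> res n (syz M P e) (post p) \<beta> \<and>
     \<alpha> = KA.cls p \<otimes>\<^bsub>KA.K\<^esub> inv\<^bsub>KA.K\<^esub> \<beta>)"

declare res.simps [simp del]

lemma res_SucI:
  assumes "stage M m P p e" "res n (syz M P e) (post p) \<beta>" "\<alpha> = KA.cls p \<otimes>\<^bsub>KA.K\<^esub> inv\<^bsub>KA.K\<^esub> \<beta>"
  shows "res (Suc n) M m \<alpha>"
  unfolding res.simps using assms by blast

lemma res_SucE:
  assumes "res (Suc n) M m \<alpha>"
  obtains P p e \<beta> where "stage M m P p e" "res n (syz M P e) (post p) \<beta>"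
    "\<alpha> = KA.cls p \<otimes>\<^bsub>KA.K\<^esub> inv\<^bsub>KA.K\<^esub> \<beta>"
  using assms unfolding res.simps by blast

lemma res_closed: "res n M m \<alpha> \<Longrightarrow> \<alpha> \<in> carrier KA.K"
proof (induction n arbitrary: M m \<alpha>)
  case (Suc n)
  obtain P p e \<beta> where s: "stage M m P p e" "res n (syz M P e) (post p) \<beta>"
    "\<alpha> = KA.cls p \<otimes>\<^bsub>KA.K\<^esub> inv\<^bsub>KA.K\<^esub> \<beta>" by (rule res_SucE[OF Suc.prems])
  show ?case using Suc.IH[OF s(2)] KA_cls_closed[OF stageD(2)[OF s(1)]] by (simp add: s(3))
qed (simp add: res.simps)

text \<open>The lift for \<open>M\<close> is reused with the transported generator. The syzygies of
  both presheaves are then the same subsets of the representable presheaf, and the identity map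
  carries the induction.\<close>

lemma res_iso:
  assumes "res n M m \<alpha>" and \<phi>: "pmap A M \<phi> M'" and "pmap A M m M"
    and inj: "\<And>Q. Q \<in> Ob A \<Longrightarrow> inj_on (\<phi> Q) (carrier (pob M Q))"
    and surj: "\<And>Q. Q \<in> Ob A \<Longrightarrow> \<phi> Q ` carrier (pob M Q) = carrier (pob M' Q)"
    and c: "\<And>Q x. Q \<in> Ob A \<Longrightarrow> x \<in> carrier (pob M Q) \<Longrightarrow> m' Q (\<phi> Q x) = \<phi> Q (m Q x)"
  shows "res n M' m' \<alpha>"
  using assms
proof (induction n arbitrary: M m M' m' \<phi> \<alpha>)
  case 0
  have "trivial M'" unfolding trivial_def
  proof
    fix Q assume Q: "Q \<in> Ob A"
    have "carrier (pob M Q) = {\<one>\<^bsub>pob M Q\<^esub>}" using 0(1) Q by (simp add: res.simps trivial_def)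
    then show "carrier (pob M' Q) = {\<one>\<^bsub>pob M' Q\<^esub>}" using 0(5)[OF Q] pmap_one[OF 0(2) Q] by auto
  qed
  then show ?case using 0(1) by (simp add: res.simps)
next
  case (Suc n)
  note \<phi> = Suc.prems(2) and m = Suc.prems(3) and inj = Suc.prems(4) and surj = Suc.prems(5) and c = Suc.prems(6)
  obtain P p e \<beta> where s: "stage M m P p e" "res n (syz M P e) (post p) \<beta>"
    "\<alpha> = KA.cls p \<otimes>\<^bsub>KA.K\<^esub> inv\<^bsub>KA.K\<^esub> \<beta>" by (rule res_SucE[OF Suc.prems(1)])
  note P = stageD[OF s(1)]
  have M: "is_presheaf A M" "is_presheaf A M'" by (rule pmapD[OF \<phi>])+
  have e': "\<phi> P e \<in> carrier (pob M' P)" by (rule pmapD(4)[OF \<phi> P(1,3)])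
  have s': "stage M' m' P p (\<phi> P e)" unfolding stage_def
  proof (intro conjI ballI P(1,2) e')
    show "par M' p (\<phi> P e) = m' P (\<phi> P e)"
      using pmapD(5)[OF \<phi> P(2,3)] P(4) c[OF P(1,3)] by simp
    fix Q x assume Q: "Q \<in> Ob A" and "x \<in> carrier (pob M' Q)"
    then obtain z where z: "z \<in> carrier (pob M Q)" "x = \<phi> Q z" using surj[OF Q] by blast
    obtain f where f: "f \<in> Hom A Q P" "par M f e = z" using stage_gen[OF s(1) Q z(1)] .
    show "\<exists>f\<in>Hom A Q P. par M' f (\<phi> P e) = x"
      by (rule bexI[OF _ f(1)]) (simp add: z(2) pmapD(5)[OF \<phi> f(1) P(3), symmetric] f(2))
  qed
  have k: "carrier (pob (syz M' P (\<phi> P e)) Q) = carrier (pob (syz M P e) Q)" if Q: "Q \<in> Ob A" for Q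
  proof -
    have "par M' f (\<phi> P e) = \<one>\<^bsub>pob M' Q\<^esub> \<longleftrightarrow> par M f e = \<one>\<^bsub>pob M Q\<^esub>" if f: "f \<in> Hom A Q P" for f
    proof
      assume "par M' f (\<phi> P e) = \<one>\<^bsub>pob M' Q\<^esub>"
      then have "\<phi> Q (par M f e) = \<phi> Q \<one>\<^bsub>pob M Q\<^esub>" using pmapD(5)[OF \<phi> f P(3)] pmap_one[OF \<phi> Q] by simp
      then show "par M f e = \<one>\<^bsub>pob M Q\<^esub>"
        by (rule inj_onD[OF inj[OF Q] _ par_closed[OF M(1) f P(3)] presheaf_one[OF M(1) Q]])
    next
      assume "par M f e = \<one>\<^bsub>pob M Q\<^esub>"
      then show "par M' f (\<phi> P e) = \<one>\<^bsub>pob M' Q\<^esub>" using pmapD(5)[OF \<phi> f P(3)] pmap_one[OF \<phi> Q] by simp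
    qed
    then show ?thesis unfolding set_eq_iff in_syz by (simp cong: bex_cong)
  qed
  have "res n (syz M' P (\<phi> P e)) (post p) \<beta>"
  proof (rule Suc.IH[OF s(2) _ syz_endo[OF s(1) m]])
    show "pmap A (syz M P e) (\<lambda>Q x. x) (syz M' P (\<phi> P e))"
      unfolding pmap_def
    proof (intro conjI ballI allI)
      show "is_presheaf A (syz M P e)" "is_presheaf A (syz M' P (\<phi> P e))"
        by (rule syz_presheaf[OF M(1) P(1,3)] syz_presheaf[OF M(2) P(1) e'])+
      show "(\<lambda>x. x) \<in> hom (pob (syz M P e) Q) (pob (syz M' P (\<phi> P e)) Q)" if "Q \<in> Ob A" for Q
        by (rule homI) (simp_all add: k[OF that], simp add: syz_def)
    qed (simp add: syz_def)
  qed (simp_all add: k)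
  then show ?case by (rule res_SucI[OF s' _ s(3)])
qed

lemma res_cong:
  assumes "res n M m \<alpha>" "pmap A M m M" "\<And>Q x. Q \<in> Ob A \<Longrightarrow> x \<in> carrier (pob M Q) \<Longrightarrow> m' Q x = m Q x"
  shows "res n M m' \<alpha>"
  by (rule res_iso[OF assms(1) pmap_id[OF pmapD(1)[OF assms(2)]] assms(2)]) (simp_all add: assms(3))

text \<open>A zero object can be appended at the end of a resolution at no cost, so two resolutions
  may be assumed to have equal length.\<close>

lemma res_Suc: "res n M m \<alpha> \<Longrightarrow> pmap A M m M \<Longrightarrow> res (Suc n) M m \<alpha>"
proof (induction n arbitrary: M m \<alpha>)
  case 0
  then have t: "trivial M" and \<alpha>: "\<alpha> = \<one>\<^bsub>KA.K\<^esub>" by (simp_all add: res.simps)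
  have M: "is_presheaf A M" by (rule pmapD(1)[OF 0(2)])
  obtain Z where Z: "zero_object A Z" by (rule zero_exists)
  note Z' = zero_object_Ob[OF Z]
  have i: "Idn A Z \<in> Hom A Z Z" using Z' by blast
  have e: "\<one>\<^bsub>pob M Z\<^esub> \<in> carrier (pob M Z)" by (rule presheaf_one[OF M Z'])
  have s: "stage M m Z (Idn A Z) \<one>\<^bsub>pob M Z\<^esub>" unfolding stage_def
  proof (intro conjI ballI Z' i e)
    show "par M (Idn A Z) \<one>\<^bsub>pob M Z\<^esub> = m Z \<one>\<^bsub>pob M Z\<^esub>"
      using presheaf_simps(3)[OF M Z' e] pmap_one[OF 0(2) Z'] by simp
    fix Q x assume Q: "Q \<in> Ob A" and "x \<in> carrier (pob M Q)"
    then have "x = \<one>\<^bsub>pob M Q\<^esub>" using t by (auto simp: trivial_def)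
    then show "\<exists>f\<in>Hom A Q Z. par M f \<one>\<^bsub>pob M Z\<^esub> = x" using par_Zr[OF M Q Z' e] Q Z' by blast
  qed
  have "trivial (syz M Z \<one>\<^bsub>pob M Z\<^esub>)" unfolding trivial_def
  proof
    fix Q assume Q: "Q \<in> Ob A"
    have "f = Zr A Q Z" if "f \<in> Hom A Q Z" for f using zero_object_to[OF Z, of f] that by (simp add: in_Hom)
    then have "u = j (Zr A Q Z)" if "u \<in> carrier (pob (syz M Z \<one>\<^bsub>pob M Z\<^esub>) Q)" for u
      using that unfolding in_syz by blast
    moreover have "j (Zr A Q Z) \<in> carrier (pob (syz M Z \<one>\<^bsub>pob M Z\<^esub>) Q)"
      unfolding in_syz using par_Zr[OF M Q Z' e] Q Z' by blast
    ultimately have "carrier (pob (syz M Z \<one>\<^bsub>pob M Z\<^esub>) Q) = {j (Zr A Q Z)}" by blast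
    then show "carrier (pob (syz M Z \<one>\<^bsub>pob M Z\<^esub>) Q) = {\<one>\<^bsub>pob (syz M Z \<one>\<^bsub>pob M Z\<^esub>) Q\<^esub>}"
      by simp
  qed
  then have r: "res 0 (syz M Z \<one>\<^bsub>pob M Z\<^esub>) (post (Idn A Z)) \<one>\<^bsub>KA.K\<^esub>" by (simp add: res.simps)
  show ?case by (rule res_SucI[OF s r]) (simp add: \<alpha> class_zero_object[OF Z i])
next
  case (Suc n)
  obtain P p e \<beta> where s: "stage M m P p e" "res n (syz M P e) (post p) \<beta>"
    "\<alpha> = KA.cls p \<otimes>\<^bsub>KA.K\<^esub> inv\<^bsub>KA.K\<^esub> \<beta>" by (rule res_SucE[OF Suc.prems(1)])
  show ?case by (rule res_SucI[OF s(1) Suc.IH[OF s(2) syz_endo[OF s(1) Suc.prems(2)]] s(3)])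
qed

lemma res_mono:
  assumes "res n M m \<alpha>" "pmap A M m M" "n \<le> k" shows "res k M m \<alpha>"
  using assms(3,1) by (induction k rule: dec_induct) (blast intro: res_Suc[OF _ assms(2)])+

end

section \<open>The horseshoe argument for endomorphisms\<close>

context additive_yoneda
begin

lemma syzE:
  assumes "u \<in> carrier (pob (syz M P e) Q)"
  obtains f where "f \<in> Hom A Q P" "u = j f" "par M f e = \<one>\<^bsub>pob M Q\<^esub>"
  using assms unfolding in_syz by blast

lemma syzI: "f \<in> Hom A Q P \<Longrightarrow> par M f e = \<one>\<^bsub>pob M Q\<^esub> \<Longrightarrow> j f \<in> carrier (pob (syz M P e) Q)"
  unfolding in_syz by blast

lemma syz_pmap:
  assumes M: "is_presheaf A M" "P \<in> Ob A" "e \<in> carrier (pob M P)"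
    and N: "is_presheaf A N" "R \<in> Ob A" "x \<in> carrier (pob N R)" and g: "g \<in> Hom A P R"
    and ker: "\<And>Q f. f \<in> Hom A Q P \<Longrightarrow> par M f e = \<one>\<^bsub>pob M Q\<^esub> \<Longrightarrow> par N (g \<cdot> f) x = \<one>\<^bsub>pob N Q\<^esub>"
  shows "pmap A (syz M P e) (post g) (syz N R x)"
  unfolding syz_def
proof (rule pmap_psub_to[OF pmap_psub_from[OF y_pmap[OF g]]])
  show "subpresheaf (y P) (pker (y P) (ev M e) M)" "subpresheaf (y R) (pker (y R) (ev N x) N)"
    by (rule subpresheaf_pker[OF ev_pmap[OF M]] subpresheaf_pker[OF ev_pmap[OF N]])+
  fix Q u assume "Q \<in> Ob A" and "u \<in> carrier (pob (psub (y P) (pker (y P) (ev M e) M)) Q)"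
  then obtain f where f: "f \<in> Hom A Q P" "u = j f" "par M f e = \<one>\<^bsub>pob M Q\<^esub>" by (auto simp: pker_def)
  show "post g Q u \<in> pker (y R) (ev N x) N Q"
    using ker[OF f(1,3)] Cmp_Hom[OF f(1) g] by (auto simp: pker_def f(2))
qed

text \<open>The generators of \<open>M'\<close> and \<open>M''\<close> combine to one on the direct
  sum \<open>W\<close>, and the lift of \<open>m\<close> to \<open>W\<close> is triangular with
  diagonal entries p' and p''. Its class is therefore the product of their classes, whatever the
  off-diagonal entry is. The syzygies form a short exact sequence again, to which the induction
  hypothesis applies.\<close>

lemma res_extension:
  assumes "res n M' m' \<alpha>'" "res n M'' m'' \<alpha>''"
    and \<iota>: "pmap A M' \<iota> M" and \<pi>: "pmap A M \<pi> M''"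
    and inj: "\<And>Q. Q \<in> Ob A \<Longrightarrow> inj_on (\<iota> Q) (carrier (pob M' Q))"
    and surj: "\<And>Q. Q \<in> Ob A \<Longrightarrow> \<pi> Q ` carrier (pob M Q) = carrier (pob M'' Q)"
    and ex: "\<And>Q. Q \<in> Ob A \<Longrightarrow> \<iota> Q ` carrier (pob M' Q) = {x \<in> carrier (pob M Q). \<pi> Q x = \<one>\<^bsub>pob M'' Q\<^esub>}"
    and m': "pmap A M' m' M'" and m: "pmap A M m M" and m'': "pmap A M'' m'' M''"
    and c': "\<And>Q x. Q \<in> Ob A \<Longrightarrow> x \<in> carrier (pob M' Q) \<Longrightarrow> m Q (\<iota> Q x) = \<iota> Q (m' Q x)"
    and c'': "\<And>Q x. Q \<in> Ob A \<Longrightarrow> x \<in> carrier (pob M Q) \<Longrightarrow> m'' Q (\<pi> Q x) = \<pi> Q (m Q x)"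
  shows "res n M m (\<alpha>' \<otimes>\<^bsub>KA.K\<^esub> \<alpha>'')"
  using assms
proof (induction n arbitrary: M' m' \<alpha>' M'' m'' \<alpha>'' \<iota> \<pi> M m)
  case 0
  note \<iota> = 0(3) and \<pi> = 0(4) and ex = 0(7)
  have t: "trivial M'" "trivial M''" "\<alpha>' = \<one>\<^bsub>KA.K\<^esub>" "\<alpha>'' = \<one>\<^bsub>KA.K\<^esub>" using 0(1,2) by (simp_all add: res.simps)
  have "trivial M" unfolding trivial_def
  proof
    fix Q assume Q: "Q \<in> Ob A"
    have "\<pi> Q x = \<one>\<^bsub>pob M'' Q\<^esub>" if "x \<in> carrier (pob M Q)" for x
      using pmapD(4)[OF \<pi> Q that] t(2) Q by (simp add: trivial_def)
    then have "carrier (pob M Q) = \<iota> Q ` carrier (pob M' Q)" unfolding ex[OF Q] by blast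
    moreover have "carrier (pob M' Q) = {\<one>\<^bsub>pob M' Q\<^esub>}" using t(1) Q by (simp add: trivial_def)
    ultimately show "carrier (pob M Q) = {\<one>\<^bsub>pob M Q\<^esub>}" using pmap_one[OF \<iota> Q] by simp
  qed
  then show ?case using t by (simp add: res.simps)
next
  case (Suc n)
  note \<iota> = Suc.prems(3) and \<pi> = Suc.prems(4) and inj = Suc.prems(5) and surj = Suc.prems(6) and ex = Suc.prems(7)
    and m' = Suc.prems(8) and m = Suc.prems(9) and m'' = Suc.prems(10) and c' = Suc.prems(11) and c'' = Suc.prems(12)
  have M': "is_presheaf A M'" and M: "is_presheaf A M" and M'': "is_presheaf A M''"
    by (rule pmapD[OF \<iota>] pmapD[OF \<pi>])+
  obtain P' p' e' \<beta>' where s': "stage M' m' P' p' e'" "res n (syz M' P' e') (post p') \<beta>'"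
    "\<alpha>' = KA.cls p' \<otimes>\<^bsub>KA.K\<^esub> inv\<^bsub>KA.K\<^esub> \<beta>'" by (rule res_SucE[OF Suc.prems(1)])
  obtain P'' p'' e'' \<beta>'' where s'': "stage M'' m'' P'' p'' e''" "res n (syz M'' P'' e'') (post p'') \<beta>''"
    "\<alpha>'' = KA.cls p'' \<otimes>\<^bsub>KA.K\<^esub> inv\<^bsub>KA.K\<^esub> \<beta>''" by (rule res_SucE[OF Suc.prems(2)])
  note P' = stageD[OF s'(1)] and P'' = stageD[OF s''(1)]
  have "e'' \<in> \<pi> P'' ` carrier (pob M P'')" using P''(3) by (simp only: surj[OF P''(1)])
  \<comment> \<open>The element \<open>b\<close> lifts the generator of \<open>M''\<close> to
    \<open>M\<close>. This choice is not compatible with \<open>m\<close>, which is why an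
    off-diagonal entry becomes necessary.\<close>
  then obtain b where b: "b \<in> carrier (pob M P'')" "\<pi> P'' b = e''" by (auto simp only: image_iff)
  obtain W i s r q where W: "is_biproduct A P' P'' W i s r q" using biproduct_exists[OF P'(1) P''(1)] .
  note d [simp] = biproductD[OF W]
  have Hom: "i \<in> Hom A P' W" "s \<in> Hom A P'' W" "r \<in> Hom A W P'" "q \<in> Hom A W P''" by (simp_all add: in_Hom)
  define a where "a = \<iota> P' e'"
  have a: "a \<in> carrier (pob M P')" unfolding a_def by (rule pmapD(4)[OF \<iota> P'(1,3)])
  define e where "e = par M r a \<otimes>\<^bsub>pob M W\<^esub> par M q b"
  have ra: "par M r a \<in> carrier (pob M W)" "par M q b \<in> carrier (pob M W)"
    by (rule par_closed[OF M Hom(3) a] par_closed[OF M Hom(4) b(1)])+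
  interpret W: comm_group "pob M W" by (rule presheaf_simps(1)[OF M d(3)])
  have e: "e \<in> carrier (pob M W)" unfolding e_def using ra by simp
  have pa: "par M f a = \<iota> Q (par M' f e')" if f: "f \<in> Hom A Q P'" for f Q
    unfolding a_def using pmapD(5)[OF \<iota> f P'(3)] by simp
  have pb: "\<pi> Q (par M f b) = par M'' f e''" if f: "f \<in> Hom A Q P''" for f Q
    using pmapD(5)[OF \<pi> f b(1)] b(2) by simp
  have pe: "par M f e = \<iota> Q (par M' (r \<cdot> f) e') \<otimes>\<^bsub>pob M Q\<^esub> par M (q \<cdot> f) b" if f: "f \<in> Hom A Q W" for f Q
  proof -
    have "par M f e = par M f (par M r a) \<otimes>\<^bsub>pob M Q\<^esub> par M f (par M q b)"
      unfolding e_def by (rule hom_mult[OF presheaf_simps(2)[OF M f] ra])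
    moreover have "r \<cdot> f \<in> Hom A Q P'" by (rule Cmp_Hom[OF f Hom(3)])
    ultimately show ?thesis
      using pa presheaf_simps(4)[OF M f Hom(3) a] presheaf_simps(4)[OF M f Hom(4) b(1)] by simp
  qed
  have \<pi>\<iota>: "\<pi> Q (\<iota> Q x) = \<one>\<^bsub>pob M'' Q\<^esub>" if "Q \<in> Ob A" "x \<in> carrier (pob M' Q)" for Q x
    using ex[OF that(1)] that(2) by blast
  have \<pi>e: "\<pi> Q (par M f e) = par M'' (q \<cdot> f) e''" if f: "f \<in> Hom A Q W" for f Q
  proof -
    have Q: "Q \<in> Ob A" by (rule Hom_Ob[OF f])
    interpret group_hom "pob M Q" "pob M'' Q" "\<pi> Q" by (rule pmap_group_hom[OF \<pi> Q])
    have rf: "r \<cdot> f \<in> Hom A Q P'" and qf: "q \<cdot> f \<in> Hom A Q P''" by (rule Cmp_Hom[OF f Hom(3)] Cmp_Hom[OF f Hom(4)])+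
    show ?thesis
      using par_closed[OF M' rf P'(3)] par_closed[OF M qf b(1)] par_closed[OF M'' qf P''(3)] pmapD(4)[OF \<iota> Q] \<pi>\<iota>[OF Q] pb[OF qf]
      by (simp add: pe[OF f])
  qed
  \<comment> \<open>An element of \<open>M\<close> whose image in \<open>M''\<close> is given by
    \<open>f\<close> differs from the pullback of \<open>b\<close> along \<open>f\<close> by
    something coming from \<open>M'\<close>. This yields the off-diagonal entry, surjectivity of the
    new generator, and surjectivity on syzygies.\<close>
  have split: "\<exists>t\<in>Hom A Q P'. x = \<iota> Q (par M' t e') \<otimes>\<^bsub>pob M Q\<^esub> par M f b"
    if Q: "Q \<in> Ob A" and x: "x \<in> carrier (pob M Q)" and f: "f \<in> Hom A Q P''" "\<pi> Q x = par M'' f e''" for Q x f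
  proof -
    interpret group_hom "pob M Q" "pob M'' Q" "\<pi> Q" by (rule pmap_group_hom[OF \<pi> Q])
    have fb: "par M f b \<in> carrier (pob M Q)" by (rule par_closed[OF M f(1) b(1)])
    have "\<pi> Q (x \<otimes>\<^bsub>pob M Q\<^esub> inv\<^bsub>pob M Q\<^esub> par M f b) = \<one>\<^bsub>pob M'' Q\<^esub>"
      using x fb pb[OF f(1)] par_closed[OF M'' f(1) P''(3)] by (simp add: f(2))
    then have "x \<otimes>\<^bsub>pob M Q\<^esub> inv\<^bsub>pob M Q\<^esub> par M f b \<in> \<iota> Q ` carrier (pob M' Q)"
      unfolding ex[OF Q] using x fb by simp
    then obtain z where z: "z \<in> carrier (pob M' Q)" "x \<otimes>\<^bsub>pob M Q\<^esub> inv\<^bsub>pob M Q\<^esub> par M f b = \<iota> Q z" by blast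
    obtain t where t: "t \<in> Hom A Q P'" "par M' t e' = z" using stage_gen[OF s'(1) Q z(1)] .
    have "x = \<iota> Q (par M' t e') \<otimes>\<^bsub>pob M Q\<^esub> par M f b"
      using x fb by (simp add: t(2) z(2)[symmetric] G.m_assoc)
    then show ?thesis using t(1) by blast
  qed
  have "\<pi> P'' (m P'' b) = par M'' p'' e''" using c''[OF P''(1) b(1)] b(2) P''(4) by simp
  \<comment> \<open>The defect of \<open>b\<close> with respect to \<open>m\<close> and p'' lies in
    \<open>M'\<close> and is written through its generator; \<open>t\<close> is the off-diagonal
    entry of the lift.\<close>
  then obtain t where t: "t \<in> Hom A P'' P'" "m P'' b = \<iota> P'' (par M' t e') \<otimes>\<^bsub>pob M P''\<^esub> par M p'' b"
    using split[OF P''(1) pmapD(4)[OF m P''(1) b(1)] P''(2)] by blast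
  define x where "x = Add A (p' \<cdot> r) (t \<cdot> q)"
  define p where "p = Add A (i \<cdot> x) (s \<cdot> (p'' \<cdot> q))"
  note [simp] = HomD[OF P'(2)] HomD[OF P''(2)] HomD[OF t(1)]
  have x: "x \<in> Hom A W P'" by (simp add: x_def in_Hom)
  have pq: "p'' \<cdot> q \<in> Hom A W P''" by (simp add: in_Hom)
  note p = biproduct_pair[OF W x pq, folded p_def]
  note [simp] = HomD[OF p(1)] HomD[OF x]
  have st: "stage M m W p e" unfolding stage_def
  proof (intro conjI ballI d(3) p(1) e)
    have 1: "par M' x e' = par M' r (par M' p' e') \<otimes>\<^bsub>pob M' W\<^esub> par M' q (par M' t e')"
      unfolding x_def using presheaf_simps(5)[OF M' Cmp_Hom[OF Hom(3) P'(2)] Cmp_Hom[OF Hom(4) t(1)] P'(3)]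
        presheaf_simps(4)[OF M' Hom(3) P'(2,3)] presheaf_simps(4)[OF M' Hom(4) t(1) P'(3)] by simp
    interpret i: group_hom "pob M' W" "pob M W" "\<iota> W" by (rule pmap_group_hom[OF \<iota> d(3)])
    have pp: "par M' p' e' \<in> carrier (pob M' P')" "par M' t e' \<in> carrier (pob M' P'')" "par M p'' b \<in> carrier (pob M P'')"
      by (rule par_closed[OF M' P'(2,3)] par_closed[OF M' t(1) P'(3)] par_closed[OF M P''(2) b(1)])+
    have 2: "\<iota> W (par M' x e') = par M r (m P' a) \<otimes>\<^bsub>pob M W\<^esub> par M q (\<iota> P'' (par M' t e'))"
      using par_closed[OF M' Hom(3) pp(1)] par_closed[OF M' Hom(4) pp(2)] c'[OF P'(1,3)] P'(4)[symmetric]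
      by (simp add: 1 pmapD(5)[OF \<iota> Hom(3) pp(1)] pmapD(5)[OF \<iota> Hom(4) pp(2)] a_def)
    have it: "\<iota> P'' (par M' t e') \<in> carrier (pob M P'')" by (rule pmapD(4)[OF \<iota> P''(1) pp(2)])
    have 3: "par M q (m P'' b) = par M q (\<iota> P'' (par M' t e')) \<otimes>\<^bsub>pob M W\<^esub> par M q (par M p'' b)"
      unfolding t(2) by (rule hom_mult[OF presheaf_simps(2)[OF M Hom(4)] it pp(3)])
    have 4: "m W e = par M r (m P' a) \<otimes>\<^bsub>pob M W\<^esub> par M q (m P'' b)"
      unfolding e_def using hom_mult[OF pmapD(3)[OF m d(3)] ra] pmapD(5)[OF m Hom(3) a] pmapD(5)[OF m Hom(4) b(1)] by simp
    have "par M r (m P' a) \<in> carrier (pob M W)" "par M q (\<iota> P'' (par M' t e')) \<in> carrier (pob M W)"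
      "par M q (par M p'' b) \<in> carrier (pob M W)"
      by (rule par_closed[OF M Hom(3) pmapD(4)[OF m P'(1) a]] par_closed[OF M Hom(4) it] par_closed[OF M Hom(4) pp(3)])+
    then show "par M p e = m W e"
      by (simp add: pe[OF p(1)] p(2,3) 2 3 4 presheaf_simps(4)[OF M Hom(4) P''(2) b(1)] W.m_assoc)
  next
    fix Q x assume Q: "Q \<in> Ob A" and x: "x \<in> carrier (pob M Q)"
    obtain f where f: "f \<in> Hom A Q P''" "par M'' f e'' = \<pi> Q x" using stage_gen[OF s''(1) Q pmapD(4)[OF \<pi> Q x]] .
    obtain g where g: "g \<in> Hom A Q P'" "x = \<iota> Q (par M' g e') \<otimes>\<^bsub>pob M Q\<^esub> par M f b"
      using split[OF Q x f(1) f(2)[symmetric]] by blast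
    note h = biproduct_pair[OF W g(1) f(1)]
    show "\<exists>f\<in>Hom A Q W. par M f e = x"
      by (rule bexI[OF _ h(1)]) (simp add: pe[OF h(1)] h(2,3) g(2))
  qed
  have pi: "p \<cdot> i = i \<cdot> p'"
  proof (rule biproduct_eq_to[OF W])
    have "r \<cdot> (p \<cdot> i) = x \<cdot> i" by (rule Cmp_rewrite[OF p(2)]) simp_all
    also have "\<dots> = p'" unfolding x_def by (simp add: Add_Cmp Cmp_assoc)
    also have "\<dots> = r \<cdot> (i \<cdot> p')" by (subst Cmp_rewrite[OF d(16)]) simp_all
    finally show "r \<cdot> (p \<cdot> i) = r \<cdot> (i \<cdot> p')" .
    have "q \<cdot> (p \<cdot> i) = (p'' \<cdot> q) \<cdot> i" by (rule Cmp_rewrite[OF p(3)]) simp_all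
    also have "\<dots> = q \<cdot> (i \<cdot> p')" by (subst Cmp_rewrite[OF d(19)]) (simp_all add: Cmp_assoc)
    finally show "q \<cdot> (p \<cdot> i) = q \<cdot> (i \<cdot> p')" .
  qed simp_all
  have cls: "KA.cls p = KA.cls p' \<otimes>\<^bsub>KA.K\<^esub> KA.cls p''"
    by (rule class_biproduct[OF W P'(2) p(1) P''(2) pi p(3)[symmetric]])
  have ri: "r \<cdot> (i \<cdot> f) = f" if "f \<in> Hom A Q P'" for f Q
    using Cmp_rewrite[OF d(16), of f] HomD[OF that] by simp
  have q0: "q \<cdot> (i \<cdot> f) = Zr A Q P''" if "f \<in> Hom A Q P'" for f Q
    using Cmp_rewrite[OF d(19), of f] HomD[OF that] by simp
  have par0: "par M (Zr A Q P'') b = \<one>\<^bsub>pob M Q\<^esub>" if "Q \<in> Ob A" for Q by (rule par_Zr[OF M that P''(1) b(1)])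
  have ker1: "par M f e = \<one>\<^bsub>pob M Q\<^esub> \<longleftrightarrow> par M' (r \<cdot> f) e' = \<one>\<^bsub>pob M' Q\<^esub>"
    if f: "f \<in> Hom A Q W" "q \<cdot> f = Zr A Q P''" for f Q
  proof -
    have Q: "Q \<in> Ob A" by (rule Hom_Ob[OF f(1)])
    interpret group_hom "pob M' Q" "pob M Q" "\<iota> Q" by (rule pmap_group_hom[OF \<iota> Q])
    have c: "par M' (r \<cdot> f) e' \<in> carrier (pob M' Q)" by (rule par_closed[OF M' Cmp_Hom[OF f(1) Hom(3)] P'(3)])
    have "par M f e = \<iota> Q (par M' (r \<cdot> f) e')" using c by (simp add: pe[OF f(1)] f(2) par0[OF Q])
    then show ?thesis using inj_on_eq_iff[OF inj[OF Q] c G.one_closed] by simp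
  qed
  have "par M (i \<cdot> f) e = \<one>\<^bsub>pob M Q\<^esub>" if f: "f \<in> Hom A Q P'" "par M' f e' = \<one>\<^bsub>pob M' Q\<^esub>" for f Q
    using ker1[OF Cmp_Hom[OF f(1) Hom(1)] q0[OF f(1)]] f(2) by (simp add: ri[OF f(1)])
  then have mi: "pmap A (syz M' P' e') (post i) (syz M W e)"
    by (rule syz_pmap[OF M' P'(1,3) M d(3) e Hom(1)])
  have "par M'' (q \<cdot> f) e'' = \<one>\<^bsub>pob M'' Q\<^esub>" if f: "f \<in> Hom A Q W" "par M f e = \<one>\<^bsub>pob M Q\<^esub>" for f Q
    using \<pi>e[OF f(1)] pmap_one[OF \<pi> Hom_Ob(1)[OF f(1)]] by (simp add: f(2))
  then have mq: "pmap A (syz M W e) (post q) (syz M'' P'' e'')"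
    by (rule syz_pmap[OF M d(3) e M'' P''(1,3) Hom(4)])
  have r1: "res n (syz M W e) (post p) (\<beta>' \<otimes>\<^bsub>KA.K\<^esub> \<beta>'')"
  proof (rule Suc.IH[OF s'(2) s''(2) mi mq])
    show "pmap A (syz M' P' e') (post p') (syz M' P' e')" "pmap A (syz M W e) (post p) (syz M W e)"
      "pmap A (syz M'' P'' e'') (post p'') (syz M'' P'' e'')"
      by (rule syz_endo[OF s'(1) m'] syz_endo[OF st m] syz_endo[OF s''(1) m''])+
  next
    fix Q assume Q: "Q \<in> Ob A"
    show "inj_on (post i Q) (carrier (pob (syz M' P' e') Q))"
    proof (rule inj_onI)
      fix u v assume uv: "u \<in> carrier (pob (syz M' P' e') Q)" "v \<in> carrier (pob (syz M' P' e') Q)" "post i Q u = post i Q v"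
      obtain f where f: "f \<in> Hom A Q P'" "u = j f" by (rule syzE[OF uv(1)])
      obtain g where g: "g \<in> Hom A Q P'" "v = j g" by (rule syzE[OF uv(2)])
      have "i \<cdot> f = i \<cdot> g" using uv(3) by (simp add: f(2) g(2))
      then have "r \<cdot> (i \<cdot> f) = r \<cdot> (i \<cdot> g)" by (rule arg_cong)
      then have "f = g" by (simp only: ri[OF f(1)] ri[OF g(1)])
      then show "u = v" by (simp add: f(2) g(2))
    qed
    show "post q Q ` carrier (pob (syz M W e) Q) = carrier (pob (syz M'' P'' e'') Q)" (is "?L = ?R")
    proof
      show "?L \<subseteq> ?R"
      proof
        fix v assume "v \<in> ?L"
        then obtain u where u: "u \<in> carrier (pob (syz M W e) Q)" "v = post q Q u" by (rule imageE)
        obtain f where f: "f \<in> Hom A Q W" "u = j f" "par M f e = \<one>\<^bsub>pob M Q\<^esub>" by (rule syzE[OF u(1)])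
        have "v = j (q \<cdot> f)" by (simp add: u(2) f(2))
        moreover have "par M'' (q \<cdot> f) e'' = \<one>\<^bsub>pob M'' Q\<^esub>" using \<pi>e[OF f(1)] pmap_one[OF \<pi> Q] by (simp add: f(3))
        ultimately show "v \<in> ?R" using syzI[OF Cmp_Hom[OF f(1) Hom(4)]] by simp
      qed
      show "?R \<subseteq> ?L"
      proof
        fix v assume "v \<in> ?R"
        then obtain f where f: "f \<in> Hom A Q P''" "v = j f" "par M'' f e'' = \<one>\<^bsub>pob M'' Q\<^esub>" by (rule syzE)
        have "\<pi> Q \<one>\<^bsub>pob M Q\<^esub> = par M'' f e''" using f(3) pmap_one[OF \<pi> Q] by simp
        then obtain g where g: "g \<in> Hom A Q P'" "\<one>\<^bsub>pob M Q\<^esub> = \<iota> Q (par M' g e') \<otimes>\<^bsub>pob M Q\<^esub> par M f b"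
          by (rule bexE[OF split[OF Q presheaf_one[OF M Q] f(1)]])
        note h = biproduct_pair[OF W g(1) f(1)]
        have "par M (Add A (i \<cdot> g) (s \<cdot> f)) e = \<one>\<^bsub>pob M Q\<^esub>" by (simp add: pe[OF h(1)] h(2,3) g(2)[symmetric])
        then have "j (Add A (i \<cdot> g) (s \<cdot> f)) \<in> carrier (pob (syz M W e) Q)" by (rule syzI[OF h(1)])
        moreover have "v = post q Q (j (Add A (i \<cdot> g) (s \<cdot> f)))" by (simp add: h(3) f(2))
        ultimately show "v \<in> ?L" by (rule image_eqI[rotated])
      qed
    qed
    show "post i Q ` carrier (pob (syz M' P' e') Q) = {u \<in> carrier (pob (syz M W e) Q). post q Q u = \<one>\<^bsub>pob (syz M'' P'' e'') Q\<^esub>}"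
      (is "?L = ?R")
    proof
      show "?L \<subseteq> ?R"
      proof
        fix v assume "v \<in> ?L"
        then obtain u where u: "u \<in> carrier (pob (syz M' P' e') Q)" "v = post i Q u" by (rule imageE)
        obtain f where f: "f \<in> Hom A Q P'" "u = j f" "par M' f e' = \<one>\<^bsub>pob M' Q\<^esub>" by (rule syzE[OF u(1)])
        have v: "v = j (i \<cdot> f)" by (simp add: u(2) f(2))
        have "par M (i \<cdot> f) e = \<one>\<^bsub>pob M Q\<^esub>"
          using ker1[OF Cmp_Hom[OF f(1) Hom(1)] q0[OF f(1)]] f(3) by (simp add: ri[OF f(1)])
        then have "v \<in> carrier (pob (syz M W e) Q)" unfolding v by (rule syzI[OF Cmp_Hom[OF f(1) Hom(1)]])
        then show "v \<in> ?R" by (simp add: v q0[OF f(1)])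
      qed
      show "?R \<subseteq> ?L"
      proof
        fix v assume v: "v \<in> ?R"
        then have "v \<in> carrier (pob (syz M W e) Q)" by simp
        then obtain f where f: "f \<in> Hom A Q W" "v = j f" "par M f e = \<one>\<^bsub>pob M Q\<^esub>" by (rule syzE)
        have qf: "q \<cdot> f = Zr A Q P''" using v by (simp add: f(2))
        note [simp] = HomD[OF f(1)]
        have "par M' (r \<cdot> f) e' = \<one>\<^bsub>pob M' Q\<^esub>" using ker1[OF f(1) qf] f(3) by simp
        then have "j (r \<cdot> f) \<in> carrier (pob (syz M' P' e') Q)" by (rule syzI[OF Cmp_Hom[OF f(1) Hom(3)]])
        moreover have "i \<cdot> (r \<cdot> f) = f" using biproduct_decomp_to[OF W, of f] Q by (simp add: qf)
        then have "v = post i Q (j (r \<cdot> f))" by (simp add: f(2))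
        ultimately show "v \<in> ?L" by (rule image_eqI[rotated])
      qed
    qed
  next
    fix Q u assume Q: "Q \<in> Ob A" and u: "u \<in> carrier (pob (syz M' P' e') Q)"
    obtain f where f: "f \<in> Hom A Q P'" "u = j f" by (rule syzE[OF u])
    note [simp] = HomD[OF f(1)]
    have "p \<cdot> (i \<cdot> f) = (i \<cdot> p') \<cdot> f" by (rule Cmp_rewrite[OF pi]) simp_all
    then show "post p Q (post i Q u) = post i Q (post p' Q u)" by (simp add: f(2) Cmp_assoc)
  next
    fix Q u assume Q: "Q \<in> Ob A" and u: "u \<in> carrier (pob (syz M W e) Q)"
    obtain f where f: "f \<in> Hom A Q W" "u = j f" by (rule syzE[OF u])
    note [simp] = HomD[OF f(1)]
    have "q \<cdot> (p \<cdot> f) = (p'' \<cdot> q) \<cdot> f" by (rule Cmp_rewrite[OF p(3)]) simp_all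
    then show "post p'' Q (post q Q u) = post q Q (post p Q u)" by (simp add: f(2) Cmp_assoc)
  qed
  show ?case
    by (rule res_SucI[OF st r1])
      (use KA_cls_closed[OF P'(2)] KA_cls_closed[OF P''(2)] res_closed[OF s'(2)] res_closed[OF s''(2)]
       in \<open>simp add: cls s'(3) s''(3) KA.K.inv_mult_group KA.K.m_ac\<close>)
qed

end

context additive_yoneda
begin

text \<open>The generator of \<open>M\<close> also generates \<open>M''\<close>. The syzygy
  \<open>N\<close> of \<open>M''\<close> contains the syzygy \<open>K\<close> of \<open>M\<close>,
  and N/K is \<open>M'\<close> by means of \<psi>. So \<open>res_extension\<close> evaluates
  \<open>N\<close>, and one more step evaluates \<open>M''\<close>. The value is forced by those of
  \<open>M'\<close> and \<open>M\<close>, with no compatibility assumed between their resolutions;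
  the price is length \<open>n + 1\<close>.\<close>

lemma res_quotient:
  assumes r': "res n M' m' \<alpha>'" and r: "res n M m \<alpha>"
    and \<iota>: "pmap A M' \<iota> M" and \<pi>: "pmap A M \<pi> M''"
    and inj: "\<And>Q. Q \<in> Ob A \<Longrightarrow> inj_on (\<iota> Q) (carrier (pob M' Q))"
    and surj: "\<And>Q. Q \<in> Ob A \<Longrightarrow> \<pi> Q ` carrier (pob M Q) = carrier (pob M'' Q)"
    and ex: "\<And>Q. Q \<in> Ob A \<Longrightarrow> \<iota> Q ` carrier (pob M' Q) = {x \<in> carrier (pob M Q). \<pi> Q x = \<one>\<^bsub>pob M'' Q\<^esub>}"
    and m': "pmap A M' m' M'" and m: "pmap A M m M" and m'': "pmap A M'' m'' M''"
    and c': "\<And>Q x. Q \<in> Ob A \<Longrightarrow> x \<in> carrier (pob M' Q) \<Longrightarrow> m Q (\<iota> Q x) = \<iota> Q (m' Q x)"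
    and c'': "\<And>Q x. Q \<in> Ob A \<Longrightarrow> x \<in> carrier (pob M Q) \<Longrightarrow> m'' Q (\<pi> Q x) = \<pi> Q (m Q x)"
  shows "res (Suc n) M'' m'' (\<alpha> \<otimes>\<^bsub>KA.K\<^esub> inv\<^bsub>KA.K\<^esub> \<alpha>')"
proof -
  have M': "is_presheaf A M'" and M: "is_presheaf A M" and M'': "is_presheaf A M''"
    by (rule pmapD[OF \<iota>] pmapD[OF \<pi>])+
  obtain P p e \<beta> where s: "stage M m P p e" "res n (syz M P e) (post p) \<beta>" "\<alpha> = KA.cls p \<otimes>\<^bsub>KA.K\<^esub> inv\<^bsub>KA.K\<^esub> \<beta>"
    by (rule res_SucE[OF res_Suc[OF r m]])
  note P = stageD[OF s(1)]
  have i: "Idn A P \<in> Hom A P P" using P(1) by blast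
  have e'': "\<pi> P e \<in> carrier (pob M'' P)" by (rule pmapD(4)[OF \<pi> P(1,3)])
  have st: "stage M'' m'' P p (\<pi> P e)" unfolding stage_def
  proof (intro conjI ballI P(1,2) e'')
    show "par M'' p (\<pi> P e) = m'' P (\<pi> P e)" using pmapD(5)[OF \<pi> P(2,3)] c''[OF P(1,3)] P(4) by simp
    fix Q x assume Q: "Q \<in> Ob A" and "x \<in> carrier (pob M'' Q)"
    then have "x \<in> \<pi> Q ` carrier (pob M Q)" by (simp only: surj[OF Q])
    then obtain z where z: "x = \<pi> Q z" "z \<in> carrier (pob M Q)" by (rule imageE)
    obtain f where f: "f \<in> Hom A Q P" "par M f e = z" using stage_gen[OF s(1) Q z(2)] .
    show "\<exists>f\<in>Hom A Q P. par M'' f (\<pi> P e) = x"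
      by (rule bexI[OF _ f(1)]) (simp add: z(1) pmapD(5)[OF \<pi> f(1) P(3), symmetric] f(2))
  qed
  define K N where "K = syz M P e" and "N = syz M'' P (\<pi> P e)"
  have KE: thesis if "u \<in> carrier (pob K Q)" "\<And>f. f \<in> Hom A Q P \<Longrightarrow> u = j f \<Longrightarrow> par M f e = \<one>\<^bsub>pob M Q\<^esub> \<Longrightarrow> thesis" for u Q thesis
    using that unfolding K_def by (rule syzE)
  have NE: thesis if "u \<in> carrier (pob N Q)" "\<And>f. f \<in> Hom A Q P \<Longrightarrow> u = j f \<Longrightarrow> \<pi> Q (par M f e) = \<one>\<^bsub>pob M'' Q\<^esub> \<Longrightarrow> thesis" for u Q thesis
  proof (rule syzE[OF that(1)[unfolded N_def]])
    fix f assume f: "f \<in> Hom A Q P" "u = j f" "par M'' f (\<pi> P e) = \<one>\<^bsub>pob M'' Q\<^esub>"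
    show thesis by (rule that(2)[OF f(1,2)]) (simp add: pmapD(5)[OF \<pi> f(1) P(3)] f(3))
  qed
  have N: "is_presheaf A N" unfolding N_def by (rule syz_presheaf[OF M'' P(1) e''])
  have eN: "pmap A N (ev M e) M"
    unfolding N_def syz_def
    by (rule pmap_psub_from[OF ev_pmap[OF M P(1,3)] subpresheaf_pker[OF ev_pmap[OF M'' P(1) e'']]])
  have im: "ev M e Q u \<in> \<iota> Q ` carrier (pob M' Q)" if Q: "Q \<in> Ob A" and u: "u \<in> carrier (pob N Q)" for Q u
  proof (rule NE[OF u])
    fix f assume f: "f \<in> Hom A Q P" "u = j f" "\<pi> Q (par M f e) = \<one>\<^bsub>pob M'' Q\<^esub>"
    show ?thesis unfolding ex[OF Q] using par_closed[OF M f(1) P(3)] f(3) by (simp add: f(2))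
  qed
  obtain \<psi> where \<psi>: "pmap A N \<psi> M'" "\<And>Q u. Q \<in> Ob A \<Longrightarrow> u \<in> carrier (pob N Q) \<Longrightarrow> \<iota> Q (\<psi> Q u) = ev M e Q u"
  proof (rule pmap_factor[OF \<iota> inj eN im])
    fix \<psi> assume "pmap A N \<psi> M'" "\<And>Q u. Q \<in> Ob A \<Longrightarrow> u \<in> carrier (pob N Q) \<Longrightarrow> \<iota> Q (\<psi> Q u) = ev M e Q u"
    then show thesis by (rule that)
  qed
  have kN: "par M'' f (\<pi> P e) = \<one>\<^bsub>pob M'' Q\<^esub>" if f: "f \<in> Hom A Q P" "par M f e = \<one>\<^bsub>pob M Q\<^esub>" for f Q
    using pmapD(5)[OF \<pi> f(1) P(3)] pmap_one[OF \<pi> Hom_Ob(1)[OF f(1)]] by (simp add: f(2))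
  have KN: "u \<in> carrier (pob N Q)" if u: "u \<in> carrier (pob K Q)" for u Q
    by (rule KE[OF u]) (use syzI kN in \<open>simp add: N_def\<close>)
  have K: "is_presheaf A K" unfolding K_def by (rule syz_presheaf[OF M P(1,3)])
  have pp: "post p Q u \<in> carrier (pob N Q)" if "Q \<in> Ob A" "u \<in> carrier (pob N Q)" for Q u
    using pmapD(4)[OF syz_endo[OF st m''] that(1)] that(2) by (simp add: N_def)
  have "res n N (post p) (\<beta> \<otimes>\<^bsub>KA.K\<^esub> \<alpha>')"
  proof (rule res_extension[OF s(2)[folded K_def] r' _ \<psi>(1) _ _ _ syz_endo[OF s(1) m, folded K_def] syz_endo[OF st m'', folded N_def] m'])
    show "pmap A K (\<lambda>Q u. u) N" unfolding pmap_def
    proof (intro conjI ballI allI K N)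
      show "(\<lambda>u. u) \<in> hom (pob K Q) (pob N Q)" if "Q \<in> Ob A" for Q
        by (rule homI) (simp_all add: KN, simp add: K_def N_def syz_def)
    qed (simp add: K_def N_def syz_def)
  next
    fix Q assume Q: "Q \<in> Ob A"
    show "inj_on (\<lambda>u. u) (carrier (pob K Q))" by simp
    show "\<psi> Q ` carrier (pob N Q) = carrier (pob M' Q)"
    proof
      show "\<psi> Q ` carrier (pob N Q) \<subseteq> carrier (pob M' Q)" using pmapD(4)[OF \<psi>(1) Q] by (rule image_subsetI)
      show "carrier (pob M' Q) \<subseteq> \<psi> Q ` carrier (pob N Q)"
      proof
        fix x assume x: "x \<in> carrier (pob M' Q)"
        have ix: "\<iota> Q x \<in> carrier (pob M Q)" by (rule pmapD(4)[OF \<iota> Q x])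
        obtain f where f: "f \<in> Hom A Q P" "par M f e = \<iota> Q x" using stage_gen[OF s(1) Q ix] .
        have "\<iota> Q x \<in> {x \<in> carrier (pob M Q). \<pi> Q x = \<one>\<^bsub>pob M'' Q\<^esub>}" unfolding ex[OF Q, symmetric] by (rule imageI[OF x])
        then have "par M'' f (\<pi> P e) = \<one>\<^bsub>pob M'' Q\<^esub>" using pmapD(5)[OF \<pi> f(1) P(3)] f(2) by simp
        then have u: "j f \<in> carrier (pob N Q)" unfolding N_def by (rule syzI[OF f(1)])
        have "\<iota> Q (\<psi> Q (j f)) = \<iota> Q x" using \<psi>(2)[OF Q u] f(2) by simp
        then have "\<psi> Q (j f) = x" by (rule inj_onD[OF inj[OF Q] _ pmapD(4)[OF \<psi>(1) Q u] x])
        then show "x \<in> \<psi> Q ` carrier (pob N Q)" using u by (rule image_eqI[OF HOL.sym])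
      qed
    qed
    show "(\<lambda>u. u) ` carrier (pob K Q) = {u \<in> carrier (pob N Q). \<psi> Q u = \<one>\<^bsub>pob M' Q\<^esub>}"
    proof -
      have "u \<in> carrier (pob K Q) \<longleftrightarrow> u \<in> carrier (pob N Q) \<and> \<psi> Q u = \<one>\<^bsub>pob M' Q\<^esub>" for u
      proof
        assume u: "u \<in> carrier (pob K Q)"
        obtain f where f: "f \<in> Hom A Q P" "u = j f" "par M f e = \<one>\<^bsub>pob M Q\<^esub>" by (rule KE[OF u])
        have "\<iota> Q (\<psi> Q u) = \<iota> Q \<one>\<^bsub>pob M' Q\<^esub>" using \<psi>(2)[OF Q KN[OF u]] f(3) pmap_one[OF \<iota> Q] by (simp add: f(2))
        then have "\<psi> Q u = \<one>\<^bsub>pob M' Q\<^esub>"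
          by (rule inj_onD[OF inj[OF Q] _ pmapD(4)[OF \<psi>(1) Q KN[OF u]] presheaf_one[OF M' Q]])
        then show "u \<in> carrier (pob N Q) \<and> \<psi> Q u = \<one>\<^bsub>pob M' Q\<^esub>" using KN[OF u] by simp
      next
        assume u: "u \<in> carrier (pob N Q) \<and> \<psi> Q u = \<one>\<^bsub>pob M' Q\<^esub>"
        obtain f where f: "f \<in> Hom A Q P" "u = j f" by (rule NE[OF conjunct1[OF u]])
        have "par M f e = \<one>\<^bsub>pob M Q\<^esub>" using \<psi>(2)[OF Q conjunct1[OF u]] pmap_one[OF \<iota> Q] conjunct2[OF u] by (simp add: f(2))
        then show "u \<in> carrier (pob K Q)" unfolding K_def f(2) by (rule syzI[OF f(1)])
      qed
      then show ?thesis by auto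
    qed
  next
    fix Q u assume Q: "Q \<in> Ob A" and u: "u \<in> carrier (pob N Q)"
    obtain f where f: "f \<in> Hom A Q P" "u = j f" by (rule NE[OF u])
    have x: "\<psi> Q u \<in> carrier (pob M' Q)" by (rule pmapD(4)[OF \<psi>(1) Q u])
    have "\<iota> Q (m' Q (\<psi> Q u)) = m Q (par M f e)" using c'[OF Q x] \<psi>(2)[OF Q u] by (simp add: f(2))
    also have "\<dots> = \<iota> Q (\<psi> Q (post p Q u))" using stage_par[OF s(1) m f(1)] \<psi>(2)[OF Q pp[OF Q u]] by (simp add: f(2))
    finally show "m' Q (\<psi> Q u) = \<psi> Q (post p Q u)"
      by (rule inj_onD[OF inj[OF Q] _ pmapD(4)[OF m' Q x] pmapD(4)[OF \<psi>(1) Q pp[OF Q u]]])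
  qed simp
  then show ?thesis unfolding N_def
    by (rule res_SucI[OF st])
      (use KA_cls_closed[OF P(2)] res_closed[OF s(2)] res_closed[OF r']
       in \<open>simp add: s(3) KA.K.inv_mult_group KA.K.m_ac\<close>)
qed

end

section \<open>Independence of the resolution\<close>

locale complemented_yoneda = additive_yoneda +
  assumes complements: "retracts_have_complements A"
begin

text \<open>An epimorphism onto a representable presheaf splits, since the identity of
  \<open>P\<close> has a preimage \<open>s\<close>. Hence \<open>P\<close> is a retract of
  \<open>W\<close>, and its complement \<open>Z\<close> represents the syzygy. The lift
  \<open>w\<close> is triangular with respect to this decomposition, so the class of
  \<open>p\<close> remains after the induction hypothesis has evaluated the syzygy.\<close>

lemma res_representable:
  assumes "res n (y P) (post p) \<beta>" and p: "p \<in> Hom A P P" shows "\<beta> = KA.cls p"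
  using assms
proof (induction n arbitrary: P p \<beta>)
  case 0
  note p = HomD[OF 0(2)]
  have P: "P \<in> Ob A" using p by auto
  have "j (Idn A P) \<in> carrier (pob (y P) P)" using P by auto
  moreover have "carrier (pob (y P) P) = {\<one>\<^bsub>pob (y P) P\<^esub>}" using 0(1) P by (simp only: res.simps trivial_def)
  ultimately have "j (Idn A P) = \<one>\<^bsub>pob (y P) P\<^esub>" by blast
  then have "zero_object A P" using P by (simp add: zero_object_iff)
  then show ?case using class_zero_object[OF _ 0(2)] 0(1) by (simp add: res.simps)
next
  case (Suc n)
  note p = Suc.prems(2)
  have P: "P \<in> Ob A" by (rule Hom_Ob[OF p])
  obtain W w e \<gamma> where s: "stage (y P) (post p) W w e" "res n (syz (y P) W e) (post w) \<gamma>"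
    "\<beta> = KA.cls w \<otimes>\<^bsub>KA.K\<^esub> inv\<^bsub>KA.K\<^esub> \<gamma>" by (rule res_SucE[OF Suc.prems(1)])
  note W = stageD[OF s(1)]
  obtain q where q: "e = j q" "q \<in> Hom A W P" using W(3) by auto
  have i: "Idn A P \<in> Hom A P P" using P by blast
  have "j (Idn A P) \<in> carrier (pob (y P) P)" using i by simp
  then obtain s where s': "s \<in> Hom A P W" "par (y P) s e = j (Idn A P)" by (rule stage_gen[OF s(1) P])
  have qs: "q \<cdot> s = Idn A P" using s'(2) by (simp add: q(1))
  have "is_retraction A P W s q" unfolding is_retraction_def using P W(1) s'(1) q(2) qs by simp
  then obtain Z i r where b: "is_biproduct A P Z W s i q r"
    using complements unfolding retracts_have_complements_def by blast
  note d [simp] = biproductD[OF b]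
  have b': "is_biproduct A Z P W i s r q"
  proof -
    have "Add A (i \<cdot> r) (s \<cdot> q) = Idn A W" using d(20) by (subst Add_commute) simp_all
    then show ?thesis unfolding is_biproduct_def by (simp add: in_Hom)
  qed
  note [simp] = HomD[OF W(2)] HomD[OF p]
  define z where "z = r \<cdot> (w \<cdot> i)"
  have z: "z \<in> Hom A Z Z" by (simp add: z_def in_Hom)
  have qw: "q \<cdot> w = p \<cdot> q" using W(4) by (simp add: q(1))
  have "q \<cdot> (w \<cdot> i) = Zr A Z P" by (subst Cmp_rewrite[OF qw]) (simp_all add: Cmp_assoc)
  then have wi: "w \<cdot> i = i \<cdot> z"
    using biproduct_decomp_to[OF b, of "w \<cdot> i"] by (simp add: z_def)
  have cls: "KA.cls w = KA.cls z \<otimes>\<^bsub>KA.K\<^esub> KA.cls p"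
    by (rule class_biproduct[OF b' z W(2) p wi qw[symmetric]])
  have yP: "is_presheaf A (y P)" by (rule y_presheaf[OF P])
  have ri: "r \<cdot> (i \<cdot> f) = f" if "f \<in> Hom A Q Z" for f Q
    using Cmp_rewrite[OF biproductD(16)[OF b'], of f] HomD[OF that] by simp
  have K: "u \<in> carrier (pob (syz (y P) W e) Q) \<Longrightarrow> \<exists>f\<in>Hom A Q Z. u = j (i \<cdot> f)" for u Q
  proof -
    assume u: "u \<in> carrier (pob (syz (y P) W e) Q)"
    obtain f where f: "f \<in> Hom A Q W" "u = j f" "par (y P) f e = \<one>\<^bsub>pob (y P) Q\<^esub>" by (rule syzE[OF u])
    note [simp] = HomD[OF f(1)]
    have "q \<cdot> f = Zr A Q P" using f(3) by (simp add: q(1))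
    then have "f = i \<cdot> (r \<cdot> f)" using biproduct_decomp_to[OF b, of f] Hom_Ob(1)[OF f(1)] by simp
    then show "\<exists>f\<in>Hom A Q Z. u = j (i \<cdot> f)" using f(2) by (intro bexI[of _ "r \<cdot> f"]) (simp_all add: in_Hom)
  qed
  have K': "j (i \<cdot> f) \<in> carrier (pob (syz (y P) W e) Q)" if f: "f \<in> Hom A Q Z" for f Q
  proof (rule syzI[OF Cmp_Hom[OF f]])
    note [simp] = HomD[OF f]
    show "i \<in> Hom A Z W" by (simp add: in_Hom)
    have "q \<cdot> (i \<cdot> f) = Zr A Q P" by (subst Cmp_rewrite[OF d(18)]) (use Hom_Ob(1)[OF f] in simp_all)
    then show "par (y P) (i \<cdot> f) e = \<one>\<^bsub>pob (y P) Q\<^esub>" by (simp add: q(1))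
  qed
  have "res n (y Z) (post z) \<gamma>"
  proof (rule res_iso[OF s(2) _ syz_endo[OF s(1) y_pmap[OF p]], where \<phi> = "post r"])
    have "pmap A (y W) (post r) (y Z)" by (rule y_pmap) (simp add: in_Hom)
    then show "pmap A (syz (y P) W e) (post r) (y Z)"
      unfolding syz_def by (rule pmap_psub_from[OF _ subpresheaf_pker[OF ev_pmap[OF yP W(1,3)]]])
  next
    fix Q assume Q: "Q \<in> Ob A"
    show "inj_on (post r Q) (carrier (pob (syz (y P) W e) Q))"
    proof (rule inj_onI)
      fix u v assume u: "u \<in> carrier (pob (syz (y P) W e) Q)" and v: "v \<in> carrier (pob (syz (y P) W e) Q)"
        and eq: "post r Q u = post r Q v"
      obtain f where f: "f \<in> Hom A Q Z" "u = j (i \<cdot> f)" using bexE[OF K[OF u]] .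
      obtain g where g: "g \<in> Hom A Q Z" "v = j (i \<cdot> g)" using bexE[OF K[OF v]] .
      show "u = v" using eq by (simp add: f(2) g(2) ri[OF f(1)] ri[OF g(1)])
    qed
    show "post r Q ` carrier (pob (syz (y P) W e) Q) = carrier (pob (y Z) Q)"
    proof
      show "post r Q ` carrier (pob (syz (y P) W e) Q) \<subseteq> carrier (pob (y Z) Q)"
      proof (rule image_subsetI)
        fix u assume u: "u \<in> carrier (pob (syz (y P) W e) Q)"
        obtain f where f: "f \<in> Hom A Q Z" "u = j (i \<cdot> f)" using bexE[OF K[OF u]] .
        show "post r Q u \<in> carrier (pob (y Z) Q)" by (simp add: f ri[OF f(1)])
      qed
      show "carrier (pob (y Z) Q) \<subseteq> post r Q ` carrier (pob (syz (y P) W e) Q)"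
      proof
        fix v assume "v \<in> carrier (pob (y Z) Q)"
        then obtain f where f: "f \<in> Hom A Q Z" "v = j f" by auto
        show "v \<in> post r Q ` carrier (pob (syz (y P) W e) Q)"
          by (rule image_eqI[OF _ K'[OF f(1)]]) (simp add: f(2) ri[OF f(1)])
      qed
    qed
    fix u assume u: "u \<in> carrier (pob (syz (y P) W e) Q)"
    obtain f where f: "f \<in> Hom A Q Z" "u = j (i \<cdot> f)" using bexE[OF K[OF u]] .
    note [simp] = HomD[OF f(1)] HomD[OF z]
    have "w \<cdot> (i \<cdot> f) = i \<cdot> (z \<cdot> f)" using Cmp_rewrite[OF wi, of f] by (simp add: Cmp_assoc)
    then show "post z Q (post r Q u) = post r Q (post w Q u)"
      using ri[OF Cmp_Hom[OF f(1) z]] by (simp add: f(2) ri[OF f(1)])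
  qed
  then have "\<gamma> = KA.cls z" by (rule Suc.IH[OF _ z])
  then show ?case using KA_cls_closed[OF z] KA_cls_closed[OF p] by (simp add: s(3) cls KA.K.m_ac)
qed

text \<open>For a trivial presheaf the first syzygy is the whole representable presheaf, so by
  \<open>res_representable\<close> the two factors of \<alpha> cancel.\<close>

lemma res_trivial:
  assumes r: "res n M m \<alpha>" and t: "trivial M" and m: "pmap A M m M" shows "\<alpha> = \<one>\<^bsub>KA.K\<^esub>"
proof -
  have M: "is_presheaf A M" by (rule pmapD(1)[OF m])
  obtain P p e \<beta> where s: "stage M m P p e" "res n (syz M P e) (post p) \<beta>" "\<alpha> = KA.cls p \<otimes>\<^bsub>KA.K\<^esub> inv\<^bsub>KA.K\<^esub> \<beta>"
    by (rule res_SucE[OF res_Suc[OF r m]])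
  note P = stageD[OF s(1)]
  have k: "carrier (pob (syz M P e) Q) = carrier (pob (y P) Q)" if Q: "Q \<in> Ob A" for Q
  proof -
    have "par M f e = \<one>\<^bsub>pob M Q\<^esub>" if "f \<in> Hom A Q P" for f
      using par_closed[OF M that P(3)] t Q by (simp add: trivial_def)
    then show ?thesis by (auto simp: in_syz)
  qed
  have "res n (y P) (post p) \<beta>"
  proof (rule res_iso[OF s(2) _ syz_endo[OF s(1) m], where \<phi> = "\<lambda>Q u. u"])
    show "pmap A (syz M P e) (\<lambda>Q u. u) (y P)"
      unfolding syz_def by (rule psub_incl[OF subpresheaf_pker[OF ev_pmap[OF M P(1,3)]]])
  qed (simp_all only: k inj_on_id2 image_ident)
  then have "\<beta> = KA.cls p" by (rule res_representable[OF _ P(2)])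
  then show ?thesis using KA_cls_closed[OF P(2)] by (simp add: s(3))
qed

text \<open>Both values are fed into \<open>res_quotient\<close> for the identity of
  \<open>M\<close>, one as the value of the subobject and the other as that of the whole. The
  quotient of the two becomes a value of a trivial presheaf.\<close>

lemma res_unique:
  assumes r: "res n M m \<alpha>" "res k M m \<beta>" and m: "pmap A M m M" shows "\<alpha> = \<beta>"
proof -
  \<comment> \<open>A trivial presheaf in the same type, obtained as the image of the zero
    endomorphism.\<close>
  let ?T = "psub M (pim M (\<lambda>Q x. \<one>\<^bsub>pob M Q\<^esub>))"
  have M: "is_presheaf A M" by (rule pmapD(1)[OF m])
  have z: "pmap A M (\<lambda>Q x. \<one>\<^bsub>pob M Q\<^esub>) M" by (rule pmap_zero[OF M M])
  have c: "carrier (pob ?T Q) = {\<one>\<^bsub>pob M Q\<^esub>}" if "Q \<in> Ob A" for Q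
    using presheaf_one[OF M that] by (auto simp: pim_def)
  have T: "is_presheaf A ?T" by (rule psub_presheaf[OF subpresheaf_pim[OF z]])
  have t: "trivial ?T" unfolding trivial_def by (simp add: c del: psub_simps(1))
  define l where "l = max n k"
  have "res l M m \<alpha>" "res l M m \<beta>" using res_mono[OF r(1) m, of l] res_mono[OF r(2) m, of l] by (simp_all add: l_def)
  then have "res (Suc l) ?T (\<lambda>Q x. x) (\<beta> \<otimes>\<^bsub>KA.K\<^esub> inv\<^bsub>KA.K\<^esub> \<alpha>)"
  proof (rule res_quotient[OF _ _ pmap_id[OF M] _ _ _ _ m m pmap_id[OF T]])
    show "pmap A M (\<lambda>Q x. \<one>\<^bsub>pob M Q\<^esub>) ?T"
      by (rule pmap_psub_to[OF z subpresheaf_pim[OF z]]) (auto simp: pim_def)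
    fix Q assume Q: "Q \<in> Ob A"
    show "(\<lambda>x. \<one>\<^bsub>pob M Q\<^esub>) ` carrier (pob M Q) = carrier (pob ?T Q)" by (simp add: pim_def)
  qed simp_all
  then have "\<beta> \<otimes>\<^bsub>KA.K\<^esub> inv\<^bsub>KA.K\<^esub> \<alpha> = \<one>\<^bsub>KA.K\<^esub>" by (rule res_trivial[OF _ t pmap_id[OF T]])
  then show ?thesis using res_closed[OF r(1)] res_closed[OF r(2)] KA.K.inv_equality[of \<beta> "inv\<^bsub>KA.K\<^esub> \<alpha>"] by simp
qed

end

section \<open>Lifting endomorphisms to a given finite resolution\<close>

context additive_yoneda
begin

lemma exact_atD:
  assumes ex: "exact_at B (parr A F u G) (parr A G v K)" and h: "F \<in> hull" "G \<in> hull" "K \<in> hull"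
    and u: "pmap A F u G" and v: "pmap A G v K" and X: "X \<in> Ob A"
  shows "pker G v K X = pim F u X"
proof -
  obtain m where m: "is_image B (parr A F u G) m" "is_kernel B (parr A G v K) m"
    using ex unfolding exact_at_def by blast
  obtain I \<iota> where I: "m = parr A I \<iota> G" "I \<in> hull" "pmap A I \<iota> G"
    "\<And>X. X \<in> Ob A \<Longrightarrow> inj_on (\<iota> X) (carrier (pob I X))"
    "\<And>X. X \<in> Ob A \<Longrightarrow> \<iota> X ` carrier (pob I X) = u X ` carrier (pob F X)"
    by (rule imageD_B[OF m(1) h(1,2) u]) (rule that)
  obtain L \<kappa> where L: "m = parr A L \<kappa> G" "L \<in> hull" "pmap A L \<kappa> G"
    "\<And>X. X \<in> Ob A \<Longrightarrow> inj_on (\<kappa> X) (carrier (pob L X))"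
    "\<And>X. X \<in> Ob A \<Longrightarrow> \<kappa> X ` carrier (pob L X) = {x \<in> carrier (pob G X). v X x = \<one>\<^bsub>pob K X\<^esub>}"
    by (rule kernelD_B[OF m(2) h(2,3) v]) (rule that)
  have IL: "I = L" "\<And>x. x \<in> carrier (pob I X) \<Longrightarrow> \<iota> X x = \<kappa> X x"
    using I(1) L(1) X by (simp_all add: parr_eq_iff)
  have "\<iota> X ` carrier (pob I X) = \<kappa> X ` carrier (pob I X)" by (rule image_cong[OF HOL.refl IL(2)])
  then show ?thesis using I(5)[OF X] L(5)[OF X] IL(1) unfolding pker_def pim_def by simp
qed

text \<open>The given resolution only provides the objects. The lifts are built from the right end
  onwards: in each step a generator has its prescribed image hit because the differential is onto
  the next syzygy.\<close>

lemma res_exists: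
  assumes r: "has_finite_resolution B (y ` Ob A) M" and m: "pmap A M m M"
  obtains n \<alpha> where "res n M m \<alpha>"
proof -
  obtain Q \<delta> n where Q: "Q 0 = M" "\<And>i. 1 \<le> i \<Longrightarrow> i \<le> n + 1 \<Longrightarrow> Q i \<in> y ` Ob A"
    "\<And>i. n + 1 < i \<Longrightarrow> zero_object B (Q i)" "\<And>i. \<delta> i \<in> Hom B (Q (Suc i)) (Q i)"
    "is_epi B (\<delta> 0)" "\<And>i. exact_at B (\<delta> (Suc i)) (\<delta> i)"
    using r unfolding has_finite_resolution_def by blast
  have "\<forall>i. \<exists>v. pmap A (Q (Suc i)) v (Q i) \<and> \<delta> i = parr A (Q (Suc i)) v (Q i)"
    using Q(4) unfolding Hom_B by blast
  then obtain u where u: "\<And>i. pmap A (Q (Suc i)) (u i) (Q i)" "\<And>i. \<delta> i = parr A (Q (Suc i)) (u i) (Q i)"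
    using choice by metis
  have h: "Q i \<in> hull" for i using Q(4)[of i] unfolding Hom_B by blast
  have ex: "pker (Q (Suc i)) (u i) (Q i) X = pim (Q (Suc (Suc i))) (u (Suc i)) X" if "X \<in> Ob A" for i X
    by (rule exact_atD[OF _ h h h u(1) u(1) that]) (use Q(6)[of i] in \<open>simp only: u(2)\<close>)
  \<comment> \<open>Generalized to any \<open>N\<close> that is the quotient of
    \<open>Q (Suc i)\<close> by the image of the next differential, so that the syzygies of
    \<open>M\<close> satisfy the same hypotheses. At \<open>l = 0\<close> one has
    \<open>i = n + 1\<close>, and the object mapping onto \<open>N\<close> is the first zero
    term.\<close>
  have "\<exists>\<alpha>. res l N z \<alpha>"
    if "i + l = Suc n" "pmap A N z N" "pmap A (Q (Suc i)) \<rho> N"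
      "\<And>X. X \<in> Ob A \<Longrightarrow> \<rho> X ` carrier (pob (Q (Suc i)) X) = carrier (pob N X)"
      "\<And>X. X \<in> Ob A \<Longrightarrow> pker (Q (Suc i)) \<rho> N X = pim (Q (Suc (Suc i))) (u (Suc i)) X" for l i N z \<rho>
    using that
  proof (induction l arbitrary: i N z \<rho>)
    case 0
    have "zero_object B (Q (Suc i))" by (rule Q(3)) (use 0(1) in simp)
    then have t: "trivial (Q (Suc i))" unfolding zero_object_B by blast
    have "trivial N" unfolding trivial_def
    proof
      fix X assume X: "X \<in> Ob A"
      have "carrier (pob (Q (Suc i)) X) = {\<one>\<^bsub>pob (Q (Suc i)) X\<^esub>}" using t X unfolding trivial_def by blast
      then have "carrier (pob N X) = {\<rho> X \<one>\<^bsub>pob (Q (Suc i)) X\<^esub>}" using 0(4)[OF X] by simp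
      then show "carrier (pob N X) = {\<one>\<^bsub>pob N X\<^esub>}" by (simp only: pmap_one[OF 0(3) X])
    qed
    then show ?case by (simp add: res.simps)
  next
    case (Suc l)
    note z = Suc.prems(2) and surj = Suc.prems(4) and ker = Suc.prems(5)
    have N: "is_presheaf A N" by (rule pmapD(1)[OF z])
    have "Q (Suc i) \<in> y ` Ob A" by (rule Q(2)) (use Suc.prems(1) in simp_all)
    then obtain P where P: "P \<in> Ob A" "Q (Suc i) = y P" by blast
    note \<rho> = Suc.prems(3)[unfolded P(2)]
    have i: "Idn A P \<in> Hom A P P" using P(1) by blast
    define e where "e = \<rho> P (j (Idn A P))"
    have e: "e \<in> carrier (pob N P)" unfolding e_def by (rule pmapD(4)[OF \<rho> P(1)]) (use i in simp)
    have \<rho>e: "\<rho> X (j f) = par N f e" if f: "f \<in> Hom A X P" for f X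
    proof -
      have "j (Idn A P) \<in> carrier (pob (y P) P)" using i by simp
      from pmapD(5)[OF \<rho> f this] show ?thesis using HomD[OF f] by (simp add: e_def)
    qed
    have gen: "\<exists>f\<in>Hom A X P. par N f e = x" if X: "X \<in> Ob A" and x: "x \<in> carrier (pob N X)" for X x
    proof -
      have "x \<in> \<rho> X ` carrier (pob (y P) X)" using x surj[OF X] unfolding P(2) by simp
      then obtain v where v: "x = \<rho> X v" "v \<in> carrier (pob (y P) X)" by (rule imageE)
      obtain f where f: "v = j f" "f \<in> Hom A X P" using v(2) by auto
      show ?thesis by (rule bexI[OF _ f(2)]) (simp add: v(1) f(1) \<rho>e[OF f(2)])
    qed
    obtain p where p: "p \<in> Hom A P P" "par N p e = z P e" using gen[OF P(1) pmapD(4)[OF z P(1) e]] by blast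
    have st: "stage N z P p e" unfolding stage_def using P(1) p e gen by blast
    have k: "carrier (pob (syz N P e) X) = pker (Q (Suc i)) \<rho> N X" for X
      unfolding set_eq_iff in_syz P(2) pker_def by (auto simp: \<rho>e)
    have ks: "subpresheaf (y P) (pker (y P) (ev N e) N)" by (rule subpresheaf_pker[OF ev_pmap[OF N P(1) e]])
    have sk: "pker (y P) (ev N e) N = (\<lambda>X. pker (Q (Suc i)) \<rho> N X)"
      using k unfolding syz_def by auto
    have u1: "pmap A (Q (Suc (Suc i))) (u (Suc i)) (y P)" using u(1)[of "Suc i"] by (simp only: P(2))
    have "\<exists>\<beta>. res l (syz N P e) (post p) \<beta>"
    proof (rule Suc.IH[OF _ syz_endo[OF st z]])
      show "Suc i + l = Suc n" using Suc.prems(1) by simp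
      show "pmap A (Q (Suc (Suc i))) (u (Suc i)) (syz N P e)"
        unfolding syz_def
      proof (rule pmap_psub_to[OF u1 ks])
        fix X x assume X: "X \<in> Ob A" and x: "x \<in> carrier (pob (Q (Suc (Suc i))) X)"
        show "u (Suc i) X x \<in> pker (y P) (ev N e) N X"
          unfolding sk ker[OF X] pim_def by (rule imageI[OF x])
      qed
    next
      fix X assume X: "X \<in> Ob A"
      show "u (Suc i) X ` carrier (pob (Q (Suc (Suc i))) X) = carrier (pob (syz N P e) X)"
        unfolding k ker[OF X] pim_def ..
      have "pker (Q (Suc (Suc i))) (u (Suc i)) (syz N P e) X = pker (Q (Suc (Suc i))) (u (Suc i)) (Q (Suc i)) X"
        unfolding pker_def P(2) by (simp add: syz_def)
      then show "pker (Q (Suc (Suc i))) (u (Suc i)) (syz N P e) X = pim (Q (Suc (Suc (Suc i)))) (u (Suc (Suc i))) X"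
        using ex[OF X, of "Suc i"] by simp
    qed
    then obtain \<beta> where "res l (syz N P e) (post p) \<beta>" by blast
    then show ?case using res_SucI[OF st _ HOL.refl] by blast
  qed
  note claim = this
  have "\<exists>\<alpha>. res (Suc n) M m \<alpha>"
  proof (rule claim[of 0 "Suc n" M m "u 0", OF _ m])
    show "pmap A (Q (Suc 0)) (u 0) M" using u(1)[of 0] by (simp only: Q(1))
    fix X assume X: "X \<in> Ob A"
    show "u 0 X ` carrier (pob (Q (Suc 0)) X) = carrier (pob M X)"
      using epiD_B[OF _ h h u(1) X, of 0] Q(5) by (simp only: u(2) Q(1))
    show "pker (Q (Suc 0)) (u 0) M X = pim (Q (Suc (Suc 0))) (u (Suc 0)) X"
      using ex[OF X, of 0] by (simp only: Q(1))
  qed simp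
  then show ?thesis using that by blast
qed

end

section \<open>The homomorphism \<open>e\<close> from the abelian to the additive Grothendieck
  group\<close>

locale regular_yoneda = additive_yoneda A j
  for A :: "('o, 'm, 'z) catdata_scheme" (structure) and j :: "'m \<Rightarrow> 'u" +
  assumes regular: "regular_category j A"
begin

sublocale complemented_yoneda A j
  by unfold_locales (use regular in \<open>simp add: regular_category_def\<close>)

definition eul :: "('o, 'm, 'u) nattrans \<Rightarrow> ('m \<Rightarrow>\<^sub>0 int) set" where
  "eul t = (SOME \<alpha>. \<exists>F \<eta> n. t = parr A F \<eta> F \<and> pmap A F \<eta> F \<and> res n F \<eta> \<alpha>)"

lemma eul_eq:
  assumes p: "pmap A F \<eta> F" and r: "res n F \<eta> \<alpha>" shows "eul (parr A F \<eta> F) = \<alpha>"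
  unfolding eul_def
proof (rule some_equality)
  show "\<exists>F' \<eta>' n. parr A F \<eta> F = parr A F' \<eta>' F' \<and> pmap A F' \<eta>' F' \<and> res n F' \<eta>' \<alpha>" using p r by blast
  fix \<beta> assume "\<exists>F' \<eta>' n. parr A F \<eta> F = parr A F' \<eta>' F' \<and> pmap A F' \<eta>' F' \<and> res n F' \<eta>' \<beta>"
  then obtain F' \<eta>' k where 1: "parr A F \<eta> F = parr A F' \<eta>' F'" "pmap A F' \<eta>' F'" "res k F' \<eta>' \<beta>" by blast
  then have "F = F'" "\<And>Q x. Q \<in> Ob A \<Longrightarrow> x \<in> carrier (pob F' Q) \<Longrightarrow> \<eta> Q x = \<eta>' Q x" by (simp_all add: parr_eq_iff)
  then have "res k F \<eta> \<beta>" using res_cong[OF 1(3,2)] by simp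
  then show "\<beta> = \<alpha>" by (rule res_unique[OF _ r p])
qed

lemma res_hull:
  assumes "F \<in> hull" "pmap A F \<eta> F" obtains n \<alpha> where "res n F \<eta> \<alpha>"
proof -
  have "has_finite_resolution B (y ` Ob A) F"
    using regular assms(1) unfolding regular_category_def B_simps by blast
  then show thesis by (rule res_exists[OF _ assms(2)]) (rule that)
qed

text \<open>For a short exact sequence only the values of the first two terms are chosen.
  \<open>res_quotient\<close> then exhibits their quotient as a value of the third, and uniqueness
  makes it the value.\<close>

lemma eul_hom: "\<exists>e\<in>hom KB.K KA.K. \<forall>t\<in>endos B. e (KB.cls t) = eul t"
proof (rule KB.universal[OF KA.comm_group_K])
  fix t assume "t \<in> endos B"
  then obtain F \<eta> where t: "F \<in> hull" "pmap A F \<eta> F" "t = parr A F \<eta> F" unfolding endos_B by blast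
  obtain n \<alpha> where r: "res n F \<eta> \<alpha>" by (rule res_hull[OF t(1,2)])
  show "eul t \<in> carrier KA.K" unfolding t(3) eul_eq[OF t(2) r] by (rule res_closed[OF r])
next
  fix f g h assume "(f, g, h) \<in> ab_triples B"
  then obtain i p where ip: "is_kernel B p i" "is_cokernel B i p" and s: "sequence_endo B i p f g h"
    unfolding ab_triples_def short_exact_def by blast
  have "p \<in> Ar B" using ip(1) unfolding is_kernel_def by blast
  then obtain G K \<pi> where p: "G \<in> hull" "K \<in> hull" "pmap A G \<pi> K" "p = parr A G \<pi> K" unfolding Ar_B by blast
  obtain F \<iota> where i: "i = parr A F \<iota> G" "F \<in> hull" "pmap A F \<iota> G"
    "\<And>X. X \<in> Ob A \<Longrightarrow> inj_on (\<iota> X) (carrier (pob F X))"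
    "\<And>X. X \<in> Ob A \<Longrightarrow> \<iota> X ` carrier (pob F X) = {x \<in> carrier (pob G X). \<pi> X x = \<one>\<^bsub>pob K X\<^esub>}"
    by (rule kernelD_B[OF ip(1)[unfolded p(4)] p(1-3)]) (rule that)
  obtain K' \<kappa> where k: "p = parr A G \<kappa> K'" "\<And>X. X \<in> Ob A \<Longrightarrow> \<kappa> X ` carrier (pob G X) = carrier (pob K' X)"
    by (rule cokernelD_B[OF ip(2)[unfolded i(1)] i(2) p(1) i(3)]) (rule that)
  have "K' = K" "\<And>X x. X \<in> Ob A \<Longrightarrow> x \<in> carrier (pob G X) \<Longrightarrow> \<pi> X x = \<kappa> X x"
    using k(1) unfolding p(4) by (simp_all add: parr_eq_iff)
  then have surj: "\<pi> X ` carrier (pob G X) = carrier (pob K X)" if "X \<in> Ob A" for X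
    using k(2)[OF that] image_cong[OF HOL.refl, of "carrier (pob G X)" "\<pi> X" "\<kappa> X"] that by simp
  have s': "f \<in> Hom B F F" "g \<in> Hom B G G" "h \<in> Hom B K K" "g \<cdot>\<^bsub>presheaves A\<^esub> i = i \<cdot>\<^bsub>presheaves A\<^esub> f"
    "h \<cdot>\<^bsub>presheaves A\<^esub> p = p \<cdot>\<^bsub>presheaves A\<^esub> g"
    using s unfolding sequence_endo_def B_simps i(1) p(4) presheaves_simps by blast+
  obtain f' g' h' where e: "pmap A F f' F" "f = parr A F f' F" "pmap A G g' G" "g = parr A G g' G" "pmap A K h' K" "h = parr A K h' K"
    using s'(1-3) unfolding Hom_B by blast
  have gi: "g' X (\<iota> X x) = \<iota> X (f' X x)" if "X \<in> Ob A" "x \<in> carrier (pob F X)" for X x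
    using s'(4) that by (simp add: e(2,4) i(1) parr_Cmp[OF i(3)] parr_Cmp[OF e(1)] parr_eq_iff)
  have hp: "h' X (\<pi> X x) = \<pi> X (g' X x)" if "X \<in> Ob A" "x \<in> carrier (pob G X)" for X x
    using s'(5) that by (simp add: e(4,6) p(4) parr_Cmp[OF p(3)] parr_Cmp[OF e(3)] parr_eq_iff)
  obtain n1 \<alpha> where r1: "res n1 F f' \<alpha>" by (rule res_hull[OF i(2) e(1)])
  obtain n2 \<beta> where r2: "res n2 G g' \<beta>" by (rule res_hull[OF p(1) e(3)])
  define n where "n = max n1 n2"
  have r: "res n F f' \<alpha>" "res n G g' \<beta>"
    by (rule res_mono[OF r1 e(1)] res_mono[OF r2 e(3)], simp add: n_def)+
  have r3: "res (Suc n) K h' (\<beta> \<otimes>\<^bsub>KA.K\<^esub> inv\<^bsub>KA.K\<^esub> \<alpha>)"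
  proof (rule res_quotient[OF r i(3) p(3) _ _ _ e(1,3,5)])
    fix X assume X: "X \<in> Ob A"
    show "inj_on (\<iota> X) (carrier (pob F X))" by (rule i(4)[OF X])
    show "\<pi> X ` carrier (pob G X) = carrier (pob K X)" by (rule surj[OF X])
    show "\<iota> X ` carrier (pob F X) = {x \<in> carrier (pob G X). \<pi> X x = \<one>\<^bsub>pob K X\<^esub>}" by (rule i(5)[OF X])
    show "g' X (\<iota> X x) = \<iota> X (f' X x)" if "x \<in> carrier (pob F X)" for x by (rule gi[OF X that])
    show "h' X (\<pi> X x) = \<pi> X (g' X x)" if "x \<in> carrier (pob G X)" for x by (rule hp[OF X that])
  qed
  have c: "\<alpha> \<in> carrier KA.K" "\<beta> \<in> carrier KA.K" by (rule res_closed[OF r1] res_closed[OF r2])+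
  have "\<alpha> \<otimes>\<^bsub>KA.K\<^esub> (\<beta> \<otimes>\<^bsub>KA.K\<^esub> inv\<^bsub>KA.K\<^esub> \<alpha>) = \<beta> \<otimes>\<^bsub>KA.K\<^esub> (\<alpha> \<otimes>\<^bsub>KA.K\<^esub> inv\<^bsub>KA.K\<^esub> \<alpha>)"
    by (rule KA.K.m_lcomm[OF c KA.K.inv_closed[OF c(1)]])
  also have "\<dots> = \<beta>" by (simp only: KA.K.r_inv[OF c(1)] KA.K.r_one[OF c(2)])
  finally show "eul g = eul f \<otimes>\<^bsub>KA.K\<^esub> eul h"
    unfolding e(2,4,6) eul_eq[OF e(1) r1] eul_eq[OF e(3) r2] eul_eq[OF e(5) r3] by (rule HOL.sym)
qed

lemma eul_yoneda:
  assumes p: "p \<in> Hom A P P" shows "eul (parr A (y P) (post p) (y P)) = KA.cls p"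
proof (rule eul_eq[OF y_pmap[OF p]])
  have P: "P \<in> Ob A" by (rule Hom_Ob[OF p])
  note [simp] = HomD[OF p]
  have yP: "is_presheaf A (y P)" by (rule y_presheaf[OF P])
  have e: "j (Idn A P) \<in> carrier (pob (y P) P)" using Idn_Hom[OF P] by simp
  have st: "stage (y P) (post p) P p (j (Idn A P))" unfolding stage_def
  proof (intro conjI ballI P p e)
    show "par (y P) p (j (Idn A P)) = post p P (j (Idn A P))" by simp
    fix Q x assume "x \<in> carrier (pob (y P) Q)"
    then obtain f where f: "x = j f" "f \<in> Hom A Q P" by auto
    show "\<exists>f\<in>Hom A Q P. par (y P) f (j (Idn A P)) = x" by (rule bexI[OF _ f(2)]) (use HomD[OF f(2)] in \<open>simp add: f(1)\<close>)
  qed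
  have "trivial (syz (y P) P (j (Idn A P)))" unfolding trivial_def
  proof
    fix Q assume Q: "Q \<in> Ob A"
    have "u \<in> carrier (pob (syz (y P) P (j (Idn A P))) Q) \<longleftrightarrow> u = j (Zr A Q P)" for u
    proof
      assume u: "u \<in> carrier (pob (syz (y P) P (j (Idn A P))) Q)"
      obtain f where f: "f \<in> Hom A Q P" "u = j f" "par (y P) f (j (Idn A P)) = \<one>\<^bsub>pob (y P) Q\<^esub>" by (rule syzE[OF u])
      then show "u = j (Zr A Q P)" using HomD[OF f(1)] by simp
    next
      have z: "Zr A Q P \<in> Hom A Q P" using Q P by blast
      assume u: "u = j (Zr A Q P)"
      show "u \<in> carrier (pob (syz (y P) P (j (Idn A P))) Q)" unfolding u by (rule syzI[OF z]) (use HomD[OF z] in simp)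
    qed
    then show "carrier (pob (syz (y P) P (j (Idn A P))) Q) = {\<one>\<^bsub>pob (syz (y P) P (j (Idn A P))) Q\<^esub>}" by auto
  qed
  then have r: "res 0 (syz (y P) P (j (Idn A P))) (post p) \<one>\<^bsub>KA.K\<^esub>" by (simp add: res.simps)
  show "res (Suc 0) (y P) (post p) (KA.cls p)"
    by (rule res_SucI[OF st r]) (use KA_cls_closed[OF p] in simp)
qed

end

section \<open>The left inverse of \<open>c\<close> for a regular heart\<close>

context bounded_weighted_yoneda
begin

lemma heart_additive: "additive_category A"
  unfolding additive_category_def
proof (intro conjI ballI)
  show "preadditive A" by (rule Y.preadditive)
  obtain Z where Z: "Z \<in> Wge" "zero_object C Z" using Wge_additive unfolding additive_subclass_def by blast
  have "zero_object A Z"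
    by (rule Y.zero_objectI) (use Z zero_Wle[OF Z(2)] zero_object_iff[of Z] in \<open>simp_all add: Ob_A Zr_A Idn_A\<close>)
  then show "\<exists>Z. zero_object A Z" by blast
  fix X Y assume XY: "X \<in> Ob A" "Y \<in> Ob A"
  then have "X \<in> Ob C" "Y \<in> Ob C" by (auto simp: Ob_A Wle_Ob)
  then obtain W i s p q where b: "is_biproduct C X Y W i s p q" using additive unfolding additive_category_def by blast
  have "W \<in> Wle" "W \<in> Wge"
    using Wle_additive Wge_additive XY b unfolding additive_subclass_def Ob_A by blast+
  then have "is_biproduct A X Y W i s p q"
    using b XY unfolding is_biproduct_def by (simp add: Ob_A Hom_A Cmp_A Add_A Zr_A Idn_A)
  then show "\<exists>W i s p q. is_biproduct A X Y W i s p q" by blast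
qed

text \<open>An object \<open>P\<close> of the heart has \<open>H(P[i])\<close> trivial for
  \<open>i\<close> nonzero. In degree 0 composition with the chosen decomposition map identifies the
  representable presheaf of \<open>P\<close> with \<open>H(P)\<close>: it is onto by
  \<open>Hset_Wle\<close> and injective by \<open>wdec_mono\<close>.\<close>

lemma hclass_heart:
  assumes g: "g \<in> Hom A P P" shows "hclass g = Y.cl (Y.y P) (Y.post g)"
proof -
  have P: "P \<in> Wge" "P \<in> Wle" "g \<in> Hom C P P" using g by (auto simp: Hom_A split: if_splits)
  have PA: "P \<in> Ob A" using P by (simp add: Ob_A)
  have PC [simp]: "P \<in> Ob C" using P by (simp add: Wle_Ob)
  have s: "supp P \<subseteq> {0}"
  proof
    fix i assume i: "i \<in> supp P"
    have "\<not> i > 0"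
    proof
      assume "i > 0"
      then have "shift C (i - 1) P \<in> Wle" using Wle_shift_nat[OF P(2), of "nat (i - 1)"] by simp
      then have "Y.trivial (Hob (shift C i P))" using trivial_Sh_Wle shift_add1(2)[OF PC, of "i - 1"] by force
      then show False using i by (simp add: supp_def)
    qed
    moreover have "\<not> i < 0"
    proof
      assume "i < 0"
      then have "shift C (i + 1) P \<in> Wge" using Wge_shift_nat[OF P(1), of "nat (- i - 1)"] by (simp add: algebra_simps)
      then have "negative (shift C i P)" using shift_add1(1,2)[OF PC, of i] by (simp add: negative_def)
      then show False using i trivial_negative by (simp add: supp_def)
    qed
    ultimately show "i \<in> {0}" by simp
  qed
  have "hclass g = finprod Y.KB.K (Y.KB.K.alt (hcls g)) {0}" by (rule hclass_superset[OF P(3) _ s]) simp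
  also have "\<dots> = hcls g 0" using hcls_closed[OF P(3), of 0] by (simp add: Y.KB.K.alt_def)
  also have "\<dots> = Y.cl (Hob P) (Har g)" using HomD[OF P(3)] by (simp add: hcls_def shift_def shift_arr_def)
  also have "\<dots> = Y.cl (Y.y P) (Y.post g)"
  proof -
    define a where "a = dec P"
    have a: "wdec a" "Dom C a = P" using dec[OF PC] by (simp_all add: a_def)
    have aH: "a \<in> Hom C P (Cod C a)" using a by (simp add: in_Hom)
    have H: "Hom A Q P = Hom C Q P" if "Q \<in> Ob A" for Q using that P by (simp add: Hom_A Ob_A)
    have yP: "is_presheaf A (Y.y P)" "Y.y P \<in> Y.hull" by (rule Y.y_presheaf[OF PA], rule abelian_hull.base, rule imageI, rule PA)
    have \<rho>: "pmap A (Y.y P) (\<lambda>Q u. j (a \<cdot> the_inv j u)) (Hob P)" unfolding pmap_def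
    proof (intro conjI ballI allI)
      show "is_presheaf A (Y.y P)" "is_presheaf A (Hob P)" by (rule yP(1) Hob_presheaf[OF PC])+
      fix Q assume Q: "Q \<in> Ob A"
      show "(\<lambda>u. j (a \<cdot> the_inv j u)) \<in> hom (pob (Y.y P) Q) (pob (Hob P) Q)"
      proof (rule homI)
        fix u assume "u \<in> carrier (pob (Y.y P) Q)"
        then obtain f where f: "u = j f" "f \<in> Hom C Q P" by (auto simp: H[OF Q])
        show "j (a \<cdot> the_inv j u) \<in> carrier (pob (Hob P) Q)" using Hset_comp[OF a(1), of f Q] f(2) a(2) by (simp add: f(1) a_def)
        fix v assume "v \<in> carrier (pob (Y.y P) Q)"
        then obtain g where g: "v = j g" "g \<in> Hom C Q P" by (auto simp: H[OF Q])
        show "j (a \<cdot> the_inv j (u \<otimes>\<^bsub>pob (Y.y P) Q\<^esub> v)) = j (a \<cdot> the_inv j u) \<otimes>\<^bsub>pob (Hob P) Q\<^esub> j (a \<cdot> the_inv j v)"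
          using HomD[OF f(2)] HomD[OF g(2)] HomD[OF aH] by (simp add: f(1) g(1) Cmp_Add Add_A)
      qed
    next
      fix Q R f u assume f: "f \<in> Hom A Q R" and "u \<in> carrier (pob (Y.y P) R)"
      then obtain g where g: "u = j g" "g \<in> Hom A R P" by auto
      have fg: "f \<in> Hom C Q R" "g \<in> Hom C R P" using f g(2) by (auto simp: Hom_A split: if_splits)
      show "j (a \<cdot> the_inv j (par (Y.y P) f u)) = par (Hob P) f (j (a \<cdot> the_inv j u))"
        using HomD[OF fg(1)] HomD[OF fg(2)] HomD[OF aH] by (simp add: g(1) Cmp_assoc Cmp_A)
    qed
    have pk: "f = Zr C Q P" if "f \<in> Hom C Q P" "a \<cdot> f = Zr C Q (Cod C a)" for f Q
      using wdec_mono[OF a(1), of f Q] that P(2) a(2) by simp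
    have "Y.cl (Y.y P) (Y.post g) = Y.cl (Hob P) (Har g)"
    proof (rule Y.cl_compare(3)[OF yP(2,2) Y.pmap_id[OF yP(1)] \<rho> _ _ _ Y.y_pmap[OF g] Y.y_pmap[OF g] Har_pmap[OF P(3)]])
      fix Q assume Q: "Q \<in> Ob A"
      show "(\<lambda>u. u) ` carrier (pob (Y.y P) Q) = carrier (pob (Y.y P) Q)" by simp
      show "(\<lambda>u. j (a \<cdot> the_inv j u)) ` carrier (pob (Y.y P) Q) = carrier (pob (Hob P) Q)"
      proof
        show "(\<lambda>u. j (a \<cdot> the_inv j u)) ` carrier (pob (Y.y P) Q) \<subseteq> carrier (pob (Hob P) Q)"
          using pmapD(4)[OF \<rho> Q] by (rule image_subsetI)
        show "carrier (pob (Hob P) Q) \<subseteq> (\<lambda>u. j (a \<cdot> the_inv j u)) ` carrier (pob (Y.y P) Q)"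
        proof
          fix v assume "v \<in> carrier (pob (Hob P) Q)"
          then obtain x where x: "v = j x" "x \<in> Hset a Q" by (auto simp: a_def)
          obtain f where f: "f \<in> Hom C Q P" "x = a \<cdot> f" using Hset_Wle[OF a(1) _ x(2)] a(2) P(2) by auto
          show "v \<in> (\<lambda>u. j (a \<cdot> the_inv j u)) ` carrier (pob (Y.y P) Q)"
            by (rule image_eqI[of _ _ "j f"]) (use f in \<open>simp_all add: x(1) H[OF Q]\<close>)
        qed
      qed
      show "Y.pker (Y.y P) (\<lambda>Q u. u) (Y.y P) Q = Y.pker (Y.y P) (\<lambda>Q u. j (a \<cdot> the_inv j u)) (Hob P) Q"
      proof -
        have QC: "Q \<in> Ob C" using Q by (auto simp: Ob_A Wle_Ob)
        have "a \<cdot> f = Zr C Q (Cod C a) \<longleftrightarrow> f = Zr C Q P" if "f \<in> Hom C Q P" for f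
          using pk[OF that] HomD[OF aH] QC by auto
        then show ?thesis by (auto simp: Y.pker_def H[OF Q] Zr_A a_def)
      qed
      fix u assume "u \<in> carrier (pob (Y.y P) Q)"
      then obtain f where f: "u = j f" "f \<in> Hom C Q P" by (auto simp: H[OF Q])
      show "Y.post g Q u = Y.post g Q u" ..
      note [simp] = HomD[OF f(2)] HomD[OF P(3)] HomD(1,2)[OF aH] HomD[OF lift(1)[OF P(3), folded a_def]]
      have "lift g \<cdot> (a \<cdot> f) = a \<cdot> (g \<cdot> f)"
        using Cmp_rewrite[OF lift(2)[OF P(3), folded a_def], of f] by (simp add: Cmp_assoc)
      then show "Har g Q (j (a \<cdot> the_inv j u)) = j (a \<cdot> the_inv j (Y.post g Q u))" by (simp add: f(1) Cmp_A)
    qed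
    then show ?thesis by (rule HOL.sym)
  qed
  finally show ?thesis .
qed

lemma c_iso:
  assumes reg: "regular_category j A" and c: "c \<in> epi (K0_add A) (K0_tr C)"
    and cc: "\<And>g. g \<in> endos A \<Longrightarrow> c (class_add A g) = class_tr C g"
  shows "c \<in> iso (K0_add A) (K0_tr C)"
proof -
  interpret R: regular_yoneda A j by unfold_locales (rule heart_additive, rule reg)
  have K: "K0_add A = R.KA.K" "class_add A = R.KA.cls" by (simp_all add: K0_add_def class_add_def)
  obtain d where d: "d \<in> hom (K0_tr C) (K0_ab Y.B)" "\<And>g. g \<in> endos C \<Longrightarrow> d (class_tr C g) = hclass g"
    using d_exists by blast
  obtain e where e: "e \<in> hom Y.KB.K R.KA.K" "\<And>t. t \<in> endos Y.B \<Longrightarrow> e (Y.KB.cls t) = R.eul t"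
    using R.eul_hom by blast
  interpret c: group_hom R.KA.K T.K c
    using c by unfold_locales (simp add: epi_def K K0_tr_eq)
  interpret d: group_hom T.K Y.KB.K d
    using d(1) by unfold_locales (simp add: K0_tr_eq Y.K0_ab_eq)
  interpret e: group_hom Y.KB.K R.KA.K e using e(1) by unfold_locales
  have "e (d (c x)) = x" if "x \<in> carrier R.KA.K" for x
    using that
  proof (induction x rule: R.KA.induct)
    case one
    show ?case by simp
  next
    case (cls g)
    define P where "P = Dom C g"
    have g: "g \<in> Hom A P P" using cls by (auto simp: endos_def in_Hom P_def Dom_A Cod_A)
    have gC: "g \<in> endos C" using g by (auto simp: Hom_A endos_def in_Hom split: if_splits)
    have "e (Y.cl (Y.y P) (Y.post g)) = R.eul (parr A (Y.y P) (Y.post g) (Y.y P))"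
      unfolding Y.cl_def Y.K0_ab_eq
    proof (rule e(2))
      show "parr A (Y.y P) (Y.post g) (Y.y P) \<in> endos Y.B"
        unfolding Y.endos_B using Y.y_pmap[OF g] abelian_hull.base[of "Y.y P" "Y.y ` Ob A"] Y.Hom_Ob(1)[OF g] by blast
    qed
    also have "\<dots> = R.KA.cls g" by (rule R.eul_yoneda[OF g])
    finally show ?case using cc[OF cls] d(2)[OF gC] by (simp add: K hclass_heart[OF g])
  next
    case (mult x x')
    then show ?case by simp
  next
    case (inv x)
    then show ?case by simp
  qed
  then have "inj_on c (carrier R.KA.K)" by (rule inj_on_inverseI[where g = "\<lambda>x. e (d x)"])
  then show ?thesis using c unfolding iso_def epi_def K bij_betw_def by simp
qed

end

text \<open>The injection \<open>j\<close> places the morphisms in the type on which the abelian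
  groups of the presheaf category live. Asking for some \<open>h\<close> and quantifying over all
  \<open>h\<close> together say that the induced endomorphisms of the homology exist and that no
  choice affects the value of \<open>d\<close>. Finiteness of the support matters because
  \<open>finprod\<close> over an infinite set is the unit by convention.\<close>

theorem proposition5p4p4:
  fixes C :: "('o, 'm) tricat" and Wle Wge :: "'o set" and j :: "'m \<Rightarrow> 'u"
  assumes "triangulated_category C"
    and "bounded_weight_structure C Wle Wge"
    and "inj j" and "infinite (UNIV :: 'u set)"
  shows "\<exists>c d.
    c \<in> epi (K0_add (heart C Wle Wge)) (K0_tr C) \<and>
    (\<forall>g\<in>endos (heart C Wle Wge). c (class_add (heart C Wle Wge) g) = class_tr C g) \<and>
    d \<in> hom (K0_tr C) (K0_ab (generated_abelian j (heart C Wle Wge))) \<and>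
    (\<forall>g\<in>endos C.
       (\<exists>h. weight_homology_endo j C Wle Wge g h) \<and>
       (\<forall>h. weight_homology_endo j C Wle Wge g h \<longrightarrow>
          finite (euler_support (generated_abelian j (heart C Wle Wge)) h) \<and>
          d (class_tr C g) = euler_class (generated_abelian j (heart C Wle Wge)) h)) \<and>
    (regular_category j (heart C Wle Wge) \<longrightarrow>
       c \<in> iso (K0_add (heart C Wle Wge)) (K0_tr C))"
proof -
  have w: "weight_structure C Wle Wge" using assms(2) by (simp add: bounded_weight_structure_def)
  interpret bounded_weighted_yoneda C Wle Wge j
    by unfold_locales (rule assms(1), rule w, rule assms(3), rule assms(2))
  obtain c where c: "c \<in> epi (K0_add A) (K0_tr C)" "\<And>g. g \<in> endos A \<Longrightarrow> c (class_add A g) = class_tr C g"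
    by (rule c_epi) (rule that)
  obtain d where d: "d \<in> hom (K0_tr C) (K0_ab Y.B)" "\<And>g. g \<in> endos C \<Longrightarrow> d (class_tr C g) = hclass g"
    using d_exists by blast
  show ?thesis
  proof (rule exI[of _ c], rule exI[of _ d], intro conjI ballI allI impI)
    show "c \<in> epi (K0_add A) (K0_tr C)" "d \<in> hom (K0_tr C) (K0_ab Y.B)" by (rule c(1) d(1))+
    show "c (class_add A g) = class_tr C g" if "g \<in> endos A" for g by (rule c(2)[OF that])
    show "c \<in> iso (K0_add A) (K0_tr C)" if "regular_category j A" by (rule c_iso[OF that c])
    fix g assume g: "g \<in> endos C"
    then have g': "g \<in> Hom C (Dom C g) (Dom C g)" by (simp add: endos_def in_Hom)
    show "\<exists>h. weight_homology_endo j C Wle Wge g h" by (rule weight_homology_exists[OF g'])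
    fix h assume h: "weight_homology_endo j C Wle Wge g h"
    show "finite (euler_support Y.B h)" by (rule euler_class_hclass(1)[OF g h])
    show "d (class_tr C g) = euler_class Y.B h" using d(2)[OF g] euler_class_hclass(2)[OF g h] by simp
  qed
qed

end
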